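(* Let $X$ be a connected compact complex manifold of dimension $n$, let $\zeta_0=\sum_{k=0}^n\zeta_{0,k}$ with each $\zeta_{0,k}$ a closed real $(n-k,n-k)$-form on $X$, and let $\mathcal E_0=(E,h,\bar\partial_0)$ be a holomorphic Hermitian vector bundle on $X$ which is $P_{\zeta_0}$-critical. Then there is an orthogonal and holomorphic decomposition $$\mathcal E_0=\bigoplus_{k=1}^{l}\mathcal G_{0,k}^{m_k},$$ where the $m_k\geq 1$ are integers, the $\mathcal G_{0,k}$ are simple $P_{\zeta_0}$-critical Hermitian holomorphic vector bundles, and for all $i\neq j$ one has $\mathrm{Hom}(\mathcal G_{0,i},\mathcal G_{0,j})=0$ (there is no non-zero holomorphic morphism $\mathcal G_{0,i}\to\mathcal G_{0,j}$).
   Context: A holomorphic bundle is simple if its only holomorphic endomorphisms are the homotheties. For a Hermitian bundle $(E,h)$ with Dolbeault operator $\bar\partial$ and Chern connection $\nabla$, the reduced curvature is $\hat F(E,\bar\partial,h)=-\frac{1}{2\mathrm i\pi}\nabla\circ\nabla$. For $\zeta=\sum_{k=0}^n\zeta_k$ with $\zeta_k$ a closed real $(n-k,n-k)$-form, set $\mathcal P_\zeta(E,\bar\partial,h)=\sum_{k=0}^n\zeta_k\wedge\hat F(E,\bar\partial,h)^k\in\Omega^{n,n}(X,\mathrm{End}(E))$. For homogeneous $\mathrm{End}(E)$-valued forms $A_1,\dots,A_m$ set $$[A_1,\dots,A_m]_{\mathrm{sym}}=\frac1{m!}\sum_{\sigma\in\mathfrak S_m}\epsilon_\sigma\,A_{\sigma(1)}\wedge\cdots\wedge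 A_{\sigma(m)},$$ where $\epsilon_\sigma=\pm1$ is the graded sign, i.e. $\alpha_{\sigma(1)}\wedge\cdots\wedge\alpha_{\sigma(m)}=\epsilon_\sigma\,\alpha_1\wedge\cdots\wedge\alpha_m$ for scalar forms $\alpha_k$ with $\deg\alpha_k=\deg A_k$. The operator $\bar\partial$ is a sub-solution of the $P_\zeta$-critical equation if for all $x\in X$ and all non-zero $v\in\Lambda^{1,0}T_x^*X\otimes\mathrm{End}(E_x)$, $$\mathrm{tr}\Big(\sum_{k=1}^n k\,\zeta_k\wedge[\underbrace{\hat F,\dots,\hat F}_{k-1},\mathrm i v,v^\dagger]_{\mathrm{sym}}\Big)>0$$ as an $(n,n)$-form at $x$, where $\dagger$ is the adjoint with respect to $h$. The bundle $(E,\bar\partial,h)$ is $P_\zeta$-critical if $\bar\partial$ is a sub-solution and $\mathcal P_\zeta(E,\bar\partial,h)=0$. *)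

theory Defs
  imports
    "HOL-Analysis.Analysis"
    "HOL-Combinatorics.Permutations"
    "Jordan_Normal_Form.Matrix"
begin

section \<open>Smooth and holomorphic functions on open subsets of a coordinate space\<close>

fun C_k_on :: "nat \<Rightarrow> 'a::real_normed_vector set \<Rightarrow> ('a \<Rightarrow> 'b::real_normed_vector) \<Rightarrow> bool" where
  "C_k_on 0 S f \<longleftrightarrow> continuous_on S f"
| "C_k_on (Suc k) S f \<longleftrightarrow>
     (\<forall>z\<in>S. f differentiable (at z)) \<and>
     (\<forall>w. C_k_on k S (\<lambda>z. frechet_derivative f (at z) w))"

definition smooth_on :: "'a::real_normed_vector set \<Rightarrow> ('a \<Rightarrow> 'b::real_normed_vector) \<Rightarrow> bool" where
  "smooth_on S f \<longleftrightarrow> (\<forall>k. C_k_on k S f)"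

abbreviation complex_linear :: "(complex ^ 'n \<Rightarrow> complex) \<Rightarrow> bool" where
  "complex_linear \<equiv> Vector_Spaces.linear (*s) (*)"

definition hol_on :: "(complex ^ 'n::finite) set \<Rightarrow> (complex ^ 'n \<Rightarrow> complex) \<Rightarrow> bool" where
  "hol_on S f \<longleftrightarrow> (\<forall>z\<in>S. \<exists>D. (f has_derivative D) (at z) \<and> complex_linear D)"


section \<open>Exterior algebra\<close>

text \<open>
  An element of the complexified exterior algebra of the dual of a real vector space is
  a function on lists of vectors. A homogeneous element of degree \<open>d\<close> is supported on
  lists of length \<open>d\<close>, on which it is alternating and multilinear over the reals.
  The wedge product is the sum over shuffles, so that
  \<open>(a \<and> b)(v, w) = a(v) b(w) - a(w) b(v)\<close> for \<open>1\<close>-forms \<open>a\<close>, \<open>b\<close>.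
\<close>

type_synonym 'v ext = "'v list \<Rightarrow> complex"

definition alternating :: "nat \<Rightarrow> ('v::real_vector) ext \<Rightarrow> bool" where
  "alternating d \<alpha> \<longleftrightarrow>
     (\<forall>vs. length vs \<noteq> d \<longrightarrow> \<alpha> vs = 0) \<and>
     (\<forall>vs. length vs = d \<longrightarrow> (\<forall>i<d. linear (\<lambda>w. \<alpha> (vs[i := w])))) \<and>
     (\<forall>vs i j. length vs = d \<and> i < j \<and> j < d \<and> vs ! i = vs ! j \<longrightarrow> \<alpha> vs = 0)"

definition shuffle_sign :: "nat \<Rightarrow> nat set \<Rightarrow> complex" where
  "shuffle_sign m I = (-1) ^ card {(i, j). i \<in> I \<and> j \<in> {..<m} - I \<and> j < i}"

definition wedge :: "'v ext \<Rightarrow> 'v ext \<Rightarrow> 'v ext" where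
  "wedge \<alpha> \<beta> vs =
     (\<Sum>I\<in>Pow {..<length vs}. shuffle_sign (length vs) I * \<alpha> (nths vs I) * \<beta> (nths vs (- I)))"

definition unit_ext :: "'v ext" where
  "unit_ext vs = (if vs = [] then 1 else 0)"

definition one_ext :: "('v \<Rightarrow> complex) \<Rightarrow> 'v ext" where
  "one_ext a vs = (case vs of [w] \<Rightarrow> a w | _ \<Rightarrow> 0)"

text \<open>\<open>type_pq p q\<close> is the complex span of the products of \<open>p\<close> complex-linear and \<open>q\<close>
  antilinear \<open>1\<close>-forms.\<close>

inductive type_pq :: "nat \<Rightarrow> nat \<Rightarrow> (complex ^ 'n::finite) ext \<Rightarrow> bool" where
  unit: "type_pq 0 0 unit_ext"
| holo: "complex_linear a \<Longrightarrow> type_pq p q \<alpha> \<Longrightarrow> type_pq (Suc p) q (wedge (one_ext a) \<alpha>)"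
| antiholo: "complex_linear (\<lambda>w. cnj (a w)) \<Longrightarrow> type_pq p q \<alpha> \<Longrightarrow>
     type_pq p (Suc q) (wedge (one_ext a) \<alpha>)"
| scale: "type_pq p q \<alpha> \<Longrightarrow> type_pq p q (\<lambda>vs. c * \<alpha> vs)"
| add: "type_pq p q \<alpha> \<Longrightarrow> type_pq p q \<beta> \<Longrightarrow> type_pq p q (\<lambda>vs. \<alpha> vs + \<beta> vs)"

text \<open>Top-degree forms are evaluated on the positively oriented real frames
  \<open>e\<^sub>1, \<i>e\<^sub>1, e\<^sub>2, \<i>e\<^sub>2, \<dots>\<close>. Reordering the pairs does not change the value; the quantifier over
  \<open>ks\<close> only avoids choosing an order on the index type. The order on the complex numbers
  is the one for which \<open>0 < z\<close> means that \<open>z\<close> is real and positive.\<close>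

definition positive_top :: "(complex ^ 'n::finite) ext \<Rightarrow> bool" where
  "positive_top \<tau> \<longleftrightarrow>
     (\<forall>ks :: 'n list. distinct ks \<and> set ks = UNIV \<longrightarrow>
        0 < \<tau> (concat (map (\<lambda>k. [axis k 1, axis k \<i>]) ks)))"

definition ext_deriv :: "('v::real_normed_vector \<Rightarrow> 'v ext) \<Rightarrow> 'v \<Rightarrow> 'v ext" where
  "ext_deriv \<omega> z vs =
     (\<Sum>i<length vs. (-1) ^ i *
        frechet_derivative (\<lambda>y. \<omega> y (take i vs @ drop (Suc i) vs)) (at z) (vs ! i))"

text \<open>Matrices of exterior forms; only the entries with indices below the rank matter.\<close>

type_synonym 'v mext = "nat \<Rightarrow> nat \<Rightarrow> 'v ext"

definition mwedge :: "nat \<Rightarrow> 'v mext \<Rightarrow> 'v mext \<Rightarrow> 'v mext" where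
  "mwedge r A B i j vs = (\<Sum>k<r. wedge (A i k) (B k j) vs)"

definition munit :: "'v mext" where
  "munit i j vs = (if i = j then unit_ext vs else 0)"

definition mwedge_list :: "nat \<Rightarrow> 'v mext list \<Rightarrow> 'v mext" where
  "mwedge_list r As = foldr (mwedge r) As munit"

definition mone :: "('v \<Rightarrow> complex mat) \<Rightarrow> 'v mext" where
  "mone a i j = one_ext (\<lambda>w. a w $$ (i, j))"

text \<open>Sign of reordering homogeneous scalar forms of degrees \<open>ds\<close> by \<open>\<sigma>\<close>: each inversion
  contributes the parity of the product of the two degrees.\<close>

definition graded_sign :: "nat list \<Rightarrow> (nat \<Rightarrow> nat) \<Rightarrow> complex" where
  "graded_sign ds \<sigma> =
     (\<Prod>(i, j) \<in> {(i, j). i < j \<and> j < length ds \<and> \<sigma> j < \<sigma> i}. (-1) ^ (ds ! \<sigma> i * ds ! \<sigma> j))"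

text \<open>Each factor of the symmetrised product is given together with its degree.\<close>

definition sym_prod :: "nat \<Rightarrow> (nat \<times> 'v mext) list \<Rightarrow> 'v mext" where
  "sym_prod r As i j vs =
     (\<Sum>\<sigma> | \<sigma> permutes {..<length As}.
        graded_sign (map fst As) \<sigma> *
        mwedge_list r (map (\<lambda>k. snd (As ! \<sigma> k)) [0..<length As]) i j vs) / fact (length As)"


section \<open>Complex manifolds and differential forms\<close>

text \<open>The manifold is the whole type \<open>'x\<close>; its complex dimension is \<open>CARD('n)\<close>.\<close>

type_synonym ('x, 'n) chart = "'x set \<times> ('x \<Rightarrow> complex ^ 'n)"

definition chart_inv :: "('x, 'n) chart \<Rightarrow> complex ^ 'n \<Rightarrow> 'x" where
  "chart_inv c = inv_into (fst c) (snd c)"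

definition holomorphic_atlas :: "('x::topological_space, 'n::finite) chart set \<Rightarrow> bool" where
  "holomorphic_atlas \<A> \<longleftrightarrow>
     (\<Union>c\<in>\<A>. fst c) = UNIV \<and>
     (\<forall>c\<in>\<A>. open (fst c) \<and> open (snd c ` fst c) \<and>
        homeomorphism (fst c) (snd c ` fst c) (snd c) (chart_inv c)) \<and>
     (\<forall>c\<in>\<A>. \<forall>d\<in>\<A>. \<forall>i.
        hol_on (snd c ` (fst c \<inter> fst d)) (\<lambda>z. vec_nth (snd d (chart_inv c z)) i))"

definition hol_fun :: "('x, 'n::finite) chart set \<Rightarrow> 'x set \<Rightarrow> ('x \<Rightarrow> complex) \<Rightarrow> bool" where
  "hol_fun \<A> W f \<longleftrightarrow> (\<forall>c\<in>\<A>. hol_on (snd c ` (W \<inter> fst c)) (\<lambda>z. f (chart_inv c z)))"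

definition smooth_fun :: "('x, 'n::finite) chart set \<Rightarrow> 'x set \<Rightarrow> ('x \<Rightarrow> complex) \<Rightarrow> bool" where
  "smooth_fun \<A> W f \<longleftrightarrow> (\<forall>c\<in>\<A>. smooth_on (snd c ` (W \<inter> fst c)) (\<lambda>z. f (chart_inv c z)))"

text \<open>A form \<open>\<omega>\<close> is given by its coordinate expressions: \<open>\<omega> c x vs\<close> is its value at \<open>x\<close> on the
  tangent vectors whose components in the chart \<open>c\<close> are \<open>vs\<close>.\<close>

type_synonym ('x, 'n) form = "('x, 'n) chart \<Rightarrow> 'x \<Rightarrow> (complex ^ 'n) ext"

definition diff_form :: "('x, 'n::finite) chart set \<Rightarrow> nat \<Rightarrow> ('x, 'n) form \<Rightarrow> bool" where
  "diff_form \<A> d \<omega> \<longleftrightarrow>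
     (\<forall>c\<in>\<A>. \<forall>x\<in>fst c. alternating d (\<omega> c x)) \<and>
     (\<forall>c\<in>\<A>. \<forall>c'\<in>\<A>. \<forall>x\<in>fst c \<inter> fst c'. \<forall>vs.
        \<omega> c x vs =
        \<omega> c' x (map (frechet_derivative (\<lambda>z. snd c' (chart_inv c z)) (at (snd c x))) vs)) \<and>
     (\<forall>c\<in>\<A>. \<forall>vs. smooth_on (snd c ` fst c) (\<lambda>z. \<omega> c (chart_inv c z) vs))"

definition closed_form :: "('x, 'n::finite) chart set \<Rightarrow> ('x, 'n) form \<Rightarrow> bool" where
  "closed_form \<A> \<omega> \<longleftrightarrow>
     (\<forall>c\<in>\<A>. \<forall>x\<in>fst c. \<forall>vs. ext_deriv (\<lambda>z. \<omega> c (chart_inv c z)) (snd c x) vs = 0)"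

definition closed_real_form ::
  "('x, 'n::finite) chart set \<Rightarrow> nat \<Rightarrow> nat \<Rightarrow> ('x, 'n) form \<Rightarrow> bool" where
  "closed_real_form \<A> p q \<omega> \<longleftrightarrow>
     diff_form \<A> (p + q) \<omega> \<and> closed_form \<A> \<omega> \<and>
     (\<forall>c\<in>\<A>. \<forall>x\<in>fst c. type_pq p q (\<omega> c x) \<and> (\<forall>vs. \<omega> c x vs \<in> \<real>))"


section \<open>Holomorphic Hermitian vector bundles\<close>

text \<open>
  Each fibre is identified, as a vector space only, with the space of column vectors of length
  \<open>rank\<close>; these identifications carry no topological information. The smooth and holomorphic
  structures, hence the Dolbeault operator, are given by local holomorphic frames \<open>(U, e)\<close>:
  the columns of \<open>e x\<close> are the values at \<open>x\<close> of the sections of the frame, and the transition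
  functions between frames are holomorphic: in a frame, the Dolbeault operator acts
  componentwise. Every bundle of finite constant rank is isomorphic to one of this form. The matrix \<open>metric x\<close>
  represents the Hermitian metric on the fibre at \<open>x\<close>, linear in the first argument.
\<close>

record 'x herm_bundle =
  rank :: nat
  frames :: "('x set \<times> ('x \<Rightarrow> complex mat)) set"
  metric :: "'x \<Rightarrow> complex mat"

definition herm :: "complex mat \<Rightarrow> complex Matrix.vec \<Rightarrow> complex Matrix.vec \<Rightarrow> complex" where
  "herm H s t = (H *\<^sub>v s) \<bullet>c t"

definition hermitian_metric :: "nat \<Rightarrow> complex mat \<Rightarrow> bool" where
  "hermitian_metric r H \<longleftrightarrow>
     H \<in> carrier_mat r r \<and>
     (\<forall>s\<in>carrier_vec r. \<forall>t\<in>carrier_vec r. herm H s t = cnj (herm H t s)) \<and>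
     (\<forall>s\<in>carrier_vec r. s \<noteq> 0\<^sub>v r \<longrightarrow> 0 < herm H s s)"

definition gram :: "'x herm_bundle \<Rightarrow> ('x \<Rightarrow> complex mat) \<Rightarrow> 'x \<Rightarrow> complex mat" where
  "gram E e x =
     mat (rank E) (rank E) (\<lambda>(i, j). herm (metric E x) (col (e x) j) (col (e x) i))"

definition hol_mat ::
  "('x, 'n::finite) chart set \<Rightarrow> 'x set \<Rightarrow> nat \<Rightarrow> nat \<Rightarrow> ('x \<Rightarrow> complex mat) \<Rightarrow> bool" where
  "hol_mat \<A> W a b g \<longleftrightarrow>
     (\<forall>x\<in>W. g x \<in> carrier_mat a b) \<and>
     (\<forall>i<a. \<forall>j<b. hol_fun \<A> W (\<lambda>x. g x $$ (i, j)))"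

definition hol_herm_bundle ::
  "('x::topological_space, 'n::finite) chart set \<Rightarrow> 'x herm_bundle \<Rightarrow> bool" where
  "hol_herm_bundle \<A> E \<longleftrightarrow>
     (\<Union>(U, e)\<in>frames E. U) = UNIV \<and>
     (\<forall>(U, e)\<in>frames E. open U \<and>
        (\<forall>x\<in>U. e x \<in> carrier_mat (rank E) (rank E) \<and> invertible_mat (e x))) \<and>
     (\<forall>(U, e)\<in>frames E. \<forall>(V, f)\<in>frames E. \<exists>g.
        hol_mat \<A> (U \<inter> V) (rank E) (rank E) g \<and> (\<forall>x\<in>U \<inter> V. e x = f x * g x)) \<and>
     (\<forall>x. hermitian_metric (rank E) (metric E x)) \<and>
     (\<forall>(U, e)\<in>frames E. \<forall>i<rank E. \<forall>j<rank E. smooth_fun \<A> U (\<lambda>x. gram E e x $$ (i, j)))"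

definition hol_morphism ::
  "('x, 'n::finite) chart set \<Rightarrow> 'x herm_bundle \<Rightarrow> 'x herm_bundle \<Rightarrow> ('x \<Rightarrow> complex mat) \<Rightarrow> bool"
where
  "hol_morphism \<A> E F \<phi> \<longleftrightarrow>
     (\<forall>x. \<phi> x \<in> carrier_mat (rank F) (rank E)) \<and>
     (\<forall>(U, e)\<in>frames E. \<forall>(V, f)\<in>frames F. \<exists>g.
        hol_mat \<A> (U \<inter> V) (rank F) (rank E) g \<and> (\<forall>x\<in>U \<inter> V. \<phi> x * e x = f x * g x))"

definition simple_bundle :: "('x, 'n::finite) chart set \<Rightarrow> 'x herm_bundle \<Rightarrow> bool" where
  "simple_bundle \<A> E \<longleftrightarrow>
     (\<forall>\<phi>. hol_morphism \<A> E E \<phi> \<longrightarrow> (\<exists>a. \<forall>x. \<phi> x = a \<cdot>\<^sub>m 1\<^sub>m (rank E)))"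

definition isometric_iso ::
  "('x, 'n::finite) chart set \<Rightarrow> 'x herm_bundle \<Rightarrow> 'x herm_bundle \<Rightarrow> bool" where
  "isometric_iso \<A> E F \<longleftrightarrow>
     (\<exists>\<phi> \<psi>. hol_morphism \<A> E F \<phi> \<and> hol_morphism \<A> F E \<psi> \<and>
        (\<forall>x. \<phi> x * \<psi> x = 1\<^sub>m (rank F) \<and> \<psi> x * \<phi> x = 1\<^sub>m (rank E)) \<and>
        (\<forall>x. \<forall>s\<in>carrier_vec (rank E). \<forall>t\<in>carrier_vec (rank E).
           herm (metric F x) (\<phi> x *\<^sub>v s) (\<phi> x *\<^sub>v t) = herm (metric E x) s t))"

text \<open>The orthogonal direct sum; for the empty list this is the zero bundle.\<close>

definition direct_sum :: "'x herm_bundle list \<Rightarrow> 'x herm_bundle" where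
  "direct_sum Es =
     \<lparr>rank = sum_list (map rank Es),
      frames = {(\<Inter>f\<in>set fs. fst f, \<lambda>x. diag_block_mat (map (\<lambda>f. snd f x) fs)) | fs.
                  list_all2 (\<lambda>f E. f \<in> frames E) fs Es},
      metric = (\<lambda>x. diag_block_mat (map (\<lambda>E. metric E x) Es))\<rparr>"


section \<open>Chern connection and curvature\<close>

text \<open>
  Local expressions in a chart and a holomorphic frame. A bundle-valued form \<open>\<Sum> \<sigma>\<^sub>i e\<^sub>i\<close> is
  represented by its components \<open>\<sigma>\<close>, a connection by its matrix \<open>\<theta>\<close> of \<open>1\<close>-forms, where
  \<open>\<nabla> e\<^sub>j = \<Sum> \<theta>\<^sub>i\<^sub>j e\<^sub>i\<close>.
\<close>

definition cov_deriv ::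
  "nat \<Rightarrow> ('v::real_normed_vector \<Rightarrow> 'v mext) \<Rightarrow> (nat \<Rightarrow> 'v \<Rightarrow> 'v ext) \<Rightarrow> nat \<Rightarrow> 'v \<Rightarrow> 'v ext" where
  "cov_deriv r \<theta> \<sigma> i z vs = ext_deriv (\<sigma> i) z vs + (\<Sum>k<r. wedge (\<theta> z i k) (\<sigma> k z) vs)"

text \<open>Column \<open>j\<close> of the matrix of \<open>\<nabla> \<circ> \<nabla>\<close> consists of the components of \<open>\<nabla> (\<nabla> e\<^sub>j)\<close>.\<close>

definition conn_curvature ::
  "nat \<Rightarrow> ('v::real_normed_vector \<Rightarrow> 'v mext) \<Rightarrow> 'v \<Rightarrow> 'v mext" where
  "conn_curvature r \<theta> z i j =
     cov_deriv r \<theta> (cov_deriv r \<theta> (\<lambda>k _. munit k j)) i z"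

text \<open>The connection whose \<open>(0,1)\<close>-part is the Dolbeault operator (in a holomorphic frame: the
  connection matrix has type \<open>(1,0)\<close>) and which satisfies \<open>d h(s,t) = h(\<nabla>s,t) + h(s,\<nabla>t)\<close>. It is
  enough to require the latter for sections with constant components \<open>s\<close>, \<open>t\<close>. Here \<open>H\<close> is the
  matrix of the metric, as a function of the coordinates.\<close>

definition chern_connection ::
  "nat \<Rightarrow> (complex ^ 'n::finite \<Rightarrow> complex mat) \<Rightarrow> complex ^ 'n \<Rightarrow> (complex ^ 'n \<Rightarrow> complex mat)" where
  "chern_connection r H z = (THE \<theta>.
     (\<forall>w. \<theta> w \<in> carrier_mat r r) \<and>
     (\<forall>i<r. \<forall>j<r. complex_linear (\<lambda>w. \<theta> w $$ (i, j))) \<and>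
     (\<forall>s\<in>carrier_vec r. \<forall>t\<in>carrier_vec r. \<forall>w.
        frechet_derivative (\<lambda>y. herm (H y) s t) (at z) w =
        herm (H z) (\<theta> w *\<^sub>v s) t + herm (H z) s (\<theta> w *\<^sub>v t)))"

definition reduced_curvature ::
  "'x herm_bundle \<Rightarrow> ('x, 'n::finite) chart \<Rightarrow> ('x \<Rightarrow> complex mat) \<Rightarrow> 'x \<Rightarrow> (complex ^ 'n) mext" where
  "reduced_curvature E c e x i j vs =
     - 1 / (2 * \<i> * of_real pi) *
     conn_curvature (rank E)
       (\<lambda>z. mone (chern_connection (rank E) (\<lambda>y. gram E e (chart_inv c y)) z)) (snd c x) i j vs"


section \<open>The \<open>P\<^sub>\<zeta>\<close>-critical equation\<close>

definition P_form ::
  "(nat \<Rightarrow> ('x, 'n::finite) form) \<Rightarrow> 'x herm_bundle \<Rightarrow>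
     ('x, 'n) chart \<Rightarrow> ('x \<Rightarrow> complex mat) \<Rightarrow> 'x \<Rightarrow> (complex ^ 'n) mext" where
  "P_form \<zeta> E c e x i j vs =
     (\<Sum>k\<le>CARD('n).
        wedge (\<zeta> k c x) (mwedge_list (rank E) (replicate k (reduced_curvature E c e x)) i j) vs)"

definition adjoint_wrt :: "nat \<Rightarrow> complex mat \<Rightarrow> complex mat \<Rightarrow> complex mat" where
  "adjoint_wrt r H M = (THE N. N \<in> carrier_mat r r \<and>
     (\<forall>s\<in>carrier_vec r. \<forall>t\<in>carrier_vec r. herm H (M *\<^sub>v s) t = herm H s (N *\<^sub>v t)))"

text \<open>An element of \<open>\<Lambda>\<^sup>1\<^sup>,\<^sup>0 T\<^sub>x\<^sup>*X \<otimes> End(E\<^sub>x)\<close>, written in a chart and a frame, is a complex-linear map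
  \<open>v\<close> from tangent vectors to matrices, and the value of \<open>v\<^sup>\<dagger>\<close> on a (real) tangent vector \<open>w\<close> is
  the adjoint of \<open>v w\<close>.\<close>

definition sub_solution ::
  "('x, 'n::finite) chart set \<Rightarrow> (nat \<Rightarrow> ('x, 'n) form) \<Rightarrow> 'x herm_bundle \<Rightarrow> bool" where
  "sub_solution \<A> \<zeta> E \<longleftrightarrow>
     (\<forall>c\<in>\<A>. \<forall>(U, e)\<in>frames E. \<forall>x\<in>fst c \<inter> U. \<forall>v :: complex ^ 'n \<Rightarrow> complex mat.
        (\<forall>w. v w \<in> carrier_mat (rank E) (rank E)) \<and>
        (\<forall>i<rank E. \<forall>j<rank E. complex_linear (\<lambda>w. v w $$ (i, j))) \<and>
        (\<exists>w. v w \<noteq> 0\<^sub>m (rank E) (rank E)) \<longrightarrow>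
        positive_top (\<lambda>vs. \<Sum>i<rank E. \<Sum>k = 1..CARD('n). of_nat k *
          wedge (\<zeta> k c x)
            (sym_prod (rank E)
               (replicate (k - 1) (2, reduced_curvature E c e x) @
                [(1, mone (\<lambda>w. \<i> \<cdot>\<^sub>m v w)),
                 (1, mone (\<lambda>w. adjoint_wrt (rank E) (gram E e x) (v w)))]) i i) vs))"

definition P_critical ::
  "('x, 'n::finite) chart set \<Rightarrow> (nat \<Rightarrow> ('x, 'n) form) \<Rightarrow> 'x herm_bundle \<Rightarrow> bool" where
  "P_critical \<A> \<zeta> E \<longleftrightarrow>
     sub_solution \<A> \<zeta> E \<and>
     (\<forall>c\<in>\<A>. \<forall>(U, e)\<in>frames E. \<forall>x\<in>fst c \<inter> U. \<forall>i<rank E. \<forall>j<rank E. \<forall>vs.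
        P_form \<zeta> E c e x i j vs = 0)"

end

theory Submission
  imports
    Defs
    "HOL-Library.Function_Algebras"
    "HOL-Library.Numeral_Type"
    "HOL-Complex_Analysis.Complex_Analysis"
    "Jordan_Normal_Form.Determinant"
    "Jordan_Normal_Form.Spectral_Radius"
begin

text \<open>Let \<open>s\<close> be a holomorphic endomorphism of a critical bundle and \<open>s\<^sup>*\<close> its pointwise adjoint. The
 \<open>(2n-1)\<close>-form \<open>Y = tr (\<Sum>k. k \<zeta>\<^sub>k [F, ..., F, \<nabla>s, s\<^sup>*])\<close> is globally defined, and \<open>dY = -T\<close>, where \<open>T\<close> is the same
 expression with \<open>\<nabla>s\<^sup>*\<close> for \<open>s\<^sup>*\<close>: the form \<open>F\<close> is parallel, and \<open>\<nabla>\<nabla>s\<close> is a multiple of \<open>[F, s]\<close>, whose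
 contributions telescope to \<open>tr ([\<Sum>k. \<zeta>\<^sub>k F\<^sup>k, s] s\<^sup>*)\<close>, zero by the critical equation. As \<open>\<nabla>s\<close> is of type (1,0)
 with adjoint \<open>\<nabla>s\<^sup>*\<close>, the sub-solution condition says that \<open>iT\<close> is positive wherever \<open>\<nabla>s\<close> is not zero. By
 Stokes' theorem the integral of \<open>iT\<close> vanishes, so \<open>\<nabla>s = 0\<close> and \<open>s\<^sup>*\<close> is holomorphic: the holomorphic
 endomorphisms form a *-algebra (\<open>nonnegative_exact_top_form\<close>, \<open>adjoint_holomorphic\<close>).

 The rest is the structure theory of such an algebra. The trace of \<open>s\<^sup>* s\<close> is a real holomorphic function, hence
 constant, so an endomorphism that vanishes at one point vanishes. A bundle that is not simple has a non-zero
 endomorphism \<open>a\<close> that is singular at a chosen point; when the rank of \<open>a\<close> there is minimal, \<open>a\<^sup>* a\<close> is a positive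
 multiple of a non-trivial orthogonal projection (\<open>nontrivial_projection\<close>). The projection and its complement
 split the bundle (\<open>projection_splits\<close>). The inclusion of a summand is parallel, so the curvature restricts and
 the summands are critical again (\<open>critical_subbundle\<close>); induction on the rank gives simple summands. Between
 two simple summands a non-zero morphism is, after scaling, an isometry (\<open>hom_isometric\<close>), so the summands can
 be grouped into multiples of bundles without morphisms between them (\<open>group_pieces\<close>). The projections to
 the summands, stacked into one matrix, are the isometry with the direct sum (\<open>decomp_isometric_iso\<close>).

 The analysis is done in coordinates: a differential form is a function of a point and a list of tangent
 vectors, and a form with values in \<open>Hom\<close> is a matrix of such functions in local holomorphic frames.\<close>

unbundle no fps_syntax
no_notation Matrix.vec_index (infixl "$" 100)
notation Matrix.vec_index (infixl "$v" 100)
notation scaleR (infixr "*R" 75)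
notation smult_mat (infixl "*m" 70)
notation mult_mat_vec (infixl "*V" 70)
hide_const (open) SumSpaces.direct_sum
abbreviation (input) "idm \<equiv> one_mat"
abbreviation (input) "zm \<equiv> zero_mat"
abbreviation (input) "zv \<equiv> zero_vec"
abbreviation (input) "cmat \<equiv> carrier_mat"
abbreviation (input) "cvec \<equiv> carrier_vec"
abbreviation (input) "mw \<equiv> mwedge"
abbreviation (input) "ed \<equiv> ext_deriv"
abbreviation (input) "fd f z \<equiv> frechet_derivative f (at z)"
abbreviation (input) "cdet \<equiv> Determinants.det"
abbreviation (input) "cI \<equiv> Finite_Cartesian_Product.mat 1"
abbreviation (input) "ci \<equiv> chart_inv"
abbreviation (input) "clin \<equiv> complex_linear"
lemmas cvec_eq = Finite_Cartesian_Product.vec_eq_iff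
lemmas mult_c = mult_carrier_mat
lemmas fd_at = frechet_derivative_at
lemmas bl_hd = bounded_linear.has_derivative
lemmas hd_transform = has_derivative_transform_within_open

text \<open>The sign \<open>(-1)^p\<close> on \<open>p\<close>-forms. It is read off from the length of the argument list, which makes the Leibniz rules equations
 between operators.\<close>
definition sg :: "'v ext => 'v ext" where "sg al vs = (-1) ^ length vs * al vs"
definition contr :: "'v => 'v ext => 'v ext" where "contr x al vs = al (x # vs)"

lemma wedge_Nil [simp]: "wedge al bt [] = al [] * bt []" by (simp add: wedge_def shuffle_sign_def)

lemma shuffle_sign_Suc_image:
 assumes "I <= {..<n}"
 shows "shuffle_sign (Suc n) (Suc ` I) = (-1) ^ card I * shuffle_sign n I"
  and "shuffle_sign (Suc n) (insert 0 (Suc ` I)) = shuffle_sign n I"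
proof -
 have fin: "finite I" using assms finite_subset by blast
 let ?S = "{(i, j). i : I & j : {..<n} - I & j < i}"
 let ?s = "%(i, j). (Suc i, Suc j)"
 have fS: "finite ?S" by (rule finite_subset[of _ "I \<times> {..<n}"]) (use fin in auto)
 have inj: "inj_on ?s ?S" by (auto simp: inj_on_def)
 have a: "{(i, j). i : Suc ` I & j : {..<Suc n} - Suc ` I & j < i} =
   (%i. (Suc i, 0)) ` I Un ?s ` ?S"
 proof (intro Set.set_eqI, goal_cases)
  case (1 p)
  obtain i j where p: "p = (i, j)" by fastforce
  show "p : {(i, j). i : Suc ` I & j : {..<Suc n} - Suc ` I & j < i} \<longleftrightarrow>
   p : (%i. (Suc i, 0)) ` I Un ?s ` ?S" unfolding p by (cases i; cases j) (auto simp: image_iff)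
 qed
 have "card (?s ` ?S) = card ?S" by (rule card_image[OF inj])
 moreover have "card ((%i. (Suc i, 0::nat)) ` I) = card I" by (rule card_image) (simp add: inj_on_def)
 moreover have "finite (?s ` ?S)" using fS by (rule finite_imageI)
 ultimately have "card ((%i. (Suc i, 0::nat)) ` I Un ?s ` ?S) = card I + card ?S" using fin by (subst card_Un_disjoint) auto
 thus "shuffle_sign (Suc n) (Suc ` I) = (-1) ^ card I * shuffle_sign n I" unfolding shuffle_sign_def a by (simp add: power_add)
 have b: "{(i, j). i : insert 0 (Suc ` I) & j : {..<Suc n} - insert 0 (Suc ` I) & j < i} = ?s ` ?S"
 proof (intro Set.set_eqI, goal_cases)
  case (1 p)
  obtain i j where p: "p = (i, j)" by fastforce
  show "p : {(i, j). i : insert 0 (Suc ` I) & j : {..<Suc n} - insert 0 (Suc ` I) & j < i} \<longleftrightarrow>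
   p : ?s ` ?S" unfolding p by (cases i; cases j) (auto simp: image_iff)
 qed
 show "shuffle_sign (Suc n) (insert 0 (Suc ` I)) = shuffle_sign n I" unfolding shuffle_sign_def b card_image[OF inj] by simp
qed

text \<open>Recursion on the argument list: contraction is an antiderivation. The algebra of the wedge product
 follows from this.\<close>
lemma wedge_Cons:
 "wedge al bt (x # vs) = wedge (contr x al) bt vs + wedge (sg al) (contr x bt) vs"
proof -
 let ?n = "length vs"
 let ?f = "%I. shuffle_sign (Suc ?n) I * al (nths (x # vs) I) * bt (nths (x # vs) (- I))"
 have lt: "{..<Suc ?n} = insert 0 (Suc ` {..<?n})" by (simp add: lessThan_Suc_eq_insert_0)
 have inj1: "inj_on ((`) Suc) (Pow {..<?n})" by (rule inj_onI) (simp add: inj_image_eq_iff)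
 have inj2: "inj_on (insert 0) (Pow (Suc ` {..<?n}))"
 proof (rule inj_onI)
  fix A B assume "A : Pow (Suc ` {..<?n})" "B : Pow (Suc ` {..<?n})" "insert 0 A = insert 0 B"
  moreover from this have "0 ~: A" "0 ~: B" by auto
  ultimately show "A = B" by (simp add: insert_ident)
 qed
 have P: "Pow (Suc ` {..<?n}) = (`) Suc ` Pow {..<?n}" by (simp add: image_Pow_surj)
 have vim: "{j. Suc j : Suc ` I} = I" "{j. Suc j : - Suc ` I} = - I" for I by auto
 have "wedge al bt (x # vs) = (SUM I:Pow (insert 0 (Suc ` {..<?n})). ?f I)" by (simp add: wedge_def lt[symmetric])
 also have "... = (SUM I:Pow (Suc ` {..<?n}). ?f I) + (SUM I:insert 0 ` Pow (Suc ` {..<?n}). ?f I)" unfolding Pow_insert by (rule sum.union_disjoint) auto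
 also have "(SUM I:insert 0 ` Pow (Suc ` {..<?n}). ?f I) = (SUM I:Pow {..<?n}. ?f (insert 0 (Suc ` I)))" using inj1 inj2 unfolding P by (simp add: sum.reindex o_def)
 also have "... = wedge (contr x al) bt vs" unfolding wedge_def
 proof (rule sum.cong[OF refl])
  fix I assume "I : Pow {..<?n}"
  hence I: "I <= {..<?n}" by auto
  have v: "{j. Suc j : insert 0 (Suc ` I)} = I" "{j. Suc j : - insert 0 (Suc ` I)} = - I" by auto
  show "?f (insert 0 (Suc ` I)) = shuffle_sign ?n I * contr x al (nths vs I) * bt (nths vs (- I))" unfolding shuffle_sign_Suc_image[OF I] nths_Cons v contr_def by simp
 qed
 also have "(SUM I:Pow (Suc ` {..<?n}). ?f I) = (SUM I:Pow {..<?n}. ?f (Suc ` I))" using inj1 unfolding P by (simp add: sum.reindex o_def)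
 also have "... = wedge (sg al) (contr x bt) vs" unfolding wedge_def
 proof (rule sum.cong[OF refl])
  fix I assume "I : Pow {..<?n}"
  hence I: "I <= {..<?n}" by auto
  have "length (nths vs I) = card I" unfolding length_nths by (rule arg_cong[where f=card]) (use I in auto)
  thus "?f (Suc ` I) = shuffle_sign ?n I * sg al (nths vs I) * contr x bt (nths vs (- I))" unfolding shuffle_sign_Suc_image[OF I] nths_Cons vim contr_def sg_def by simp
 qed
 finally show ?thesis by simp
qed

lemma wedge_add_left: "wedge (al + bt) gm = wedge al gm + wedge bt gm" by (rule ext) (simp add: wedge_def algebra_simps sum.distrib)
lemma wedge_add_right: "wedge al (bt + gm) = wedge al bt + wedge al gm" by (rule ext) (simp add: wedge_def algebra_simps sum.distrib)
lemma wedge_zero [simp]: "wedge 0 gm = 0" "wedge gm 0 = 0" by (rule ext, simp add: wedge_def)+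
lemma wedge_minus_left: "wedge (- al) gm = - wedge al gm" by (rule ext) (simp add: wedge_def sum_negf)
lemma wedge_minus_right: "wedge al (- gm) = - wedge al gm" by (rule ext) (simp add: wedge_def sum_negf)
lemma wedge_diff_left: "wedge (al - bt) gm = wedge al gm - wedge bt gm" using wedge_add_left[of al "- bt" gm] by (simp add: wedge_minus_left)
lemma wedge_diff_right: "wedge al (bt - gm) = wedge al bt - wedge al gm" using wedge_add_right[of al bt "- gm"] by (simp add: wedge_minus_right)
lemma wedge_scale_left: "wedge (%vs. c * al vs) gm = (%vs. c * wedge al gm vs)" by (rule ext) (simp add: wedge_def sum_distrib_left algebra_simps)
lemma wedge_scale_right: "wedge al (%vs. c * gm vs) = (%vs. c * wedge al gm vs)" by (rule ext) (simp add: wedge_def sum_distrib_left algebra_simps)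
lemma wedge_sum_left: "wedge (SUM k:K. f k) gm = (SUM k:K. wedge (f k) gm)" by (induction K rule: infinite_finite_induct) (simp_all only: sum.infinite sum.empty sum.insert wedge_zero wedge_add_left not_False_eq_True)
lemma wedge_sum_right: "wedge gm (SUM k:K. f k) = (SUM k:K. wedge gm (f k))" by (induction K rule: infinite_finite_induct) (simp_all only: sum.infinite sum.empty sum.insert wedge_zero wedge_add_right not_False_eq_True)

lemma contr_simps: "contr x (al + bt) = contr x al + contr x bt"
 "contr x (sg al) = - sg (contr x al)" "sg (sg al) = al" "sg (al + bt) = sg al + sg bt"
 "sg (- al) = - sg al" "sg (al - bt) = sg al - sg bt" by (rule ext, simp add: contr_def sg_def algebra_simps flip: power_mult_distrib)+

lemma contr_wedge: "contr x (wedge al bt) = wedge (contr x al) bt + wedge (sg al) (contr x bt)" by (rule ext) (simp add: contr_def[of x "wedge al bt"] wedge_Cons)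

lemma sg_wedge: "sg (wedge al bt) = wedge (sg al) (sg bt)"
proof
 fix vs show "sg (wedge al bt) vs = wedge (sg al) (sg bt) vs"
 proof (induction vs arbitrary: al bt)
  case (Cons x vs)
  show ?case using Cons[of "contr x al" bt] Cons[of "sg al" "contr x bt"] by (simp add: sg_def[of _ "_ # _"] wedge_Cons contr_simps wedge_minus_left wedge_minus_right)
    (simp add: sg_def[of _ vs] algebra_simps)
 qed (simp add: sg_def)
qed

lemma wedge_assoc: "wedge (wedge al bt) gm = wedge al (wedge bt gm)"
proof
 fix vs show "wedge (wedge al bt) gm vs = wedge al (wedge bt gm) vs" by (induction vs arbitrary: al bt gm)
   (auto simp: wedge_Cons contr_wedge sg_wedge wedge_add_left wedge_add_right)
qed

text \<open>Forms of degree \<open>p\<close>; multilinearity and antisymmetry are the separate notion \<open>alt\<close>.\<close>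
definition hdeg :: "nat => 'v ext => bool" where "hdeg p al \<longleftrightarrow> (ALL vs. length vs ~= p --> al vs = 0)"

lemma sg_hdeg: "hdeg p al ==> sg al = (%vs. (-1) ^ p * al vs)" by (rule ext) (auto simp: hdeg_def sg_def)

lemma hdeg_contr: "hdeg p al ==> hdeg (p - 1) (contr x al)" by (auto simp: hdeg_def contr_def)

lemma hdeg_0_contr: "hdeg 0 al ==> contr x al = 0" by (rule ext) (auto simp: hdeg_def contr_def)

lemma hdeg_wedge: "hdeg p al ==> hdeg q bt ==> hdeg (p + q) (wedge al bt)" unfolding hdeg_def
proof (intro allI impI)
 fix vs :: "'a list"
 assume *: "ALL vs::'a list. length vs ~= p --> al vs = 0" "ALL vs::'a list. length vs ~= q --> bt vs = 0"
  and l: "length vs ~= p + q"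
 have len: "length (nths vs I) + length (nths vs (- I)) = length vs" for I
 proof -
  have "length (nths vs I) + length (nths vs (- I)) =
   card ({i. i < length vs & i : I} Un {i. i < length vs & i : - I})" unfolding length_nths by (rule card_Un_disjoint[symmetric]) auto
  also have "{i. i < length vs & i : I} Un {i. i < length vs & i : - I} = {..<length vs}" by auto
  finally show ?thesis by simp
 qed
 have "al (nths vs I) * bt (nths vs (- I)) = 0" for I using len[of I] * l by (metis mult_eq_0_iff)
 thus "wedge al bt vs = 0" by (auto simp: wedge_def mult.assoc intro!: sum.neutral)
qed

lemma wedge_commute: "hdeg q bt ==> wedge al bt = wedge bt ((sg ^^ q) al)"
proof
 fix vs assume "hdeg q bt"
 thus "wedge al bt vs = wedge bt ((sg ^^ q) al) vs"
 proof (induction vs arbitrary: al bt q)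
  case Nil
  have "(sg ^^ q) al [] = al []" by (induction q) (auto simp: sg_def)
  thus ?case by simp
 next
  case (Cons x vs)
  have c: "contr x ((sg ^^ q) al) = (%vs. (-1) ^ q * (sg ^^ q) (contr x al) vs)"
  proof (induction q)
   case (Suc k)
   show ?case
   proof (rule ext)
    fix vs
    show "contr x ((sg ^^ Suc k) al) vs = (-1) ^ Suc k * (sg ^^ Suc k) (contr x al) vs" by (simp add: contr_simps sg_def[of _ vs] Suc)
   qed
  qed simp
  have "(-1) ^ q * ((-1) ^ q * w) = w" for w :: complex by (simp flip: power_add mult.assoc)
  hence 1: "wedge (sg bt) (contr x ((sg ^^ q) al)) vs = wedge bt ((sg ^^ q) (contr x al)) vs" unfolding c sg_hdeg[OF Cons.prems] by (simp add: wedge_scale_left wedge_scale_right)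
  have 2: "wedge (sg al) (contr x bt) vs = wedge (contr x bt) ((sg ^^ q) al) vs"
  proof (cases q)
   case 0
   thus ?thesis using hdeg_0_contr[of bt x] Cons.prems by simp
  next
   case (Suc k)
   thus ?thesis using Cons.IH[OF hdeg_contr[OF Cons.prems], of "sg al" x] by (simp add: funpow_swap1)
  qed
  show ?case using Cons.IH[OF Cons.prems, of "contr x al"] by (simp add: wedge_Cons 1 2)
 qed
qed

lemma wedge_map: "wedge al bt (map f vs) = wedge (%us. al (map f us)) (%us. bt (map f us)) vs" by (simp add: wedge_def nths_map)

lemma wedge_unit [simp]: "wedge unit_ext al = al" "wedge al unit_ext = al"
proof -
 have z: "contr x unit_ext = 0" for x :: 'a by (rule ext) (simp add: contr_def unit_ext_def)
 have s: "sg unit_ext = (unit_ext :: 'a ext)" by (rule ext) (simp add: sg_def unit_ext_def)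
 have "wedge unit_ext al vs = al vs" for al :: "'a ext" and vs by (induction vs arbitrary: al) (auto simp: wedge_Cons z s contr_def, auto simp: unit_ext_def)
 thus 1: "wedge unit_ext al = al" for al :: "'a ext" by blast
 have "hdeg 0 (unit_ext :: 'a ext)" by (simp add: hdeg_def unit_ext_def)
 thus "wedge al unit_ext = al" using wedge_commute[of 0 unit_ext al] 1 by simp
qed

lemma fd_cong:
 assumes "open S" "z : S" "!!y. y : S ==> f y = g y"
 shows "fd f z = fd g z"
  and "f differentiable (at z) \<longleftrightarrow> g differentiable (at z)"
proof -
 have "(f has_derivative D) (at z) \<longleftrightarrow> (g has_derivative D) (at z)" for D using hd_transform[of f D z UNIV S g]
   hd_transform[of g D z UNIV S f] assms by auto
 thus "fd f z = fd g z"
  "f differentiable (at z) \<longleftrightarrow> g differentiable (at z)" unfolding frechet_derivative_def differentiable_def by simp_all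
qed

lemma C_k_cong:
 assumes "open S" "!!z. z : S ==> f z = g z"
 shows "C_k_on k S f ==> C_k_on k S g" using assms(2)
proof (induction k arbitrary: f g)
 case 0
 thus ?case by (simp cong: continuous_on_cong)
next
 case (Suc k)
 have "C_k_on k S (%z. fd g z w)" for w
 proof (rule Suc.IH)
  show "C_k_on k S (%z. fd f z w)" using Suc.prems(1) by simp
  show "fd f z w = fd g z w" if "z : S" for z using fd_cong(1)[OF assms(1) that, of f g] Suc.prems(2) by simp
 qed
 moreover have "g differentiable (at z)" if "z : S" for z using fd_cong(2)[OF assms(1) that, of f g] Suc.prems that by simp
 ultimately show ?case by simp
qed

lemma smooth_on_cong:
 assumes "open S" "!!z. z : S ==> f z = g z"
 shows "smooth_on S f ==> smooth_on S g" using C_k_cong[OF assms] by (auto simp: smooth_on_def)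

lemma C_k_Suc_imp: "C_k_on (Suc k) S f ==> C_k_on k S f"
proof (induction k arbitrary: f)
 case 0
 thus ?case by (auto intro!: differentiable_imp_continuous_on simp: differentiable_on_def differentiable_at_withinI)
next
 case (Suc k)
 thus ?case by auto
qed

lemma diff_fd: "f differentiable (at z) ==> (f has_derivative fd f z) (at z)" by (simp add: frechet_derivative_works)

lemma frechet_const [simp]: "fd (%_. c) z = (%_. 0)" by (rule fd_at[symmetric]) simp

lemma C_k_const: "C_k_on k S (%_. c)"
proof (induction k arbitrary: c)
 case (Suc k)
 have "C_k_on k S (%z. fd (%_. c) z w)" for w unfolding frechet_const using Suc[of 0] by simp
 thus ?case by simp
qed simp

lemma C_k_linear:
 assumes T: "bounded_linear T" and "open S"
 shows "C_k_on k S f ==> C_k_on k S (%z. T (f z))"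
proof (induction k arbitrary: f)
 case 0
 thus ?case by (simp add: bounded_linear.continuous_on[OF T])
next
 case (Suc k)
 have d: "((%z. T (f z)) has_derivative (%w. T (fd f z w))) (at z)" if "z : S" for z using Suc.prems that by (auto intro!: bl_hd[OF T] diff_fd)
 have "C_k_on k S (%z. fd (%z. T (f z)) z w)" for w by (rule C_k_cong[OF `open S`, of "%z. T (fd f z w)"])
   (use Suc in "simp_all flip: fd_at[OF d]")
 thus ?case using d by (auto simp: differentiable_def)
qed

lemma C_k_add:
 assumes "open S"
 shows "C_k_on k S f ==> C_k_on k S g ==> C_k_on k S (%z. f z + g z)"
proof (induction k arbitrary: f g)
 case 0
 thus ?case by (simp add: continuous_on_add)
next
 case (Suc k)
 have d: "((%z. f z + g z) has_derivative (%w. fd f z w + fd g z w)) (at z)"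
  if "z : S" for z using Suc.prems that by (auto intro!: has_derivative_add diff_fd)
 have "C_k_on k S (%z. fd (%z. f z + g z) z w)" for w by (rule C_k_cong[OF assms, of "%z. fd f z w + fd g z w"])
   (use Suc in "simp_all flip: fd_at[OF d]")
 thus ?case using d by (auto simp: differentiable_def)
qed

lemma C_k_mult:
 fixes f g :: "'a::real_normed_vector => 'b::real_normed_algebra"
 assumes "open S"
 shows "C_k_on k S f ==> C_k_on k S g ==> C_k_on k S (%z. f z * g z)"
proof (induction k arbitrary: f g)
 case 0
 thus ?case by (simp add: continuous_on_mult)
next
 case (Suc k)
 let ?D = "%z w. f z * fd g z w + fd f z w * g z"
 have d: "((%z. f z * g z) has_derivative ?D z) (at z)" if "z : S" for z using Suc.prems that by (auto intro!: has_derivative_mult diff_fd)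
 have "C_k_on k S (%z. ?D z w)" for w using Suc.prems C_k_Suc_imp[of k S f] C_k_Suc_imp[of k S g] by (intro C_k_add[OF assms] Suc.IH) auto
 hence "C_k_on k S (%z. fd (%z. f z * g z) z w)" for w by (rule C_k_cong[OF assms, rotated]) (simp flip: fd_at[OF d])
 thus ?case using d by (auto simp: differentiable_def)
qed

lemma C_k_inverse:
 fixes f :: "'a::real_normed_vector => 'b::real_normed_field"
 assumes "open S" "!!z. z : S ==> f z ~= 0"
 shows "C_k_on k S f ==> C_k_on k S (%z. inverse (f z))"
proof (induction k)
 case 0
 thus ?case using assms(2) by (auto intro: continuous_on_inverse)
next
 case (Suc k)
 let ?D = "%z w. - (inverse (f z) * fd f z w * inverse (f z))"
 have d: "((%z. inverse (f z)) has_derivative ?D z) (at z)" if "z : S" for z using Suc.prems that assms(2) by (auto intro!: Deriv.has_derivative_inverse diff_fd)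
 have i: "C_k_on k S (%z. inverse (f z))" using Suc C_k_Suc_imp by blast
 have "C_k_on k S (%z. (-1) * (inverse (f z) * fd f z w * inverse (f z)))" for w using Suc.prems by (intro C_k_mult[OF assms(1)] i C_k_const) auto
 note * = this
 have "C_k_on k S (%z. fd (%z. inverse (f z)) z w)" for w by (rule C_k_cong[OF assms(1) _ *[of w]])
   (simp_all flip: fd_at[OF d])
 thus ?case using d by (auto simp: differentiable_def)
qed

context
 fixes S :: "'a::real_normed_vector set"
 assumes S: "open S"
begin

lemma smooth_const: "smooth_on S (%_. c)" by (simp add: smooth_on_def C_k_const)
lemma smooth_add: "smooth_on S f ==> smooth_on S g ==> smooth_on S (%z. f z + g z)" by (simp add: smooth_on_def C_k_add S)
lemma smooth_mult: "smooth_on S f ==> smooth_on S g ==> smooth_on S (%z. f z * g z :: complex)" by (simp add: smooth_on_def C_k_mult S)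
lemma smooth_cnj: "smooth_on S f ==> smooth_on S (%z. cnj (f z))" by (simp add: smooth_on_def C_k_linear S bounded_linear_cnj)
lemma smooth_inverse: "smooth_on S f ==> (!!z. z : S ==> f z ~= 0) ==> smooth_on S (%z. inverse (f z) :: complex)" by (simp add: smooth_on_def C_k_inverse S)
lemma smooth_minus: "smooth_on S f ==> smooth_on S (%z. - f z :: complex)" using smooth_mult[OF smooth_const[of "-1"], of f] by simp
lemma smooth_diff: "smooth_on S f ==> smooth_on S g ==> smooth_on S (%z. f z - g z :: complex)" using smooth_add[of f "%z. - g z"] smooth_minus[of g] by simp
lemma smooth_sum: "(!!i. i : I ==> smooth_on S (f i)) ==> smooth_on S (%z. SUM i:I. f i z :: complex)" by (induction I rule: infinite_finite_induct) (simp_all add: smooth_const smooth_add)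

lemma smooth_pd: "smooth_on S f ==> smooth_on S (%z. fd f z w)" unfolding smooth_on_def using C_k_on.simps(2) by blast

end

lemma smooth_dble: "smooth_on S f ==> z : S ==> f differentiable (at z)" unfolding smooth_on_def using C_k_on.simps(2)[of 0 S f] by blast
lemma smooth_imp_continuous: "smooth_on S f ==> continuous_on S f" unfolding smooth_on_def using C_k_on.simps(1)[of S f] by blast
lemma smooth_on_subset: "smooth_on S f ==> T <= S ==> smooth_on T f"
proof -
 have "C_k_on k S f ==> T <= S ==> C_k_on k T f" for k by (induction k arbitrary: f) (auto intro: continuous_on_subset)
 thus "smooth_on S f ==> T <= S ==> smooth_on T f" by (auto simp: smooth_on_def)
qed

lemma deriv_line:
 fixes f :: "'a::real_normed_vector => 'b::real_normed_vector"
 assumes "bounded_linear T" "f differentiable (at (y + s *R v))"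
 shows "((%s. T (f (y + s *R v))) has_real_derivative T (fd f (y + s *R v) v)) (at s)"
proof -
 have "((%s. y + s *R v) has_derivative (%h. h *R v)) (at s)" by (auto intro!: derivative_eq_intros)
 from has_derivative_compose[OF this diff_fd[OF assms(2)]]
 have "((%s. T (f (y + s *R v))) has_derivative (%h. T (fd f (y + s *R v) (h *R v)))) (at s)" by (rule bl_hd[OF assms(1)])
 moreover have "T (fd f (y + s *R v) (h *R v)) = T (fd f (y + s *R v) v) * h" for h using linear_frechet_derivative[OF assms(2)] assms(1) by (simp add: linear_scale bounded_linear.linear)
 ultimately show ?thesis by (simp add: has_field_derivative_def)
qed

text \<open>The mean value theorem, applied twice, finds a mixed derivative inside the double difference quotient.\<close>
lemma mixed_difference:
 fixes f :: "'a::real_normed_vector => 'b::real_normed_vector"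
 assumes T: "bounded_linear T" and h: "0 < (h::real)"
  and in1: "!!s t. 0 <= s ==> s <= h ==> 0 <= t ==> t <= h ==> z + s *R v + t *R w : S"
  and d1: "!!y. y : S ==> f differentiable (at y)"
  and d2: "!!y. y : S ==> (%y. fd f y v) differentiable (at y)"
 shows "EX s t. 0 <= s & s <= h & 0 <= t & t <= h &
  T (f (z + h *R v + h *R w) - f (z + h *R v) - f (z + h *R w) + f z) =
  h * h * T (fd (%y. fd f y v) (z + s *R v + t *R w) w)"
proof -
 interpret T: bounded_linear T by fact
 let ?a = "%y. fd f y v"
 have i1: "z + h *R w + s *R v : S" and i2: "z + s *R v : S" if "0 <= s" "s <= h" for s using in1[of s h] in1[of s 0] that h by (simp_all add: add.commute add.left_commute)
 have "EX s. 0 < s & s < h & (T (f (z + h *R w + h *R v)) - T (f (z + h *R v))) -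
   (T (f (z + h *R w + 0 *R v)) - T (f (z + 0 *R v))) =
   (h - 0) * (T (?a (z + h *R w + s *R v)) - T (?a (z + s *R v)))" by (rule MVT2[OF h]) (auto intro!: DERIV_diff deriv_line T d1 i1 i2)
 then obtain s where s: "0 < s" "s < h" "T (f (z + h *R v + h *R w) - f (z + h *R v) - f (z + h *R w) + f z) =
   h * (T (?a (z + s *R v + h *R w)) - T (?a (z + s *R v)))" by (auto simp: algebra_simps T.add T.diff)
 have "EX t. 0 < t & t < h & T (?a (z + s *R v + h *R w)) - T (?a (z + s *R v + 0 *R w)) =
   (h - 0) * T (fd ?a (z + s *R v + t *R w) w)" by (rule MVT2[OF h]) (use in1[of s] s in "auto intro!: deriv_line T d2")
 then obtain t where t: "0 < t" "t < h" "T (?a (z + s *R v + h *R w)) - T (?a (z + s *R v)) =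
   h * T (fd ?a (z + s *R v + t *R w) w)" by auto
 show ?thesis using s t by (intro exI[of _ s] exI[of _ t]) (auto simp: mult.assoc)
qed

text \<open>The double difference is symmetric in the two directions and approximates both mixed derivatives.\<close>
lemma second_derivative_symmetric:
 fixes f :: "'a::real_normed_vector => complex"
 assumes S: "open S" and z: "z : S" and C: "smooth_on S f"
 shows "fd (%y. fd f y v) z w =
     fd (%y. fd f y w) z v"
proof -
 let ?A = "%y. fd (%y. fd f y v) y w"
 let ?B = "%y. fd (%y. fd f y w) y v"
 have d1: "!!y. y : S ==> f differentiable (at y)" using C smooth_dble by blast
 have d2: "!!y u. y : S ==> (%y. fd f y u) differentiable (at y)" using C smooth_dble smooth_pd[OF S] by blast
 have cont: "isCont ?A z" "isCont ?B z" using smooth_imp_continuous[OF smooth_pd[OF S smooth_pd[OF S C]]] S z by (auto simp: continuous_on_eq_continuous_at)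
 obtain e where e: "e > 0" "ball z e <= S" using S z open_contains_ball by blast
 define K where "K = norm v + norm w + 1"
 have K: "K > 0" by (simp add: K_def add_nonneg_pos)
 define h where "h n = e / (2 * K * Suc n)" for n
 have h0: "h n > 0" for n using e K by (simp add: h_def)
 have near: "norm (s *R v + t *R w) <= h n * K" if "0 <= s" "s <= h n" "0 <= t" "t <= h n" for s t n
 proof -
  have "norm (s *R v + t *R w) <= s * norm v + t * norm w" using norm_triangle_ineq[of "s *R v" "t *R w"] that by simp
  also have "... <= h n * norm v + h n * norm w" using that by (intro add_mono mult_right_mono) auto
  also have "... <= h n * K" using h0[of n] by (simp add: K_def algebra_simps)
  finally show ?thesis .
 qed
 have hK: "h n * K < e" for n
 proof -
  have "h n * K = e / (2 * Suc n)" using K by (simp add: h_def)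
  also have "... < e" using e by (simp add: field_simps add_pos_nonneg)
  finally show ?thesis .
 qed
 have inS: "z + s *R v + t *R w : S" if "0 <= s" "s <= h n" "0 <= t" "t <= h n" for s t n using near[OF that] hK[of n] e(2) by (auto simp: dist_norm add.assoc subset_iff norm_minus_commute)
 have h_lim: "(%n. h n * K) \<longlonglongrightarrow> 0"
 proof -
  have "(%n. (e / 2) * inverse (real (Suc n))) \<longlonglongrightarrow> (e/2) * 0" by (intro tendsto_mult tendsto_const LIMSEQ_inverse_real_of_nat)
  moreover have "h n * K = (e / 2) * inverse (real (Suc n))" for n unfolding h_def using K by (simp add: field_simps del: of_nat_Suc)
  ultimately show ?thesis by (simp only: mult_zero_right)
 qed
 have main: "T (?A z) = T (?B z)" if T: "bounded_linear T" for T :: "complex => real"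
 proof -
  have "ALL n. EX p q. T (?A p) = T (?B q) & norm (p - z) <= h n * K & norm (q - z) <= h n * K"
  proof
   fix n
   obtain s t where st: "0 <= s" "s <= h n" "0 <= t" "t <= h n"
    "T (f (z + h n *R v + h n *R w) - f (z + h n *R v) - f (z + h n *R w) + f z) = h n * h n * T (?A (z + s *R v + t *R w))" using mixed_difference[OF T h0[of n], of z v w S f, OF inS[where n=n] d1 d2] by auto
   have inS': "z + s *R w + t *R v : S" if "0 <= s" "s <= h n" "0 <= t" "t <= h n" for s t using inS[of t n s] that by (simp add: algebra_simps)
   then obtain s' t' where st': "0 <= s'" "s' <= h n" "0 <= t'" "t' <= h n"
    "T (f (z + h n *R w + h n *R v) - f (z + h n *R w) - f (z + h n *R v) + f z) = h n * h n * T (?B (z + s' *R w + t' *R v))" using mixed_difference[OF T h0[of n], of z w v S f, OF inS' d1 d2] by auto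
   have "f (z + h n *R w + h n *R v) - f (z + h n *R w) - f (z + h n *R v) + f z =
    f (z + h n *R v + h n *R w) - f (z + h n *R v) - f (z + h n *R w) + f z" by (simp add: algebra_simps)
   hence "h n * h n * T (?A (z + s *R v + t *R w)) = h n * h n * T (?B (z + s' *R w + t' *R v))" unfolding st(5)[symmetric] st'(5)[symmetric] by (rule arg_cong[of _ _ T, OF sym])
   hence "T (?A (z + s *R v + t *R w)) = T (?B (z + s' *R w + t' *R v))" using h0[of n] by simp
   thus "EX p q. T (?A p) = T (?B q) & norm (p - z) <= h n * K & norm (q - z) <= h n * K" using near[OF st(1-4)] near[OF st'(3,4,1,2)]
    by (intro exI[of _ "z + s *R v + t *R w"] exI[of _ "z + s' *R w + t' *R v"]) (auto simp: algebra_simps)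
  qed
  then obtain p q where pq: "!!n. T (?A (p n)) = T (?B (q n))" "!!n. norm (p n - z) <= h n * K" "!!n. norm (q n - z) <= h n * K" by metis
  have "p \<longlonglongrightarrow> z" by (rule LIM_zero_cancel, rule Lim_null_comparison[OF _ h_lim]) (simp add: pq(2))
  moreover have "q \<longlonglongrightarrow> z" by (rule LIM_zero_cancel, rule Lim_null_comparison[OF _ h_lim]) (simp add: pq(3))
  ultimately have pz: "p \<longlonglongrightarrow> z" and qz: "q \<longlonglongrightarrow> z" by auto
  have lim: "(%n. T (?A (p n))) \<longlonglongrightarrow> T (?A z)" by (rule bounded_linear.tendsto[OF T isCont_tendsto_compose[OF cont(1) pz]])
  have "(%n. T (?B (q n))) \<longlonglongrightarrow> T (?B z)" by (rule bounded_linear.tendsto[OF T isCont_tendsto_compose[OF cont(2) qz]])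
  thus ?thesis using LIMSEQ_unique[OF lim] by (simp only: pq(1))
 qed
 show ?thesis using main[OF bounded_linear_Re] main[OF bounded_linear_Im] by (rule complex_eqI)
qed

lemma clin_iff:
 "clin D \<longleftrightarrow> (ALL x y. D (x + y) = D x + D y) & (ALL c x. D (c *s x) = c * D x)" unfolding Vector_Spaces.linear_iff using vec.vector_space_axioms vector_space_over_itself.vector_space_axioms by auto

lemma hol_onD:
 assumes "hol_on S f" "z : S"
 shows "f differentiable (at z)" "clin (fd f z)"
  "(f has_derivative fd f z) (at z)"
proof -
 obtain D where D: "(f has_derivative D) (at z)" "clin D" using assms unfolding hol_on_def by blast
 thus "f differentiable (at z)" "clin (fd f z)" using fd_at[OF D(1)] by (auto simp: differentiable_def)
 thus "(f has_derivative fd f z) (at z)" by (simp add: diff_fd)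
qed

lemma hol_on_subset: "hol_on S f ==> T <= S ==> hol_on T f" unfolding hol_on_def by blast

lemma hol_on_cong: 
 assumes "open S" "!!z. z : S ==> f z = g z" "hol_on S f"
 shows "hol_on S g" unfolding hol_on_def
proof
 fix z assume z: "z : S"
 show "EX D. (g has_derivative D) (at z) & clin D" using hd_transform[OF hol_onD(3)[OF assms(3) z] assms(1) z assms(2)]
   hol_onD(2)[OF assms(3) z] by auto
qed

lemma hol_on_continuous: "hol_on S f ==> continuous_on S f" by (meson differentiable_at_withinI differentiable_imp_continuous_on differentiable_on_def hol_onD(1))

lemma vec_smult_norm: "norm (c *s (w :: complex ^ 'n::finite)) = norm c * norm w" unfolding norm_vec_def by (simp add: norm_mult L2_set_right_distrib)

lemma smult_bl: "bounded_linear (%c. c *s (w :: complex ^ 'n::finite))" by (rule bounded_linear_intro[where K="norm w"])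
  (simp_all add: vec_smult_norm cvec_eq vector_scaleR_component vector_smult_component algebra_simps)

lemma hol_on_line:
 assumes h: "hol_on S f" and z: "z + t *s w : S"
 shows "((%t. f (z + t *s w)) has_field_derivative fd f (z + t *s w) w) (at t)"
proof -
 have "((%t. z + t *s w) has_derivative (%h. h *s w)) (at t)" using bounded_linear_imp_has_derivative[OF smult_bl[of w], of "at t"] by (auto intro!: derivative_eq_intros)
 from has_derivative_compose[OF this hol_onD(3)[OF h z]]
 have "((%t. f (z + t *s w)) has_derivative (%h. fd f (z + t *s w) (h *s w))) (at t)" .
 moreover have "(%h. fd f (z + t *s w) (h *s w)) = (*) (fd f (z + t *s w) w)" using hol_onD(2)[OF h z] by (auto simp: clin_iff mult.commute)
 ultimately show ?thesis by (simp only: has_field_derivative_def)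
qed

text \<open>Cauchy's formula on a complex line, written over a fixed parameter interval so that one can differentiate
 under the integral sign in the remaining variables.\<close>
lemma Cauchy_directional_derivative:
 assumes h: "hol_on S f" and r: "r > 0" and S: "!!t. norm t <= r ==> z + t *s w : S"
 shows "fd f z w =
  integral (cbox 0 1) (%s. f (z + circlepath 0 r s *s w) / circlepath 0 r s)"
proof -
 let ?g = "%t. f (z + t *s w)"
 have d: "(?g has_field_derivative fd f (z + t *s w) w) (at t)" if "norm t <= r" for t by (rule hol_on_line[OF h S[OF that]])
 have cont: "continuous_on (cball 0 r) ?g" by (rule DERIV_continuous_on[where D="%t. fd f (z + t *s w) w"]) (auto intro!: DERIV_subset[OF d])
 have hol: "?g holomorphic_on ball 0 r" unfolding holomorphic_on_open[OF open_ball] 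
 proof
  fix x :: complex assume "x : ball 0 r"
  hence "norm x <= r" by simp
  from d[OF this] show "EX f'. (?g has_field_derivative f') (at x)" by blast
 qed
 have "(?g has_field_derivative (1 / (2 * of_real pi * \<i>) * contour_integral (circlepath 0 r) (%u. ?g u / (u-0)^2))) (at 0)" by (rule Cauchy_derivative_integral_circlepath(2)[OF cont hol]) (use r in simp)
 moreover have "(?g has_field_derivative fd f z w) (at 0)" using d[of 0] r by simp
 ultimately have "fd f z w =
   1 / (2 * of_real pi * \<i>) * contour_integral (circlepath 0 r) (%u. ?g u / (u-0)^2)" by (rule DERIV_unique[rotated])
 hence "fd f z w =
   1 / (2 * of_real pi * \<i>) * contour_integral (circlepath 0 r) (%u. ?g u / u^2)" by (simp only: diff_zero)
 also have "contour_integral (circlepath 0 r) (%u. ?g u / u^2) =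
   integral {0..1} (%s. (2 * of_real pi * \<i>) * (?g (circlepath 0 r s) / circlepath 0 r s))" unfolding contour_integral_integral
 proof (rule integral_cong)
  fix s :: real
  have nz: "circlepath 0 r s ~= 0" using r by (simp add: circlepath)
  have vd: "vector_derivative (circlepath 0 r) (at s) = 2 * of_real pi * \<i> * circlepath 0 r s" using vector_derivative_circlepath[of 0 r s] by (simp add: circlepath mult.assoc)
  have "a / b^2 * (k * b) = k * (a / b)" if "b ~= 0" for a b k :: complex using that by (simp add: power2_eq_square)
  thus "?g (circlepath 0 r s) / (circlepath 0 r s)^2 * vector_derivative (circlepath 0 r) (at s) =
    (2 * of_real pi * \<i>) * (?g (circlepath 0 r s) / circlepath 0 r s)" unfolding vd using nz by blast
 qed
 also have "... = (2 * of_real pi * \<i>) * integral {0..1} (%s. ?g (circlepath 0 r s) / circlepath 0 r s)" by (rule integral_mult_right)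
 finally show ?thesis by simp
qed

lemma hol_uniform_discs:
 fixes S :: "(complex ^ 'n::finite) set"
 assumes "open S" "z0 : S"
 obtains r d where "r > 0" "d > 0" "!!z t. z : ball z0 d ==> norm t <= r ==> z + t *s w : S" "ball z0 d <= S"
proof -
 obtain e where e: "e > 0" "ball z0 e <= S" using assms open_contains_ball by blast
 define r where "r = e / (2 * (norm w + 1))"
 have nw: "norm w + 1 > 0" by (simp add: add_nonneg_pos)
 have r: "r > 0" using e nw by (simp add: r_def)
 show ?thesis
 proof (rule that[of r "e/2"])
  fix z t assume z: "z : ball z0 (e/2)" and t: "norm (t::complex) <= r"
  have "norm (t *s w) <= r * norm w" using t by (simp add: vec_smult_norm mult_right_mono)
  also have "... <= r * (norm w + 1)" using r by simp
  also have "... = e / 2" using nw by (simp add: r_def field_simps)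
  finally have "dist z (z + t *s w) <= e / 2" by (simp add: dist_norm)
  hence "dist z0 (z + t *s w) < e" using z dist_triangle[of z0 "z + t *s w" z] by (simp add: dist_commute)
  thus "z + t *s w : S" using e by auto
 qed (use e r in auto)
qed

text \<open>By the integral formula a directional derivative is an integral that depends continuously on the point.\<close>
lemma hol_on_directional_continuous:
 assumes "open S" "hol_on S f"
 shows "continuous_on S (%z. fd f z w)" unfolding continuous_on_eq_continuous_at[OF assms(1)]
proof
 fix z0 assume "z0 : S"
 from hol_uniform_discs[OF assms(1) this, of w] obtain r d where rd: "r > 0" "d > 0"
  "!!z t. z : ball z0 d ==> norm t <= r ==> z + t *s w : S" by metis
 have nc: "norm (circlepath 0 r s) = r" for s using rd(1) by (simp add: circlepath norm_mult)
 have c: "continuous_on UNIV (circlepath 0 r)" by (simp add: circlepath) (intro continuous_intros)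
 have nz: "circlepath 0 r s ~= 0" for s using nc[of s] rd(1) by auto
 have "continuous_on (ball z0 d \<times> cbox 0 1) (%(z, s). f (z + circlepath 0 r s *s w) / circlepath 0 r s)" unfolding case_prod_beta
 proof (intro continuous_on_divide continuous_on_compose2[OF hol_on_continuous[OF assms(2)]])
  show c': "continuous_on (ball z0 d \<times> cbox 0 1) (%p. circlepath 0 r (snd p))" by (intro continuous_on_compose2[OF c]) (auto intro: continuous_intros)
  show "continuous_on (ball z0 d \<times> cbox 0 1) (%p. fst p + circlepath 0 r (snd p) *s w)" by (intro continuous_on_add bounded_linear.continuous_on[OF smult_bl] c' continuous_intros)
 qed (use rd nc nz in auto)
 from integral_continuous_on_param[OF this]
 have "continuous_on (ball z0 d) (%z. fd f z w)" by (rule continuous_on_eq) (use Cauchy_directional_derivative[OF assms(2) rd(1) rd(3)] in auto)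
 thus "isCont (%z. fd f z w) z0" using rd(2) by (simp add: continuous_on_eq_continuous_at)
qed

lemma hol_on_directional:
 assumes "open S" "hol_on S f"
 shows "hol_on S (%z. fd f z w)" unfolding hol_on_def
proof
 fix z0 assume "z0 : S"
 from hol_uniform_discs[OF assms(1) this, of w] obtain r d where rd: "r > 0" "d > 0"
  "!!z t. z : ball z0 d ==> norm t <= r ==> z + t *s w : S" "ball z0 d <= S" by metis
 let ?c = "circlepath 0 r"
 have nc: "norm (?c s) = r" for s using rd(1) by (simp add: circlepath norm_mult)
 have c: "continuous_on UNIV ?c" by (simp add: circlepath) (intro continuous_intros)
 have nz: "?c s ~= 0" for s using nc[of s] rd(1) by auto
 have inS: "z + ?c s *s w : S" if "z : ball z0 d" for z s using rd(3)[OF that, of "?c s"] nc[of s] by simp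
 define D where "D z s = Blinfun (%u. fd f (z + ?c s *s w) u / ?c s)" for z s
 have bl: "bounded_linear (fd f z)" if "z : S" for z using hol_onD(3)[OF assms(2) that] has_derivative_bounded_linear by blast
 have D: "blinfun_apply (D z s) = (%u. fd f (z + ?c s *s w) u / ?c s)" if "z : ball z0 d" for z s unfolding D_def
  by (rule bounded_linear_Blinfun_apply) (intro bounded_linear_compose[OF bounded_linear_divide] bl inS that)
 have cc: "continuous_on (ball z0 d \<times> cbox 0 1) (%p. ?c (snd p))" by (intro continuous_on_compose2[OF c]) (auto intro: continuous_intros)
 have cz: "continuous_on (ball z0 d \<times> cbox 0 1) (%p. fst p + ?c (snd p) *s w)" by (intro continuous_on_add bounded_linear.continuous_on[OF smult_bl] cc continuous_intros)
 have cD: "continuous_on (ball z0 d \<times> cbox 0 1) (%(z, s). D z s)"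
 proof (rule continuous_on_blinfun_componentwise)
  fix i :: "complex ^ 'a"
  have "continuous_on (ball z0 d \<times> cbox 0 1) (%p. fd f (fst p + ?c (snd p) *s w) i / ?c (snd p))" by (intro continuous_on_divide cc continuous_on_compose2[OF hol_on_directional_continuous[OF assms]] cz)
    (use inS nz in auto)
  thus "continuous_on (ball z0 d \<times> cbox 0 1) (%x. blinfun_apply (case x of (z, s) => D z s) i)" by (rule continuous_on_eq) (auto simp: D)
 qed
 have cf: "continuous_on (cbox 0 1) (%s. f (z + ?c s *s w) / ?c s)" if "z : ball z0 d" for z by (intro continuous_on_divide continuous_on_compose2[OF hol_on_continuous[OF assms(2)]]
   continuous_on_add bounded_linear.continuous_on[OF smult_bl] continuous_on_subset[OF c] continuous_intros)
   (use inS that nz in auto)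
 have "((%z. integral (cbox 0 1) (%s. f (z + ?c s *s w) / ?c s)) has_derivative
   blinfun_apply (integral (cbox 0 1) (D z0))) (at z0 within ball z0 d)"
 proof (rule leibniz_rule[OF _ _ cD])
  fix z s assume z: "z : ball z0 d"
  have 1: "((%z. z + ?c s *s w) has_derivative (%u. u)) (at z)" by (auto intro!: derivative_eq_intros)
  have "((%z. f (z + ?c s *s w)) has_derivative (%u. fd f (z + ?c s *s w) u)) (at z)" by (rule has_derivative_compose[OF 1 hol_onD(3)[OF assms(2) inS[OF z]]])
  hence "((%z. f (z + ?c s *s w) / ?c s) has_derivative blinfun_apply (D z s)) (at z)" unfolding D[OF z] by (rule bl_hd[OF bounded_linear_divide])
  thus "((%z. f (z + ?c s *s w) / ?c s) has_derivative blinfun_apply (D z s)) (at z within ball z0 d)" by (rule has_derivative_at_withinI)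
  show "(%s. f (z + ?c s *s w) / ?c s) integrable_on cbox 0 1" by (rule integrable_continuous[OF cf[OF z]])
 qed (use rd in auto)
 hence "((%z. integral (cbox 0 1) (%s. f (z + ?c s *s w) / ?c s)) has_derivative
   blinfun_apply (integral (cbox 0 1) (D z0))) (at z0)" using rd(2) by (simp add: at_within_open[of z0 "ball z0 d"])
 hence der: "((%z. fd f z w) has_derivative blinfun_apply (integral (cbox 0 1) (D z0))) (at z0)" by (rule hd_transform[where s="ball z0 d"])
   (use rd(2) Cauchy_directional_derivative[OF assms(2) rd(1) rd(3)] in auto)
 have iD: "D z0 integrable_on cbox 0 1" by (rule integrable_continuous, rule continuous_on_compose2[OF cD, where f="%s. (z0, s)", simplified])
   (use rd in "auto intro!: continuous_intros")
 have app: "blinfun_apply (integral (cbox 0 1) (D z0)) u = integral (cbox 0 1) (%s. blinfun_apply (D z0 s) u)" for u using integral_linear[OF iD blinfun.bounded_linear_left[of u]] by (simp add: o_def)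
 have "blinfun_apply (integral (cbox 0 1) (D z0)) (c *s u) = c * blinfun_apply (integral (cbox 0 1) (D z0)) u" for c u
 proof -
  have "blinfun_apply (D z0 s) (c *s u) = c * blinfun_apply (D z0 s) u" for s using hol_onD(2)[OF assms(2) inS[of z0 s]] rd(2) D[of z0 s] by (simp add: clin_iff)
  thus ?thesis unfolding app by simp
 qed
 thus "EX D. ((%z. fd f z w) has_derivative D) (at z0) & clin D" using der by (intro exI[of _ "blinfun_apply (integral (cbox 0 1) (D z0))"]) (simp add: clin_iff blinfun.add_right)
qed

text \<open>Directional derivatives are again
 holomorphic by the integral formula, and this can be iterated.\<close>
theorem hol_on_smooth:
 assumes "open S" "hol_on S f"
 shows "smooth_on S f"
proof -
 have "C_k_on k S f" for k using assms(2)
 proof (induction k arbitrary: f)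
  case 0
  thus ?case by (simp add: hol_on_continuous)
 next
  case (Suc k)
  thus ?case using hol_on_directional[OF assms(1)] hol_onD(1) by auto
 qed
 thus ?thesis by (simp add: smooth_on_def)
qed

lemma hol_on_const: "hol_on S (%_. c)" unfolding hol_on_def by (auto intro!: exI[of _ "%_. 0"] simp: clin_iff)

lemma hol_on_add: "hol_on S f ==> hol_on S g ==> hol_on S (%z. f z + g z)" unfolding hol_on_def
proof
 fix z assume *: "ALL z:S. EX D. (f has_derivative D) (at z) & clin D"
  "ALL z:S. EX D. (g has_derivative D) (at z) & clin D" "z : S"
 then obtain D D' where "(f has_derivative D) (at z)" "clin D" "(g has_derivative D') (at z)" "clin D'" by blast
 thus "EX D. ((%z. f z + g z) has_derivative D) (at z) & clin D" by (intro exI[of _ "%w. D w + D' w"] conjI has_derivative_add) (auto simp: clin_iff algebra_simps)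
qed

lemma hol_on_mult: "hol_on S f ==> hol_on S g ==> hol_on S (%z. f z * g z)" unfolding hol_on_def
proof
 fix z assume *: "ALL z:S. EX D. (f has_derivative D) (at z) & clin D"
  "ALL z:S. EX D. (g has_derivative D) (at z) & clin D" "z : S"
 then obtain D D' where "(f has_derivative D) (at z)" "clin D" "(g has_derivative D') (at z)" "clin D'" by blast
 thus "EX D. ((%z. f z * g z) has_derivative D) (at z) & clin D" by (intro exI[of _ "%w. f z * D' w + D w * g z"] conjI has_derivative_mult) (auto simp: clin_iff algebra_simps)
qed

lemma hol_on_inverse: "hol_on S f ==> (!!z. z : S ==> f z ~= 0) ==> hol_on S (%z. inverse (f z))" unfolding hol_on_def
proof
 fix z assume *: "ALL z:S. EX D. (f has_derivative D) (at z) & clin D" "!!z. z : S ==> f z ~= 0" "z : S"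
 then obtain D where "(f has_derivative D) (at z)" "clin D" by blast
 thus "EX D. ((%z. inverse (f z)) has_derivative D) (at z) & clin D" using *(2,3) by (intro exI[of _ "%w. - (inverse (f z) * D w * inverse (f z))"] conjI Deriv.has_derivative_inverse)
   (auto simp: clin_iff algebra_simps)
qed

lemma hol_on_sum: "(!!i. i : I ==> hol_on S (f i)) ==> hol_on S (%z. SUM i:I. f i z)" by (induction I rule: infinite_finite_induct) (simp_all add: hol_on_const hol_on_add)

section \<open>Exterior derivative\<close>

definition pd :: "'v::real_normed_vector => ('v => 'v ext) => 'v => 'v ext" where
 "pd w al z vs = fd (%y. al y vs) z w"

definition edf :: "('v::real_normed_vector => 'v ext) => 'v => bool" where
 "edf al z \<longleftrightarrow> (ALL vs. (%y. al y vs) differentiable (at z))"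

definition esm :: "'v::real_normed_vector set => ('v => 'v ext) => bool" where
 "esm S al \<longleftrightarrow> (ALL vs. smooth_on S (%y. al y vs))"

lemma esm_edf: "esm S al ==> z : S ==> edf al z" using smooth_dble unfolding esm_def edf_def by blast

lemma edf_hd: "edf al z ==> ((%y. al y vs) has_derivative (%w. pd w al z vs)) (at z)" by (simp add: edf_def pd_def diff_fd)

lemma hd_edf: "(!!vs. ((%y. al y vs) has_derivative D vs) (at z)) ==> edf al z" unfolding edf_def differentiable_def by blast

lemma pd_eqI: "(!!vs. ((%y. al y vs) has_derivative (%w. D w vs)) (at z)) ==> pd w al z = D w"
proof (rule ext)
 fix vs assume *: "!!vs. ((%y. al y vs) has_derivative (%w. D w vs)) (at z)"
 have "fd (%y. al y vs) z = (%w. D w vs)" by (rule fd_at[symmetric, OF *])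
 thus "pd w al z vs = D w vs" by (simp add: pd_def)
qed

lemma
 assumes "edf al z" "edf bt z"
 shows edf_add: "edf (%y. al y + bt y) z"
  and pd_add: "pd w (%y. al y + bt y) z = pd w al z + pd w bt z"
proof -
 have "((%y. (al y + bt y) vs) has_derivative (%w. (pd w al z + pd w bt z) vs)) (at z)" for vs unfolding plus_fun_apply by (intro has_derivative_add edf_hd assms)
 note 1 = this
 show "edf (%y. al y + bt y) z" by (rule hd_edf, rule 1)
 show "pd w (%y. al y + bt y) z = pd w al z + pd w bt z" by (rule pd_eqI[where D="%w. pd w al z + pd w bt z"], rule 1)
qed

lemma
 assumes "edf al z"
 shows edf_sg: "edf (%y. sg (al y)) z"
  and pd_sg: "pd w (%y. sg (al y)) z = sg (pd w al z)"
  and edf_minus: "edf (%y. - al y) z"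
  and pd_minus: "pd w (%y. - al y) z = - pd w al z"
  and edf_contr: "edf (%y. contr x (al y)) z"
  and pd_contr: "pd w (%y. contr x (al y)) z = contr x (pd w al z)"
  and edf_scale: "edf (%y vs. c * al y vs) z"
  and pd_scale: "pd w (%y vs. c * al y vs) z = (%vs. c * pd w al z vs)"
proof -
 have 1: "((%y. sg (al y) vs) has_derivative (%w. sg (pd w al z) vs)) (at z)" for vs unfolding sg_def by (intro has_derivative_mult_right edf_hd assms)
 have 2: "((%y. (- al y) vs) has_derivative (%w. (- pd w al z) vs)) (at z)" for vs unfolding uminus_apply by (intro has_derivative_minus edf_hd assms)
 have 3: "((%y. contr x (al y) vs) has_derivative (%w. contr x (pd w al z) vs)) (at z)" for vs unfolding contr_def by (intro edf_hd assms)
 have 4: "((%y. c * al y vs) has_derivative (%w. c * pd w al z vs)) (at z)" for vs by (intro has_derivative_mult_right edf_hd assms)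
 show "edf (%y. sg (al y)) z" by (rule hd_edf, rule 1)
 show "pd w (%y. sg (al y)) z = sg (pd w al z)" by (rule pd_eqI[where D="%w. sg (pd w al z)"], rule 1)
 show "edf (%y. - al y) z" by (rule hd_edf, rule 2)
 show "pd w (%y. - al y) z = - pd w al z" by (rule pd_eqI[where D="%w. - pd w al z"], rule 2)
 show "edf (%y. contr x (al y)) z" by (rule hd_edf, rule 3)
 show "pd w (%y. contr x (al y)) z = contr x (pd w al z)" by (rule pd_eqI[where D="%w. contr x (pd w al z)"], rule 3)
 show "edf (%y vs. c * al y vs) z" by (rule hd_edf, rule 4)
 show "pd w (%y vs. c * al y vs) z = (%vs. c * pd w al z vs)" by (rule pd_eqI[where D="%w vs. c * pd w al z vs"], rule 4)
qed

lemma
 assumes "edf al z" "edf bt z"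
 shows edf_wedge: "edf (%y. wedge (al y) (bt y)) z"
  and pd_wedge: "pd w (%y. wedge (al y) (bt y)) z = wedge (pd w al z) (bt z) + wedge (al z) (pd w bt z)"
proof -
 have "((%y. wedge (al y) (bt y) vs) has_derivative
  (%w. (wedge (pd w al z) (bt z) + wedge (al z) (pd w bt z)) vs)) (at z)" for vs
 proof -
  have "((%y. wedge (al y) (bt y) vs) has_derivative
   (%w. SUM I:Pow {..<length vs}. (shuffle_sign (length vs) I * al z (nths vs I)) * pd w bt z (nths vs (- I)) +
     (shuffle_sign (length vs) I * pd w al z (nths vs I)) * bt z (nths vs (- I)))) (at z)" unfolding wedge_def by (intro has_derivative_sum has_derivative_mult has_derivative_mult_right edf_hd assms)
  thus ?thesis unfolding plus_fun_apply wedge_def sum.distrib by (simp only: add.commute)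
 qed
 note 1 = this
 show "edf (%y. wedge (al y) (bt y)) z" by (rule hd_edf, rule 1)
 show "pd w (%y. wedge (al y) (bt y)) z = wedge (pd w al z) (bt z) + wedge (al z) (pd w bt z)" by (rule pd_eqI[where D="%w. wedge (pd w al z) (bt z) + wedge (al z) (pd w bt z)"], rule 1)
qed

lemma ed_Nil [simp]: "ed al z [] = 0" by (simp add: ext_deriv_def)

text \<open>Cartan's formula for a constant vector field; with \<open>contr_wedge\<close> it makes the Leibniz rule an induction
 on the argument list.\<close>
lemma contr_ext_deriv: "contr x (ed al z) = pd x al z - ed (%y. contr x (al y)) z"
proof
 fix vs
 show "contr x (ed al z) vs = (pd x al z - ed (%y. contr x (al y)) z) vs" unfolding contr_def[of x "ed al z"] ext_deriv_def[of al] length_Cons sum.lessThan_Suc_shift by (simp add: ext_deriv_def pd_def contr_def sum_negf)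
qed

lemma ed_Cons: "ed al z (x # vs) = pd x al z vs - ed (%y. contr x (al y)) z vs" using fun_cong[OF contr_ext_deriv[of x al z], of vs] by (simp add: contr_def)

lemma ed_add:
 assumes "edf al z" "edf bt z"
 shows "ed (%y. al y + bt y) z = ed al z + ed bt z"
proof
 fix vs show "ed (%y. al y + bt y) z vs = (ed al z + ed bt z) vs" using assms by (induction vs arbitrary: al bt) (simp_all add: ed_Cons pd_add contr_simps edf_contr)
qed

lemma ed_scale:
 assumes "edf al z"
 shows "ed (%y vs. c * al y vs) z = (%vs. c * ed al z vs)"
proof
 fix vs show "ed (%y vs. c * al y vs) z vs = c * ed al z vs" using assms
 proof (induction vs arbitrary: al)
  case (Cons x vs)
  have "contr x (%vs. c * al y vs) = (%vs. c * contr x (al y) vs)" for y by (auto simp: contr_def)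
  thus ?case using Cons by (simp add: ed_Cons pd_scale edf_contr algebra_simps)
 qed simp
qed

lemma ed_minus: "edf al z ==> ed (%y. - al y) z = - ed al z" using ed_scale[of al z "-1"] by (simp add: fun_Compl_def)

lemma ed_diff:
 assumes "edf al z" "edf bt z"
 shows "ed (%y. al y - bt y) z = ed al z - ed bt z" using ed_add[OF assms(1) edf_minus[OF assms(2)]] ed_minus[OF assms(2)] by simp

lemma ed_const [simp]: "ed (%_. al) z = 0"
proof
 fix vs show "ed (%_. al) z vs = 0 vs" by (induction vs arbitrary: al) (auto simp: ed_Cons pd_def)
qed

lemma edf_const: "edf (%_. al) z" by (simp add: edf_def)

lemma edf_sum: "(!!k. k : K ==> edf (al k) z) ==> edf (%y. SUM k:K. al k y) z"
proof (induction K rule: infinite_finite_induct)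
 case (insert x F)
 thus ?case by (simp only: sum.insert not_False_eq_True) (rule edf_add, auto)
qed (simp_all only: sum.infinite sum.empty edf_const not_False_eq_True)

lemma ed_sum:
 "(!!k. k : K ==> edf (al k) z) ==> ed (%y. SUM k:K. al k y) z = (SUM k:K. ed (al k) z)"
proof (induction K rule: infinite_finite_induct)
 case (insert x F)
 have "ed (%y. al x y + (SUM k:F. al k y)) z = ed (al x) z + ed (%y. SUM k:F. al k y) z" by (rule ed_add) (use insert.prems edf_sum[of F] in auto)
 thus ?case using insert by (simp only: sum.insert not_False_eq_True) simp
qed (simp_all only: sum.infinite sum.empty ed_const not_False_eq_True)

lemma ed_sg:
 assumes "edf al z"
 shows "ed (%y. sg (al y)) z = - sg (ed al z)"
proof
 fix vs show "ed (%y. sg (al y)) z vs = (- sg (ed al z)) vs" using assms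
 proof (induction vs arbitrary: al)
  case (Cons x vs)
  have "ed (%y. contr x (sg (al y))) z vs = - ed (%y. sg (contr x (al y))) z vs" using ed_minus[OF edf_sg[OF edf_contr[OF Cons.prems, of x]]] by (simp add: contr_simps)
  moreover have "ed (%y. sg (contr x (al y))) z vs = - sg (ed (%y. contr x (al y)) z) vs" using Cons.IH[OF edf_contr[OF Cons.prems, of x]] by simp
  ultimately show ?case using Cons.prems by (simp add: ed_Cons pd_sg sg_def[of _ "_ # _"]) (simp add: sg_def[of _ vs] algebra_simps)
 qed (simp add: sg_def)
qed

theorem ed_wedge:
 assumes "edf al z" "edf bt z"
 shows "ed (%y. wedge (al y) (bt y)) z = wedge (ed al z) (bt z) + wedge (sg (al z)) (ed bt z)"
proof
 fix vs
 show "ed (%y. wedge (al y) (bt y)) z vs =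
  (wedge (ed al z) (bt z) + wedge (sg (al z)) (ed bt z)) vs" using assms
 proof (induction vs arbitrary: al bt)
  case (Cons x vs)
  note d = Cons.prems edf_contr[OF Cons.prems(1), of x] edf_contr[OF Cons.prems(2), of x] edf_sg[OF Cons.prems(1)]
  have e: "wedge (ed (%y. sg (al y)) z) (contr x (bt z)) vs = - wedge (sg (ed al z)) (contr x (bt z)) vs" by (simp only: ed_sg[OF d(1)] wedge_minus_left uminus_apply)
  have "ed (%y. contr x (wedge (al y) (bt y))) z vs =
   ed (%y. wedge (contr x (al y)) (bt y)) z vs + ed (%y. wedge (sg (al y)) (contr x (bt y))) z vs" using ed_add[OF edf_wedge[OF d(3,2)] edf_wedge[OF d(5,4)]] by (simp add: contr_wedge)
  also have "... = wedge (ed (%y. contr x (al y)) z) (bt z) vs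
    + wedge (sg (contr x (al z))) (ed bt z) vs
    + (- wedge (sg (ed al z)) (contr x (bt z)) vs + wedge (al z) (ed (%y. contr x (bt y)) z) vs)" using Cons.IH[OF d(3,2)] Cons.IH[OF d(5,4)] by (simp only: plus_fun_apply e contr_simps)
  finally show ?case by (simp add: ed_Cons[of "%y. wedge (al y) (bt y)"] pd_wedge[OF Cons.prems] wedge_Cons contr_ext_deriv
     contr_simps wedge_diff_left wedge_diff_right wedge_minus_left)
 qed simp
qed

lemma ed_cong:
 assumes "open S" "z : S" "!!y. y : S ==> al y = bt y"
 shows "ed al z = ed bt z"
proof
 fix vs
 show "ed al z vs = ed bt z vs" unfolding ext_deriv_def using fd_cong(1)[OF assms(1,2), of "%y. al y us" "%y. bt y us" for us] assms(3) by simp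
qed

lemma hdeg_ext_deriv: "(!!y. hdeg p (al y)) ==> hdeg (Suc p) (ed al z)" unfolding hdeg_def ext_deriv_def by (auto intro!: sum.neutral)

context
 fixes S :: "'v::real_normed_vector set" assumes S: "open S"
begin

lemma esm_add: "esm S al ==> esm S bt ==> esm S (%y. al y + bt y)" by (simp add: esm_def smooth_add[OF S])

lemma esm_diff: "esm S al ==> esm S bt ==> esm S (%y. al y - bt y)" by (simp add: esm_def smooth_diff[OF S])
lemma esm_scale: "esm S al ==> esm S (%y vs. c * al y vs)" by (simp add: esm_def smooth_mult[OF S] smooth_const[OF S])
lemma esm_const: "esm S (%y. al)" by (simp add: esm_def smooth_const[OF S])
lemma esm_wedge: "esm S al ==> esm S bt ==> esm S (%y. wedge (al y) (bt y))" unfolding esm_def wedge_def by (intro allI smooth_sum[OF S] smooth_mult[OF S] smooth_const[OF S]) auto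
lemma esm_ext_deriv: "esm S al ==> esm S (ed al)" unfolding esm_def ext_deriv_def by (intro allI smooth_sum[OF S] smooth_mult[OF S] smooth_const[OF S] smooth_pd[OF S]) auto
lemma esm_pd: "esm S al ==> esm S (pd w al)" unfolding esm_def pd_def by (intro allI smooth_pd[OF S]) auto
lemma esm_contr: "esm S al ==> esm S (%y. contr x (al y))" unfolding esm_def contr_def by auto
lemma esm_sum: "(!!k. k : K ==> esm S (al k)) ==> esm S (%y. SUM k:K. al k y)"
proof (induction K rule: infinite_finite_induct)
 case (insert x F)
 thus ?case by (simp only: sum.insert not_False_eq_True) (rule esm_add, auto)
qed (simp_all only: sum.infinite sum.empty esm_const not_False_eq_True)

lemma pd_ext_deriv_commute:
 assumes "esm S al" "z : S"
 shows "pd x (ed al) z = ed (pd x al) z"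
proof
 fix vs :: "'v list"
 let ?u = "%i. take i vs @ drop (Suc i) vs"
 have sm: "smooth_on S (%y. al y us)" for us using assms(1) by (simp add: esm_def)
 have "((%y. ed al y vs) has_derivative (%x. SUM i<length vs. (-1) ^ i *
   fd (%y. fd (%y. al y (?u i)) y (vs ! i)) z x)) (at z)" unfolding ext_deriv_def by (intro has_derivative_sum has_derivative_mult_right diff_fd
    smooth_dble[OF smooth_pd[OF S sm] assms(2)])
 hence "pd x (ed al) z vs = (SUM i<length vs. (-1) ^ i *
   fd (%y. fd (%y. al y (?u i)) y (vs ! i)) z x)" by (simp add: pd_def fd_at[symmetric])
 also have "... = ed (pd x al) z vs" unfolding ext_deriv_def pd_def using second_derivative_symmetric[OF S assms(2) sm] by simp
 finally show "pd x (ed al) z vs = ed (pd x al) z vs" .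
qed

text \<open>Induction on the argument list: the second derivatives cancel by their symmetry.\<close>
theorem ed_ext_deriv:
 assumes "esm S al" "z : S"
 shows "ed (ed al) z = 0"
proof
 fix vs show "ed (ed al) z vs = 0 vs" using assms(1)
 proof (induction vs arbitrary: al)
  case (Cons x vs)
  note c = esm_contr[OF Cons.prems, of x]
  have "ed (%y. contr x (ed al y)) z = ed (pd x al) z - ed (ed (%y. contr x (al y))) z" unfolding contr_ext_deriv by (rule ed_diff) (use esm_edf[OF _ assms(2)] esm_pd Cons.prems c esm_ext_deriv in auto)
  thus ?case using Cons.IH[OF c] by (simp add: ed_Cons pd_ext_deriv_commute[OF Cons.prems assms(2)])
 qed simp
qed

end

section \<open>Matrices of forms\<close>

lemma sum_app: "(SUM k:K. f k) x = (SUM k:K. f k x)" by (induction K rule: infinite_finite_induct) simp_all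

definition md :: "('v::real_normed_vector => 'v mext) => 'v => 'v mext" where
 "md A z i j = ed (%y. A y i j) z"
definition msg :: "'v mext => 'v mext" where "msg A i j = sg (A i j)"
definition mdf where "mdf A z \<longleftrightarrow> (ALL i j. edf (%y. A y i j) z)"
definition msm where "msm S A \<longleftrightarrow> (ALL i j. esm S (%y. A y i j))"
definition mdeg :: "nat => 'v mext => bool" where "mdeg p A \<longleftrightarrow> (ALL i j. hdeg p (A i j))"
definition mdim :: "nat => nat => 'v mext => bool" where
 "mdim p q A \<longleftrightarrow> (ALL i j. i >= p \<or> j >= q --> A i j = 0)"
definition smul :: "complex => 'v mext => 'v mext" where "smul c A i j vs = c * A i j vs"
definition mtr :: "nat => 'v mext => 'v ext" where "mtr r A = (SUM i<r. A i i)"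

lemma mw_sum: "mw r A B i j = (SUM k<r. wedge (A i k) (B k j))" by (rule ext) (simp add: mwedge_def sum_app)

lemma mw_assoc: "mw r (mw s A B) C = mw s A (mw r B C)"
proof (intro ext)
 fix i j vs
 have "(SUM k<r. SUM l<s. wedge (wedge (A i l) (B l k)) (C k j)) = (SUM l<s. SUM k<r. wedge (A i l) (wedge (B l k) (C k j)))" by (subst sum.swap) (simp add: wedge_assoc)
 thus "mw r (mw s A B) C i j vs = mw s A (mw r B C) i j vs" by (simp add: mw_sum wedge_sum_left wedge_sum_right)
qed

lemma mw_add_left: "mw r (A + B) C = mw r A C + mw r B C" by (intro ext) (simp add: mwedge_def wedge_add_left sum.distrib)
lemma mw_add_right: "mw r C (A + B) = mw r C A + mw r C B" by (intro ext) (simp add: mwedge_def wedge_add_right sum.distrib)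
lemma mw_minus_left: "mw r (- A) C = - mw r A C" by (intro ext) (simp add: mwedge_def wedge_minus_left sum_negf)
lemma mw_minus_right: "mw r C (- A) = - mw r C A" by (intro ext) (simp add: mwedge_def wedge_minus_right sum_negf)
lemma mw_diff_left: "mw r (A - B) C = mw r A C - mw r B C" using mw_add_left[of r A "- B" C] by (simp add: mw_minus_left)
lemma mw_diff_right: "mw r C (A - B) = mw r C A - mw r C B" using mw_add_right[of r C A "- B"] by (simp add: mw_minus_right)
lemma mw_zero [simp]: "mw r 0 C = 0" "mw r C 0 = 0" by (intro ext, simp add: mwedge_def)+
lemma mw_smul_left: "mw r (smul c A) B = smul c (mw r A B)"
proof -
 have "smul c A i k = (%vs. c * A i k vs)" for i k by (auto simp: smul_def)
 thus ?thesis by (intro ext) (simp add: mwedge_def wedge_scale_left smul_def sum_distrib_left)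
qed
lemma mw_smul_right: "mw r A (smul c B) = smul c (mw r A B)"
proof -
 have "smul c B i k = (%vs. c * B i k vs)" for i k by (auto simp: smul_def)
 thus ?thesis by (intro ext) (simp add: mwedge_def wedge_scale_right smul_def sum_distrib_left)
qed
lemma mw_sum_left: "mw r (SUM k:K. f k) C = (SUM k:K. mw r (f k) C)" by (induction K rule: infinite_finite_induct)
  (simp_all only: sum.infinite sum.empty sum.insert mw_zero mw_add_left not_False_eq_True)
lemma mw_sum_right: "mw r C (SUM k:K. f k) = (SUM k:K. mw r C (f k))" by (induction K rule: infinite_finite_induct)
  (simp_all only: sum.infinite sum.empty sum.insert mw_zero mw_add_right not_False_eq_True)

lemmas mw_lin = mw_add_left mw_add_right mw_minus_left mw_minus_right
 mw_diff_left mw_diff_right mw_assoc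

lemma msg_mw: "msg (mw r A B) = mw r (msg A) (msg B)"
proof -
 have "sg (SUM k:K. f k) = (SUM k:K. sg (f k))" for K :: "nat set" and f :: "nat => 'a ext" by (rule ext) (simp add: sg_def sum_app sum_distrib_left)
 thus ?thesis by (intro ext) (simp add: msg_def mw_sum sg_wedge)
qed

lemma msg_mdeg: "mdeg p A ==> msg A = (if even p then A else - A)"
proof (intro ext)
 fix i j vs assume "mdeg p A"
 hence "sg (A i j) vs = (-1) ^ p * A i j vs" using sg_hdeg[of p "A i j"] by (simp add: mdeg_def)
 thus "msg A i j vs = (if even p then A else - A) i j vs" by (simp add: msg_def)
qed
lemma msg_mdeg': "mdeg 0 A ==> msg A = A" "mdeg 1 A ==> msg A = - A" "mdeg 2 A ==> msg A = A" by (simp_all add: msg_mdeg)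

lemma hdeg_add: "hdeg p al ==> hdeg p bt ==> hdeg p (al + bt)" by (auto simp: hdeg_def)
lemma hdeg_zero: "hdeg p 0" by (auto simp: hdeg_def)
lemma hdeg_sum: "(!!k. k : K ==> hdeg p (f k)) ==> hdeg p (SUM k:K. f k)" by (auto simp: hdeg_def sum_app)
lemma mdeg_add: "mdeg p A ==> mdeg p B ==> mdeg p (A + B)" by (auto simp: mdeg_def hdeg_def)
lemma mdeg_diff: "mdeg p A ==> mdeg p B ==> mdeg p (A - B)" by (auto simp: mdeg_def hdeg_def)
lemma mdeg_smul: "mdeg p A ==> mdeg p (smul c A)" by (auto simp: mdeg_def hdeg_def smul_def)
lemma mdeg_mw: "mdeg p A ==> mdeg q B ==> mdeg (p + q) (mw r A B)" unfolding mdeg_def mw_sum by (intro allI hdeg_sum hdeg_wedge) auto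
lemma mdeg_md: "(!!y. mdeg p (A y)) ==> mdeg (Suc p) (md A z)" unfolding mdeg_def md_def by (intro allI hdeg_ext_deriv) auto

lemma mdim_add: "mdim p q A ==> mdim p q B ==> mdim p q (A + B)" by (auto simp: mdim_def)
lemma mdim_diff: "mdim p q A ==> mdim p q B ==> mdim p q (A - B)" by (auto simp: mdim_def)
lemma mdim_smul: "mdim p q A ==> mdim p q (smul c A)" by (auto simp: mdim_def smul_def fun_eq_iff)
lemma mdim_mw: "mdim p q A ==> mdim q' s B ==> mdim p s (mw r A B)" unfolding mdim_def mw_sum by (intro allI impI sum.neutral) auto
lemma mdim_md: "(!!y. mdim p q (A y)) ==> mdim p q (md A z)" unfolding mdim_def md_def by auto

lemma mw_munit: "mdim p r A ==> mw r A munit = A" "mdim r p A ==> mw r munit A = A"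
proof -
 have u: "munit i j = (if i = j then unit_ext else 0)" for i j :: nat by (auto simp: munit_def)
 have "(SUM k<r. wedge (A i k) (munit k j)) = (if j < r then A i j else 0)" for i j by (simp add: u if_distrib cong: if_cong)
 thus "mdim p r A ==> mw r A munit = A" by (intro ext) (auto simp: mw_sum mdim_def)
 have "(SUM k<r. wedge (munit i k) (A k j)) = (if i < r then A i j else 0)" for i j by (simp add: u if_distrib if_distribR cong: if_cong)
 thus "mdim r p A ==> mw r munit A = A" by (intro ext) (auto simp: mw_sum mdim_def)
qed

lemma mtr_add: "mtr r (A + B) = mtr r A + mtr r B" by (simp add: mtr_def sum.distrib)
lemma mtr_diff: "mtr r (A - B) = mtr r A - mtr r B" by (simp add: mtr_def sum_subtractf)
lemma mtr_minus: "mtr r (- A) = - mtr r A" by (simp add: mtr_def sum_negf)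
lemma mtr_sum: "mtr r (SUM k:K. f k) = (SUM k:K. mtr r (f k))" by (rule ext, simp only: mtr_def sum_app, rule sum.swap)
lemma mtr_smul: "mtr r (smul c A) vs = c * mtr r A vs" by (simp add: mtr_def smul_def sum_app sum_distrib_left)

lemma mtr_commute_1: "mdeg 1 B ==> mtr s (mw r (msg A) B) = mtr r (mw s B A)" unfolding mtr_def mw_sum by (subst sum.swap) (simp add: mdeg_def wedge_commute[of 1] msg_def contr_simps)
lemma mtr_commute_even: "mdeg p B ==> even p ==> mtr s (mw r A B) = mtr r (mw s B A)" unfolding mtr_def mw_sum
proof (subst sum.swap, intro sum.cong refl)
 fix i j assume "mdeg p B" "even p"
 moreover have "(sg ^^ p) al = al" if "even p" for al :: "'a ext"
 proof -
  obtain k where "p = 2 * k" using `even p` by (auto elim: evenE)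
  moreover have "(sg ^^ (2 * k)) al = al" by (induction k) (simp_all add: contr_simps)
  ultimately show ?thesis by simp
 qed
 ultimately show "wedge (A i j) (B j i) = wedge (B j i) (A i j)" by (simp add: mdeg_def wedge_commute[of p])
qed

lemma mdf_mw: "mdf A z ==> mdf B z ==> mdf (%y. mw r (A y) (B y)) z" unfolding mdf_def mw_sum by (intro allI edf_sum edf_wedge) auto
lemma mdf_add: "mdf A z ==> mdf B z ==> mdf (%y. A y + B y) z" unfolding mdf_def by (simp add: edf_add)
lemma mdf_const: "mdf (%_. A) z" by (simp add: mdf_def edf_const)
lemma md_add: "mdf A z ==> mdf B z ==> md (%y. A y + B y) z = md A z + md B z" unfolding mdf_def by (intro ext) (simp add: md_def ed_add)
lemma md_diff: "mdf A z ==> mdf B z ==> md (%y. A y - B y) z = md A z - md B z" unfolding mdf_def by (intro ext) (simp add: md_def ed_diff)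
lemma md_smul: "mdf A z ==> md (%y. smul c (A y)) z = smul c (md A z)"
proof -
 have "smul c A i k = (%vs. c * A i k vs)" for i k and A :: "'a mext" by (auto simp: smul_def)
 thus "mdf A z ==> ?thesis" unfolding mdf_def by (intro ext) (simp add: md_def ed_scale smul_def)
qed
lemma md_const [simp]: "md (%_. A) z = 0" by (intro ext) (simp add: md_def)
lemma md_mw:
 assumes "mdf A z" "mdf B z"
 shows "md (%y. mw r (A y) (B y)) z = mw r (md A z) (B z) + mw r (msg (A z)) (md B z)"
proof (intro ext)
 fix i j vs
 have "ed (%y. SUM k<r. wedge (A y i k) (B y k j)) z =
   (SUM k<r. wedge (md A z i k) (B z k j) + wedge (msg (A z) i k) (md B z k j))" using assms unfolding mdf_def by (subst ed_sum) (auto intro!: edf_wedge sum.cong simp: ed_wedge md_def msg_def)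
 thus "md (%y. mw r (A y) (B y)) z i j vs = (mw r (md A z) (B z) + mw r (msg (A z)) (md B z)) i j vs" by (simp add: md_def mw_sum sum.distrib)
qed
lemma ed_mtr: "mdf A z ==> ed (%y. mtr r (A y)) z = mtr r (md A z)" unfolding mtr_def mdf_def by (subst ed_sum) (auto simp: md_def)
lemma md_cong: "open S ==> z : S ==> (!!y. y : S ==> A y = B y) ==> md A z = md B z" unfolding md_def by (intro ext, rule fun_cong[where f="ed _ _"], rule ed_cong) auto

lemma msm_mdf: "msm S A ==> z : S ==> mdf A z" by (auto simp: msm_def mdf_def intro: esm_edf)

context
 fixes S :: "'v::real_normed_vector set" assumes S: "open S"
begin
lemma msm_mw: "msm S A ==> msm S B ==> msm S (%y. mw r (A y) (B y))" unfolding msm_def mw_sum by (intro allI esm_sum[OF S] esm_wedge[OF S]) auto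
lemma msm_add: "msm S A ==> msm S B ==> msm S (%y. A y + B y)" unfolding msm_def by (simp add: esm_add[OF S])
lemma msm_diff: "msm S A ==> msm S B ==> msm S (%y. A y - B y)" unfolding msm_def by (simp add: esm_diff[OF S])
lemma msm_const: "msm S (%y. A)" unfolding msm_def by (simp add: esm_const[OF S])
lemma msm_md: "msm S A ==> msm S (md A)" unfolding msm_def md_def by (intro allI esm_ext_deriv[OF S]) auto
lemma msm_smul: "msm S A ==> msm S (%y. smul c (A y))" unfolding msm_def esm_def smul_def by (auto intro!: smooth_mult[OF S] smooth_const[OF S])
lemma esm_mtr: "msm S A ==> esm S (%y. mtr r (A y))" unfolding msm_def mtr_def by (intro esm_sum[OF S]) auto
lemma md_md: "msm S A ==> z : S ==> md (md A) z = 0"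
proof (intro ext)
 fix i j vs assume "msm S A" "z : S"
 hence "ed (ed (%y. A y i j)) z = 0"  by (intro ed_ext_deriv[OF S]) (auto simp: msm_def)
 thus "md (md A) z i j vs = 0 i j vs" by (simp add: md_def)
qed
end

declare plus_fun_apply [simp del] zero_fun_apply [simp del] minus_apply [simp del] uminus_apply [simp del]
lemmas fun_apps = plus_fun_apply zero_fun_apply minus_apply uminus_apply

section \<open>Connections in local frames\<close>

text \<open>The curvature \<open>d\<theta> + \<theta>\<^sup>2\<close> of the connection matrix \<open>\<theta>\<close>.\<close>
definition curv :: "nat => ('v::real_normed_vector => 'v mext) => 'v => 'v mext" where
 "curv r t z = md t z + mw r (t z) (t z)"

text \<open>Covariant derivative of a matrix of functions that represents a morphism between two bundles with connection.\<close>
definition nab :: "nat => ('v::real_normed_vector => 'v mext) => nat => ('v => 'v mext) => ('v => 'v mext) => 'v => 'v mext" where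
 "nab r t r' t' M z = md M z + mw r' (t' z) (M z) - mw r (M z) (t z)"

text \<open>Covariant exterior derivative of a matrix of forms with values in the endomorphisms.\<close>
definition cov :: "nat => ('v::real_normed_vector => 'v mext) => ('v => 'v mext) => 'v => 'v mext" where
 "cov r t A z = md A z + mw r (t z) (A z) - mw r (msg (A z)) (t z)"

lemma md_nab:
 assumes S: "open S" "z : S" and sm: "msm S t" "msm S t'" "msm S M"
  and deg: "mdeg 1 (t z)" "mdeg 1 (t' z)" "mdeg 0 (M z)"
 shows "md (nab r t r' t' M) z + mw r' (t' z) (nab r t r' t' M z) + mw r (nab r t r' t' M z) (t z) =
  mw r' (curv r' t' z) (M z) - mw r (M z) (curv r t z)"
proof -
 note d = sm[THEN msm_mdf, OF S(2)] msm_mdf[OF msm_md[OF S(1) sm(3)] S(2)]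
 have "md (%z. md M z + mw r' (t' z) (M z) - mw r (M z) (t z)) z =
   md (md M) z + md (%z. mw r' (t' z) (M z)) z - md (%z. mw r (M z) (t z)) z" by (subst md_diff, (intro mdf_add mdf_mw d)+, subst md_add, (intro mdf_add mdf_mw d)+, rule refl)
 also have "... = mw r' (md t' z) (M z) - mw r' (t' z) (md M z) - mw r (md M z) (t z) - mw r (M z) (md t z)"
  by (simp only: md_mw[OF d(2,3)] md_mw[OF d(3,1)] md_md[OF S(1) sm(3) S(2)] msg_mdeg'(1)[OF deg(3)] msg_mdeg'(2)[OF deg(2)]
    mw_lin) (simp add: algebra_simps)
 finally have e: "md (nab r t r' t' M) z = ..." by (simp only: nab_def[abs_def])
 show ?thesis unfolding e by (simp only: nab_def curv_def mw_lin algebra_simps)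
qed

text \<open>The Bianchi identity.\<close>
lemma cov_curv:
 assumes S: "open S" "z : S" and sm: "msm S t" and deg: "!!y. mdeg 1 (t y)"
 shows "cov r t (curv r t) z = 0"
proof -
 note d = sm[THEN msm_mdf, OF S(2)] msm_mdf[OF msm_md[OF S(1) sm] S(2)]
 have "md (%z. md t z + mw r (t z) (t z)) z = md (md t) z + md (%z. mw r (t z) (t z)) z" by (intro md_add mdf_mw d)
 also have "... = mw r (md t z) (t z) - mw r (t z) (md t z)" by (simp only: md_mw[OF d(1,1)] md_md[OF S(1) sm S(2)] msg_mdeg'(2)[OF deg] mw_lin) simp
 finally have e: "md (curv r t) z = ..." by (simp only: curv_def[abs_def])
 have "mdeg 2 (curv r t z)" unfolding curv_def using mdeg_add mdeg_md[of 1 t z] mdeg_mw[of 1 _ 1] deg by (metis one_add_one Suc_1)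
 thus ?thesis unfolding cov_def e by (simp only: msg_mdeg'(3) curv_def mw_lin) (simp add: algebra_simps)
qed

lemma cov_mw:
 assumes "mdf A z" "mdf B z"
 shows "cov r t (%y. mw r (A y) (B y)) z = mw r (cov r t A z) (B z) + mw r (msg (A z)) (cov r t B z)" unfolding cov_def md_mw[OF assms] by (simp only: msg_mw mw_lin algebra_simps)

lemma cov_sum:
 assumes "!!k. k : K ==> mdf (A k) z"
 shows "cov r t (%y. SUM k:K. A k y) z = (SUM k:K. cov r t (A k) z)"
proof -
 have ms: "msg (SUM k:K. f k) = (SUM k:K. msg (f k))" for K :: "'c set" and f :: "'c => 'b mext" by (intro ext) (simp add: msg_def sg_def sum_app sum_distrib_left)
 have "md (%y. SUM k:K. A k y) z = (SUM k:K. md (A k) z)"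
 proof (intro ext)
  fix i j vs
  have "ed (%y. SUM k:K. A k y i j) z = (SUM k:K. ed (%y. A k y i j) z)" by (rule ed_sum) (use assms in "simp add: mdf_def")
  thus "md (%y. SUM k:K. A k y) z i j vs = (SUM k:K. md (A k) z) i j vs" by (simp add: md_def sum_app)
 qed
 thus ?thesis unfolding cov_def by (simp add: ms mw_sum_left mw_sum_right sum.distrib sum_subtractf)
qed

text \<open>The trace of the graded commutator with the connection form vanishes, so \<open>d tr = tr \<nabla>\<close>.\<close>
lemma ed_mtr_cov:
 assumes "mdf A z" "mdeg 1 (t z)"
 shows "ed (%y. mtr r (A y)) z = mtr r (cov r t A z)" unfolding ed_mtr[OF assms(1)] cov_def mtr_diff mtr_add using mtr_commute_1[OF assms(2), of r r "A z"] by simp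

definition mpow :: "nat => 'v mext => nat => 'v mext" where
 "mpow r A k = mwedge_list r (replicate k A)"

lemma mpow_simps [simp]: "mpow r A 0 = munit" "mpow r A (Suc k) = mw r A (mpow r A k)" by (simp_all add: mpow_def mwedge_list_def)

lemma mpow_Suc2: "mdim r r A ==> mpow r A (Suc k) = mw r (mpow r A k) A"
proof (induction k)
 case (Suc k)
 have "mpow r A (Suc (Suc k)) = mw r A (mpow r A (Suc k))" by simp
 also have "... = mw r A (mw r (mpow r A k) A)" by (simp only: Suc)
 finally show ?case by (simp add: mw_assoc)
qed (simp add: mw_munit)

lemma msg_munit: "msg munit = munit" by (intro ext) (simp add: msg_def sg_def munit_def unit_ext_def)

lemma msg_mpow: "mdeg 2 A ==> msg (mpow r A k) = mpow r A k" by (induction k) (simp_all add: msg_munit msg_mw msg_mdeg')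

lemma mdf_mpow: "mdf F z ==> mdf (%y. mpow r (F y) k) z" by (induction k) (auto simp: mdf_const intro: mdf_mw)

lemma msm_mpow: "open S ==> msm S F ==> msm S (%y. mpow r (F y) k)" by (induction k) (auto simp: msm_const intro: msm_mw)

lemma cov_mpow:
 assumes "mdf F z" "mdim r r (t z)" "cov r t F z = 0"
 shows "cov r t (%y. mpow r (F y) k) z = 0"
proof (induction k)
 case 0
 thus ?case using mw_munit[of r r "t z"] assms(2) by (simp add: cov_def msg_munit)
next
 case (Suc k)
 thus ?case by (simp add: cov_mw[OF assms(1) mdf_mpow[OF assms(1)]] assms(3))
qed

lemma telescope_commutator:
 assumes "mdim r r F" "mdim r r s"
 shows "(SUM a<k. mw r (mpow r F a) (mw r (mw r F s - mw r s F) (mpow r F (k - Suc a)))) =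
  mw r (mpow r F k) s - mw r s (mpow r F k)"
proof (induction k)
 case 0
 thus ?case using mw_munit[OF assms(2)] by simp
next
 case (Suc k)
 let ?C = "mw r F s - mw r s F"
 have dC: "mdim r r ?C" by (intro mdim_diff mdim_mw[where q=r and q'=r] assms)
 have "mpow r F (Suc k - Suc a) = mw r (mpow r F (k - Suc a)) F" if "a < k" for a using mpow_Suc2[OF assms(1), of "k - Suc a"] that by (simp add: Suc_diff_Suc del: mpow_simps)
 hence "(SUM a<k. mw r (mpow r F a) (mw r ?C (mpow r F (Suc k - Suc a)))) =
   mw r (SUM a<k. mw r (mpow r F a) (mw r ?C (mpow r F (k - Suc a)))) F" unfolding mw_sum_left by (intro sum.cong refl) (simp only: lessThan_iff mw_assoc)
 also have "... = mw r (mpow r F k) (mw r s F) - mw r s (mpow r F (Suc k))" by (subst Suc) (simp only: mpow_Suc2[OF assms(1)] mw_lin)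
 moreover have "mw r (mpow r F k) (mw r ?C (mpow r F (Suc k - Suc k))) =
  mw r (mpow r F (Suc k)) s - mw r (mpow r F k) (mw r s F)" using mw_munit[OF dC] by (simp only: diff_self_eq_0 mpow_simps(1) mpow_Suc2[OF assms(1)] mw_lin)
 ultimately show ?case by (simp only: sum.lessThan_Suc) simp
qed

lemma smul_sum: "smul c (SUM k:K. f k) = (SUM k:K. smul c (f k))" by (intro ext) (simp add: smul_def sum_app sum_distrib_left)

text \<open>The trace of \<open>k [F, ..., F, A, B]\<close> (\<open>k - 1\<close> entries \<open>F\<close>, symmetrised) equals the trace of this form. The sum runs over the gap
 between \<open>A\<close> and \<open>B\<close>, which is all that cyclic invariance leaves of the permutations.\<close>
definition Xk :: "nat => 'v mext => 'v mext => 'v mext => nat => 'v mext" where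
 "Xk r F A B k = (SUM a<k. mw r (mpow r F a) (mw r A (mw r (mpow r F (k - Suc a)) B)))"

text \<open>Here \<open>v\<close> stands for \<open>\<nabla>s\<close> and \<open>N\<close> for the adjoint of \<open>s\<close>. Covariant differentiation hits \<open>v\<close> or \<open>N\<close>, as \<open>F\<close> is parallel. The
 terms from \<open>v\<close> telescope to a commutator of \<open>s\<close> with \<open>\<Sum>k. \<zeta>\<^sub>k F\<^sup>k\<close>, and this sum is zero.\<close>
theorem ed_primitive:
 fixes ze :: "nat => 'v::real_normed_vector => 'v ext"
 assumes S: "open S" "z : S" and sm: "msm S F" "msm S v" "msm S N"
  and ze: "!!k. k <= n ==> esm S (ze k)" "!!k. k <= n ==> ed (ze k) z = 0" "!!k. k <= n ==> sg (ze k z) = ze k z"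
  and deg: "mdeg 1 (t z)" "mdeg 2 (F z)" "mdeg 1 (v z)" "mdeg 0 s"
  and dim: "mdim r r (t z)" "mdim r r (F z)" "mdim r r s" "mdim r r (N z)"
  and covF: "cov r t F z = 0" and covv: "cov r t v z = smul c (mw r (F z) s - mw r s (F z))"
  and covN: "cov r t N z = u"
  and P: "!!i j. i < r ==> j < r ==> (SUM k<=n. wedge (ze k z) (mpow r (F z) k i j)) = 0"
 shows "ed (%y. \<Sum>k=1..n. wedge (ze k y) (mtr r (Xk r (F y) (v y) (N y) k))) z =
  - (\<Sum>k=1..n. wedge (ze k z) (mtr r (Xk r (F z) (v z) u k)))"
proof -
 note d = sm[THEN msm_mdf, OF S(2)]
 have dX1: "mdf (%y. mw r (mpow r (F y) a) (mw r (v y) (mw r (mpow r (F y) b) (N y)))) z" for a b by (intro mdf_mw mdf_mpow d)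
 have cX1: "cov r t (%y. mw r (mpow r (F y) a) (mw r (v y) (mw r (mpow r (F y) b) (N y)))) z =
   mw r (mpow r (F z) a) (mw r (cov r t v z) (mw r (mpow r (F z) b) (N z)))
   - mw r (mpow r (F z) a) (mw r (v z) (mw r (mpow r (F z) b) u))" for a b by (simp add: cov_mw mdf_mw mdf_mpow d cov_mpow[OF d(1) dim(1) covF] covN msg_mw msg_mpow[OF deg(2)]
    msg_mdeg'(2)[OF deg(3)] mw_lin)
 have sX: "msm S (%y. Xk r (F y) (v y) (N y) k)" for k
 proof -
  have "msm S (%y. SUM a:K. mw r (mpow r (F y) a) (mw r (v y) (mw r (mpow r (F y) (k - Suc a)) (N y))))" if "finite K" for K using that
  proof induction
   case (insert x K)
   show ?case unfolding sum.insert[OF insert.hyps(1,2)] by (intro msm_add[OF S(1)] msm_mw[OF S(1)] msm_mpow S sm insert.IH)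
  qed (simp add: msm_const[OF S(1)])
  thus ?thesis unfolding Xk_def by blast
 qed
 have cX: "cov r t (%y. Xk r (F y) (v y) (N y) k) z =
   smul c (mw r (mw r (mpow r (F z) k) s - mw r s (mpow r (F z) k)) (N z)) - Xk r (F z) (v z) u k" for k unfolding Xk_def cov_sum[OF dX1] cX1 sum_subtractf covv telescope_commutator[OF dim(2,3), symmetric] mw_sum_left
  by (simp only: mw_smul_left mw_smul_right mw_assoc smul_sum)
 have dk: "ed (%y. wedge (ze k y) (mtr r (Xk r (F y) (v y) (N y) k))) z =
   (%vs. c * (wedge (ze k z) (mtr r (mw r (mpow r (F z) k) (mw r s (N z)))) vs
      - wedge (ze k z) (mtr r (mw r (mpow r (F z) k) (mw r (N z) s))) vs))
   - wedge (ze k z) (mtr r (Xk r (F z) (v z) u k))" if k: "k <= n" for k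
 proof -
  have "mtr r (mw r s (mw r (mpow r (F z) k) (N z))) = mtr r (mw r (mw r (mpow r (F z) k) (N z)) s)" by (rule mtr_commute_even[OF deg(4), symmetric]) simp
  hence "mtr r (cov r t (%y. Xk r (F y) (v y) (N y) k) z) =
   (%vs. c * (mtr r (mw r (mpow r (F z) k) (mw r s (N z)))
      - mtr r (mw r (mpow r (F z) k) (mw r (N z) s))) vs) - mtr r (Xk r (F z) (v z) u k)" unfolding cX mtr_diff mtr_smul[abs_def] mw_lin by simp
  note cX' = this
  have "ed (%y. wedge (ze k y) (mtr r (Xk r (F y) (v y) (N y) k))) z =
    wedge (ze k z) (mtr r (cov r t (%y. Xk r (F y) (v y) (N y) k) z))" using ed_wedge[OF esm_edf[OF ze(1)[OF k] S(2)] esm_edf[OF esm_mtr[OF S(1) sX] S(2)], of r k]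
   by (simp add: ze(2,3)[OF k] ed_mtr_cov[where A="%y. Xk r (F y) (v y) (N y) k" and t=t, OF msm_mdf[OF sX S(2)] deg(1)])
  thus ?thesis unfolding cX' wedge_diff_right wedge_scale_right by (simp add: minus_apply)
 qed
 have z: "(\<Sum>k=1..n. wedge (ze k z) (mtr r (mw r (mpow r (F z) k) B))) + wedge (ze 0 z) (mtr r B) = 0" if B: "mdim r r B" for B
 proof -
  have "(SUM k<=n. wedge (ze k z) (mtr r (mw r (mpow r (F z) k) B))) =
   (SUM k<=n. SUM i<r. SUM j<r. wedge (wedge (ze k z) (mpow r (F z) k i j)) (B j i))" by (simp add: mtr_def mw_sum wedge_sum_right wedge_assoc)
  also have "... = (SUM i<r. SUM j<r. wedge (SUM k<=n. wedge (ze k z) (mpow r (F z) k i j)) (B j i))" unfolding wedge_sum_left by (rule trans[OF sum.swap], rule sum.cong[OF refl], rule sum.swap)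
  also have "... = 0" using P by simp
  finally show ?thesis using sum.atLeast_Suc_atMost[of 0 n "%k. wedge (ze k z) (mtr r (mw r (mpow r (F z) k) B))"] mw_munit[OF B] by (simp add: atMost_atLeast0 add.commute)
 qed
 have "mtr r (mw r s (N z)) = mtr r (mw r (N z) s)" by (rule mtr_commute_even[OF deg(4), symmetric]) simp
 note comm = this
 have zz: "(\<Sum>k=1..n. wedge (ze k z) (mtr r (mw r (mpow r (F z) k) (mw r s (N z))))) =
   (\<Sum>k=1..n. wedge (ze k z) (mtr r (mw r (mpow r (F z) k) (mw r (N z) s))))" by (rule add_right_imp_eq[OF trans[OF z[OF mdim_mw[OF dim(3,4), of r], unfolded comm]
    z[OF mdim_mw[OF dim(4,3), of r], symmetric]]])
 have "ed (%y. \<Sum>k=1..n. wedge (ze k y) (mtr r (Xk r (F y) (v y) (N y) k))) z =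
  (\<Sum>k=1..n. ed (%y. wedge (ze k y) (mtr r (Xk r (F y) (v y) (N y) k))) z)" by (rule ed_sum, rule edf_wedge) (use esm_edf[OF ze(1) S(2)] esm_edf[OF esm_mtr[OF S(1) sX] S(2)] in simp_all)
 also have "... = - (\<Sum>k=1..n. wedge (ze k z) (mtr r (Xk r (F z) (v z) u k)))"
 proof
  fix vs
  show "(\<Sum>k=1..n. ed (%y. wedge (ze k y) (mtr r (Xk r (F y) (v y) (N y) k))) z) vs =
   (- (\<Sum>k=1..n. wedge (ze k z) (mtr r (Xk r (F z) (v z) u k)))) vs" using fun_cong[OF zz, of vs] by (simp add: dk fun_apps sum_app sum_subtractf flip: sum_distrib_left)
 qed
 finally show ?thesis .
qed

section \<open>Adjoints\<close>

definition mstar :: "'v mext => 'v mext" where "mstar A i j vs = cnj (A j i vs)"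

lemma mstar_simps: "mstar (A + B) = mstar A + mstar B" "mstar (A - B) = mstar A - mstar B" "mstar (mstar A) = A"
 "mstar 0 = 0" by (intro ext, simp add: mstar_def fun_apps)+

lemma mstar_mw:
 assumes "mdeg 0 A \<or> mdeg 0 B"
 shows "mstar (mw r A B) = mw r (mstar B) (mstar A)"
proof (intro ext)
 fix i j vs
 have c: "cnj (wedge al bt vs) = wedge (%us. cnj (al us)) (%us. cnj (bt us)) vs" for al bt :: "'a ext" by (simp add: wedge_def shuffle_sign_def)
 have "wedge (A j k) (B k i) = wedge (B k i) (A j k)" for k
 proof (cases "mdeg 0 B")
  case True
  thus ?thesis using wedge_commute[of 0 "B k i" "A j k"] by (simp add: mdeg_def)
 next
  case False
  with assms have "mdeg 0 A" by blast
  thus ?thesis using wedge_commute[of 0 "A j k" "B k i"] by (simp add: mdeg_def)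
 qed
 moreover have "mstar X i j = (%us. cnj (X j i us))" for X :: "'a mext" and i j by (auto simp: mstar_def)
 ultimately show "mstar (mw r A B) i j vs = mw r (mstar B) (mstar A) i j vs" by (simp add: mwedge_def mstar_def[of "mw r A B"] c)
qed

lemma
 assumes "mdf A z"
 shows mdf_mstar: "mdf (%y. mstar (A y)) z" and md_mstar: "md (%y. mstar (A y)) z = mstar (md A z)"
proof -
 have d: "((%y. mstar (A y) i j vs) has_derivative (%w. cnj (fd (%y. A y j i vs) z w))) (at z)" for i j vs unfolding mstar_def
  by (rule bl_hd[OF bounded_linear_cnj]) (use assms in "auto simp: mdf_def edf_def intro: diff_fd")
 thus "mdf (%y. mstar (A y)) z" unfolding mdf_def edf_def differentiable_def by blast
 show "md (%y. mstar (A y)) z = mstar (md A z)" by (intro ext) (simp add: md_def mstar_def[of "md A z"] ext_deriv_def fd_at[OF d, symmetric])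
qed

lemma mdeg_mstar: "mdeg p A ==> mdeg p (mstar A)" by (auto simp: mdeg_def hdeg_def mstar_def)

text \<open>The connections are metric, so differentiating the relation between a morphism and its adjoint gives the same
 relation between their covariant derivatives.\<close>
lemma nab_adjoint:
 assumes S: "open S" "z : S"
  and d: "mdf H z" "mdf H' z" "mdf M z" "mdf N z"
  and deg: "mdeg 0 (H z)" "mdeg 0 (H' z)" "mdeg 0 (M z)" "mdeg 0 (N z)"
  and adj: "!!y. y : S ==> mw r (H y) (N y) = mw r' (mstar (M y)) (H' y)"
  and compat: "md H z = mw r (H z) (t z) + mw r (mstar (t z)) (H z)"
  and compat': "md H' z = mw r' (H' z) (t' z) + mw r' (mstar (t' z)) (H' z)"
 shows "mw r (H z) (nab r' t' r t N z) = mw r' (mstar (nab r t r' t' M z)) (H' z)"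
proof -
 have "md (%y. mw r (H y) (N y)) z = md (%y. mw r' (mstar (M y)) (H' y)) z" by (rule md_cong[OF S adj])
 hence e: "mw r (md H z) (N z) + mw r (H z) (md N z) =
   mw r' (mstar (md M z)) (H' z) + mw r' (mstar (M z)) (md H' z)" by (simp add: md_mw d mdf_mstar md_mstar msg_mdeg' deg mdeg_mstar)
 have a: "mw r (H z) (mw r' (N z) X) = mw r' (mstar (M z)) (mw r' (H' z) X)"
  "mw r X (mw r (H z) (N z)) = mw r X (mw r' (mstar (M z)) (H' z))" for X using adj[OF S(2)] by (metis mw_assoc)+
 show ?thesis using e unfolding nab_def compat compat' mw_lin mstar_simps a by (simp add: mstar_mw deg mw_lin a algebra_simps)
qed

definition mclin :: "(complex ^ 'n) mext => bool" where
 "mclin A \<longleftrightarrow> mdeg 1 A & (ALL i j. clin (%w. A i j [w]))"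

lemma wedge_single: "wedge al bt [w] = al [w] * bt [] + al [] * bt [w]" by (simp add: wedge_Cons contr_def sg_def)

lemma mw_single:
 "mdeg 0 A ==> mw r A B i j [w] = (SUM k<r. A i k [] * B k j [w])"
 "mdeg 0 B ==> mw r A B i j [w] = (SUM k<r. A i k [w] * B k j [])" by (simp_all add: mwedge_def wedge_single mdeg_def hdeg_def)

lemma mclin_mw:
 assumes "mdeg 0 A"
 shows "mclin B ==> mclin (mw r A B)" "mclin B ==> mclin (mw r B A)" unfolding mclin_def using mdeg_mw[of 0 A 1 B] mdeg_mw[of 1 B 0 A] assms by (auto simp: mw_single clin_iff sum.distrib sum_distrib_left algebra_simps)

lemma mclin_add: "mclin A ==> mclin B ==> mclin (A + B)" "mclin A ==> mclin B ==> mclin (A - B)" unfolding mclin_def by (auto simp: mdeg_add mdeg_diff clin_iff fun_apps algebra_simps)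

text \<open>A form that is both complex linear and antilinear vanishes.\<close>
lemma mclin_antilinear_zero:
 assumes A: "mclin A" and B: "mclin (mstar A)"
 shows "A = 0"
proof (intro ext)
 fix i j vs
 show "A i j vs = 0 i j vs"
 proof (cases "EX w. vs = [w]")
  case True
  then obtain w where w: "vs = [w]" by blast
  have "A i j [\<i> *s w] = \<i> * A i j [w]" using A by (simp add: mclin_def clin_iff)
  moreover have "mstar A j i [\<i> *s w] = \<i> * mstar A j i [w]" using B by (simp add: mclin_def clin_iff)
  hence "cnj (mstar A j i [\<i> *s w]) = cnj (\<i> * mstar A j i [w])" by simp
  hence "A i j [\<i> *s w] = - \<i> * A i j [w]" by (simp add: mstar_def)
  ultimately show ?thesis using w by (simp add: fun_apps)
 next
  case False
  hence "length vs ~= 1" by (auto simp: length_Suc_conv)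
  thus ?thesis using A by (auto simp: mclin_def mdeg_def hdeg_def fun_apps)
 qed
qed

section \<open>The symmetrised product under the trace\<close>

lemma mdim_mpow_left: "mdim r r F ==> mdim r c X ==> mdim r c (mw r (mpow r F n) X)"
proof (induction n)
 case 0
 thus ?case by (simp add: mw_munit)
next
 case (Suc n)
 thus ?case by (simp add: mw_assoc) (rule mdim_mw)
qed

lemma mdim_mpow_right: "mdim r r F ==> mdim c r X ==> mdim c r (mw r X (mpow r F n))"
proof (cases n)
 case 0
 thus "mdim c r X ==> ?thesis" by (simp add: mw_munit)
next
 case (Suc m)
 assume F: "mdim r r F" and X: "mdim c r X"
 have "mdim r r (mpow r F (Suc m))" unfolding mpow_Suc2[OF F] by (rule mdim_mpow_left[OF F F])
 thus ?thesis unfolding Suc by (rule mdim_mw[OF X])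
qed

lemma mpow_add:
 assumes "mdim r r F" "mdim r c X"
 shows "mw r (mpow r F a) (mw r (mpow r F b) X) = mw r (mpow r F (a + b)) X"
proof (induction a)
 case 0
 show ?case using mw_munit(2)[OF mdim_mpow_left[OF assms]] by simp
next
 case (Suc a)
 show ?case by (simp add: mw_assoc Suc)
qed

lemma mdeg_mpow: "mdeg 2 F ==> mdeg (2 * n) (mpow r F n)"
proof (induction n)
 case 0
 thus ?case by (auto simp: mdeg_def hdeg_def munit_def unit_ext_def)
next
 case (Suc n)
 thus ?case using mdeg_mw[of 2 F "2 * n" "mpow r F n" r] by simp
qed

lemma foldr_mw_replicate:
 assumes "mdim r r F" "mdim r c Y"
 shows "foldr (mw r) (replicate n F) Y = mw r (mpow r F n) Y" by (induction n) (simp_all add: mw_munit(2)[OF assms(2)] mw_assoc del: foldr_replicate)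

lemma mw_list_two:
 assumes "mdim r r F" "mdim r r A" "mdim r r B"
 shows "mwedge_list r (replicate p F @ [A] @ replicate b F @ [B] @ replicate c F) =
  mw r (mpow r F p) (mw r A (mw r (mpow r F b) (mw r B (mpow r F c))))"
proof -
 have 1: "mdim r r (mw r B (mpow r F c))" by (rule mdim_mpow_right[OF assms(1,3)])
 have 2: "mdim r r (mw r A (mw r (mpow r F b) (mw r B (mpow r F c))))" by (rule mdim_mw[OF assms(2) mdim_mpow_left[OF assms(1) 1]])
 show ?thesis by (simp add: mwedge_list_def foldr_mw_replicate[OF assms(1) 1] foldr_mw_replicate[OF assms(1) 2]
    mpow_def[unfolded mwedge_list_def, symmetric] del: foldr_replicate)
qed

lemma mtr_two:
 assumes d: "mdim r r F" "mdim r r A" "mdim r r B" and g: "mdeg 2 F" "mdeg 1 A" "mdeg 1 B"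
 shows "mtr r (mwedge_list r (replicate p F @ [A] @ replicate b F @ [B] @ replicate c F)) =
   mtr r (mw r (mpow r F (c + p)) (mw r A (mw r (mpow r F b) B)))"
  and "mtr r (mwedge_list r (replicate p F @ [B] @ replicate b F @ [A] @ replicate c F)) =
   - mtr r (mw r (mpow r F b) (mw r A (mw r (mpow r F (c + p)) B)))"
proof -
 have x: "mdim r r (mw r A (mw r (mpow r F b) B))" by (rule mdim_mw[OF d(2) mdim_mpow_left[OF d(1,3)]])
 show "mtr r (mwedge_list r (replicate p F @ [A] @ replicate b F @ [B] @ replicate c F)) =
   mtr r (mw r (mpow r F (c + p)) (mw r A (mw r (mpow r F b) B)))" unfolding mw_list_two[OF d] mpow_add[OF d(1) x, symmetric]
  using mtr_commute_even[OF mdeg_mpow[OF g(1), of c r], of r r "mw r (mpow r F p) (mw r A (mw r (mpow r F b) B))"] by (simp add: mw_assoc)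
 let ?Z = "%n. mpow r F n"
 let ?U = "mw r (?Z b) (mw r A (mw r (?Z c) (?Z p)))"
 have mU: "msg ?U = - ?U" by (simp add: msg_mw msg_mpow[OF g(1)] msg_mdeg'(2)[OF g(2)] mw_lin)
 have "mtr r (mwedge_list r (replicate p F @ [B] @ replicate b F @ [A] @ replicate c F)) =
   mtr r (mw r (?Z p) (mw r B (mw r (?Z b) (mw r A (?Z c)))))" unfolding mw_list_two[OF d(1,3,2)] ..
 also have "... = mtr r (mw r B ?U)" using mtr_commute_even[OF mdeg_mpow[OF g(1), of p r], of r r "mw r B (mw r (?Z b) (mw r A (?Z c)))"] by (simp add: mw_assoc)
 also have "... = mtr r (mw r (- ?U) B)" using mtr_commute_1[OF g(3), of r r ?U] by (simp add: mU)
 also have "... = - mtr r (mw r (mpow r F b) (mw r A (mw r (mpow r F (c + p)) B)))" unfolding mpow_add[OF d(1,3), symmetric] by (simp add: mw_lin mtr_minus)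
 finally show "mtr r (mwedge_list r (replicate p F @ [B] @ replicate b F @ [A] @ replicate c F)) =
   - mtr r (mw r (mpow r F b) (mw r A (mw r (mpow r F (c + p)) B)))" .
qed

lemma sum_permutations_two_points:
 fixes G :: "nat => nat => complex"
 assumes C: "!!q. q <= k ==> (SUM p:{..k} - {q}. G p q) = C" and k: "k >= 1"
 shows "of_nat k * (\<Sum>si | si permutes {..k}. G (si (k - 1)) (si k)) = fact (Suc k) * C"
proof -
 let ?P = "{si. si permutes {..k}}"
 have "(SUM si:?P. G (si (k - 1)) (si k)) = (SUM si:?P. G (si a) (si k))" if "a < k" for a
 proof -
  let ?t = "Transposition.transpose (k - 1) a"
  have t: "?t permutes {..k}" using that k by (intro permutes_swap_id) auto
  have "?t k = k" using that k by (auto simp: Transposition.transpose_def)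
  thus ?thesis using sum_permutations_compose_right[OF t, of "%si. G (si a) (si k)"] by simp
 qed
 note eq = this
 have "(SUM a<k. SUM si:?P. G (si a) (si k)) = (SUM a<k. SUM si:?P. G (si (k - 1)) (si k))" by (rule sum.cong[OF refl], rule eq[symmetric]) simp
 hence "of_nat k * (SUM si:?P. G (si (k - 1)) (si k)) = (SUM a<k. SUM si:?P. G (si a) (si k))" by (simp only: sum_constant card_lessThan)
 also have "... = (SUM si:?P. SUM a<k. G (si a) (si k))" by (rule sum.swap)
 also have "... = (SUM si:?P. C)"
 proof (rule sum.cong[OF refl])
  fix si assume "si : ?P"
  hence si: "si permutes {..k}" by simp
  have "si ` {..<k} = si ` ({..k} - {k})" by (rule arg_cong[where f="(`) si"]) auto
  also have "... = {..k} - {si k}" using permutes_image[OF si] inj_on_image_set_diff[OF permutes_inj_on[OF si, of UNIV], of "{..k}" "{k}"] by auto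
  finally have "(SUM p:{..k} - {si k}. G p (si k)) = (SUM a<k. G (si a) (si k))" using sum.reindex[OF permutes_inj_on[OF si, of "{..<k}"], of "%p. G p (si k)"] by simp
  moreover have "si k <= k" using permutes_in_image[OF si, of k] by simp
  ultimately show "(SUM a<k. G (si a) (si k)) = C" using C by metis
 qed
 also have "... = fact (Suc k) * C" by (simp add: card_permutations[of "{..k}" "Suc k"] algebra_simps)
 finally show ?thesis .
qed

lemma graded_sign_two_odd:
 assumes si: "si permutes {..k}" and k: "k >= 1"
 shows "graded_sign (replicate (k - 1) 2 @ [1, 1]) si = (if inv_into UNIV si k < inv_into UNIV si (k - 1) then -1 else 1)"
proof -
 let ?ds = "replicate (k - 1) 2 @ [1, 1] :: nat list"
 let ?I = "{(i, j). i < j & j < length ?ds & si j < si i}"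
 let ?q = "inv_into UNIV si k" and ?p = "inv_into UNIV si (k - 1)"
 have len: "length ?ds = Suc k" using k by simp
 have s: "si ?q = k" "si ?p = k - 1" using permutes_inverses(1)[OF si] by auto
 have i: "inv_into UNIV si (si x) = x" for x using permutes_inverses(2)[OF si] by auto
 have I: "?I = {(i, j). i < j & j <= k & si j < si i}" unfolding len less_Suc_eq_le ..
 have fin: "finite ?I" unfolding I by (rule finite_subset[of _ "{..k} \<times> {..k}"]) auto
 have ds: "?ds ! x = (if x < k - 1 then 2 else 1)" if "x <= k" for x using that k by (auto simp: nth_append nth_Cons split: nat.split)
 have "graded_sign ?ds si = (\<Prod>x\<in>?I. if x = (?q, ?p) then -1 else 1)" unfolding graded_sign_def
 proof (rule prod.cong[OF refl])
  fix x assume "x : ?I"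
  then obtain a b where x: "x = (a, b)" "a < b" "b <= k" "si b < si a" unfolding I by blast
  have le: "si a <= k" "si b <= k" using permutes_in_image[OF si] x by (auto simp: less_imp_le)
  show "(case x of (i, j) => (-1) ^ (?ds ! si i * ?ds ! si j)) = (if x = (?q, ?p) then -1 else (1::complex))"
  proof (cases "si b < k - 1")
   case True
   hence "b ~= ?p" using s by auto
   thus ?thesis using x ds[OF le(1)] ds[OF le(2)] True by auto
  next
   case False
   hence "si b = k - 1" "si a = k" using x(4) le by auto
   hence "b = ?p" "a = ?q" using i by metis+
   thus ?thesis using x ds[OF le(1)] ds[OF le(2)] False s k by auto
  qed
 qed
 also have "... = (if (?q, ?p) : ?I then -1 else 1)" using fin by (simp add: prod.delta)
 also have "(?q, ?p) : ?I \<longleftrightarrow> ?q < ?p" using s k permutes_in_image[OF permutes_inv[OF si], of "k - 1"] by (auto simp: len)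
 finally show ?thesis .
qed

lemma sum_swap_scaled:
 fixes c f :: complex
 shows "(SUM i:I. c * ((SUM si:P. g si * m si i) / f)) = c * (SUM si:P. g si * (SUM i:I. m si i)) / f"
proof -
 have "(SUM si:P. g si * (SUM i:I. m si i)) = (SUM i:I. SUM si:P. g si * m si i)" by (simp only: sum_distrib_left, rule sum.swap)
 thus ?thesis by (simp only: times_divide_eq_right sum_divide_distrib[symmetric] sum_distrib_left[symmetric])
qed

text \<open>A permutation is determined, up to the order of the equal even factors, by the positions of \<open>A\<close> and \<open>B\<close>.
 Cyclic invariance reduces each position pair to a gap, and exchanging the two odd factors costs the same sign in
 the product and in the trace.\<close>
theorem sym_prod_trace:
 fixes F A B :: "'v mext"
 assumes d: "mdim r r F" "mdim r r A" "mdim r r B" and g: "mdeg 2 F" "mdeg 1 A" "mdeg 1 B" and k: "k >= 1"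
 shows "(SUM i<r. of_nat k * sym_prod r (replicate (k - 1) (2, F) @ [(1, A), (1, B)]) i i vs) = mtr r (Xk r F A B k) vs"
proof -
 let ?L = "replicate (k - 1) (2::nat, F) @ [(1, A), (1, B)]"
 let ?h = "%p q x. if x = p then A else if x = q then B else F"
 have len: "length ?L = Suc k" using k by simp
 have fst: "map fst ?L = replicate (k - 1) 2 @ [1, 1]" by simp
 have nth: "snd (?L ! x) = ?h (k - 1) k x" if "x <= k" for x using that k by (auto simp: nth_append nth_Cons split: nat.split)
 define G where "G p q = (if q < p then -1 else 1) * mtr r (mwedge_list r (map (?h p q) [0..<Suc k])) vs" for p q
 define Y where "Y a = mtr r (mw r (mpow r F a) (mw r A (mw r (mpow r F (k - Suc a)) B))) vs" for a
 have tm: "graded_sign (map fst ?L) si * (SUM i<r. mwedge_list r (map (%x. snd (?L ! si x)) [0..<Suc k]) i i vs) =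
   G (inv_into UNIV si (k - 1)) (inv_into UNIV si k)" if si: "si permutes {..k}" for si
 proof -
  have "map (%x. snd (?L ! si x)) [0..<Suc k] = map (?h (inv_into UNIV si (k - 1)) (inv_into UNIV si k)) [0..<Suc k]"
  proof (rule map_cong[OF refl])
   fix x assume "x : set [0..<Suc k]"
   hence "x <= k" by auto
   hence "si x <= k" using permutes_in_image[OF si, of x] by simp
   moreover have "si x = y \<longleftrightarrow> x = inv_into UNIV si y" for y using permutes_inv_eq[OF si, of y x] by metis
   ultimately show "snd (?L ! si x) = ?h (inv_into UNIV si (k - 1)) (inv_into UNIV si k) x" using nth[of "si x"] by simp
  qed
  thus ?thesis unfolding G_def fst graded_sign_two_odd[OF si k] by (simp only: mtr_def sum_app)
 qed
 have wd: "map (?h p q) [0..<Suc k] = replicate p F @ [A] @ replicate (q - Suc p) F @ [B] @ replicate (k - q) F"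
  if "p < q" "q <= k" for p q by (rule nth_equalityI) (use that in "auto simp: nth_append nth_Cons simp del: upt_Suc split: nat.split")
 have wd': "map (?h p q) [0..<Suc k] = replicate q F @ [B] @ replicate (p - Suc q) F @ [A] @ replicate (k - p) F"
  if "q < p" "p <= k" for p q by (rule nth_equalityI) (use that in "auto simp: nth_append nth_Cons simp del: upt_Suc split: nat.split")
 have G1: "G p q = Y (k - q + p)" if "p < q" "q <= k" for p q
 proof -
  have "k - Suc (k - q + p) = q - Suc p" using that by simp
  thus ?thesis using that unfolding G_def wd[OF that] mtr_two(1)[OF d g] Y_def by simp
 qed
 have G2: "G p q = Y (p - Suc q)" if "q < p" "p <= k" for p q
 proof -
  have "k - Suc (p - Suc q) = k - p + q" using that by simp
  thus ?thesis using that unfolding G_def wd'[OF that] mtr_two(2)[OF d g] Y_def by (simp add: uminus_apply)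
 qed
 have C: "(SUM p:{..k} - {q}. G p q) = (SUM a<k. Y a)" if q: "q <= k" for q
 proof -
  have u: "{..k} - {q} = {..<q} Un {Suc q..<Suc k}" using q by auto
  have disj: "{..<q} Int {Suc q..<Suc k} = {}" by auto
  have "(SUM p:{..k} - {q}. G p q) = (SUM p<q. G p q) + (\<Sum>p=Suc q..<Suc k. G p q)" unfolding u by (rule sum.union_disjoint[OF finite_lessThan finite_atLeastLessThan disj])
  also have "(\<Sum>p=Suc q..<Suc k. G p q) = (SUM a<k - q. Y a)" by (rule sum.reindex_bij_witness[of _ "%a. a + Suc q" "%p. p - Suc q"]) (use G2 in auto)
  also have "(SUM p<q. G p q) = (\<Sum>a=k - q..<k. Y a)" by (rule sum.reindex_bij_witness[of _ "%a. a + q - k" "%p. k - q + p"]) (use G1 q in auto)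
  also have "(\<Sum>a=k - q..<k. Y a) + (SUM a<k - q. Y a) = (SUM a<k. Y a)" using sum.atLeastLessThan_concat[of 0 "k - q" k Y] by (simp add: atLeast0LessThan add.commute)
  finally show ?thesis .
 qed
 have "(SUM i<r. of_nat k * sym_prod r ?L i i vs) = of_nat k * (\<Sum>si | si permutes {..k}.
   graded_sign (map fst ?L) si * (SUM i<r. mwedge_list r (map (%x. snd (?L ! si x)) [0..<Suc k]) i i vs)) / fact (Suc k)" unfolding sym_prod_def len lessThan_Suc_atMost by (rule sum_swap_scaled)
 also have "... = of_nat k * (\<Sum>si | si permutes {..k}. G (inv_into UNIV si (k - 1)) (inv_into UNIV si k)) / fact (Suc k)" by (intro arg_cong[where f="%x. of_nat k * x / fact (Suc k)"] sum.cong refl tm) simp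
 also have "... = of_nat k * (\<Sum>si | si permutes {..k}. G (si (k - 1)) (si k)) / fact (Suc k)" by (simp only: sum_permutations_inverse[of "%si. G (si (k - 1)) (si k)" "{..k}"])
 also have "... = (SUM a<k. Y a)" by (simp only: sum_permutations_two_points[OF C k]) (simp del: fact_Suc)
 also have "... = mtr r (Xk r F A B k) vs" by (simp add: Xk_def mtr_sum sum_app Y_def)
 finally show ?thesis .
qed

section \<open>Matrix-valued functions\<close>

text \<open>Smooth and holomorphic functions share the closure properties that make matrix inversion stay in the class.\<close>
locale fnf =
 fixes Q :: "('a => complex) => bool" and S :: "'a set"
 assumes Q_const: "Q (%_. c)"
  and Q_add: "Q f ==> Q g ==> Q (%z. f z + g z)"
  and Q_mult: "Q f ==> Q g ==> Q (%z. f z * g z)"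
  and Q_inverse: "Q f ==> (!!z. z : S ==> f z ~= 0) ==> Q (%z. inverse (f z))"
  and Q_cong: "Q f ==> (!!z. z : S ==> f z = g z) ==> Q g"

definition minv :: "complex mat => complex mat" where
 "minv A = inverse (det A) *m adj_mat A"

lemma minv:
 assumes "A : cmat n n" "det A ~= 0"
 shows "minv A : cmat n n" "A * minv A = idm n" "minv A * A = idm n"
proof -
 note a = adj_mat[OF assms(1)]
 show c: "minv A : cmat n n" using a by (simp add: minv_def)
 have "A * minv A = inverse (det A) *m (A * adj_mat A)" unfolding minv_def by (rule mult_smult_distrib[OF assms(1) a(1)])
 thus "A * minv A = idm n" using assms(2) a(2) by (auto intro!: eq_matI)
 thus "minv A * A = idm n" using mat_mult_left_right_inverse[OF assms(1) c] by blast
qed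

lemma invertible_det: "A : cmat n n ==> invertible_mat (A :: complex mat) \<longleftrightarrow> det A ~= 0"
proof
 assume A: "A : cmat n n"
 { assume "invertible_mat A"
  then obtain B where "inverts_mat A B" "inverts_mat B A" unfolding invertible_mat_def by blast
  hence AB: "A * B = idm n" "B * A = idm (dim_row B)" using A by (auto simp: inverts_mat_def)
  hence "dim_col (A * B) = n" "dim_col (B * A) = dim_row B" by auto
  hence B: "B : cmat n n" using A by (auto intro: carrier_matI)
  have "det A * det B = 1" using det_mult[OF A B] AB by simp
  thus "det A ~= 0" by auto }
 { assume "det A ~= 0"
  thus "invertible_mat A" unfolding invertible_mat_def inverts_mat_def using minv[OF A] A by (intro conjI exI[of _ "minv A"]) auto }
qed

context fnf
begin

lemma Q_sum: "(!!i. i : I ==> Q (f i)) ==> Q (%z. SUM i:I. f i z)" by (induction I rule: infinite_finite_induct) (simp_all add: Q_const Q_add)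
lemma Q_prod: "(!!i. i : I ==> Q (f i)) ==> Q (%z. \<Prod>i\<in>I. f i z)" by (induction I rule: infinite_finite_induct) (simp_all add: Q_const Q_mult)

definition Qm :: "nat => nat => ('a => complex mat) => bool" where
 "Qm a b A \<longleftrightarrow> (ALL z:S. A z : cmat a b) & (ALL i<a. ALL j<b. Q (%z. A z $$ (i, j)))"

lemma Qm_carrier: "Qm a b A ==> z : S ==> A z : cmat a b" by (simp add: Qm_def)

lemma Qm_cong:
 assumes "Qm a b A" "!!z. z : S ==> A z = B z"
 shows "Qm a b B" unfolding Qm_def
proof (intro conjI ballI allI impI)
 fix i j assume "i < a" "j < b"
 hence "Q (%z. A z $$ (i, j))" using assms(1) by (simp add: Qm_def)
 thus "Q (%z. B z $$ (i, j))" by (rule Q_cong) (simp add: assms(2))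
qed (use assms in "auto simp: Qm_def")

lemma Qm_mult: "Qm a b A ==> Qm b c B ==> Qm a c (%z. A z * B z)"
proof -
 assume A: "Qm a b A" and B: "Qm b c B"
 have "Q (%z. (A z * B z) $$ (i, j))" if "i < a" "j < c" for i j
 proof (rule Q_cong)
  show "Q (%z. SUM k:{0..<b}. A z $$ (i, k) * B z $$ (k, j))" using A B that by (intro Q_sum Q_mult) (auto simp: Qm_def)
  show "(SUM k:{0..<b}. A z $$ (i, k) * B z $$ (k, j)) = (A z * B z) $$ (i, j)" if "z : S" for z using Qm_carrier[OF A that] Qm_carrier[OF B that] `i < a` `j < c` by (auto simp: scalar_prod_def)
 qed
 moreover have "A z * B z : cmat a c" if "z : S" for z by (rule mult_c[OF Qm_carrier[OF A that] Qm_carrier[OF B that]])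
 ultimately show ?thesis by (simp add: Qm_def)
qed

lemma Qm_const: "A : cmat a b ==> Qm a b (%_. A)" by (auto simp: Qm_def Q_const)

lemma QmI: "(!!z. z : S ==> A z : cmat a b) ==> (!!i j. i < a ==> j < b ==> Q (f i j)) ==>
  (!!i j z. i < a ==> j < b ==> z : S ==> f i j z = A z $$ (i, j)) ==> Qm a b A" unfolding Qm_def
proof (intro conjI ballI allI impI)
 fix i j assume *: "!!i j. i < a ==> j < b ==> Q (f i j)"
  "!!i j z. i < a ==> j < b ==> z : S ==> f i j z = A z $$ (i, j)" "i < a" "j < b"
 show "Q (%z. A z $$ (i, j))" by (rule Q_cong[OF *(1)[OF *(3,4)]]) (rule *(2)[OF *(3,4)])
qed

lemma Qm_entry: "Qm a b A ==> i < a ==> j < b ==> Q (%z. A z $$ (i, j))" by (simp add: Qm_def)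

lemma Qm_add:
 assumes "Qm a b A" "Qm a b B"
 shows "Qm a b (%z. A z + B z)"
proof (rule QmI)
 show "A z + B z : cmat a b" if "z : S" for z using assms that by (auto simp: Qm_def)
 show "Q (%z. A z $$ (i, j) + B z $$ (i, j))" if "i < a" "j < b" for i j by (intro Q_add Qm_entry[OF assms(1)] Qm_entry[OF assms(2)] that)
 show "A z $$ (i, j) + B z $$ (i, j) = (A z + B z) $$ (i, j)" if "i < a" "j < b" "z : S" for i j z using that Qm_carrier[OF assms(1) that(3)] Qm_carrier[OF assms(2) that(3)] by auto
qed

lemma Qm_smult:
 assumes "Qm a b A"
 shows "Qm a b (%z. c *m A z)"
proof (rule QmI)
 show "c *m A z : cmat a b" if "z : S" for z using assms that by (auto simp: Qm_def)
 show "Q (%z. c * A z $$ (i, j))" if "i < a" "j < b" for i j by (intro Q_mult Q_const Qm_entry[OF assms(1)] that)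
 show "c * A z $$ (i, j) = (c *m A z) $$ (i, j)" if "i < a" "j < b" "z : S" for i j z using that Qm_carrier[OF assms(1) that(3)] by auto
qed

lemma Q_det: "Qm n n A ==> Q (%z. det (A z))"
proof (rule Q_cong)
 assume A: "Qm n n A"
 have "p permutes {0..<n} ==> i < n ==> p i < n" for p i using permutes_in_image by fastforce
 thus "Q (%z. SUM p:{p. p permutes {0..<n}}. signof p * (\<Prod>i\<in>{0..<n}. A z $$ (i, p i)))" using A by (intro Q_sum Q_mult Q_prod Q_const) (auto simp: Qm_def)
qed (auto simp: det_def' Qm_def)

lemma Qm_minv:
 assumes A: "Qm n n A" and nz: "!!z. z : S ==> det (A z) ~= 0"
 shows "Qm n n (%z. minv (A z))"
proof -
 have "Q (%z. minv (A z) $$ (i, j))" if ij: "i < n" "j < n" for i j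
 proof (rule Q_cong)
  let ?D = "%z. mat (n - 1) (n - 1) (%(i', j'). A z $$ (if i' < j then i' else Suc i', if j' < i then j' else Suc j'))"
  have "Qm (n - 1) (n - 1) ?D" using A by (auto simp: Qm_def)
  thus "Q (%z. inverse (det (A z)) * ((-1) ^ (j + i) * det (?D z)))" by (intro Q_mult Q_const Q_det Q_inverse[OF Q_det[OF A] nz]) auto
  show "inverse (det (A z)) * ((-1) ^ (j + i) * det (?D z)) = minv (A z) $$ (i, j)" if "z : S" for z using Qm_carrier[OF A that] ij by (auto simp: minv_def adj_mat_def cofactor_def mat_delete_def)
 qed
 thus ?thesis using minv(1)[OF Qm_carrier[OF A] nz] by (auto simp: Qm_def)
qed

end

lemma ff_sm: "open S ==> fnf (smooth_on S) S" by unfold_locales (auto intro: smooth_const smooth_add smooth_mult smooth_inverse smooth_on_cong)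

lemma ff_hol: "open S ==> fnf (hol_on S) S" by unfold_locales (auto intro: hol_on_const hol_on_add hol_on_mult hol_on_inverse hol_on_cong)

abbreviation smm where "smm S == fnf.Qm (smooth_on S) S"
abbreviation holo_mat where "holo_mat S == fnf.Qm (hol_on S) S"

lemma holo_smooth_mat: "open S ==> holo_mat S a b A ==> smm S a b A" by (simp add: fnf.Qm_def[OF ff_sm] fnf.Qm_def[OF ff_hol] hol_on_smooth)

definition ctr :: "complex mat => complex mat" where
 "ctr A = mat (dim_col A) (dim_row A) (%(i, j). cnj (A $$ (j, i)))"

lemma ctr_c [simp]: "A : cmat a b ==> ctr A : cmat b a" by (simp add: ctr_def)
lemma ctr_index: "A : cmat a b ==> i < b ==> j < a ==> ctr A $$ (i, j) = cnj (A $$ (j, i))" by (simp add: ctr_def)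
lemma ctr_ctr: "ctr (ctr A) = A" by (rule eq_matI) (auto simp: ctr_def)
lemma ctr_mult: "A : cmat a b ==> B : cmat b c ==> ctr (A * B) = ctr B * ctr A" by (rule eq_matI) (auto simp: ctr_def scalar_prod_def mult.commute)
lemma ctr_one: "ctr (idm n) = idm n" by (rule eq_matI) (auto simp: ctr_def)

lemma smooth_mat_ctrans:
 assumes S: "open S" and A: "smm S a b A"
 shows "smm S b a (%z. ctr (A z))"
proof -
 note fs = ff_sm[OF S]
 show ?thesis
 proof (rule fnf.QmI[OF fs])
  show "ctr (A z) : cmat b a" if "z : S" for z using fnf.Qm_carrier[OF fs A that] by simp
  show "smooth_on S (%z. cnj (A z $$ (j, i)))" if "i < b" "j < a" for i j by (rule smooth_cnj[OF S fnf.Qm_entry[OF fs A that(2,1)]])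
  show "cnj (A z $$ (j, i)) = ctr (A z) $$ (i, j)" if "i < b" "j < a" "z : S" for i j z using ctr_index[OF fnf.Qm_carrier[OF fs A that(3)] that(1,2)] by simp
 qed
qed

lemma herm_sum:
 assumes "M : cmat r q" "s : cvec q" "t : cvec r"
 shows "herm M s t = (SUM i<r. SUM j<q. M $$ (i, j) * s $v j * cnj (t $v i))" using assms by (auto simp: herm_def scalar_prod_def sum_distrib_right atLeast0LessThan intro!: sum.cong)

lemma herm_unit:
 assumes "M : cmat r q" "i < r" "j < q"
 shows "herm M (unit_vec q j) (unit_vec r i) = M $$ (i, j)"
proof -
 have "unit_vec q j $v j' = (if j' = j then 1 else (0::complex))" if "j' < q" for j' using that assms by simp
 moreover have "cnj (unit_vec r i $v i') = (if i' = i then 1 else 0)" if "i' < r" for i' using that assms by simp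
 ultimately have "herm M (unit_vec q j) (unit_vec r i) =
   (\<Sum>i'<r. \<Sum>j'<q. M $$ (i', j') * (if j' = j then 1 else 0) * (if i' = i then 1 else 0))" unfolding herm_sum[OF assms(1) unit_vec_carrier unit_vec_carrier] by (intro sum.cong refl) simp
 also have "... = M $$ (i, j)" using assms 
 proof -
  have "(\<Sum>j'<q. M $$ (i', j') * (if j' = j then 1 else 0) * (if i' = i then 1 else 0)) =
    (if i' = i then M $$ (i', j) else 0)" for i'
  proof -
   have "(\<Sum>j'<q. M $$ (i', j') * (if j' = j then 1 else 0) * (if i' = i then 1 else 0)) =
    (\<Sum>j'<q. if j' = j then M $$ (i', j) * (if i' = i then 1 else 0) else 0)" by (rule sum.cong) auto
   thus ?thesis using assms(3) by simp
  qed
  thus ?thesis using assms(2) by simp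
 qed
 finally show ?thesis .
qed

lemma herm_eqI:
 assumes "M : cmat r q" "N : cmat r q"
  "!!s t. s : cvec q ==> t : cvec r ==> herm M s t = herm N s t"
 shows "M = N"
proof (rule eq_matI)
 fix i j assume "i < dim_row N" "j < dim_col N"
 hence "i < r" "j < q" using assms(2) by auto
 thus "M $$ (i, j) = N $$ (i, j)" using assms(3)[of "unit_vec q j" "unit_vec r i"] herm_unit[OF assms(1)] herm_unit[OF assms(2)] by simp
qed (use assms in auto)

lemma herm_right:
 assumes "A : cmat r q" "M : cmat q p" "s : cvec p"
 shows "herm A (M *V s) t = herm (A * M) s t" using assms by (simp add: herm_def assoc_mult_mat_vec[OF assms])

lemma herm_left:
 assumes "A : cmat r q" "M : cmat r p" "s : cvec q" "t : cvec p"
 shows "herm A s (M *V t) = herm (ctr M * A) s t"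
proof -
 have "herm A s (M *V t) = (SUM i<r. SUM j<q. SUM k<p. cnj (M $$ (i, k)) * A $$ (i, j) * s $v j * cnj (t $v k))" using assms by (subst herm_sum[OF assms(1,3)])
   (auto simp: scalar_prod_def sum_distrib_left atLeast0LessThan algebra_simps intro!: sum.cong)
 also have "... = (SUM i<r. SUM k<p. SUM j<q. cnj (M $$ (i, k)) * A $$ (i, j) * s $v j * cnj (t $v k))" by (rule sum.cong[OF refl], rule sum.swap)
 also have "... = (SUM k<p. SUM i<r. SUM j<q. cnj (M $$ (i, k)) * A $$ (i, j) * s $v j * cnj (t $v k))" by (rule sum.swap)
 also have "... = (SUM k<p. SUM j<q. SUM i<r. cnj (M $$ (i, k)) * A $$ (i, j) * s $v j * cnj (t $v k))" by (rule sum.cong[OF refl], rule sum.swap)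
 also have "... = herm (ctr M * A) s t"
 proof -
  note cM = ctr_c[OF assms(2)]
  have "(ctr M * A) $$ (k, j) = (SUM i<r. cnj (M $$ (i, k)) * A $$ (i, j))" if "k < p" "j < q" for k j using that assms(1) carrier_matD[OF cM] ctr_index[OF assms(2)] by (simp add: scalar_prod_def atLeast0LessThan)
  thus ?thesis unfolding herm_sum[OF mult_c[OF cM assms(1)] assms(3,4)] by (intro sum.cong refl) (simp add: sum_distrib_right)
 qed
 finally show ?thesis .
qed

lemma congruence_entry:
 assumes H: "H : cmat r r" and e: "e : cmat r q" and ij: "i < q" "j < q"
 shows "(ctr e * H * e) $$ (i, j) = herm H (col e j) (col e i)"
proof -
 have c: "ctr e * H * e : cmat q q" by (rule mult_c[OF mult_c[OF ctr_c[OF e] H] e])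
 have col: "col e k = e *V unit_vec q k" if "k < q" for k by (rule eq_vecI) (use e that in auto)
 have "herm H (col e j) (col e i) = herm H (e *V unit_vec q j) (e *V unit_vec q i)" using ij by (simp add: col)
 also have "... = herm (H * e) (unit_vec q j) (e *V unit_vec q i)" by (rule herm_right[OF H e]) simp
 also have "... = herm (ctr e * (H * e)) (unit_vec q j) (unit_vec q i)" by (rule herm_left[where q=q]) (use H e in auto)
 also have "... = (ctr e * H * e) $$ (i, j)" using herm_unit[OF c ij] assoc_mult_mat[OF ctr_c[OF e] H e] by simp
 finally show ?thesis by simp
qed

lemma herm_add_mat: "A : cmat r q ==> B : cmat r q ==> s : cvec q ==> t : cvec r ==>
 herm (A + B) s t = herm A s t + herm B s t" by (simp add: herm_sum[of _ r q] algebra_simps sum.distrib)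

lemma hmD:
 assumes "hermitian_metric r H"
 shows "H : cmat r r" "ctr H = H" "det H ~= 0"
proof -
 show c: "H : cmat r r" using assms by (simp add: hermitian_metric_def)
 have "H $$ (j, i) = cnj (H $$ (i, j))" if "i < r" "j < r" for i j
 proof -
  have "herm H (unit_vec r i) (unit_vec r j) = cnj (herm H (unit_vec r j) (unit_vec r i))" using assms unfolding hermitian_metric_def by (metis unit_vec_carrier)
  thus ?thesis using herm_unit[OF c] that by simp
 qed
 note sym = this
 show "ctr H = H"
 proof (rule eq_matI)
  fix i j assume "i < dim_row H" "j < dim_col H"
  hence "i < r" "j < r" using c by auto
  thus "ctr H $$ (i, j) = H $$ (i, j)" using sym[of j i] ctr_index[OF c, of i j] by simp
 qed (use c in "auto simp: ctr_def")
 show "det H ~= 0"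
 proof
  assume "det H = 0"
  then obtain v where v: "v : cvec r" "v ~= zv r" "H *V v = zv r" using det_0_iff_vec_prod_zero[OF c] by blast
  hence "herm H v v = 0" unfolding herm_def v(3) by (simp add: scalar_prod_def)
  moreover have "0 < herm H v v" using assms v(1,2) unfolding hermitian_metric_def by blast
  ultimately show False by simp
 qed
qed

section \<open>The Chern connection\<close>

definition Dm :: "nat => (complex ^ 'n::finite => complex mat) => complex ^ 'n => complex ^ 'n => complex mat" where
 "Dm r H z w = mat r r (%(i, j). fd (%y. H y $$ (i, j)) z w)"

text \<open>The (1,0)-part of the derivative of \<open>H\<close>.\<close>
definition Dm10 :: "nat => (complex ^ 'n::finite => complex mat) => complex ^ 'n => complex ^ 'n => complex mat" where
 "Dm10 r H z w = mat r r (%(i, j). (fd (%y. H y $$ (i, j)) z w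
   - \<i> * fd (%y. H y $$ (i, j)) z (\<i> *s w)) / 2)"

lemma complex_linear_10:
 assumes L: "linear (L :: complex ^ 'n::finite => complex)"
 shows "clin (%w. (L w - \<i> * L (\<i> *s w)) / 2)"
proof -
 have sm: "c *s w = Re c *R w + Im c *R (\<i> *s w)" for c and w :: "complex ^ 'n"
 proof -
  have "c * x = Re c *R x + Im c *R (\<i> * x)" for x by (simp add: complex_eq_iff)
  thus ?thesis by (simp add: cvec_eq)
 qed
 have 1: "L (c *s w) = of_real (Re c) * L w + of_real (Im c) * L (\<i> *s w)" for c w using linear_add[OF L] linear_scale[OF L] sm[of c w] by (simp add: scaleR_conv_of_real)
 have 2: "\<i> *s (c *s w) = (\<i> * c) *s w" for c and w :: "complex ^ 'n" by (simp add: vector_smult_assoc)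
 have 3: "L (\<i> *s (c *s w)) = of_real (- Im c) * L w + of_real (Re c) * L (\<i> *s w)" for c w using 1[of "\<i> * c" w] 2[of c w] by simp
 have 4: "\<i> *s (x + y) = \<i> *s x + \<i> *s y" for x y :: "complex ^ 'n" by (simp add: vector_add_ldistrib)
 have cc: "c = of_real (Re c) + \<i> * of_real (Im c)" for c by (simp add: complex_eq)
 show ?thesis unfolding clin_iff 4
 proof (intro conjI allI)
  fix c w
  show "(L (c *s w) - \<i> * L (\<i> *s (c *s w))) / 2 = c * ((L w - \<i> * L (\<i> *s w)) / 2)"
  proof -
   have "a * p + b * q - \<i> * (- b * p + a * q) = (a + \<i> * b) * (p - \<i> * q)" for a b p q :: complex by (simp add: algebra_simps)
   from this[of "of_real (Re c)" "L w" "of_real (Im c)" "L (\<i> *s w)"] show ?thesis unfolding 3[of c w] 1[of c w] cc[of c, symmetric] by simp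
  qed
 qed (simp add: linear_add[OF L] field_simps)
qed

text \<open>A connection that is metric and of type (1,0) in a holomorphic frame is determined by these two conditions:
 the (1,0)-part of \<open>dH\<close> is \<open>H\<close> times the connection matrix.\<close>
lemma chern_connection_eq:
 fixes H :: "complex ^ 'n::finite => complex mat"
 assumes S: "open S" "z : S" and H: "!!y. y : S ==> hermitian_metric r (H y)"
  and sm: "!!i j. i < r ==> j < r ==> (%y. H y $$ (i, j)) differentiable (at z)"
 shows "chern_connection r H z = (%w. minv (H z) * Dm10 r H z w)"
  and "Dm r H z w = H z * (minv (H z) * Dm10 r H z w) + ctr (minv (H z) * Dm10 r H z w) * H z"
  and "i < r ==> j < r ==> clin (%w. (minv (H z) * Dm10 r H z w) $$ (i, j))"
proof -
 note h = hmD[OF H]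
 have hz: "H z : cmat r r" "ctr (H z) = H z" "det (H z) ~= 0" using h S by auto
 note iz = minv[OF hz(1,3)]
 have P: "Dm10 r H z w : cmat r r" "Dm r H z w : cmat r r" for w by (simp_all add: Dm10_def Dm_def)
 let ?th = "%w. minv (H z) * Dm10 r H z w"
 have th: "?th w : cmat r r" for w using iz P by auto
 have Hth: "H z * ?th w = Dm10 r H z w" for w using assoc_mult_mat[OF hz(1) iz(1) P(1)[of w]] iz(2) P(1)[of w] by simp
 have fd: "linear (fd (%y. H y $$ (i, j)) z)" if "i < r" "j < r" for i j using linear_frechet_derivative[OF sm[OF that]] .
 have cl: "clin (%w. Dm10 r H z w $$ (i, j))" if "i < r" "j < r" for i j using complex_linear_10[OF fd[OF that]] that by (simp add: Dm10_def)
 show clt: "i < r ==> j < r ==> clin (%w. ?th w $$ (i, j))" for i j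
 proof -
  assume ij: "i < r" "j < r"
  have "?th w $$ (i, j) = (SUM k:{0..<r}. minv (H z) $$ (i, k) * Dm10 r H z w $$ (k, j))" for w using ij iz P[of w] by (auto simp: scalar_prod_def)
  thus ?thesis using cl ij by (auto simp: clin_iff sum.distrib sum_distrib_left algebra_simps)
 qed
 have herm_der: "fd (%y. H y $$ (j, i)) z w = cnj (fd (%y. H y $$ (i, j)) z w)"
  if ij: "i < r" "j < r" for i j w
 proof -
  have "H y $$ (j, i) = cnj (H y $$ (i, j))" if "y : S" for y using ctr_index[OF h(1)[OF that], of j i] h(2)[OF that] ij by simp
  hence "fd (%y. H y $$ (j, i)) z = fd (%y. cnj (H y $$ (i, j))) z" by (rule fd_cong(1)[OF S])
  also have "... = (%w. cnj (fd (%y. H y $$ (i, j)) z w))" by (rule fd_at[symmetric])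
    (rule bl_hd[OF bounded_linear_cnj diff_fd[OF sm[OF ij]]])
  finally show ?thesis by simp
 qed
 show comp: "Dm r H z w = H z * ?th w + ctr (?th w) * H z" for w
 proof -
  have "ctr (?th w) * H z = ctr (H z * ?th w)" using ctr_mult[OF hz(1) th[of w]] hz(2) by simp
  hence "H z * ?th w + ctr (?th w) * H z = Dm10 r H z w + ctr (Dm10 r H z w)" using Hth by simp
  also have "... = Dm r H z w"
  proof (rule eq_matI)
   fix i j assume "i < dim_row (Dm r H z w)" "j < dim_col (Dm r H z w)"
   hence ij: "i < r" "j < r" using P[of w] by auto
   have "cnj (Dm10 r H z w $$ (j, i)) = (fd (%y. H y $$ (i, j)) z w
     + \<i> * fd (%y. H y $$ (i, j)) z (\<i> *s w)) / 2" using ij by (simp add: Dm10_def herm_der[OF ij])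
   thus "(Dm10 r H z w + ctr (Dm10 r H z w)) $$ (i, j) = Dm r H z w $$ (i, j)" using ij carrier_matD[OF P(1)[of w]] carrier_matD[OF ctr_c[OF P(1)[of w]]]
    by (simp add: ctr_index[OF P(1)]) (simp add: Dm10_def Dm_def field_simps)
  qed (use carrier_matD[OF P(1)[of w]] carrier_matD[OF P(2)[of w]] carrier_matD[OF ctr_c[OF P(1)[of w]]] in simp_all)
  finally show ?thesis by simp
 qed
 have dh: "fd (%y. herm (H y) s t) z w = herm (Dm r H z w) s t"
  if st: "s : cvec r" "t : cvec r" for s t w
 proof -
  have "fd (%y. herm (H y) s t) z =
    fd (%y. SUM i<r. SUM j<r. H y $$ (i, j) * s $v j * cnj (t $v i)) z" by (rule fd_cong(1)[OF S]) (rule herm_sum[OF h(1) st])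
  also have "... = (%w. SUM i<r. SUM j<r. fd (%y. H y $$ (i, j)) z w * s $v j * cnj (t $v i))" by (rule fd_at[symmetric])
    (intro has_derivative_sum has_derivative_mult_left diff_fd sm, auto)
  finally show ?thesis using herm_sum[OF P(2) st] by (simp add: Dm_def)
 qed
 have iff: "(ALL s:cvec r. ALL t:cvec r. ALL w. fd (%y. herm (H y) s t) z w =
    herm (H z) (ta w *V s) t + herm (H z) s (ta w *V t)) \<longleftrightarrow>
   (ALL w. Dm r H z w = H z * ta w + ctr (ta w) * H z)" if "!!w. ta w : cmat r r" for ta
 proof -
  have e: "herm (H z) (ta w *V s) t + herm (H z) s (ta w *V t) = herm (H z * ta w + ctr (ta w) * H z) s t"
   if "s : cvec r" "t : cvec r" for s t w using herm_right[OF hz(1) `!!w. ta w : cmat r r`, of s w t] herm_left[OF hz(1) `!!w. ta w : cmat r r`, of s t w]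
    herm_add_mat[OF mult_c[OF hz(1) `!!w. ta w : cmat r r`]
     mult_c[OF ctr_c[OF `!!w. ta w : cmat r r`] hz(1)] that, of w w] that by simp
  have c: "H z * ta w + ctr (ta w) * H z : cmat r r" for w by (intro add_carrier_mat mult_c[OF ctr_c[OF that] hz(1)])
  show ?thesis using e dh herm_eqI[OF P(2) c] by auto
 qed
 show "chern_connection r H z = ?th" unfolding chern_connection_def
 proof (rule the_equality)
  show "(ALL w. ?th w : cmat r r) & (ALL i<r. ALL j<r. clin (%w. ?th w $$ (i, j))) &
   (ALL s:cvec r. ALL t:cvec r. ALL w. fd (%y. herm (H y) s t) z w =
    herm (H z) (?th w *V s) t + herm (H z) s (?th w *V t))" using iff[of ?th, OF th] comp th clt by blast
 next
  fix ta :: "complex ^ 'n => complex mat"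
  assume *: "(ALL w. ta w : cmat r r) & (ALL i<r. ALL j<r. clin (%w. ta w $$ (i, j))) &
   (ALL s:cvec r. ALL t:cvec r. ALL w. fd (%y. herm (H y) s t) z w =
    herm (H z) (ta w *V s) t + herm (H z) s (ta w *V t))"
  hence c: "ta w : cmat r r" for w by blast
  from * iff[of ta, OF c] have D: "Dm r H z w = H z * ta w + ctr (ta w) * H z" for w by blast
  have lin: "ta (\<i> *s w) = \<i> *m ta w" for w by (rule eq_matI) (use * c in "auto simp: clin_iff carrier_matD[OF c]")
  show "ta = ?th"
  proof
   fix w
   have "Dm10 r H z w = H z * ta w"
   proof (rule eq_matI)
    fix i j assume "i < dim_row (H z * ta w)" "j < dim_col (H z * ta w)"
    hence ij: "i < r" "j < r" using hz(1) c[of w] by auto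
    have a: "Dm r H z w $$ (i, j) = (H z * ta w) $$ (i, j) + (ctr (ta w) * H z) $$ (i, j)" unfolding D using ij carrier_matD[OF mult_c[OF ctr_c[OF c[of w]] hz(1)]] by simp
    have b: "Dm r H z (\<i> *s w) $$ (i, j) = \<i> * (H z * ta w) $$ (i, j) - \<i> * (ctr (ta w) * H z) $$ (i, j)" unfolding D lin using ij hz(1) c[of w]
     by (auto simp: scalar_prod_def ctr_def sum_distrib_left sum_negf algebra_simps)
    show "Dm10 r H z w $$ (i, j) = (H z * ta w) $$ (i, j)"
    proof -
     have "Dm10 r H z w $$ (i, j) = (Dm r H z w $$ (i, j) - \<i> * Dm r H z (\<i> *s w) $$ (i, j)) / 2" using ij by (simp add: Dm_def Dm10_def)
     thus ?thesis unfolding a b by (simp add: algebra_simps)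
    qed
   qed (use hz(1) c[of w] P in auto)
   hence "?th w = minv (H z) * (H z * ta w)" by simp
   also have "... = ta w" using assoc_mult_mat[OF iz(1) hz(1) c[of w]] iz(3) c[of w] by simp
   finally show "ta w = ?th w" by simp
  qed
 qed
qed

section \<open>Matrices as forms\<close>

text \<open>A matrix as a matrix of 0-forms: the value sits on the empty argument list.\<close>
definition zf :: "nat => nat => complex mat => 'v mext" where
 "zf p q M i j vs = (if i < p & j < q & vs = [] then M $$ (i, j) else 0)"

lemma zf_basic [simp]: "mdeg 0 (zf p q M)" "mdim p q (zf p q M)" by (auto simp: zf_def mdeg_def hdeg_def mdim_def fun_eq_iff fun_apps)

lemma hdeg0_eqI: "hdeg 0 al ==> hdeg 0 bt ==> al [] = bt [] ==> al = bt"
proof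
 fix vs assume "hdeg 0 al" "hdeg 0 bt" "al [] = bt []"
 thus "al vs = bt vs" by (cases vs) (auto simp: hdeg_def)
qed

lemma mdeg0_eqI: "mdeg 0 A ==> mdeg 0 B ==> (!!i j. A i j [] = B i j []) ==> A = B" by (intro ext, rule fun_cong, rule hdeg0_eqI) (auto simp: mdeg_def)

lemma mw_Nil: "mw r A B i j [] = (SUM k<r. A i k [] * B k j [])" by (simp add: mwedge_def)

lemma zf_mult: "A : cmat p q ==> B : cmat q s ==> zf p s (A * B) = mw q (zf p q A) (zf q s B)" using mdeg_mw[of 0 "zf p q A" 0 "zf q s B" q]
 by (intro mdeg0_eqI) (auto simp: mw_Nil zf_def scalar_prod_def atLeast0LessThan)

lemma munit_def2: "munit k j = (if k = j then unit_ext else 0)" by (auto simp: munit_def fun_apps)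

lemma zf_one_entry:
 "i < r ==> mw r (zf r r (idm r)) A i j = A i j" "j < r ==> mw r A (zf r r (idm r)) i j = A i j"
proof -
 have z: "zf r r (idm r) i j = (if i = j & i < r then unit_ext else 0)" for i j :: nat by (auto simp: zf_def unit_ext_def fun_eq_iff fun_apps one_mat_def)
 assume i: "i < r"
 hence "mw r (zf r r (idm r)) A i j = (SUM k<r. if k = i then A i j else 0)" unfolding mw_sum by (intro sum.cong refl) (simp add: z)
 thus "mw r (zf r r (idm r)) A i j = A i j" using i by simp
next
 have z: "zf r r (idm r) i j = (if i = j & i < r then unit_ext else 0)" for i j :: nat by (auto simp: zf_def unit_ext_def fun_eq_iff fun_apps one_mat_def)
 assume j: "j < r"
 hence "mw r A (zf r r (idm r)) i j = (SUM k<r. if k = j then A i j else 0)" unfolding mw_sum by (intro sum.cong refl) (simp add: z)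
 thus "mw r A (zf r r (idm r)) i j = A i j" using j by simp
qed

lemma zf_one: "mdim r c A ==> mw r (zf r r (idm r)) A = A" "mdim c r A ==> mw r A (zf r r (idm r)) = A"
proof -
 assume A: "mdim r c A"
 have "mdim r c (mw r (zf r r (idm r)) A)" by (rule mdim_mw[OF zf_basic(2) A])
 hence "mw r (zf r r (idm r)) A i j = A i j" for i j using A zf_one_entry(1)[of i r A j] by (cases "i < r") (auto simp: mdim_def)
 thus "mw r (zf r r (idm r)) A = A" by blast
next
 assume A: "mdim c r A"
 have "mdim c r (mw r A (zf r r (idm r)))" by (rule mdim_mw[OF A zf_basic(2)])
 hence "mw r A (zf r r (idm r)) i j = A i j" for i j using A zf_one_entry(2)[of j r A i] by (cases "j < r") (auto simp: mdim_def)
 thus "mw r A (zf r r (idm r)) = A" by blast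
qed

lemma mstar_zf: "A : cmat p q ==> mstar (zf p q A) = zf q p (ctr A)" by (intro ext) (auto simp: mstar_def zf_def ctr_index)

lemma msm_zf:
 assumes "open S" "smm S p q M"
 shows "msm S (%z. zf p q (M z))"
proof -
 have "smooth_on S (%z. zf p q (M z) i j vs)" for i j vs
 proof (cases "i < p & j < q & vs = []")
  case True
  hence "(%z. zf p q (M z) i j vs) = (%z. M z $$ (i, j))" by (simp add: zf_def)
  thus ?thesis using True fnf.Qm_entry[OF ff_sm[OF assms(1)] assms(2)] by simp
 next
  case False
  hence "(%z. zf p q (M z) i j vs) = (%z. 0)" by (auto simp: zf_def)
  thus ?thesis using smooth_const[OF assms(1)] by simp
 qed
 thus ?thesis unfolding msm_def esm_def by blast
qed

lemma md_zf_single: "i < p ==> j < q ==> md (%y. zf p q (M y)) z i j [w] = fd (%y. M y $$ (i, j)) z w" by (simp add: md_def ext_deriv_def zf_def)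

lemma mdeg1_eqI: "mdeg 1 A ==> mdeg 1 B ==> (!!i j w. A i j [w] = B i j [w]) ==> A = B"
proof (intro ext)
 fix i j vs assume *: "mdeg 1 A" "mdeg 1 B" "!!i j w. A i j [w] = B i j [w]"
 show "A i j vs = B i j vs"
 proof (cases "length vs = 1")
  case True thus ?thesis using *(3) by (auto simp: length_Suc_conv)
 next
  case False thus ?thesis using *(1,2) by (auto simp: mdeg_def hdeg_def)
 qed
qed

definition chern :: "nat => (complex ^ 'n::finite => complex mat) => complex ^ 'n => (complex ^ 'n) mext" where
 "chern r H z i j = (if i < r & j < r then one_ext (%w. (minv (H z) * Dm10 r H z w) $$ (i, j)) else 0)"

lemma hdeg_one_ext: "hdeg 1 (one_ext a)" by (auto simp: hdeg_def one_ext_def split: list.split)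

lemma chernD: "mdeg 1 (chern r H z)" "mdim r r (chern r H z)" by (auto simp: chern_def mdeg_def mdim_def hdeg_one_ext[simplified] hdeg_zero)

lemma chern_single: "i < r ==> j < r ==> chern r H z i j [w] = (minv (H z) * Dm10 r H z w) $$ (i, j)" by (simp add: chern_def one_ext_def)

lemma chern_mclin:
 fixes H :: "complex ^ 'n::finite => complex mat"
 assumes S: "open S" "z : S" and H: "!!y. y : S ==> hermitian_metric r (H y)" and sm: "smm S r r H"
 shows "mclin (chern r H z)"
  and "md (%y. zf r r (H y)) z = mw r (zf r r (H z)) (chern r H z) + mw r (mstar (chern r H z)) (zf r r (H z))"
  and "msm S (chern r H)"
  and "i < r ==> j < r ==> mone (chern_connection r H z) i j = chern r H z i j"
proof -
 let ?th = "%w. minv (H z) * Dm10 r H z w"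
 let ?R = "mw r (zf r r (H z)) (chern r H z) + mw r (mstar (chern r H z)) (zf r r (H z))"
 note fs = ff_sm[OF S(1)]
 have d: "(%y. H y $$ (i, j)) differentiable (at z)" if "i < r" "j < r" "z : S" for i j z by (rule smooth_dble[OF fnf.Qm_entry[OF fs sm that(1,2)] that(3)])
 have dz: "(%y. H y $$ (i, j)) differentiable (at z)" if "i < r" "j < r" for i j by (rule d[OF that S(2)])
 note ch = chern_connection_eq[OF S H dz]
 have z0: "(0::(complex^'n) ext) x = 0" for x by (simp add: zero_fun_apply)
 show "mclin (chern r H z)" unfolding mclin_def
 proof (intro conjI allI chernD)
  fix i j
  show "clin (%w. chern r H z i j [w])"
  proof (cases "i < r & j < r")
   case True
   thus ?thesis using ch(3)[of i j] by (simp add: chern_single)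
  next
   case False
   thus ?thesis by (auto simp: chern_def clin_iff z0)
  qed
 qed
 have hz: "H z : cmat r r" using hmD[OF H[OF S(2)]] by auto
 have th: "?th w : cmat r r" for w using minv(1)[OF hz] hmD[OF H[OF S(2)]] by (auto simp: Dm10_def)
 show "md (%y. zf r r (H y)) z = ?R"
 proof (rule mdeg1_eqI)
  show "mdeg 1 (md (%y. zf r r (H y)) z)" using mdeg_md[of 0 "%y. zf r r (H y)" z] by simp
  show "mdeg 1 (?R)" using mdeg_mw[of 0 "zf r r (H z)" 1 "chern r H z" r] mdeg_mw[of 1 "mstar (chern r H z)" 0 "zf r r (H z)" r] by (intro mdeg_add) (auto simp: chernD[simplified] mdeg_mstar[OF chernD(1)[simplified]])
  fix i j w
  have m: "mstar (chern r H z) i k [w] = ctr (?th w) $$ (i, k)" if "i < r" "k < r" for i k using that ctr_index[OF th] by (simp add: mstar_def chern_single)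
  show "md (%y. zf r r (H y)) z i j [w] = (?R) i j [w]"
  proof (cases "i < r & j < r")
   case True
   have "md (%y. zf r r (H y)) z i j [w] = Dm r H z w $$ (i, j)" using True by (simp add: md_zf_single Dm_def)
   also have "... = (SUM k<r. H z $$ (i, k) * (?th w) $$ (k, j)) +
     (SUM k<r. ctr (?th w) $$ (i, k) * H z $$ (k, j))"
   proof -
    have "Dm r H z w = H z * (?th w) + ctr (?th w) * H z" by (rule ch(2))
    hence "Dm r H z w $$ (i, j) = (H z * (?th w)) $$ (i, j) + (ctr (?th w) * H z) $$ (i, j)" using True carrier_matD[OF mult_c[OF ctr_c[OF th[of w]] hz]] by simp
    also have "(H z * (?th w)) $$ (i, j) = (SUM k<r. H z $$ (i, k) * (?th w) $$ (k, j))" using True carrier_matD[OF hz] carrier_matD[OF th[of w]] by (subst index_mult_mat(1)) (auto simp: scalar_prod_def atLeast0LessThan)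
    also have "(ctr (?th w) * H z) $$ (i, j) =
      (SUM k<r. ctr (?th w) $$ (i, k) * H z $$ (k, j))" using True carrier_matD[OF hz] carrier_matD[OF ctr_c[OF th[of w]]] by (subst index_mult_mat(1)) (auto simp: scalar_prod_def atLeast0LessThan)
    finally show ?thesis .
   qed
   also have "... = (?R) i j [w]" unfolding plus_fun_apply using True by (simp add: mw_single m chern_single zf_def)
   finally show ?thesis .
  next
   case False
   hence "md (%y. zf r r (H y)) z i j = 0" using mdim_md[OF zf_basic(2), of r r H z] by (auto simp: mdim_def)
   moreover have "mstar (chern r H z) i k [w] = 0" if "~i < r" for k using that by (simp add: mstar_def chern_def z0)
   moreover have "chern r H z k j [w] = 0" if "~j < r" for k using that by (simp add: chern_def z0)
   ultimately show ?thesis unfolding plus_fun_apply using False by (auto simp: mw_single zf_def z0)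
  qed
 qed
 show "msm S (chern r H)" unfolding msm_def esm_def
 proof (intro allI)
  fix i j vs
  show "smooth_on S (%y. chern r H y i j vs)"
  proof (cases "i < r & j < r & (EX w. vs = [w])")
   case True
   then obtain w where w: "vs = [w]" and ij: "i < r" "j < r" by blast
   have "smm S r r (%z. Dm10 r H z w)"
   proof (rule fnf.QmI[OF fs, where f="%i j z. (1 / 2) * (fd (%y. H y $$ (i, j)) z w
      - \<i> * fd (%y. H y $$ (i, j)) z (\<i> *s w))"])
    show "smooth_on S (%z. (1 / 2) * (fd (%y. H y $$ (i, j)) z w
      - \<i> * fd (%y. H y $$ (i, j)) z (\<i> *s w)))" if "i < r" "j < r" for i j by (intro smooth_mult[OF S(1)] smooth_diff[OF S(1)] smooth_const[OF S(1)] smooth_pd[OF S(1)]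
       fnf.Qm_entry[OF fs sm] that)
   qed (simp_all add: Dm10_def)
   hence "smm S r r (%z. minv (H z) * Dm10 r H z w)" by (intro fnf.Qm_mult[OF fs fnf.Qm_minv[OF fs sm]]) (use hmD[OF H] in auto)
   thus ?thesis using ij by (simp add: w chern_single fnf.Qm_def[OF fs])
  next
   case False
   have "chern r H y i j vs = 0" for y
   proof (cases "i < r & j < r")
    case True
    hence "length vs ~= 1" using False by (auto simp: length_Suc_conv)
    thus ?thesis using chernD(1)[of r H y] by (auto simp: mdeg_def hdeg_def)
   next
    case False thus ?thesis by (auto simp: chern_def z0)
   qed
   thus ?thesis by (simp add: smooth_const[OF S(1)])
  qed
 qed
 show "i < r ==> j < r ==> mone (chern_connection r H z) i j = chern r H z i j"
 proof -
  assume ij: "i < r" "j < r"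
  have "chern_connection r H z = ?th" by (rule ch(1))
  thus "mone (chern_connection r H z) i j = chern r H z i j" using ij by (simp add: mone_def chern_def)
 qed
qed

lemma conn_curvature_curv:
 assumes S: "open S" "z : S" and e: "!!y i j. y : S ==> i < r ==> j < r ==> ta y i j = t y i j" and ij: "i < r" "j < r"
 shows "conn_curvature r ta z i j = curv r t z i j"
proof -
 have c: "cov_deriv r ta (%k _. munit k j) i z = ta z i j" for i z
 proof
  fix vs
  have "cov_deriv r ta (%k _. munit k j) i z vs = (SUM k<r. if k = j then ta z i k vs else 0)" unfolding cov_deriv_def ed_const zero_fun_apply add_0_left by (intro sum.cong refl) (simp add: munit_def2 fun_apps)
  thus "cov_deriv r ta (%k _. munit k j) i z vs = ta z i j vs" using ij by simp
 qed
 have d: "ed (%y. ta y i j) z = md t z i j" unfolding md_def by (rule ed_cong[OF S]) (use e ij in auto)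
 show ?thesis
 proof
  fix vs
  have "conn_curvature r ta z i j vs = md t z i j vs + (SUM k<r. wedge (ta z i k) (ta z k j) vs)" unfolding conn_curvature_def cov_deriv_def[of r ta "cov_deriv r ta (%k _. munit k j)"] c d ..
  also have "... = curv r t z i j vs" using e S ij by (simp add: curv_def mwedge_def fun_apps)
  finally show "conn_curvature r ta z i j vs = curv r t z i j vs" .
 qed
qed

section \<open>Alternating forms\<close>

text \<open>Alternating forms, defined by iterated contraction to match the recursion for the wedge product.\<close>
fun alt :: "nat => ('v::real_vector) ext => bool" where
 "alt 0 al \<longleftrightarrow> hdeg 0 al"
| "alt (Suc p) al \<longleftrightarrow> hdeg (Suc p) al & (ALL x. alt p (contr x al)) & (ALL x y. contr (x + y) al = contr x al + contr y al) &
   (ALL c x. contr (c *R x) al = (%vs. of_real c * contr x al vs)) & (ALL x. contr x (contr x al) = 0)"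

lemma contr_zero [simp]: "contr x 0 = 0" by (rule ext) (simp add: contr_def zero_fun_apply)
lemma contr_add: "contr x (al + bt) = contr x al + contr x bt" by (rule contr_simps)
lemma contr_scale: "contr x (%vs. c * al vs) = (%vs. c * contr x al vs)" by (rule ext) (simp add: contr_def)
lemma scale_zero_ext: "(%vs. c * (0 :: 'v ext) vs) = 0" by (rule ext) (simp add: zero_fun_apply)

lemma alt_hdeg: "alt p al ==> hdeg p al" by (cases p) auto

lemma alt_contr_cases: "alt p al ==> (p = 0 & (ALL x. contr x al = 0)) \<or> (EX p'. p = Suc p' & (ALL x. alt p' (contr x al)))" by (cases p) (auto simp: hdeg_0_contr)

lemma alt_contr_lin:
 assumes "alt p al"
 shows "contr (x + y) al = contr x al + contr y al" "contr (c *R x) al = (%vs. of_real c * contr x al vs)"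
  "contr x (contr x al) = 0"
proof -
 have "contr (x + y) al = contr x al + contr y al & contr (c *R x) al = (%vs. of_real c * contr x al vs) & contr x (contr x al) = 0"
 proof (cases p)
  case 0
  hence "contr x al = 0" for x using assms hdeg_0_contr by auto
  thus ?thesis by (simp add: scale_zero_ext)
 next
  case (Suc p')
  thus ?thesis using assms by simp
 qed
 thus "contr (x + y) al = contr x al + contr y al" "contr (c *R x) al = (%vs. of_real c * contr x al vs)"
  "contr x (contr x al) = 0" by blast+
qed

lemma alt_zero: "alt p 0" by (induction p) (simp_all add: hdeg_zero scale_zero_ext)

lemma alt_scale: "alt p al ==> alt p (%vs. c * al vs)"
proof (induction p arbitrary: al)
 case 0 thus ?case by (auto simp: hdeg_def)
next
 case (Suc p)
 hence "hdeg (Suc p) (%vs. c * al vs)" by (auto simp: hdeg_def)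
 with Suc show ?case by (auto simp: contr_scale fun_eq_iff fun_apps algebra_simps)
qed

lemma alt_add: "alt p al ==> alt p bt ==> alt p (al + bt)"
proof (induction p arbitrary: al bt)
 case 0 thus ?case by (simp add: hdeg_add)
next
 case (Suc p)
 thus ?case by (simp add: contr_add hdeg_add) (auto simp: fun_eq_iff fun_apps algebra_simps)
qed

lemma alt_sg: "alt p al ==> alt p (sg al)" by (subst sg_hdeg[OF alt_hdeg], assumption, rule alt_scale)

lemma alt_sum: "(!!k. k : K ==> alt p (f k)) ==> alt p (SUM k:K. f k)"
proof (induction K rule: infinite_finite_induct)
 case (insert x F)
 thus ?case unfolding sum.insert[OF insert.hyps(1,2)] by (intro alt_add) auto
qed (simp_all only: sum.infinite sum.empty alt_zero not_False_eq_True)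

lemma alt_wedge: "alt p al ==> alt q bt ==> alt (p + q) (wedge al bt)"
proof (induction "p + q" arbitrary: p q al bt)
 case 0
 thus ?case using hdeg_wedge[of 0 al 0 bt] by simp
next
 case (Suc m)
 note c1 = alt_contr_lin[OF Suc.prems(1)] and c2 = alt_contr_lin[OF Suc.prems(2)]
 have a1: "alt m (wedge (contr x al) bt)" for x using alt_contr_cases[OF Suc.prems(1)] Suc.hyps Suc.prems(2) by (auto simp: alt_zero)
 have a2: "alt m (wedge (sg al) (contr x bt))" for x using alt_contr_cases[OF Suc.prems(2)] Suc.hyps alt_sg[OF Suc.prems(1)] by (auto simp: alt_zero)
 have s2: "wedge gm (%vs. of_real c * \<delta> vs) = (%vs. of_real c * wedge gm \<delta> vs)" for gm \<delta> :: "'a ext" and c by (rule wedge_scale_right)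
 have s1: "wedge (%vs. of_real c * \<delta> vs) gm = (%vs. of_real c * wedge \<delta> gm vs)" for gm \<delta> :: "'a ext" and c by (rule wedge_scale_left)
 have z: "contr x (contr x (wedge al bt)) = 0" for x unfolding contr_wedge contr_add c1(3) c2(3) wedge_zero contr_simps(2) contr_simps(3) wedge_minus_left by simp
 have l1: "contr (x + y) (wedge al bt) = contr x (wedge al bt) + contr y (wedge al bt)" for x y unfolding contr_wedge c1(1) c2(1) wedge_add_left wedge_add_right by (simp add: algebra_simps)
 have l2: "contr (c *R x) (wedge al bt) = (%vs. of_real c * contr x (wedge al bt) vs)" for x c unfolding contr_wedge c1(2) c2(2) s1 s2 by (simp add: fun_eq_iff fun_apps algebra_simps)
 have "alt m (contr x (wedge al bt))" for x unfolding contr_wedge by (intro alt_add a1 a2)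
 moreover have "hdeg (Suc m) (wedge al bt)" using hdeg_wedge[OF alt_hdeg[OF Suc.prems(1)] alt_hdeg[OF Suc.prems(2)]] Suc.hyps(2) by simp
 ultimately have "alt (Suc m) (wedge al bt)" using z l1 l2 by simp
 thus ?case using Suc.hyps(2) by simp
qed

lemma alternating_alt: "alternating d al ==> alt d al"
proof (induction d arbitrary: al)
 case 0
 thus ?case by (auto simp: alternating_def hdeg_def)
next
 case (Suc d)
 have supp: "!!vs. length vs ~= Suc d ==> al vs = 0"
  and lin: "!!vs i. length vs = Suc d ==> i < Suc d ==> linear (%w. al (vs[i := w]))"
  and rep: "!!vs i j. length vs = Suc d ==> i < j ==> j < Suc d ==> vs ! i = vs ! j ==> al vs = 0" using Suc.prems unfolding alternating_def by blast+
 have "alternating d (contr x al)" for x unfolding alternating_def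
 proof (intro conjI allI impI)
  fix vs :: "'a list" assume "length vs ~= d"
  thus "contr x al vs = 0" using supp by (simp add: contr_def)
 next
  fix vs :: "'a list" and i assume "length vs = d" "i < d"
  thus "linear (%w. contr x al (vs[i := w]))" using lin[of "x # vs" "Suc i"] by (simp add: contr_def)
 next
  fix vs :: "'a list" and i j assume "length vs = d & i < j & j < d & vs ! i = vs ! j"
  thus "contr x al vs = 0" using rep[of "x # vs" "Suc i" "Suc j"] by (simp add: contr_def)
 qed
 hence "alt d (contr x al)" for x by (rule Suc.IH)
 moreover have "contr (x + y) al = contr x al + contr y al" for x y
 proof
  fix vs
  show "contr (x + y) al vs = (contr x al + contr y al) vs"
  proof (cases "length vs = d")
   case True
   thus ?thesis using linear_add[OF lin[of "x # vs" 0], of x y] by (simp add: contr_def plus_fun_apply)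
  qed (simp add: contr_def supp plus_fun_apply)
 qed
 moreover have "contr (c *R x) al = (%vs. of_real c * contr x al vs)" for c x
 proof
  fix vs
  show "contr (c *R x) al vs = of_real c * contr x al vs"
  proof (cases "length vs = d")
   case True
   thus ?thesis using linear_scale[OF lin[of "x # vs" 0], of c x] by (simp add: contr_def scaleR_conv_of_real)
  qed (simp add: contr_def supp)
 qed
 moreover have "contr x (contr x al) = 0" for x
 proof
  fix vs
  show "contr x (contr x al) vs = 0 vs"
  proof (cases "Suc (length vs) = d")
   case True
   thus ?thesis using rep[of "x # x # vs" 0 1] by (simp add: contr_def zero_fun_apply)
  qed (simp add: contr_def supp zero_fun_apply)
 qed
 moreover have "hdeg (Suc d) al" using supp by (simp add: hdeg_def)
 ultimately show ?case by simp
qed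

lemma alt_slot_linear:
 assumes "alt d al" "length vs = d" "i < d"
 shows "al (vs[i := x + y]) = al (vs[i := x]) + al (vs[i := y])" "al (vs[i := c *R x]) = of_real c * al (vs[i := x])"
proof -
 have "al (vs[i := x + y]) = al (vs[i := x]) + al (vs[i := y]) & al (vs[i := c *R x]) = of_real c * al (vs[i := x])" using assms
 proof (induction d arbitrary: al vs i)
  case (Suc d)
  then obtain v us where vs: "vs = v # us" "length us = d" by (auto simp: length_Suc_conv)
  show ?case
  proof (cases i)
   case 0
   have "contr (x + y) al us = (contr x al + contr y al) us" "contr (c *R x) al us = of_real c * contr x al us" using alt_contr_lin(1,2)[OF Suc.prems(1)] by auto
   thus ?thesis using 0 vs by (simp add: contr_def plus_fun_apply)
  next
   case (Suc i')
   have "alt d (contr v al)" using Suc.prems(1) by simp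
   from Suc.IH[OF this vs(2), of i'] show ?thesis using Suc Suc.prems(3) vs by (simp add: contr_def)
  qed
 qed simp
 thus "al (vs[i := x + y]) = al (vs[i := x]) + al (vs[i := y])" "al (vs[i := c *R x]) = of_real c * al (vs[i := x])" by auto
qed

lemma alt_swap_head: "alt d al ==> al (x # y # vs) = - al (y # x # vs)"
proof -
 assume a: "alt d al"
 have z: "al (u # u # vs) = 0" for u using fun_cong[OF alt_contr_lin(3)[OF a, of u], of vs] by (simp add: contr_def zero_fun_apply)
 have l: "al ((u + u') # us) = al (u # us) + al (u' # us)" for u u' us using fun_cong[OF alt_contr_lin(1)[OF a, of u u'], of us] by (simp add: contr_def plus_fun_apply)
 have l2: "al (w # (u + u') # us) = al (w # u # us) + al (w # u' # us)" for w u u' us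
 proof -
  from alt_contr_cases[OF a] show ?thesis
  proof
   assume "d = 0 & (ALL x. contr x al = 0)"
   hence "contr w al us = 0 us" for us by simp
   thus ?thesis by (simp add: contr_def zero_fun_apply)
  next
   assume "EX p'. d = Suc p' & (ALL x. alt p' (contr x al))"
   then obtain p' where "alt p' (contr w al)" by blast
   from fun_cong[OF alt_contr_lin(1)[OF this, of u u'], of us] show ?thesis by (simp add: contr_def plus_fun_apply)
  qed
 qed
 have "0 = al ((x + y) # (x + y) # vs)" using z by simp
 also have "... = al (x # y # vs) + al (y # x # vs)" unfolding l l2 using z by simp
 finally show ?thesis by (simp add: eq_neg_iff_add_eq_0)
qed

lemma alt_repeat:
 assumes "alt d al" "i < j" "j < length vs" "vs ! i = vs ! j"
 shows "al vs = 0" using assms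
proof (induction d arbitrary: al vs i j)
 case 0
 hence "length vs ~= 0" by auto
 thus ?case using 0 by (auto simp: hdeg_def)
next
 case (Suc d)
 then obtain v us where vs: "vs = v # us" by (cases vs) auto
 have c: "alt d (contr w al)" for w using Suc.prems(1) by simp
 show ?case
 proof (cases i)
  case (Suc i')
  then obtain j' where "j = Suc j'" using Suc.prems(2) by (cases j) auto
  thus ?thesis using Suc.IH[OF c[of v], of i' j' us] Suc Suc.prems vs by (simp add: contr_def)
 next
  case 0
  then obtain w ws where us: "us = w # ws" using Suc.prems vs by (cases us) auto
  show ?thesis
  proof (cases "j = 1")
   case True
   hence "v = w" using 0 Suc.prems vs us by simp
   thus ?thesis using fun_cong[OF alt_contr_lin(3)[OF Suc.prems(1), of v], of ws] vs us by (simp add: contr_def zero_fun_apply)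
  next
   case False
   then obtain j' where j': "j = Suc (Suc j')" 
   proof -
    have "j = Suc (Suc (j - 2))" using False 0 Suc.prems(2) by simp
    thus ?thesis using that by blast
   qed
   have "contr w al (v # ws) = 0" by (rule Suc.IH[OF c, of 0 "Suc j'"]) (use 0 Suc.prems vs us j' in auto)
   thus ?thesis using alt_swap_head[OF Suc.prems(1), of v w ws] vs us by (simp add: contr_def)
  qed
 qed
qed

lemma alt_map:
 assumes f: "linear f" and a: "alt d al"
 shows "alt d (%vs. al (map f vs))" using a
proof (induction d arbitrary: al)
 case 0
 thus ?case by (auto simp: hdeg_def)
next
 case (Suc d)
 have c: "contr x (%vs. al (map f vs)) = (%vs. contr (f x) al (map f vs))" for x al by (auto simp: contr_def)
 have "hdeg (Suc d) (%vs. al (map f vs))" using alt_hdeg[OF Suc.prems] by (auto simp: hdeg_def)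
 moreover have "alt d (%vs. contr (f x) al (map f vs))" for x using Suc by simp
 ultimately show ?case using alt_contr_lin[OF Suc.prems] by (simp add: c linear_add[OF f] linear_scale[OF f] plus_fun_def zero_fun_def)
qed

lemma alt_dependent:
 assumes a: "alt d al" and l: "length vs = d" and i: "i < d" and s: "vs ! i : span (set vs - {vs ! i})"
 shows "al vs = 0"
proof -
 let ?g = "%w. al (vs[i := w])"
 have "linear ?g" by (rule linearI) (simp_all add: alt_slot_linear[OF a l i] scaleR_conv_of_real)
 moreover have "?g u = 0" if "u : set vs - {vs ! i}" for u
 proof -
  obtain j where j: "j < d" "vs ! j = u" using `u : set vs - {vs ! i}` l by (auto simp: in_set_conv_nth)
  have "j ~= i" using j `u : set vs - {vs ! i}` by auto
  thus ?thesis using alt_repeat[OF a, of i j "vs[i := u]"] alt_repeat[OF a, of j i "vs[i := u]"] j i l by (cases "i < j") auto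
 qed
 ultimately have "?g (vs ! i) = 0" using linear_eq_0_on_span[of ?g "set vs - {vs ! i}"] s by blast
 thus ?thesis by simp
qed

section \<open>Top-degree forms and determinants\<close>

text \<open>Induction over a factorisation of \<open>f\<close> into elementary maps, for which the effect on an alternating form is visible.\<close>
lemma alt_det:
 fixes f :: "real ^ 'm => real ^ 'm"
 assumes f: "linear f" and a: "alt CARD('m) bt" and ms: "distinct ms" "set ms = (UNIV :: 'm set)"
 shows "bt (map f (map (%k. axis k 1) ms)) = of_real (cdet (matrix f)) * bt (map (%k. axis k 1) ms)"
proof -
 let ?e = "%k. axis k 1 :: real ^ 'm"
 let ?es = "map ?e ms"
 have len: "length ms = CARD('m)" using distinct_card[OF ms(1)] ms(2) by simp
 have pos: "EX i<CARD('m). ms ! i = k" for k using ms(2) len by (metis UNIV_I in_set_conv_nth)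
 have uniq: "i < CARD('m) ==> j < CARD('m) ==> ms ! i = ms ! j \<longleftrightarrow> i = j" for i j using nth_eq_iff_index_eq[OF ms(1)] len by simp
 let ?P = "%f. ALL bt. alt CARD('m) bt --> bt (map f ?es) = of_real (cdet (matrix f)) * bt ?es"
 have PI: "?P f" if "cdet (matrix f) = d" "!!bt. alt CARD('m) bt ==> bt (map f ?es) = of_real d * bt ?es" for f d using that by simp
 have rep: "bt vs = 0" if "alt CARD('m) bt" "length vs = CARD('m)" "i < CARD('m)" "j < CARD('m)" "i ~= j" "vs ! i = vs ! j"
  for bt :: "(real ^ 'm) ext" and vs i j using alt_repeat[OF that(1), of i j vs] alt_repeat[OF that(1), of j i vs] that by (cases "i < j") auto
 have "?P f" using f
 proof (rule induct_linear_elementary)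
  fix f g :: "real ^ 'm => real ^ 'm"
  assume *: "linear f" "linear g" "?P f" "?P g"
  show "?P (f \<circ> g)"
  proof (intro allI impI)
   fix bt :: "(real ^ 'm) ext" assume b: "alt CARD('m) bt"
   have "bt (map f (map g ?es)) = of_real (cdet (matrix g)) * bt (map f ?es)" using *(4) alt_map[OF *(1) b] by blast
   thus "bt (map (f \<circ> g) ?es) = of_real (cdet (matrix (f \<circ> g))) * bt ?es" using *(3) b by (simp add: matrix_compose[OF *(2,1)] det_mul o_assoc)
  qed
 next
  fix f :: "real ^ 'm => real ^ 'm" and i
  assume *: "linear f" "!!x. f x $ i = 0"
  have "Finite_Cartesian_Product.row i (matrix f) = 0" by (simp add: Finite_Cartesian_Product.row_def matrix_def *(2) cvec_eq)
  hence d: "cdet (matrix f) = 0" by (rule det_zero_row)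
  show "?P f"
  proof (rule PI[OF d])
   fix bt :: "(real ^ 'm) ext" assume b: "alt CARD('m) bt"
   let ?vs = "map f ?es"
   have "bt ?vs = 0"
   proof (cases "distinct ?vs")
    case False
    then obtain k l where "k < length ?vs" "l < length ?vs" "k ~= l" "?vs ! k = ?vs ! l" using distinct_conv_nth[of ?vs] by blast
    thus ?thesis using rep[OF b, of ?vs k l] len by simp
   next
    case True
    let ?H = "{x :: real ^ 'm. x $ i = 0}"
    have sub: "Real_Vector_Spaces.subspace ?H" by (auto simp: Real_Vector_Spaces.subspace_def)
    have sH: "set ?vs <= ?H" using *(2) by auto
    have "dependent (set ?vs)"
    proof (rule ccontr)
     assume ind: "~dependent (set ?vs)"
     have "card (set ?vs) = CARD('m)" using distinct_card[OF True] len by simp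
     hence "UNIV <= span (set ?vs)" using card_ge_dim_independent[of "set ?vs" UNIV] ind by (simp add: dim_UNIV)
     also have "... <= ?H" using span_minimal[OF sH sub] .
     finally have "axis i 1 : ?H" by blast
     thus False by (simp add: axis_def)
    qed
    then obtain u where u: "u : set ?vs" "u : span (set ?vs - {u})" unfolding dependent_def by blast
    then obtain k where "k < CARD('m)" "?vs ! k = u" using len by (auto simp: in_set_conv_nth)
    thus ?thesis using alt_dependent[OF b, of ?vs k] u len by simp
   qed
   thus "bt ?vs = of_real 0 * bt ?es" by simp
  qed
 next
  fix c :: "'m => real"
  let ?f = "%x :: real ^ 'm. \<chi> i. c i * x $ i"
  have d: "cdet (matrix ?f) = (\<Prod>k\<in>UNIV. c k)" by (subst det_diagonal) (auto simp: matrix_def axis_def)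
  have fe: "?f (?e k) = c k *R ?e k" for k by (simp add: cvec_eq axis_def)
  show "?P ?f"
  proof (rule PI[OF d])
   fix bt :: "(real ^ 'm) ext" assume b: "alt CARD('m) bt"
   let ?L = "%S. map (%k. (if k : S then c k else 1) *R ?e k) ms"
   have "bt (?L S) = of_real (\<Prod>k\<in>S. c k) * bt ?es" for S :: "'m set" using finite[of S]
   proof (induction S rule: finite_induct)
    case (insert k S)
    obtain i where i: "i < CARD('m)" "ms ! i = k" using pos by blast
    have "?L (insert k S) = (?L S)[i := c k *R ?e k]" by (rule nth_equalityI) (use i len uniq in "auto simp: nth_list_update")
    moreover have "?L S = (?L S)[i := ?e k]" by (rule nth_equalityI) (use i len uniq insert in "auto simp: nth_list_update")
    ultimately have "bt (?L (insert k S)) = of_real (c k) * bt (?L S)" using alt_slot_linear(2)[OF b, of "?L S" i "c k" "?e k"] i len by simp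
    thus ?case using insert by simp
   qed simp
   from this[of UNIV] show "bt (map ?f ?es) = of_real (\<Prod>k\<in>UNIV. c k) * bt ?es" by (simp add: fe o_def)
  qed
 next
  fix m n :: 'm assume mn: "m ~= n"
  let ?t = "Transposition.transpose m n"
  let ?f = "%x :: real ^ 'm. \<chi> i. x $ ?t i"
  have p: "?t permutes UNIV" by (simp add: permutes_swap_id)
  have "matrix ?f = (\<chi> i. cI $ ?t i)" by (simp add: matrix_def Finite_Cartesian_Product.mat_def axis_def cvec_eq)
  hence "cdet (matrix ?f) = of_int (sign ?t) * cdet (cI :: real ^ 'm ^ 'm)" using Determinants.det_permute_rows[OF p, of "cI :: real ^ 'm ^ 'm"] by simp
  hence d: "cdet (matrix ?f) = -1" using mn by (simp add: sign_swap_id)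
  have fe: "?f (?e k) = ?e (?t k)" for k by (auto simp: cvec_eq axis_def Transposition.transpose_def)
  show "?P ?f"
  proof (rule PI[OF d])
   fix bt :: "(real ^ 'm) ext" assume b: "alt CARD('m) bt"
   obtain i j where ij: "i < CARD('m)" "ms ! i = m" "j < CARD('m)" "ms ! j = n" using pos by metis
   have "i ~= j" using ij mn by auto
   define g where "g x y = bt (?es[i := x, j := y])" for x y
   have "g x x = 0" for x unfolding g_def by (rule rep[OF b _ ij(1,3) `i ~= j`]) (use ij len in "auto simp: nth_list_update")
   moreover have "g (x + x') y = g x y + g x' y" "g y (x + x') = g y x + g y x'" for x x' y unfolding g_def using alt_slot_linear(1)[OF b, of "?es[j := y]" i x x'] alt_slot_linear(1)[OF b, of "?es[i := y]" j x x']
     ij len list_update_swap[OF `i ~= j`, of ?es] by simp_all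
   ultimately have "g x y + g y x = 0" for x y by (metis add_0_left add_0_right)
   moreover have "map ?f ?es = ?es[i := ?e n, j := ?e m]" unfolding map_map o_def fe by (rule nth_equalityI) (use ij len uniq mn in "auto simp: nth_list_update Transposition.transpose_def")
   moreover have "?es = ?es[i := ?e m, j := ?e n]" by (rule nth_equalityI) (use ij len uniq in "auto simp: nth_list_update")
   ultimately have "bt (map ?f ?es) + bt ?es = 0" unfolding g_def by metis
   thus "bt (map ?f ?es) = of_real (-1) * bt ?es" by (simp add: eq_neg_iff_add_eq_0)
  qed
 next
  fix m n :: 'm assume mn: "m ~= n"
  let ?f = "%x :: real ^ 'm. \<chi> i. if i = m then x $ m + x $ n else x $ i"
  have "matrix ?f = (\<chi> k. if k = m then Finite_Cartesian_Product.row m (cI) + 1 *s Finite_Cartesian_Product.row n (cI) else Finite_Cartesian_Product.row k (cI))"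
   by (simp add: matrix_def Finite_Cartesian_Product.mat_def axis_def Finite_Cartesian_Product.row_def cvec_eq)
  hence d: "cdet (matrix ?f) = 1" using det_row_operation[OF mn, of "cI :: real ^ 'm ^ 'm" 1] by simp
  have fe: "?f (?e k) = (if k = n then ?e n + ?e m else ?e k)" for k using mn by (auto simp: cvec_eq axis_def)
  show "?P ?f"
  proof (rule PI[OF d])
   fix bt :: "(real ^ 'm) ext" assume b: "alt CARD('m) bt"
   obtain i j where ij: "i < CARD('m)" "ms ! i = m" "j < CARD('m)" "ms ! j = n" using pos by metis
   have "i ~= j" using ij mn by auto
   have "map ?f ?es = ?es[j := ?e n + ?e m]" by (rule nth_equalityI) (use ij len uniq in "auto simp: fe nth_list_update")
   moreover have "?es[j := ?e n] = ?es" using ij len by (simp add: list_update_same_conv)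
   moreover have "bt (?es[j := ?e m]) = 0" by (rule rep[OF b _ ij(1,3) `i ~= j`]) (use ij len `i ~= j` in auto)
   ultimately show "bt (map ?f ?es) = of_real 1 * bt ?es" using alt_slot_linear(1)[OF b, of ?es j "?e n" "?e m"] ij len by simp
  qed
 qed
 thus ?thesis using a by blast
qed

text \<open>Holomorphic coordinate changes preserve orientation. The segment from the identity to \<open>D\<close>, with a complex parameter,
 meets the singular maps in finitely many points only, so a path in the plane around them keeps the real determinant
 non-zero and hence of one sign.\<close>
lemma complex_linear_det_pos:
 fixes T :: "real ^ 'm => complex ^ 'n" and D :: "complex ^ 'n => complex ^ 'n"
 assumes T: "linear T" and T': "linear T'" "!!y. T' (T y) = y" "!!z. T (T' z) = z"
  and D: "!!x y. D (x + y) = D x + D y" "!!c x. D (c *s x) = c *s D x" and inj: "inj D"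
 shows "cdet (matrix (%y. T' (D (T y)))) > 0"
proof -
 let ?F = "%t y. T' ((1 - t) *s T y + t *s D (T y))"
 define q where "q t = cdet (matrix (?F t))" for t
 define P :: "complex poly ^ 'n ^ 'n" where "P = (\<chi> i j. [: cI $ i $ j, matrix D $ i $ j - cI $ i $ j :])"
 have Dl: "Vector_Spaces.linear (*s) (*s) D" unfolding Vector_Spaces.linear_iff using D vec.vector_space_axioms by auto
 let ?G = "%t x. (1 - t) *s x + t *s D x"
 have Gl: "Vector_Spaces.linear (*s) (*s) (?G t)" for t unfolding Vector_Spaces.linear_iff using D vec.vector_space_axioms by (auto simp: cvec_eq algebra_simps)
 have pd: "poly (cdet P) t = cdet (matrix (?G t))" for t
 proof -
  have "poly (P $ i $ j) t = matrix (?G t) $ i $ j" for i j by (simp add: P_def matrix_def Finite_Cartesian_Product.mat_def axis_def algebra_simps)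
  thus ?thesis by (simp add: Determinants.det_def poly_sum poly_prod)
 qed
 have p0: "poly (cdet P) 0 = 1"
 proof -
  have "?G 0 = (%x. x)" by (rule ext) (simp add: cvec_eq)
  hence "matrix (?G 0) = cI" by (simp add: matrix_def Finite_Cartesian_Product.mat_def axis_def cvec_eq)
  thus ?thesis unfolding pd by simp
 qed
 let ?Z = "{t. poly (cdet P) t = 0}"
 have fin: "finite ?Z" using p0 by (intro poly_roots_finite) auto
 have lF: "linear (?F t)" for t
 proof -
  have "linear (?G t)"
  proof (rule linearI)
   fix c x
   have "c *R x = of_real c *s x" for x :: "complex ^ 'n" by (simp add: cvec_eq scaleR_conv_of_real[where 'a=complex])
   hence e: "c *R y = of_real c *s y" for y :: "complex ^ 'n" by blast
   show "?G t (c *R x) = c *R ?G t x" unfolding e D(2) by (simp add: cvec_eq algebra_simps)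
  qed (simp add: D cvec_eq algebra_simps)
  thus ?thesis using linear_compose[OF linear_compose[OF T] T'(1), of "?G t"] by (simp add: o_def)
 qed
 have nz: "q t ~= 0" if "t ~: ?Z" for t
 proof -
  have "inj (?G t)" using that det_nz_iff_inj_gen[OF Gl] pd by simp
  hence "inj (?F t)" using T'(2,3) unfolding inj_def by metis
  thus ?thesis unfolding q_def using det_nz_iff_inj[OF lF] by blast
 qed
 have cont: "continuous_on UNIV q"
 proof -
  have "continuous_on UNIV (%t. ?F t x $ i)" for x i by (intro continuous_intros bounded_linear.continuous_on[OF linear_conv_bounded_linear[THEN iffD1, OF T'(1)]]
     bounded_linear.continuous_on[OF smult_bl])
  thus ?thesis unfolding q_def Determinants.det_def matrix_def vec_lambda_beta by (intro continuous_on_sum continuous_on_mult continuous_on_const continuous_on_prod)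
 qed
 have "connected (- ?Z)" by (rule path_connected_imp_connected, rule path_connected_complement_countable)
   (use countable_finite[OF fin] in auto)
 hence con: "connected (q ` (- ?Z))" using connected_continuous_image continuous_on_subset[OF cont] by blast
 have F0: "?F 0 = id" by (rule ext) (simp add: T'(2))
 have q0: "q 0 = 1" unfolding q_def F0 by (simp add: matrix_id_mat_1)
 have F1: "?F 1 = (%y. T' (D (T y)))" by (rule ext) simp
 have G1: "?G 1 = D" by (rule ext) simp
 have "cdet (matrix D) ~= 0" using det_nz_iff_inj_gen[OF Dl] inj by blast
 hence 1: "1 ~: ?Z" using pd[of 1] G1 by simp
 have 0: "0 ~: ?Z" using p0 by simp
 have "q 1 > 0"
 proof (rule ccontr)
  assume "~q 1 > 0"
  hence "0 : q ` (- ?Z)" using connectedD_interval[OF con, of "q 1" "q 0" 0] 0 1 q0 by auto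
  then obtain t where "t ~: ?Z" "q t = 0" by force
  thus False using nz[of t] by blast
 qed
 thus ?thesis unfolding q_def F1 .
qed

section \<open>Integrals of compactly supported functions\<close>

lemma continuous_extend_zero:
 fixes f :: "'a::t2_space => 'b::real_normed_vector"
 assumes "open U" "continuous_on U f" "compact K" "K <= U" "!!x. x ~: K ==> f x = 0"
 shows "continuous_on UNIV f"
proof -
 have "continuous_on (- K) f" by (rule continuous_on_eq[of _ "%_. 0"]) (use assms(5) in auto)
 hence "continuous_on (U Un - K) f" by (intro continuous_on_open_Un assms) (use assms(3) compact_imp_closed in auto)
 moreover have "U Un - K = UNIV" using assms(4) by auto
 ultimately show ?thesis by simp
qed

lemma integral_supported:
 fixes f :: "'a::euclidean_space => real"
 assumes "!!x. x ~: S ==> f x = 0"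
 shows "integral UNIV f = integral S f"
proof -
 have "f = (%x. if x : S then f x else 0)" by (rule ext) (use assms in auto)
 thus ?thesis using integral_restrict_UNIV[of S f] by simp
qed

lemma ai_compact_support:
 fixes f :: "'a::euclidean_space => real"
 assumes "continuous_on UNIV f" "compact K" "!!x. x ~: K ==> f x = 0"
 shows "f absolutely_integrable_on UNIV"
proof -
 obtain c where c: "K <= cbox (-c) c" using bounded_subset_cbox_symmetric[OF compact_imp_bounded[OF assms(2)]] by blast
 have "f absolutely_integrable_on cbox (-c) c" by (rule absolutely_integrable_continuous[OF continuous_on_subset[OF assms(1)]]) simp
 moreover have "f = (%x. if x : cbox (-c) c then f x else 0)" by (rule ext) (use assms(3) c in auto)
 ultimately show ?thesis using absolutely_integrable_restrict_UNIV[of "cbox (-c) c" f] by simp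
qed

lemma absolutely_integrable_open_subset:
 fixes f :: "'a::euclidean_space => real"
 assumes "f absolutely_integrable_on UNIV" "open S"
 shows "f absolutely_integrable_on S" by (rule set_integrable_subset[OF assms(1)]) (use assms(2) in auto)

text \<open>Differentiate the constant function t \<mapsto> integral of f(y + t e).\<close>
lemma integral_directional_derivative:
 fixes f :: "'a::euclidean_space => real"
 assumes d: "!!y. f differentiable (at y)" and c: "continuous_on UNIV (%y. fd f y e)"
  and K: "compact K" "!!y. y ~: K ==> f y = 0"
 shows "integral UNIV (%y. fd f y e) = 0"
proof -
 let ?D = "%y. fd f y e"
 obtain R where R: "!!y. y : K ==> norm y <= R" using compact_imp_bounded[OF K(1)] bounded_iff by blast
 obtain b :: 'a where b: "cball 0 (R + norm e) <= cbox (-b) b" using bounded_subset_cbox_symmetric[OF bounded_cball] by metis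
 let ?B = "cbox (-b) b"
 have KB: "y : ?B" if "y : K" for y using R[OF that] b by (auto simp: add_increasing2)
 define F where "F t = integral ?B (%y. f (y + t *R e))" for t
 have F: "F t = integral UNIV f" if t: "t : ball 0 1" for t
 proof -
  have "F t = integral (cbox (-b + t *R e) (b + t *R e)) f" using integral_shift_cbox_plus[of "-b" b f "t *R e"] by (simp add: F_def o_def add.commute)
  also have "... = integral UNIV f"
  proof (rule integral_supported[symmetric])
   fix x assume x: "x ~: cbox (-b + t *R e) (b + t *R e)"
   have "x ~: K"
   proof
    assume "x : K"
    hence "norm (x - t *R e) <= R + \<bar>t\<bar> * norm e" using norm_triangle_ineq4[of x "t *R e"] R[of x] by simp
    also have "... <= R + 1 * norm e" using t by (intro add_left_mono mult_right_mono) auto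
    finally have "x - t *R e : ?B" using b by (auto simp: subset_iff)
    hence "x : cbox (-b + t *R e) (b + t *R e)" by (auto simp: mem_box inner_diff_left inner_add_left)
    thus False using x by simp
   qed
   thus "f x = 0" by (rule K(2))
  qed
  finally show ?thesis .
 qed
 have cf: "continuous_on UNIV f" using d by (meson differentiable_imp_continuous_on differentiable_on_def differentiable_at_withinI)
 have "(F has_field_derivative integral ?B (%y. ?D (y + 0 *R e))) (at 0 within ball 0 1)" unfolding F_def
 proof (rule leibniz_rule_field_derivative)
  fix t y
  show "((%t. f (y + t *R e)) has_field_derivative ?D (y + t *R e)) (at t within ball 0 1)" by (rule has_field_derivative_at_within, rule deriv_line[of "%x. x"]) (use d in auto)
  show "(%y. f (y + t *R e)) integrable_on ?B" by (intro integrable_continuous continuous_on_compose2[OF cf] continuous_intros) auto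
 next
  show "continuous_on (ball 0 1 \<times> ?B) (%(t, y). ?D (y + t *R e))" unfolding case_prod_beta by (intro continuous_on_compose2[OF c] continuous_intros) auto
 qed auto
 hence "(F has_field_derivative integral ?B ?D) (at 0)" by (simp add: at_within_open[of 0 "ball 0 1"])
 hence "integral ?B ?D = 0" by (rule DERIV_local_const[of _ _ _ 1]) (use F in auto)
 moreover have "integral UNIV ?D = integral ?B ?D"
 proof (rule integral_supported)
  fix x assume "x ~: ?B"
  hence x: "x : - K" using KB by blast
  have "open (- K)" using K(1) compact_imp_closed by blast
  from fd_cong(1)[OF this x, of f "%_. 0"] K(2) show "?D x = 0" by simp
 qed
 ultimately show ?thesis by simp
qed

lemma integral_change_of_variables_real:
 fixes f :: "real ^ 'm::{finite,wellorder} => real"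
 assumes S: "open S" and d: "!!x. x : S ==> (g has_derivative g' x) (at x)" and inj: "inj_on g S"
  and f: "f absolutely_integrable_on (g ` S)"
 shows "integral (g ` S) f = integral S (%x. \<bar>cdet (matrix (g' x))\<bar> * f (g x))"
proof -
 let ?f = "%x. Finite_Cartesian_Product.vec (f x) :: real ^ 1"
 have "?f absolutely_integrable_on (g ` S)" using f by (simp add: absolutely_integrable_on_1_iff)
 hence "integral (g ` S) ?f = integral S (%x. \<bar>cdet (matrix (g' x))\<bar> *R ?f (g x))" using S d inj by (intro integral_change_of_variables) (auto intro: has_derivative_at_withinI)
 thus ?thesis by (simp add: integral_on_1_eq cvec_eq)
qed

section \<open>Real coordinates adapted to the complex frame\<close>

lemma frame_coordinates:
 assumes ks: "distinct ks" "set ks = (UNIV :: 'n::finite set)"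
 obtains T :: "real ^ 'n bit0 => complex ^ 'n" and T' ms where "linear T" "linear T'" "!!y. T' (T y) = y" "!!z. T (T' z) = z"
  "distinct ms" "set ms = (UNIV :: 'n bit0 set)"
  "map T (map (%k. axis k 1) ms) = concat (map (%k. [axis k 1, axis k \<i>]) ks)"
proof -
 let ?fr = "concat (map (%k. [axis k 1, axis k \<i>]) ks) :: (complex ^ 'n) list"
 have lk: "length ks = CARD('n)" using distinct_card[OF ks(1)] ks(2) by simp
 have "length ?fr = 2 * length ks" by (induction ks) auto
 hence lf: "length ?fr = CARD('n bit0)" using lk by simp
 obtain ms where ms: "set ms = (UNIV :: 'n bit0 set)" "distinct ms" using finite_distinct_list[of "UNIV :: 'n bit0 set"] by auto
 have lm: "length ms = CARD('n bit0)" using distinct_card[OF ms(2)] ms(1) by simp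
 define T where "T y = (SUM i<CARD('n bit0). (y $ (ms ! i)) *R (?fr ! i))" for y :: "real ^ 'n bit0"
 have T: "linear T" by (rule linearI) (simp_all add: T_def scaleR_left_distrib sum.distrib scaleR_sum_right)
 have Te: "T (axis (ms ! i) 1) = ?fr ! i" if "i < CARD('n bit0)" for i
 proof -
  have "T (axis (ms ! i) 1) = (SUM j<CARD('n bit0). if j = i then ?fr ! j else 0)" unfolding T_def by (rule sum.cong) (use that lm nth_eq_iff_index_eq[OF ms(2)] in "auto simp: axis_def")
  thus ?thesis using that by simp
 qed
 have map: "map T (map (%k. axis k 1) ms) = ?fr" by (rule nth_equalityI) (use lf lm Te in "simp_all")
 have "surj T"
 proof -
  have sub: "Real_Vector_Spaces.subspace (range T)" using linear_subspace_image[OF T subspace_UNIV] .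
  have fr: "set ?fr <= range T" unfolding map[symmetric] by auto
  have "z : range T" for z
  proof -
   have e: "axis k (z $ k) = Re (z $ k) *R axis k 1 + Im (z $ k) *R axis k \<i>" for k by (simp add: cvec_eq axis_def complex_eq_iff)
   have "axis k 1 : range T" "axis k \<i> : range T" for k using fr ks(2) by auto
   hence "axis k (z $ k) : range T" for k unfolding e by (intro subspace_add[OF sub] subspace_scale[OF sub])
   moreover have "z = (SUM k:UNIV. axis k (z $ k))" by (simp add: cvec_eq axis_def)
   ultimately show ?thesis using subspace_sum[OF sub, of UNIV "%k. axis k (z $ k)"] by simp
  qed
  thus ?thesis by blast
 qed
 moreover have "inj T" using linear_surjective_imp_injective[OF T `surj T`] by (simp add: dim_UNIV)
 moreover obtain T' where T': "linear T'" "T' \<circ> T = id" using linear_injective_left_inverse[OF T `inj T`] by blast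
 ultimately have "T' (T y) = y" "T (T' z) = z" for y z by (metis comp_apply id_apply, metis comp_apply id_apply surjD)
 thus ?thesis using that[OF T T'(1)] ms map by blast
qed

section \<open>Vector-valued holomorphic maps and bump functions\<close>

lemma vec_hol_derivative:
 fixes g :: "complex ^ 'n::finite => complex ^ 'm::finite"
 assumes "!!k. hol_on S (%z. g z $ k)" "z : S"
 shows "(g has_derivative (%w. \<chi> k. fd (%z. g z $ k) z w)) (at z)"
proof -
 have "((%z. SUM k:UNIV. (g z $ k) *s axis k 1) has_derivative
   (%w. SUM k:UNIV. fd (%z. g z $ k) z w *s axis k 1)) (at z)" by (intro has_derivative_sum bl_hd[OF smult_bl] hol_onD(3)[OF assms])
 moreover have "(SUM k:UNIV. fd (%z. g z $ k) z w *s axis k 1) =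
   (\<chi> k. fd (%z. g z $ k) z w)" for w using basis_expansion[of "\<chi> k. fd (%z. g z $ k) z w"] by simp
 ultimately show ?thesis by (simp add: basis_expansion)
qed

lemma
 fixes g :: "complex ^ 'n::finite => complex ^ 'm::finite"
 assumes h: "!!k. hol_on S (%z. g z $ k)"
 shows vec_hol_differentiable: "z : S ==> g differentiable (at z)"
  and vec_hol_frechet: "z : S ==> fd g z w $ k = fd (%z. g z $ k) z w"
  and vec_hol_linear: "z : S ==> fd g z (x + y) = fd g z x + fd g z y"
   "z : S ==> fd g z (c *s x) = c *s fd g z x"
  and vec_hol_continuous: "open S ==> continuous_on S (%z. fd g z w)"
proof -
 have f: "fd g z = (%w. \<chi> k. fd (%z. g z $ k) z w)" if "z : S" for z by (rule fd_at[symmetric], rule vec_hol_derivative[OF h that])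
 show "z : S ==> g differentiable (at z)" using vec_hol_derivative[OF h] by (auto simp: differentiable_def)
 show "z : S ==> fd g z w $ k = fd (%z. g z $ k) z w" by (simp add: f)
 show "z : S ==> fd g z (x + y) = fd g z x + fd g z y" using hol_onD(2)[OF h] by (simp add: f clin_iff cvec_eq)
 show "z : S ==> fd g z (c *s x) = c *s fd g z x" using hol_onD(2)[OF h] by (simp add: f clin_iff cvec_eq)
 assume S: "open S"
 have "continuous_on S (%z. \<chi> k. fd (%z. g z $ k) z w)" by (intro continuous_on_vec_lambda hol_on_directional_continuous[OF S h])
 thus "continuous_on S (%z. fd g z w)" by (rule continuous_on_eq) (simp add: f)
qed

lemma C_1_Un:
 assumes "open S" "open T" "C_k_on 1 S f" "C_k_on 1 T f"
 shows "C_k_on 1 (S Un T) f" using assms by (auto intro!: continuous_on_open_Un)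

lemma max_zero_square_derivative: "((%s::real. (max 0 s)\<^sup>2) has_real_derivative 2 * max 0 s) (at s)"
proof -
 consider "s > 0" | "s < 0" | "s = 0" by linarith
 thus ?thesis
 proof cases
  case 1
  have "((%s. s\<^sup>2) has_real_derivative 2 * max 0 s) (at s)" using 1 by (auto intro!: derivative_eq_intros)
  thus ?thesis by (rule has_field_derivative_transform_within_open[where S="{0<..}"]) (use 1 in auto)
 next
  case 2
  have "((%s. 0) has_real_derivative 2 * max 0 s) (at s)" using 2 by auto
  thus ?thesis by (rule has_field_derivative_transform_within_open[where S="{..<0}"]) (use 2 in auto)
 next
  case 3
  have "(%h :: real. (max 0 h)\<^sup>2 / h) \<midarrow>0\<rightarrow> 0"
  proof (rule Lim_null_comparison)
   show "\<forall>\<^sub>F h :: real in at 0. norm ((max 0 h)\<^sup>2 / h) <= \<bar>h\<bar>" by (rule always_eventually) (auto simp: max_def power2_eq_square abs_mult)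
   show "(%h :: real. \<bar>h\<bar>) \<midarrow>0\<rightarrow> 0" by (auto intro!: tendsto_eq_intros)
  qed
  thus ?thesis using 3 by (simp add: DERIV_def)
 qed
qed

lemma bump_composition_C1:
 fixes g :: "complex ^ 'n::finite => complex ^ 'm::finite"
 assumes S: "open S" and h: "!!k. hol_on S (%z. g z $ k)"
 shows "C_k_on 1 S (%z. (max 0 (R\<^sup>2 - (dist (g z) c)\<^sup>2))\<^sup>2 :: real)"
proof -
 let ?q = "%z. R\<^sup>2 - (g z - c) \<bullet> (g z - c)"
 let ?Dg = "%z w. fd g z w"
 have q: "R\<^sup>2 - (dist (g z) c)\<^sup>2 = ?q z" for z by (simp add: dist_norm power2_norm_eq_inner)
 let ?D = "%z w. 2 * max 0 (?q z) * (- ((g z - c) \<bullet> ?Dg z w + ?Dg z w \<bullet> (g z - c)))"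
 have d: "((%z. (max 0 (?q z))\<^sup>2) has_derivative ?D z) (at z)" if "z : S" for z
 proof -
  have "(g has_derivative ?Dg z) (at z)" using diff_fd vec_hol_differentiable[OF h that] by blast
  hence "(?q has_derivative (%w. - ((g z - c) \<bullet> ?Dg z w + ?Dg z w \<bullet> (g z - c)))) (at z)" by (auto intro!: derivative_eq_intros)
  from has_derivative_compose[OF this max_zero_square_derivative[unfolded has_field_derivative_def]]
  show ?thesis .
 qed
 have cg: "continuous_on S g" using vec_hol_differentiable[OF h] by (meson differentiable_at_withinI differentiable_imp_continuous_on differentiable_on_def)
 have "continuous_on S (%z. ?D z w)" for w by (intro continuous_intros cg vec_hol_continuous[OF h S])
 note cD = this
 have "continuous_on S (%z. fd (%z. (max 0 (?q z))\<^sup>2) z w)" for w by (rule continuous_on_eq[OF cD[of w]]) (simp flip: fd_at[OF d])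
 moreover have "(%z. (max 0 (?q z))\<^sup>2) differentiable (at z)" if "z : S" for z using d[OF that] by (auto simp: differentiable_def)
 ultimately show ?thesis unfolding q by simp
qed

section \<open>Exterior derivative of a multiple\<close>

lemma ed_fmult:
 fixes r :: "'v::real_normed_vector => complex"
 assumes r: "r differentiable (at z)" and a: "edf al z"
 shows "ed (%y vs. r y * al y vs) z =
  wedge (one_ext (fd r z)) (al z) + (%vs. r z * ed al z vs)"
  and "edf (%y vs. r y * al y vs) z"
proof -
 define rh where "rh y vs = (if vs = [] then r y else 0)" for y and vs :: "'v list"
 have w: "wedge (rh y) bt = (%vs. r y * bt vs)" for y bt
 proof -
  have "rh y = (%vs. r y * unit_ext vs)" by (auto simp: rh_def unit_ext_def)
  thus ?thesis using wedge_scale_left[of "r y" unit_ext bt] by simp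
 qed
 have e: "edf rh z"
 proof -
  have "(%y. rh y vs) differentiable (at z)" for vs by (cases "vs = []") (simp_all add: rh_def r)
  thus ?thesis by (simp add: edf_def)
 qed
 have s: "sg (rh z) = rh z" by (rule ext) (simp add: sg_def rh_def)
 have d: "ed rh z = one_ext (fd r z)"
 proof
  fix vs
  have "ed rh z vs = 0" if "length vs ~= 1"
  proof -
   have "hdeg (Suc 0) (ed rh z)" by (rule hdeg_ext_deriv) (simp add: hdeg_def rh_def)
   thus ?thesis using that by (simp add: hdeg_def)
  qed
  thus "ed rh z vs = one_ext (fd r z) vs" by (cases "length vs = 1") (auto simp: length_Suc_conv ext_deriv_def rh_def one_ext_def split: list.split)
 qed
 show "ed (%y vs. r y * al y vs) z =
  wedge (one_ext (fd r z)) (al z) + (%vs. r z * ed al z vs)" using ed_wedge[OF e a] by (simp add: w s d)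
 show "edf (%y vs. r y * al y vs) z" using edf_wedge[OF e a] by (simp add: w)
qed

lemma alt_one_ext:
 assumes "linear a"
 shows "alt 1 (one_ext a)"
proof -
 have c: "contr x (one_ext a) = (%vs. if vs = [] then a x else 0)" for x by (rule ext) (auto simp: contr_def one_ext_def split: list.split)
 show ?thesis using linear_add[OF assms] linear_scale[OF assms] by (simp add: c hdeg_one_ext[unfolded One_nat_def])
   (auto simp: hdeg_def fun_eq_iff fun_apps scaleR_conv_of_real contr_def)
qed

section \<open>Stokes' theorem for a compact complex manifold\<close>

locale chart_cover =
 fixes I :: "'i set" and W :: "'i => 'x::t2_space set" and fi :: "'i => 'x => complex ^ 'n::finite"
  and qs :: "'i => complex ^ 'n => 'x"
 assumes compact: "compact (UNIV :: 'x set)" and cover: "EX i:I. x : W i"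
  and openW: "i : I ==> open (W i)" and open_image: "i : I ==> open (fi i ` W i)"
  and homeo: "i : I ==> homeomorphism (W i) (fi i ` W i) (fi i) (qs i)"
  and trans: "i : I ==> j : I ==> hol_on (fi i ` (W i Int W j)) (%z. fi j (qs i z) $ k)"
begin

abbreviation dom :: "'i => (complex ^ 'n) set" where "dom i == fi i ` W i"
abbreviation ov :: "'i => 'i => (complex ^ 'n) set" where "ov i j == fi i ` (W i Int W j)"
abbreviation tr :: "'i => 'i => complex ^ 'n => complex ^ 'n" where "tr i j == (%z. fi j (qs i z))"
abbreviation Dtr :: "'i => 'i => complex ^ 'n => complex ^ 'n => complex ^ 'n" where
 "Dtr i j z == fd (tr i j) z"

lemma inverse_left [simp]: "i : I ==> x : W i ==> qs i (fi i x) = x" using homeo by (simp add: homeomorphism_def)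

lemma image_ov: "i : I ==> z : ov i j \<longleftrightarrow> z : dom i & qs i z : W j" by auto

lemma open_phi_image:
 assumes "i : I" "open V"
 shows "open (fi i ` (W i Int V))"
proof -
 have "openin (top_of_set (dom i)) (fi i ` (W i Int V))" by (rule homeomorphism_imp_open_map[OF homeo[OF assms(1)]]) (simp add: openin_open_Int assms(2))
 thus ?thesis using open_image[OF assms(1)] openin_open_eq by blast
qed

lemma open_ov: "i : I ==> j : I ==> open (ov i j)" by (rule open_phi_image[OF _ openW])

lemma psi_notin: "i : I ==> K <= dom i ==> z : dom i ==> z ~: K ==> qs i z ~: qs i ` K"
proof
 assume a: "i : I" "K <= dom i" "z : dom i" "z ~: K" "qs i z : qs i ` K"
 then obtain k x y where "k : K" "qs i z = qs i k" "z = fi i x" "x : W i" "k = fi i y" "y : W i" by blast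
 thus False using a by simp
qed

lemma tr_ov: "i : I ==> j : I ==> z : ov i j ==> tr i j z : ov j i & tr j i (tr i j z) = z" by auto

lemma tr_derivative: "i : I ==> j : I ==> z : ov i j ==> (tr i j has_derivative Dtr i j z) (at z)" by (rule diff_fd[OF vec_hol_differentiable[OF trans]])

lemma Dtr_inverse:
 assumes "i : I" "j : I" "z : ov i j"
 shows "Dtr j i (tr i j z) (Dtr i j z w) = w"
proof -
 have "(tr j i \<circ> tr i j has_derivative Dtr j i (tr i j z) \<circ> Dtr i j z) (at z)" by (rule diff_chain_at[OF tr_derivative tr_derivative]) (use assms tr_ov in auto)
 moreover have "(tr j i \<circ> tr i j has_derivative id) (at z)" by (rule hd_transform[OF has_derivative_id[of "at z", folded id_def] open_ov[OF assms(1,2)] assms(3)])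
   (use assms in auto)
 ultimately have "Dtr j i (tr i j z) \<circ> Dtr i j z = id" by (rule has_derivative_unique)
 thus ?thesis by (metis comp_apply id_apply)
qed

lemma C1_pullback:
 assumes "i : I" "j : I" "x : W i Int W j" "(%z. f (qs j z)) differentiable (at (fi j x))"
 shows "fd (%z. f (qs i z)) (fi i x) w =
  fd (%z. f (qs j z)) (fi j x) (Dtr i j (fi i x) w)"
proof -
 have z: "fi i x : ov i j" using assms by auto
 have "((%z. f (qs j z)) has_derivative fd (%z. f (qs j z)) (fi j x)) (at (tr i j (fi i x)))" using assms diff_fd by simp
 from has_derivative_compose[OF tr_derivative[OF assms(1,2) z] this]
 have "((%z. f (qs i z)) has_derivative (%w. fd (%z. f (qs j z)) (fi j x) (Dtr i j (fi i x) w))) (at (fi i x))" by (rule hd_transform[OF _ open_ov[OF assms(1,2)] z]) (use assms in auto)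
 thus ?thesis using fd_at by metis
qed

definition bump :: "'i => complex ^ 'n => real => 'x => real" where
 "bump i c R x = (if x : W i then (max 0 (R\<^sup>2 - (dist (fi i x) c)\<^sup>2))\<^sup>2 else 0)"

lemma bump_nonneg: "0 <= bump i c R x" by (simp add: bump_def)

lemma bump_support: "0 < R ==> i : I ==> x ~: qs i ` cball c R ==> bump i c R x = 0"
proof -
 assume a: "0 < R" "i : I" "x ~: qs i ` cball c R"
 have "fi i x ~: cball c R" if "x : W i" using a(3) that imageI[of "fi i x" "cball c R" "qs i"] a(2) by auto
 hence "R <= dist (fi i x) c" if "x : W i" using that by (force simp: dist_commute)
 hence "R\<^sup>2 <= (dist (fi i x) c)\<^sup>2" if "x : W i" using that a(1) by (intro power_mono) auto
 thus ?thesis by (simp add: bump_def)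
qed

lemma bump_positive: "0 < R ==> x : W i ==> dist (fi i x) c < R ==> 0 < bump i c R x"
proof -
 assume a: "0 < R" "x : W i" "dist (fi i x) c < R"
 have "(dist (fi i x) c)\<^sup>2 < R\<^sup>2" using a by (intro power_strict_mono) auto
 thus ?thesis using a(2) by (simp add: bump_def max_def)
qed

lemma compact_image: "i : I ==> K <= dom i ==> compact K ==> compact (qs i ` K)" by (rule compact_continuous_image) (use homeo in "auto simp: homeomorphism_def intro: continuous_on_subset")

lemma bump_C1:
 assumes i: "i : I" and R: "0 < R" and K: "cball c R <= dom i" and j: "j : I"
 shows "C_k_on 1 (dom j) (%z. bump i c R (qs j z))"
proof -
 let ?K = "qs i ` cball c R"
 have "closed ?K" by (rule compact_imp_closed[OF compact_image[OF i K]]) simp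
 hence o: "open (ov j i)" "open (fi j ` (W j Int - ?K))" by (auto intro!: open_phi_image j openW i)
 have "C_k_on 1 (ov j i) (%z. (max 0 (R\<^sup>2 - (dist (tr j i z) c)\<^sup>2))\<^sup>2)" by (rule bump_composition_C1[OF o(1) trans[OF j i]])
 hence 1: "C_k_on 1 (ov j i) (%z. bump i c R (qs j z))" by (rule C_k_cong[OF o(1), rotated]) (use j in "auto simp: bump_def")
 have 2: "C_k_on 1 (fi j ` (W j Int - ?K)) (%z. bump i c R (qs j z))" by (rule C_k_cong[OF o(2), rotated, OF C_k_const[of 1 _ 0]]) (use j bump_support[OF R i] in auto)
 have "?K <= W i" using K i by auto
 hence "(W j Int W i) Un (W j Int - ?K) = W j" by blast
 hence "ov j i Un fi j ` (W j Int - ?K) = dom j" unfolding image_Un[symmetric] by simp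
 thus ?thesis using C_1_Un[OF o 1 2] by simp
qed

lemma partition_of_unity:
 obtains A :: "('i \<times> (complex ^ 'n) \<times> real) set" and K :: "'i \<times> (complex ^ 'n) \<times> real => (complex ^ 'n) set"
  and rh :: "'i \<times> (complex ^ 'n) \<times> real => 'x => real"
 where "finite A" "!!b. b : A ==> fst b : I" "!!b. b : A ==> compact (K b)"
  "!!b. b : A ==> K b <= dom (fst b)"
  "!!b x. b : A ==> x ~: qs (fst b) ` K b ==> rh b x = 0" "!!b x. b : A ==> 0 <= rh b x"
  "!!b j. b : A ==> j : I ==> C_k_on 1 (dom j) (%z. rh b (qs j z))"
  "!!x. (SUM b:A. rh b x) = 1"
proof -
 define G where "G = {(i, c, R). i : I & 0 < R & cball c R <= dom i}"
 define B where "B b = bump (fst b) (fst (snd b)) (snd (snd b))" for b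
 define N where "N b = W (fst b) Int fi (fst b) -` ball (fst (snd b)) (snd (snd b))" for b
 have "open (N b)" if "b : G" for b
 proof -
  have i: "fst b : I" using that by (auto simp: G_def)
  have "continuous_on (W (fst b)) (fi (fst b))" using homeo[OF i] by (simp add: homeomorphism_def)
  thus ?thesis unfolding N_def by (rule continuous_open_preimage[OF _ openW[OF i] open_ball])
 qed
 moreover have "UNIV <= (\<Union>b\<in>G. N b)"
 proof
  fix x
  obtain i where i: "i : I" "x : W i" using cover by blast
  obtain R where R: "R > 0" "cball (fi i x) R <= dom i" using open_image[OF i(1)] i(2) open_contains_cball by (metis imageI)
  have "(i, fi i x, R) : G" "x : N (i, fi i x, R)" using i R by (auto simp: G_def N_def)
  thus "x : (\<Union>b\<in>G. N b)" by blast
 qed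
 ultimately obtain A where A: "A <= G" "finite A" "UNIV <= (\<Union>b\<in>A. N b)" by (rule compactE_image[OF compact])
 have G: "fst b : I" "0 < snd (snd b)" "cball (fst (snd b)) (snd (snd b)) <= dom (fst b)" if "b : A" for b
 proof -
  have "b : G" using that A(1) by blast
  thus "fst b : I" "0 < snd (snd b)" "cball (fst (snd b)) (snd (snd b)) <= dom (fst b)" by (simp_all add: G_def split_beta)
 qed
 have nn: "0 <= B b x" for b x by (simp add: B_def bump_nonneg)
 have pos: "0 < (SUM b:A. B b x)" for x
 proof -
  obtain b where b: "b : A" "x : N b" using A(3) by blast
  have "0 < B b x" unfolding B_def by (rule bump_positive) (use b G in "auto simp: N_def dist_commute")
  thus ?thesis using A(2) b(1) nn by (intro sum_pos2[of A b]) auto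
 qed
 have C: "C_k_on 1 (dom j) (%z. B b (qs j z))" if "b : A" "j : I" for b j unfolding B_def by (rule bump_C1) (use G that in auto)
 have "C_k_on 1 (dom j) (%z. SUM b:F. B b (qs j z))" if "j : I" "F <= A" for F j using finite_subset[OF that(2) A(2)] that(2)
 proof (induction F rule: finite_induct)
  case empty
  show ?case using C_k_const[of 1 "dom j" "0::real"] by simp
 next
  case (insert b F)
  hence "C_k_on 1 (dom j) (%z. B b (qs j z))" "C_k_on 1 (dom j) (%z. SUM b:F. B b (qs j z))" using C[OF _ that(1)] by blast+
  from C_k_add[OF open_image[OF that(1)] this] show ?case by (simp only: sum.insert[OF insert.hyps])
 qed
 note CS = this
 let ?rh = "%b x. B b x * inverse (SUM b:A. B b x)"
 have Crh: "C_k_on 1 (dom j) (%z. ?rh b (qs j z))" if "b : A" "j : I" for b j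
 proof (rule C_k_mult[OF open_image[OF that(2)] C[OF that]])
  show "C_k_on 1 (dom j) (%z. inverse (SUM b:A. B b (qs j z)))" by (rule C_k_inverse[OF open_image[OF that(2)] _ CS[OF that(2) order_refl]]) (use pos in "simp add: less_imp_neq[symmetric]")
 qed
 show ?thesis
 proof (rule that[of A "%b. cball (fst (snd b)) (snd (snd b))" ?rh])
  fix b x assume b: "b : A"
  show "0 <= ?rh b x" using nn pos by (simp add: less_imp_le)
  show "x ~: qs (fst b) ` cball (fst (snd b)) (snd (snd b)) ==> ?rh b x = 0" using bump_support[OF G(2)[OF b] G(1)[OF b]] by (simp add: B_def)
 next
  fix x show "(SUM b:A. ?rh b x) = 1" using pos[of x] by (simp flip: sum_distrib_right)
 next
  fix b j assume "b : A" "j : I"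
  thus "C_k_on 1 (dom j) (%z. ?rh b (qs j z))" by (rule Crh)
 qed (use A(2) G in auto)
qed

end

text \<open>The indices may carry more data than a chart. The forms \<open>ee i\<close> are the
 local expressions of one global \<open>(2n-1)\<close>-form, and \<open>T\<close> are real coordinates adapted to the complex frame.\<close>
locale stokes_data = chart_cover I W fi qs
 for I :: "'i set" and W :: "'i => 'x::t2_space set" and fi :: "'i => 'x => complex ^ 'n::finite"
  and qs :: "'i => complex ^ 'n => 'x" +
 fixes ee :: "'i => complex ^ 'n => (complex ^ 'n) ext" and ks :: "'n list"
  and T :: "real ^ 'n bit0 => complex ^ 'n" and T' :: "complex ^ 'n => real ^ 'n bit0" and ms :: "'n bit0 list"
 assumes smooth: "i : I ==> esm (fi i ` W i) (ee i)"
  and alt_form: "i : I ==> z : fi i ` W i ==> alt (2 * CARD('n) - 1) (ee i z)"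
  and alt_deriv: "i : I ==> z : fi i ` W i ==> alt (2 * CARD('n)) (ed (ee i) z)"
  and transform: "i : I ==> j : I ==> x : W i Int W j ==>
   ee i (fi i x) vs = ee j (fi j x) (map (fd (%z. fi j (qs i z)) (fi i x)) vs)"
  and transform_deriv: "i : I ==> j : I ==> x : W i Int W j ==>
   ed (ee i) (fi i x) vs =
   ed (ee j) (fi j x) (map (fd (%z. fi j (qs i z)) (fi i x)) vs)"
  and T: "linear T" "linear T'" "!!y. T' (T y) = y" "!!z. T (T' z) = z"
  and ms: "distinct ms" "set ms = (UNIV :: 'n bit0 set)"
  and frame: "map T (map (%k. axis k 1) ms) = concat (map (%k. [axis k 1, axis k \<i>]) ks)"
begin

lemma blT: "bounded_linear T" "bounded_linear T'" using T(1,2) by (simp_all add: linear_conv_bounded_linear)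
lemma vimage_T: "T' ` V = T -` V" using T(3,4) by (auto simp: image_iff) metis

lemma compact_T': "compact K ==> compact (T' ` K)" by (rule compact_continuous_image[OF linear_continuous_on[OF blT(2)]])

abbreviation fr :: "(complex ^ 'n) list" where "fr == concat (map (%k. [axis k 1, axis k \<i>]) ks)"

definition jac :: "'i => 'i => complex ^ 'n => real" where
 "jac i j z = cdet (matrix (%y. T' (Dtr i j z (T y))))"

lemma jac_pos: "i : I ==> j : I ==> z : ov i j ==> 0 < jac i j z"
proof -
 assume i: "i : I" "j : I" "z : ov i j"
 have "inj (Dtr i j z)" by (rule inj_on_inverseI[of _ "Dtr j i (tr i j z)"]) (rule Dtr_inverse[OF i])
 thus ?thesis unfolding jac_def using complex_linear_det_pos[OF T(1,2,3,4) vec_hol_linear[OF trans[OF i(1,2)] i(3)]] by simp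
qed

lemma jac_top:
 assumes i: "i : I" "j : I" "z : ov i j" and a: "alt (2 * CARD('n)) al"
 shows "al (map (Dtr i j z) fr) = of_real (jac i j z) * al fr"
proof -
 let ?f = "%y. T' (Dtr i j z (T y))"
 have D: "linear (Dtr i j z)" using tr_derivative[OF i] by (rule has_derivative_linear)
 have f: "linear ?f" using linear_compose[OF linear_compose[OF T(1) D] T(2)] by (simp add: o_def)
 have a': "alt CARD('n bit0) (%vs. al (map T vs))" using alt_map[OF T(1) a] by simp
 have "map T (map ?f (map (%k. axis k 1) ms)) = map (Dtr i j z) (map T (map (%k. axis k 1) ms))" by (simp add: T)
 hence e: "map T (map ?f (map (%k. axis k 1) ms)) = map (Dtr i j z) fr" unfolding frame .
 show ?thesis using alt_det[OF f a' ms] unfolding e frame jac_def .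
qed

abbreviation top :: "'i => complex ^ 'n => real" where "top i z == Re (ed (ee i) z fr)"

abbreviation cut :: "('x => real) => 'i => complex ^ 'n => (complex ^ 'n) ext" where
 "cut rh i == (%y vs. complex_of_real (rh (qs i y)) * ee i y vs)"

text \<open>The coefficient of \<open>d(\<rho>\<eta>)\<close>, for a cut-off function \<open>\<rho>\<close> and the form \<open>\<eta>\<close> of the locale.\<close>
definition tf :: "('x => real) => 'i => complex ^ 'n => real" where
 "tf rh i z = Re (ed (cut rh i) z fr)"

definition extend :: "('i => complex ^ 'n => real) => 'i => real ^ 'n bit0 => real" where
 "extend q i y = (if T y : dom i then q i (T y) else 0)"

lemma cut_C1:
 assumes "i : I" "C_k_on 1 (dom i) (%z. rh (qs i z))"
 shows "C_k_on 1 (dom i) (%y. cut rh i y vs)" using smooth[OF assms(1)] unfolding esm_def smooth_on_def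
 by (intro C_k_mult[OF open_image[OF assms(1)]] C_k_linear[OF bounded_linear_of_real open_image[OF assms(1)]] assms(2)) blast

lemma cut_differentiable:
 assumes "i : I" "C_k_on 1 (dom i) (%z. rh (qs i z))" "z : dom i"
 shows "(%z. rh (qs i z)) differentiable (at z)" "(%z. complex_of_real (rh (qs i z))) differentiable (at z)"
  "edf (cut rh i) z"
proof -
 show 1: "(%z. rh (qs i z)) differentiable (at z)" using assms(2,3) by (auto simp only: C_k_on.simps One_nat_def)
 show "(%z. complex_of_real (rh (qs i z))) differentiable (at z)" using bl_hd[OF bounded_linear_of_real diff_fd[OF 1]] by (auto simp: differentiable_def)
 show "edf (cut rh i) z" using cut_C1[OF assms(1,2)] assms(3) by (auto simp only: edf_def C_k_on.simps One_nat_def)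
qed

lemma tf_continuous:
 assumes "i : I" "C_k_on 1 (dom i) (%z. rh (qs i z))"
 shows "continuous_on (dom i) (tf rh i)"
proof -
 have "continuous_on (dom i) (%z. fd (%y. cut rh i y vs) z w)" for vs w using cut_C1[OF assms, of vs] by simp
 thus ?thesis unfolding tf_def ext_deriv_def by (intro continuous_intros)
qed

lemma cut_transform:
 assumes i: "i : I" "C_k_on 1 (dom i) (%z. rh (qs i z))" and j: "j : I" "C_k_on 1 (dom j) (%z. rh (qs j z))"
  and x: "x : W i Int W j"
 shows "ed (cut rh i) (fi i x) vs = ed (cut rh j) (fi j x) (map (Dtr i j (fi i x)) vs)"
proof -
 have zi: "fi i x : dom i" and zj: "fi j x : dom j" using x by auto
 note di = cut_differentiable[OF i zi] and dj = cut_differentiable[OF j zj]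
 have "fd (%z. complex_of_real (rh (qs i z))) (fi i x) w =
  fd (%z. complex_of_real (rh (qs j z))) (fi j x) (Dtr i j (fi i x) w)" for w by (rule C1_pullback[OF i(1) j(1) x, of "%x. complex_of_real (rh x)"]) (rule dj(2))
 hence o: "(%vs. one_ext (fd (%z. complex_of_real (rh (qs j z))) (fi j x)) (map (Dtr i j (fi i x)) vs)) =
  one_ext (fd (%z. complex_of_real (rh (qs i z))) (fi i x))" by (auto simp: one_ext_def fun_eq_iff split: list.split)
 have e: "(%vs. ee j (fi j x) (map (Dtr i j (fi i x)) vs)) = ee i (fi i x)" by (rule ext) (rule transform[OF i(1) j(1) x, symmetric])
 show ?thesis unfolding ed_fmult(1)[OF di(2) esm_edf[OF smooth[OF i(1)] zi]]
   ed_fmult(1)[OF dj(2) esm_edf[OF smooth[OF j(1)] zj]] plus_fun_apply using transform_deriv[OF i(1) j(1) x, of vs] x i(1) j(1) by (simp add: wedge_map o e)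
qed

lemma cut_alt:
 assumes i: "i : I" "C_k_on 1 (dom i) (%z. rh (qs i z))" and z: "z : dom i"
 shows "alt (2 * CARD('n)) (ed (cut rh i) z)"
proof -
 note d = cut_differentiable[OF i z]
 have l: "linear (fd (%z. complex_of_real (rh (qs i z))) z)" by (rule linear_frechet_derivative[OF d(2)])
 have "alt (1 + (2 * CARD('n) - 1)) (wedge (one_ext (fd (%z. complex_of_real (rh (qs i z))) z)) (ee i z))" by (rule alt_wedge[OF alt_one_ext[OF l] alt_form[OF i(1) z]])
 moreover have "0 < CARD('n)" by simp
 ultimately show ?thesis unfolding ed_fmult(1)[OF d(2) esm_edf[OF smooth[OF i(1)] z]] using alt_deriv[OF i(1) z] by (intro alt_add alt_scale) (auto simp: Suc_leI)
qed

lemma tf_transform: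
 assumes i: "i : I" "C_k_on 1 (dom i) (%z. rh (qs i z))" and j: "j : I" "C_k_on 1 (dom j) (%z. rh (qs j z))"
  and x: "x : W i Int W j"
 shows "tf rh i (fi i x) = jac i j (fi i x) * tf rh j (fi j x)"
proof -
 have "alt (2 * CARD('n)) (ed (cut rh j) (fi j x))" using x by (intro cut_alt j) auto
 from jac_top[OF i(1) j(1) _ this, of "fi i x"] show ?thesis unfolding tf_def cut_transform[OF i j x] using x by simp
qed

lemma tf_zero:
 assumes i: "i : I" and K: "closed K" "!!x. x ~: K ==> rh x = 0" and z: "z : dom i" "qs i z ~: K"
 shows "tf rh i z = 0"
proof -
 have o: "open (fi i ` (W i Int - K))" using K(1) by (intro open_phi_image[OF i]) auto
 have "ed (cut rh i) z = ed (%_. 0) z" by (rule ed_cong[OF o]) (use i K z in "auto simp: zero_fun_apply")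
 thus ?thesis by (simp add: tf_def ed_const zero_fun_apply)
qed

lemma extend_change_of_variables:
 assumes i: "i : I" and j: "j : I"
  and q: "!!x. x : W i Int W j ==> q i (fi i x) = jac i j (fi i x) * q j (fi j x)"
  and zi: "!!z. z : dom i ==> z ~: ov i j ==> q i z = 0" and zj: "!!z. z : dom j ==> z ~: ov j i ==> q j z = 0"
  and int: "extend q j absolutely_integrable_on UNIV"
 shows "integral UNIV (extend q i) = integral UNIV (extend q j)"
proof -
 let ?S = "T' ` ov i j" and ?S' = "T' ` ov j i"
 let ?g = "%y. T' (tr i j (T y))"
 have o: "open (T' ` V)" if "open V" for V unfolding vimage_T by (rule open_vimage[OF that]) (rule linear_continuous_on[OF blT(1)])
 have oS: "open ?S" "open ?S'" using o[OF open_ov[OF i j]] o[OF open_ov[OF j i]] by auto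
 have gS: "?g ` ?S = ?S'"
 proof -
  have "?g ` ?S = T' ` tr i j ` ov i j" by (simp add: image_image T)
  also have "tr i j ` ov i j = ov j i"
  proof (intro subset_antisym subsetI)
   fix z assume "z : tr i j ` ov i j"
   thus "z : ov j i" using tr_ov[OF i j] by blast
  next
   fix z assume "z : ov j i"
   hence "tr j i z : ov i j" "z = tr i j (tr j i z)" using tr_ov[OF j i, of z] by simp_all
   thus "z : tr i j ` ov i j" by (rule rev_image_eqI)
  qed
  finally show ?thesis .
 qed
 have inj: "inj_on ?g ?S"
 proof (rule inj_on_inverseI)
  fix y assume "y : ?S"
  then obtain z where "y = T' z" "z : ov i j" by blast
  thus "T' (tr j i (T (?g y))) = y" using tr_ov[OF i j] by (simp add: T)
 qed
 have d: "(?g has_derivative (%w. T' (Dtr i j (T y) (T w)))) (at y)" if "y : ?S" for y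
 proof -
  have "T y : ov i j" using that T by auto
  from has_derivative_compose[OF bounded_linear_imp_has_derivative[OF blT(1)] tr_derivative[OF i j this]]
  show ?thesis by (rule bl_hd[OF blT(2)])
 qed
 have "integral UNIV (extend q j) = integral ?S' (extend q j)" by (rule integral_supported) (use zj T in "auto simp: extend_def vimage_T")
 also have "... = integral ?S (%y. \<bar>jac i j (T y)\<bar> * extend q j (?g y))" unfolding gS[symmetric] jac_def by (rule integral_change_of_variables_real[OF oS(1) d inj])
   (use absolutely_integrable_open_subset[OF int oS(2)] gS in auto)
 also have "... = integral ?S (extend q i)"
 proof (rule integral_cong)
  fix y assume "y : ?S"
  then obtain z where z: "y = T' z" "z : ov i j" by blast
  then obtain x where x: "x : W i Int W j" "z = fi i x" by blast
  thus "\<bar>jac i j (T y)\<bar> * extend q j (?g y) = extend q i y" using q[OF x(1)] jac_pos[OF i j z(2)] i j by (simp add: extend_def z T)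
 qed
 also have "... = integral UNIV (extend q i)" by (rule integral_supported[symmetric]) (use zi T in "auto simp: extend_def vimage_T")
 finally show ?thesis by simp
qed

lemma extend_continuous:
 assumes i: "i : I" and K: "compact K" "K <= dom i" and z: "!!z. z : dom i ==> z ~: K ==> q i z = 0"
  and c: "continuous_on (dom i) (q i)"
 shows "continuous_on UNIV (extend q i)" "compact (T' ` K)" "y ~: T' ` K ==> extend q i y = 0"
  "extend q i absolutely_integrable_on UNIV"
proof -
 have o: "open (T -` dom i)" by (rule open_vimage[OF open_image[OF i]]) (rule linear_continuous_on[OF blT(1)])
 have z': "extend q i y = 0" if "y ~: T' ` K" for y using that z by (auto simp: extend_def vimage_T)
 thus "y ~: T' ` K ==> extend q i y = 0" .
 show cK: "compact (T' ` K)" by (rule compact_T'[OF K(1)])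
 have "continuous_on (T -` dom i) (%y. q i (T y))" by (rule continuous_on_compose2[OF c linear_continuous_on[OF blT(1)]]) auto
 hence "continuous_on (T -` dom i) (extend q i)" by (rule continuous_on_eq) (simp add: extend_def)
 thus cont: "continuous_on UNIV (extend q i)" by (rule continuous_extend_zero[OF o _ cK]) (use K(2) z' in "auto simp: vimage_T")
 show "extend q i absolutely_integrable_on UNIV" by (rule ai_compact_support[OF cont cK z'])
qed

text \<open>Stokes in one chart: the coefficient of the exact form is a sum of directional derivatives of compactly
 supported functions.\<close>
lemma tf_integral:
 assumes i: "i : I" and C: "C_k_on 1 (dom i) (%z. rh (qs i z))"
  and K: "compact K" "K <= dom i" "!!x. x ~: qs i ` K ==> rh x = 0"
 shows "integral UNIV (extend (tf rh) i) = 0"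
proof -
 have cK: "compact (T' ` K)" by (rule compact_T'[OF K(1)])
 define G where "G vs z = (if z : dom i then cut rh i z vs else 0)" for vs z
 have oK: "open (- K)" using K(1) compact_imp_closed by blast
 have G0: "G vs z = 0" if "z ~: K" for vs z using K(3)[OF psi_notin[OF i K(2) _ that]] by (simp add: G_def)
 have CG: "C_k_on 1 UNIV (G vs)" for vs
 proof -
  have "C_k_on 1 (dom i) (G vs)" by (rule C_k_cong[OF open_image[OF i] _ cut_C1[where vs=vs, OF i C]]) (simp add: G_def)
  moreover have "C_k_on 1 (- K) (G vs)" by (rule C_k_cong[OF oK, rotated, OF C_k_const[of 1 _ 0]]) (use G0 in auto)
  moreover have "dom i Un - K = UNIV" using K(2) by auto
  ultimately show ?thesis using C_1_Un[OF open_image[OF i] oK] by metis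
 qed
 have dG: "(G vs has_derivative fd (G vs) z) (at z)" for vs z using CG[of vs] by (intro diff_fd) simp
 have df: "((%y. Re (G vs (T y))) has_derivative (%w. Re (fd (G vs) (T y) (T w)))) (at y)" for vs y by (rule bl_hd[OF bounded_linear_Re has_derivative_compose[OF bounded_linear_imp_has_derivative[OF blT(1)] dG]])
 have ff: "fd (%y. Re (G vs (T y))) y w = Re (fd (G vs) (T y) (T w))" for vs y w by (simp add: fd_at[OF df, symmetric])
 have cf: "continuous_on UNIV (%y. Re (fd (G vs) (T y) (T w)))" for vs w
 proof -
  have "continuous_on UNIV (%z. fd (G vs) z (T w))" using CG[of vs] by simp
  from continuous_on_compose2[OF this linear_continuous_on[OF blT(1), of UNIV]]
  show ?thesis by (intro continuous_on_Re) auto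
 qed
 have I0: "integral UNIV (%y. Re (fd (G vs) (T y) (T w))) = 0" for vs w
 proof -
  have "integral UNIV (%y. fd (%y. Re (G vs (T y))) y w) = 0"
  proof (rule integral_directional_derivative)
   show "(%y. Re (G vs (T y))) differentiable (at y)" for y using df by (auto simp: differentiable_def)
   show "continuous_on UNIV (%y. fd (%y. Re (G vs (T y))) y w)" unfolding ff by (rule cf)
   show "compact (T' ` K)" by (rule cK)
   show "Re (G vs (T y)) = 0" if "y ~: T' ` K" for y
   proof -
    have "T y ~: K" using that T(3)[of y] by (metis imageI)
    thus ?thesis by (simp add: G0)
   qed
  qed
  thus ?thesis unfolding ff .
 qed
 have integrable: "(%y. Re (fd (G vs) (T y) (T w))) integrable_on UNIV" for vs w
 proof -
  have "Re (fd (G vs) (T y) (T w)) = 0" if "y ~: T' ` K" for y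
  proof -
   have "T y : - K" using that T(3)[of y] by (metis ComplI imageI)
   from fd_cong(1)[OF oK this, of "G vs" "%_. 0"] G0 show ?thesis by simp
  qed
  from ai_compact_support[OF cf cK this] show ?thesis using set_lebesgue_integral_eq_integral(1) by blast
 qed
 have e: "extend (tf rh) i y = (SUM k<length fr. (-1) ^ k *
   Re (fd (G (take k fr @ drop (Suc k) fr)) (T y) (T (T' (fr ! k)))))" for y
 proof -
  have m: "Re ((-1) ^ k * c) = (-1) ^ k * Re c" for k c by (cases "even k") auto
  show ?thesis
  proof (cases "T y : dom i")
   case True
   have "fd (G vs) (T y) = fd (%y. cut rh i y vs) (T y)" for vs by (rule fd_cong(1)[OF open_image[OF i] True]) (simp add: G_def)
   thus ?thesis using True by (simp add: extend_def tf_def ext_deriv_def m T del: length_concat)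
  next
   case False
   hence "T y : - K" using K(2) by blast
   have "fd (G vs) (T y) w = 0" for vs w using fd_cong(1)[OF oK `T y : - K`, of "G vs" "%_. 0"] G0 by simp
   thus ?thesis using False by (simp add: extend_def del: length_concat)
  qed
 qed
 show ?thesis unfolding e by (subst integral_sum) (auto intro!: integrable integrable_on_mult_right simp: I0 simp del: length_concat)
qed

lemma nonneg_integral_zero:
 fixes f :: "real ^ 'm => real"
 assumes c: "continuous_on UNIV f" and K: "compact K" "!!y. y ~: K ==> f y = 0" and nn: "!!y. 0 <= f y"
  and I: "integral UNIV f = 0"
 shows "f y = 0"
proof -
 obtain b where b: "insert y (insert (y + 1) K) <= box (-b) b" using bounded_subset_box_symmetric[of "insert y (insert (y + 1) K)"] compact_imp_bounded[OF K(1)] by auto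
 have i: "f integrable_on cbox (-b) b" by (rule integrable_continuous[OF continuous_on_subset[OF c]]) simp
 have "integral UNIV f = integral (cbox (-b) b) f" by (rule integral_supported) (use b box_subset_cbox K(2) in blast)
 hence "(f has_integral 0) (cbox (-b) b)" using integrable_integral[OF i] I by simp
 thus ?thesis by (rule has_integral_0_cbox_imp_0[OF continuous_on_subset[OF c] nn, rotated]) (use b box_subset_cbox in auto)
qed

text \<open>Cut the form with the partition of unity twice. The double sum of the integrals of \<open>\<rho>\<^sub>a d(\<rho>\<^sub>b \<eta>)\<close>, each computed in a chart of either
 factor, is zero when summed over \<open>a\<close> first and is the sum of the integrals of \<open>\<rho>\<^sub>a d\<eta>\<close> when summed over \<open>b\<close> first. The latter are
 non-negative, so all of them vanish, and so does the continuous integrand.\<close>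
theorem nonnegative_exact_top_form:
 assumes nonneg: "!!i z. i : I ==> z : dom i ==> 0 <= top i z" and i: "i : I" "z : dom i"
 shows "top i z = 0"
proof (rule partition_of_unity, goal_cases)
 case (1 A K rh)
 note A = 1
 define u where "u a b i z = rh a (qs i z) * tf (rh b) i z" for a b i z
 define v where "v a i z = rh a (qs i z) * top i z" for a i z
 have KW: "qs (fst b) ` K b <= W (fst b)" if "b : A" for b using A(2)[OF that] A(4)[OF that] by auto
 have cl: "closed (qs (fst b) ` K b)" if "b : A" for b by (rule compact_imp_closed[OF compact_image[OF A(2)[OF that] A(4)[OF that] A(3)[OF that]]])
 have psiK: "qs (fst b) z ~: qs (fst b) ` K b" if "b : A" "z : dom (fst b)" "z ~: K b" for b z by (rule psi_notin[OF A(2)[OF that(1)] A(4)[OF that(1)] that(2,3)])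
 have ct: "continuous_on (dom j) (tf (rh b) j)" "continuous_on (dom j) (%z. rh b (qs j z))" if "b : A" "j : I" for b j
 proof -
  show "continuous_on (dom j) (tf (rh b) j)" by (rule tf_continuous[OF that(2) A(7)[OF that]])
  have "ALL z:dom j. (%z. rh b (qs j z)) differentiable (at z)" using A(7)[OF that] by (auto simp only: C_k_on.simps One_nat_def)
  thus "continuous_on (dom j) (%z. rh b (qs j z))" by (intro differentiable_imp_continuous_on) (auto simp only: differentiable_on_def intro: differentiable_at_withinI)
 qed
 have zero_b: "tf (rh b) j z = 0" if "b : A" "j : I" "z : dom j" "qs j z ~: qs (fst b) ` K b" for b j z by (rule tf_zero[OF that(2) cl[OF that(1)] A(5)[OF that(1)] that(3,4)])
 have cov: "integral UNIV (extend (u a b) (fst a)) = integral UNIV (extend (u a b) (fst b))"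
  and ib: "extend (u a b) (fst b) integrable_on UNIV" "extend (u a b) (fst a) integrable_on UNIV"
  if a: "a : A" and b: "b : A" for a b
 proof -
  note Ia = A(2)[OF a] and Ib = A(2)[OF b]
  have zb: "u a b (fst b) z = 0" if "z : dom (fst b)" "z ~: K b" for z using zero_b[OF b Ib that(1) psiK[OF b that]] by (simp add: u_def)
  have za: "u a b (fst a) z = 0" if "z : dom (fst a)" "z ~: K a" for z using A(5)[OF a psiK[OF a that]] by (simp add: u_def)
  have cu: "continuous_on (dom j) (u a b j)" if "j : I" for j unfolding u_def by (intro continuous_intros ct a b that)
  note eb = extend_continuous(4)[where q="u a b", OF Ib A(3,4)[OF b] zb cu[OF Ib]]
  note ea = extend_continuous(4)[where q="u a b", OF Ia A(3,4)[OF a] za cu[OF Ia]]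
  show "extend (u a b) (fst b) integrable_on UNIV" "extend (u a b) (fst a) integrable_on UNIV" using ea eb set_lebesgue_integral_eq_integral(1) by blast+
  show "integral UNIV (extend (u a b) (fst a)) = integral UNIV (extend (u a b) (fst b))"
  proof (rule extend_change_of_variables[OF Ia Ib _ _ _ eb])
   fix x assume "x : W (fst a) Int W (fst b)"
   thus "u a b (fst a) (fi (fst a) x) = jac (fst a) (fst b) (fi (fst a) x) * u a b (fst b) (fi (fst b) x)" using tf_transform[OF Ia A(7)[OF b Ia] Ib A(7)[OF b Ib], of x] Ia Ib by (simp add: u_def)
  next
   fix z assume z: "z : dom (fst a)" "z ~: ov (fst a) (fst b)"
   hence "qs (fst a) z ~: W (fst b)" using image_ov[OF Ia] by blast
   thus "u a b (fst a) z = 0" using zero_b[OF b Ia z(1)] KW[OF b] by (auto simp: u_def)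
  next
   fix z assume z: "z : dom (fst b)" "z ~: ov (fst b) (fst a)"
   hence "qs (fst b) z ~: W (fst a)" using image_ov[OF Ib] by blast
   thus "u a b (fst b) z = 0" using A(5)[OF a] KW[OF a] by (auto simp: u_def)
  qed
 qed
 have sum_a: "extend (tf (rh b)) j y = (SUM a:A. extend (u a b) j y)" for b j y by (simp add: extend_def u_def A(8) flip: sum_distrib_right)
 have sum_b: "extend (v a) j y = (SUM b:A. extend (u a b) j y)" if j: "j : I" for a j y
 proof (cases "T y : dom j")
  case True
  have "(SUM b:A. tf (rh b) j z) = top j z" if z: "z : dom j" for z
  proof -
   have "(SUM b:A. ed (cut (rh b) j) z) = ed (%y. SUM b:A. cut (rh b) j y) z" by (rule ed_sum[symmetric]) (rule cut_differentiable(3)[OF j A(7)[OF _ j] z])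
   also have "... = ed (ee j) z"
   proof (rule ed_cong[OF open_image[OF j] z])
    fix y
    have "(SUM b:A. cut (rh b) j y) vs = complex_of_real (SUM b:A. rh b (qs j y)) * ee j y vs" for vs by (simp add: sum_app sum_distrib_right)
    thus "(SUM b:A. cut (rh b) j y) = ee j y" by (intro ext) (simp add: A(8))
   qed
   finally have "(SUM b:A. ed (cut (rh b) j) z) fr = ed (ee j) z fr" by (rule arg_cong)
   hence "(SUM b:A. ed (cut (rh b) j) z fr) = ed (ee j) z fr" by (simp only: sum_app)
   thus ?thesis by (simp add: tf_def flip: Re_sum)
  qed
  thus ?thesis using True by (simp add: extend_def u_def v_def flip: sum_distrib_left)
 qed (simp add: extend_def)
 have "(SUM a:A. integral UNIV (extend (v a) (fst a))) = (SUM a:A. SUM b:A. integral UNIV (extend (u a b) (fst a)))"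
 proof (rule sum.cong[OF refl])
  fix a assume a: "a : A"
  have "extend (v a) (fst a) = (%y. SUM b:A. extend (u a b) (fst a) y)" by (rule ext) (rule sum_b[OF A(2)[OF a]])
  thus "integral UNIV (extend (v a) (fst a)) = (SUM b:A. integral UNIV (extend (u a b) (fst a)))" using integral_sum[OF A(1), of "%b. extend (u a b) (fst a)" UNIV] ib(2)[OF a] by simp
 qed
 also have "... = (SUM b:A. SUM a:A. integral UNIV (extend (u a b) (fst b)))" using cov by (subst sum.swap) (intro sum.cong, auto)
 also have "... = (SUM b:A. integral UNIV (extend (tf (rh b)) (fst b)))"
 proof (rule sum.cong[OF refl])
  fix b assume b: "b : A"
  have "extend (tf (rh b)) (fst b) = (%y. SUM a:A. extend (u a b) (fst b) y)" by (rule ext) (rule sum_a)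
  thus "(SUM a:A. integral UNIV (extend (u a b) (fst b))) = integral UNIV (extend (tf (rh b)) (fst b))" using integral_sum[OF A(1), of "%a. extend (u a b) (fst b)" UNIV] ib(1)[OF _ b] by simp
 qed
 also have "... = 0" by (rule sum.neutral) (use tf_integral[OF A(2) A(7)[OF _ A(2)] A(3,4,5)] in blast)
 finally have s0: "(SUM a:A. integral UNIV (extend (v a) (fst a))) = 0" .
 have v0: "rh a x * top (fst a) (fi (fst a) x) = 0" if a: "a : A" "x : W (fst a)" for a x
 proof -
  note Ia = A(2)[OF a(1)]
  have nn: "0 <= extend (v b) (fst b) y" if "b : A" for b y using A(6)[OF that] nonneg[OF A(2)[OF that]] by (auto simp: extend_def v_def)
  have zv: "v b (fst b) z = 0" if "b : A" "z : dom (fst b)" "z ~: K b" for b z using A(5)[OF that(1) psiK[OF that]] by (simp add: v_def)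
  have "continuous_on (dom j) (top j)" if "j : I" for j
  proof -
   have "C_k_on 1 (dom j) (%y. ee j y vs)" for vs using smooth[OF that] by (simp only: esm_def smooth_on_def)
   hence "continuous_on (dom j) (%z. fd (%y. ee j y vs) z w)" for vs w by (simp only: C_k_on.simps One_nat_def)
   thus ?thesis unfolding ext_deriv_def by (intro continuous_intros)
  qed
  hence cv: "continuous_on (dom (fst b)) (v b (fst b))" if "b : A" for b unfolding v_def using that by (intro continuous_on_mult ct) (auto simp: A(2))
  have e: "continuous_on UNIV (extend (v b) (fst b))" "compact (T' ` K b)"
    "!!y. y ~: T' ` K b ==> extend (v b) (fst b) y = 0"
    "extend (v b) (fst b) absolutely_integrable_on UNIV" if b: "b : A" for b using extend_continuous[where q="v b", OF A(2)[OF b] A(3,4)[OF b] zv[OF b] cv[OF b]] by auto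
  have "integral UNIV (extend (v b) (fst b)) >= 0" if b: "b : A" for b
  proof (rule Henstock_Kurzweil_Integration.integral_nonneg)
   show "extend (v b) (fst b) integrable_on UNIV" using e(4)[OF b] set_lebesgue_integral_eq_integral(1) by blast
  qed (rule nn[OF b])
  hence I0: "integral UNIV (extend (v a) (fst a)) = 0" using s0 A(1) a(1) by (simp add: sum_nonneg_eq_0_iff)
  have "extend (v a) (fst a) (T' (fi (fst a) x)) = 0" by (rule nonneg_integral_zero[OF e(1,2)[OF a(1)] e(3)[OF a(1)] nn[OF a(1)] I0])
  thus ?thesis using a Ia by (simp add: extend_def v_def T)
 qed
 obtain x where x: "x : W i" "z = fi i x" using i(2) by blast
 have "EX a:A. rh a x ~= 0" using A(8)[of x] by (metis sum.neutral zero_neq_one)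
 then obtain a where a: "a : A" "rh a x ~= 0" by blast
 hence xa: "x : W (fst a)" using A(5) KW by blast
 have top0: "top (fst a) (fi (fst a) x) = 0" using v0[OF a(1) xa] a(2) by simp
 have "ed (ee i) (fi i x) fr = of_real (jac i (fst a) (fi i x)) * ed (ee (fst a)) (fi (fst a) x) fr" unfolding transform_deriv[OF i(1) A(2)[OF a(1)] IntI[OF x(1) xa]]
  by (rule jac_top[OF i(1) A(2)[OF a(1)]]) (use x xa A(2)[OF a(1)] alt_deriv in auto)
 thus ?case using top0 x(2) by simp
qed

end

section \<open>Holomorphic sections and parallel morphisms\<close>

lemma md_zf_mclin:
 assumes S: "open S" "z : S" and M: "holo_mat S p q M"
 shows "mclin (md (%y. zf p q (M y)) z)"
proof -
 have "clin (%w. md (%y. zf p q (M y)) z i j [w])" for i j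
 proof (cases "i < p & j < q")
  case True
  thus ?thesis using hol_onD(2)[OF fnf.Qm_entry[OF ff_hol[OF S(1)] M] S(2)] by (simp add: md_zf_single)
 next
  case False
  have "mdim p q (md (%y. zf p q (M y)) z)" by (rule mdim_md) simp
  hence "md (%y. zf p q (M y)) z i j = 0" using False by (auto simp: mdim_def)
  thus ?thesis by (simp add: clin_iff zero_fun_apply)
 qed
 moreover have "mdeg (Suc 0) (md (%y. zf p q (M y)) z)" by (rule mdeg_md) simp
 ultimately show ?thesis by (simp add: mclin_def)
qed

lemma holo_matI_mclin:
 assumes S: "open S" and M: "smm S p q M" and l: "!!z. z : S ==> mclin (md (%y. zf p q (M y)) z)"
 shows "holo_mat S p q M"
proof (rule fnf.QmI[OF ff_hol[OF S]])
 show "M z : cmat p q" if "z : S" for z by (rule fnf.Qm_carrier[OF ff_sm[OF S] M that])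
 fix i j assume ij: "i < p" "j < q"
 show "hol_on S (%z. M z $$ (i, j))" unfolding hol_on_def
 proof
  fix z assume z: "z : S"
  have "(%z. M z $$ (i, j)) differentiable (at z)" using smooth_dble[OF fnf.Qm_entry[OF ff_sm[OF S] M ij] z] .
  moreover have "clin (%w. fd (%z. M z $$ (i, j)) z w)" using l[OF z] unfolding md_zf_single[OF ij, symmetric] mclin_def by blast
  ultimately show "EX D. ((%z. M z $$ (i, j)) has_derivative D) (at z) & clin D" using diff_fd by blast
 qed
qed simp

lemma nab_mclin:
 assumes "mclin (md M z)" "mclin (t z)" "mclin (t' z)" "mdeg 0 (M z)"
 shows "mclin (nab r t r' t' M z)" unfolding nab_def by (intro mclin_add mclin_mw assms)

lemma nab_dim:
 assumes "!!y. mdim r' r (M y)" "mdim r r (t z)" "mdim r' r' (t' z)"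
 shows "mdim r' r (nab r t r' t' M z)" unfolding nab_def by (intro mdim_diff mdim_add mdim_md mdim_mw[OF assms(3,1)] mdim_mw[OF assms(1,2)] assms(1))

lemma nab_mw:
 assumes "mdf A z" "mdf B z" "mdeg 0 (A z)"
 shows "nab r t r'' t'' (%y. mw r' (A y) (B y)) z =
  mw r' (nab r' t' r'' t'' A z) (B z) + mw r' (A z) (nab r t r' t' B z)" unfolding nab_def by (simp add: md_mw assms msg_mdeg' mw_lin algebra_simps)

locale metric_pair =
 fixes S :: "(complex ^ 'n::finite) set" and r r' :: nat and H H' :: "complex ^ 'n => complex mat"
 assumes S: "open S"
  and H: "!!y. y : S ==> hermitian_metric r (H y)" "smm S r r H"
  and H': "!!y. y : S ==> hermitian_metric r' (H' y)" "smm S r' r' H'"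
begin

abbreviation "th == chern r H"
abbreviation "th' == chern r' H'"

lemma nab_adjoint_zf:
 assumes z: "z : S" and M: "smm S r' r M" and N: "smm S r r' N"
  and adj: "!!y. y : S ==> H y * N y = ctr (M y) * H' y"
 shows "mw r (zf r r (H z)) (nab r' th' r th (%y. zf r r' (N y)) z) =
  mw r' (mstar (nab r th r' th' (%y. zf r' r (M y)) z)) (zf r' r' (H' z))"
proof (rule nab_adjoint[OF S z])
 note fs = ff_sm[OF S]
 fix y assume y: "y : S"
 note c = hmD(1)[OF H(1)[OF y]] hmD(1)[OF H'(1)[OF y]]
  fnf.Qm_carrier[OF fs M y] fnf.Qm_carrier[OF fs N y]
 show "mw r (zf r r (H y)) (zf r r' (N y)) = mw r' (mstar (zf r' r (M y))) (zf r' r' (H' y))" using adj[OF y] c by (simp add: mstar_zf flip: zf_mult)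
qed (use z S H H' M N chern_mclin(2)[OF S z] in "auto intro: msm_mdf msm_zf")

text \<open>Both covariant derivatives are of type (1,0), and they are adjoint to each other; hence they are also of
 type (0,1).\<close>
theorem adjoint_holomorphic_parallel:
 assumes z: "z : S" and M: "holo_mat S r' r M" and N: "holo_mat S r r' N"
  and adj: "!!y. y : S ==> H y * N y = ctr (M y) * H' y"
 shows "nab r th r' th' (%y. zf r' r (M y)) z = 0"
proof -
 note h = hmD[OF H'(1)[OF z]] hmD[OF H(1)[OF z]]
 note tl = chern_mclin(1)[OF S z H] chern_mclin(1)[OF S z H']
 let ?A = "nab r th r' th' (%y. zf r' r (M y)) z" and ?B = "nab r' th' r th (%y. zf r r' (N y)) z"
 note iH = minv[OF h(1,3)]
 have AB: "mw r (zf r r (H z)) ?B = mw r' (mstar ?A) (zf r' r' (H' z))" by (rule nab_adjoint_zf[OF z holo_smooth_mat[OF S M] holo_smooth_mat[OF S N] adj])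
 have "mclin ?B" by (intro nab_mclin tl md_zf_mclin[OF S z N]) simp_all
 hence "mclin (mw r (zf r r (H z)) ?B)" by (intro mclin_mw(1)) simp_all
 hence "mclin (mw r' (mw r (zf r r (H z)) ?B) (zf r' r' (minv (H' z))))" by (rule mclin_mw(2)[rotated]) simp_all
 moreover have "mw r' (mw r (zf r r (H z)) ?B) (zf r' r' (minv (H' z))) = mstar ?A"
 proof -
  have d: "mdim r r' (mstar ?A)"
  proof -
   have "mdim r' r ?A" by (intro nab_dim chernD) simp
   thus ?thesis by (auto simp: mdim_def mstar_def fun_eq_iff fun_apps)
  qed
  show ?thesis unfolding AB mw_assoc zf_mult[OF h(1) iH(1), symmetric] iH(2) zf_one(2)[OF d] ..
 qed
 ultimately have "mclin (mstar ?A)" by simp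
 moreover have "mclin ?A" by (intro nab_mclin tl md_zf_mclin[OF S z M]) simp_all
 ultimately show ?thesis using mclin_antilinear_zero by blast
qed

theorem parallel_curvature:
 assumes z: "z : S" and M: "smm S r' r M"
  and par: "!!z. z : S ==> nab r th r' th' (%y. zf r' r (M y)) z = 0"
 shows "mw r' (curv r' th' z) (zf r' r (M z)) = mw r (zf r' r (M z)) (curv r th z)"
proof -
 have "md (nab r th r' th' (%y. zf r' r (M y))) z = md (%_. 0) z" by (rule md_cong[OF S z par])
 hence "md (nab r th r' th' (%y. zf r' r (M y))) z = 0" by (simp only: md_const)
 moreover have "msm S th" "msm S th'" using chern_mclin(3)[OF S z H] chern_mclin(3)[OF S z H'] by auto
 ultimately show ?thesis using md_nab[OF S z, of th th' "%y. zf r' r (M y)" r r'] par[OF z] M by (simp add: chernD(1)[unfolded One_nat_def] msm_zf[OF S])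
qed

end

section \<open>Conjugation invariance of the traces\<close>

lemma mpow_intertwine:
 assumes F: "mw r F' J = mw rh J F" and dim: "mdim r rh J" "mdim rh rh F"
 shows "mw r (mpow r F' a) J = mw rh J (mpow rh F a)"
proof (induction a)
 case 0
 thus ?case using dim by (simp add: mw_munit)
next
 case (Suc a)
 have "mw r (mpow r F' (Suc a)) J = mw r F' (mw rh J (mpow rh F a))" by (simp add: mw_assoc Suc)
 also have "... = mw rh (mw rh J F) (mpow rh F a)" by (simp add: F[symmetric] mw_assoc)
 finally show ?case by (simp add: mw_assoc)
qed

text \<open>The retraction \<open>K\<close> cancels against \<open>J\<close> cyclically under the trace. Applied to frame changes, where \<open>J\<close> is invertible, and to
 subbundles, where it is not.\<close>
lemma mtr_Xk_conjugate:
 assumes F: "mw r F' J = mw rh J F"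
  and A: "A' = mw rh J (mw rh A K)" and B: "B' = mw rh J (mw rh B K)"
  and KJ: "mw r K J = zf rh rh (idm rh)"
  and dim: "mdim r rh J" "mdim rh r K" "mdim rh rh F" "mdim rh rh A" "mdim rh rh B" and deg: "mdeg 0 K"
 shows "mtr r (Xk r F' A' B' k) = mtr rh (Xk rh F A B k)"
proof -
 note P = mpow_intertwine[OF F dim(1,3)]
 have P': "mw r (mpow r F' a) (mw rh J X) = mw rh J (mw rh (mpow rh F a) X)" for a X using P[of a] by (metis mw_assoc)
 have KJX: "mw r K (mw rh J X) = X" if "mdim rh c X" for c X using KJ zf_one(1)[OF that] by (simp flip: mw_assoc)
 have dp: "mdim rh rh (mw rh (mpow rh F b) B)" for b
 proof (induction b)
  case (Suc b)
  thus ?case by (simp add: mw_assoc mdim_mw[OF dim(3)])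
 qed (simp add: mw_munit(2)[OF dim(5)] dim)
 have db: "mdim rh r (mw rh (mpow rh F b) (mw rh B K))" for b using mdim_mw[OF dp dim(2)] by (simp add: mw_assoc)
 have *: "mtr r (mw r (mpow r F' a) (mw r A' (mw r (mpow r F' b) B'))) =
  mtr rh (mw rh (mpow rh F a) (mw rh A (mw rh (mpow rh F b) B)))" for a b
 proof -
  let ?X = "mw rh (mpow rh F a) (mw rh A (mw rh (mpow rh F b) B))"
  have 1: "mw r (mpow r F' a) (mw r A' (mw r (mpow r F' b) B')) = mw rh J (mw rh ?X K)" unfolding A B by (simp add: mw_assoc P' KJX[OF db])
  have "mtr r (mw rh J (mw rh ?X K)) = mtr r (mw rh (mw rh J ?X) K)" by (simp add: mw_assoc)
  also have "... = mtr rh (mw r K (mw rh J ?X))" by (rule mtr_commute_even[OF deg]) simp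
  also have "... = mtr rh ?X"
  proof (rule arg_cong[where f="mtr rh"], rule KJX[where c=rh])
   have m: "mdim rh rh (mw rh (mpow rh F a) X)" if "mdim rh rh X" for a X
   proof (induction a)
    case (Suc b)
    thus ?case by (simp add: mw_assoc mdim_mw[OF dim(3)])
   qed (simp add: mw_munit[OF that] that)
   show "mdim rh rh ?X" by (rule m[OF mdim_mw[OF dim(4) m[OF dim(5)]]])
  qed
  finally show ?thesis unfolding 1 .
 qed
 show ?thesis unfolding Xk_def mtr_sum by (intro sum.cong refl *)
qed

section \<open>Pulling forms back along a holomorphic change of coordinates\<close>

definition pull :: "('v => 'v) => 'v mext => 'v mext" where "pull f A i j vs = A i j (map f vs)"

lemma pull_mw: "pull f (mw r A B) = mw r (pull f A) (pull f B)"
proof -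
 have "pull f C i j = (%us. C i j (map f us))" for C i j by (rule ext) (simp add: pull_def)
 thus ?thesis by (intro ext) (simp add: pull_def[of _ "mw r A B"] mwedge_def wedge_map)
qed

lemma pull_munit: "pull f munit = munit" by (intro ext) (simp add: pull_def munit_def unit_ext_def)

lemma pull_mpow: "pull f (mpow r A k) = mpow r (pull f A) k" by (induction k) (simp_all add: pull_munit pull_mw)

lemma pull_simps: "pull f (A + B) = pull f A + pull f B" "pull f (A - B) = pull f A - pull f B" "pull f (smul c A) = smul c (pull f A)"
 "pull f (zf p q M) = zf p q M" by (intro ext, simp add: pull_def fun_apps smul_def zf_def)+

lemma pull_Xk: "pull f (Xk r F A B k) = Xk r (pull f F) (pull f A) (pull f B) k"
proof -
 have s: "pull f (SUM k:K. g k) = (SUM k:K. pull f (g k))" for K and g :: "nat => 'a mext" by (intro ext) (simp add: pull_def sum_app)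
 show ?thesis unfolding Xk_def s pull_mw pull_mpow ..
qed

lemma mtr_pull: "mtr r (pull f A) vs = mtr r A (map f vs)" by (simp add: mtr_def pull_def sum_app)

definition malt :: "nat => ('v::real_vector) mext => bool" where "malt p A \<longleftrightarrow> (ALL i j. alt p (A i j))"

lemma malt_mw: "malt p A ==> malt q B ==> malt (p + q) (mw r A B)" unfolding malt_def mw_sum by (intro allI alt_sum alt_wedge) auto

lemma malt_munit: "malt 0 munit" by (auto simp: malt_def munit_def hdeg_def unit_ext_def)

lemma malt_mpow: "malt 2 F ==> malt (2 * k) (mpow r F k)"
proof (induction k)
 case (Suc k)
 thus ?case using malt_mw[of 2 F "2 * k"] by simp
qed (simp add: malt_munit)

lemma alt_mtr_Xk:
 assumes "malt 2 F" "malt p A" "malt q B"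
 shows "alt (2 * (k - 1) + p + q) (mtr r (Xk r F A B k))"
proof -
 have "malt (2 * (k - 1) + p + q) (mw r (mpow r F a) (mw r A (mw r (mpow r F (k - Suc a)) B)))" if "a < k" for a
 proof -
  have "malt (2 * a + (p + (2 * (k - Suc a) + q))) (mw r (mpow r F a) (mw r A (mw r (mpow r F (k - Suc a)) B)))" by (intro malt_mw malt_mpow assms)
  moreover have "2 * a + (p + (2 * (k - Suc a) + q)) = 2 * (k - 1) + p + q" using that by simp
  ultimately show ?thesis by simp
 qed
 thus ?thesis unfolding Xk_def mtr_sum unfolding mtr_def malt_def by (intro alt_sum) auto
qed

lemma mclin_alt:
 fixes A :: "(complex ^ 'n::finite) mext"
 shows "mclin A ==> malt 1 A"
proof -
 assume A: "mclin A"
 have "A i j = one_ext (%w. A i j [w])" for i j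
 proof
  fix vs
  have "A i j vs = 0" if "length vs ~= 1" using A that by (simp add: mclin_def mdeg_def hdeg_def)
  thus "A i j vs = one_ext (%w. A i j [w]) vs" by (cases "length vs = 1") (auto simp: one_ext_def length_Suc_conv split: list.split)
 qed
 moreover have "linear (%w. A i j [w])" for i j
 proof (rule linearI)
  fix c and x :: "complex ^ 'n"
  have "c *R x = complex_of_real c *s x" unfolding cvec_eq vector_scaleR_component vector_smult_component by (simp add: scaleR_conv_of_real)
  thus "A i j [c *R x] = c *R A i j [x]" using A by (simp add: mclin_def clin_iff scaleR_conv_of_real)
 qed (use A in "simp add: mclin_def clin_iff")
 ultimately show ?thesis unfolding malt_def using alt_one_ext by metis
qed

lemma alt_hdeg0: "malt 0 A \<longleftrightarrow> mdeg 0 A" by (simp add: malt_def mdeg_def)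

lemma complex_linear_basis:
 assumes "clin l"
 shows "l w = (SUM k:UNIV. l (axis k 1) * w $ k)"
proof -
 have add: "!!x y. l (x + y) = l x + l y" and sc: "!!c x. l (c *s x) = c * l x" using assms by (auto simp: clin_iff)
 have z: "l 0 = 0" using sc[of 0 0] by simp
 have "l (SUM k:A. w $ k *s axis k 1) = (SUM k:A. l (axis k 1) * w $ k)" for A :: "'a set" by (induction A rule: infinite_finite_induct) (simp_all add: z add sc)
 from this[of UNIV] show ?thesis by (simp add: basis_expansion)
qed

lemma one_form_expansion:
 assumes b: "hdeg 1 bt" "clin (%w. bt [w])"
 shows "bt = (SUM k:UNIV. (%vs. bt [axis k 1] * one_ext (%w. w $ k) vs))"
proof
 fix vs
 have "bt vs = (SUM k:UNIV. bt [axis k 1] * one_ext (%w. w $ k) vs)"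
 proof (cases "length vs = 1")
  case True
  then obtain w where "vs = [w]" by (auto simp: length_Suc_conv)
  thus ?thesis using complex_linear_basis[OF b(2), of w] by (simp add: one_ext_def)
 next
  case False
  hence "one_ext l vs = 0" for l :: "complex ^ 'a => complex" using hdeg_one_ext[of l] by (simp add: hdeg_def)
  thus ?thesis using False b(1) by (simp add: hdeg_def)
 qed
 thus "bt vs = (SUM k:UNIV. (%vs. bt [axis k 1] * one_ext (%w. w $ k) vs)) vs" by (simp add: sum_app)
qed

lemma ed_exact_sum:
 fixes b :: "'k::finite => 'v::real_normed_vector => complex"
 assumes S: "open S" "z : S" and f: "!!k. smooth_on S (f k)" and b: "!!k. b k differentiable (at z)"
  and e: "!!y. y : S ==> bt y = (SUM k:UNIV. (%vs. b k y * one_ext (fd (f k) y) vs))"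
 shows "ed bt z = (SUM k:UNIV. wedge (one_ext (fd (b k) z)) (one_ext (fd (f k) z)))"
proof -
 define al where "al k y vs = (if vs = [] then f k y else 0)" for k and y :: 'v and vs :: "'v list"
 have sm: "esm S (al k)" for k unfolding esm_def
 proof
  fix vs show "smooth_on S (%y. al k y vs)" using f[of k] smooth_const[OF S(1), of 0] by (cases "vs = []") (simp_all add: al_def)
 qed
 have dal: "ed (al k) y = one_ext (fd (f k) y)" for k y
 proof
  fix vs
  have "hdeg (Suc 0) (ed (al k) y)" by (rule hdeg_ext_deriv) (simp add: hdeg_def al_def)
  thus "ed (al k) y vs = one_ext (fd (f k) y) vs" using hdeg_one_ext[of "fd (f k) y"] by (cases "length vs = 1") (auto simp: hdeg_def length_Suc_conv ext_deriv_def al_def one_ext_def)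
 qed
 note dd = ed_ext_deriv[OF S(1) sm S(2)]
 note ed = esm_edf[OF esm_ext_deriv[OF S(1) sm] S(2)]
 have "ed bt z = ed (%y. SUM k:UNIV. (%vs. b k y * ed (al k) y vs)) z" by (rule ed_cong[OF S]) (simp only: e dal)
 also have "... = (SUM k:UNIV. ed (%y vs. b k y * ed (al k) y vs) z)" by (rule ed_sum) (rule ed_fmult(2)[OF b ed])
 also have "... = (SUM k:UNIV. wedge (one_ext (fd (b k) z)) (one_ext (fd (f k) z)))" unfolding ed_fmult(1)[OF b ed] dd by (intro sum.cong refl ext) (simp add: fun_apps dal)
 finally show ?thesis .
qed

lemma smooth_coordinate: "open S ==> smooth_on S (%y. (y :: complex ^ 'n::finite) $ k)"
proof (rule hol_on_smooth)
 show "hol_on S (%y. y $ k)" unfolding hol_on_def by (intro ballI exI[of _ "%y. y $ k"] conjI bl_hd[OF bounded_linear_vec_nth has_derivative_ident]) (simp add: clin_iff)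
qed

lemma frechet_coordinate: "fd (%y. (y :: complex ^ 'n::finite) $ k) z = (%w. w $ k)" by (rule fd_at[symmetric]) (rule bl_hd[OF bounded_linear_vec_nth has_derivative_ident])

lemma ed_complex_linear:
 fixes bt :: "complex ^ 'n::finite => (complex ^ 'n) ext"
 assumes S: "open S" "z : S" and sm: "esm S bt" and b: "!!y. y : S ==> hdeg 1 (bt y)" "!!y. y : S ==> clin (%w. bt y [w])"
 shows "ed bt z = (SUM k:UNIV. wedge (one_ext (fd (%y. bt y [axis k 1]) z)) (one_ext (%w. w $ k)))"
  and "alt 2 (ed bt z)"
proof -
 have d: "(%y. bt y [axis k 1]) differentiable (at z)" for k using esm_edf[OF sm S(2)] by (simp add: edf_def)
 show e: "ed bt z = (SUM k:UNIV. wedge (one_ext (fd (%y. bt y [axis k 1]) z)) (one_ext (%w. w $ k)))"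
 proof -
  have "bt y = (SUM k:UNIV. (%vs. bt y [axis k 1] * one_ext (fd (%y. y $ k) y) vs))" if "y : S" for y unfolding frechet_coordinate by (rule one_form_expansion[OF b[OF that]])
  from ed_exact_sum[OF S smooth_coordinate[OF S(1)] d this] show ?thesis unfolding frechet_coordinate .
 qed
 have "linear (%w :: complex ^ 'n. w $ k)" for k by (rule linearI) simp_all
 hence "alt (1 + 1) (wedge (one_ext (fd (%y. bt y [axis k 1]) z)) (one_ext (%w. w $ k)))" for k by (intro alt_wedge alt_one_ext linear_frechet_derivative d)
 thus "alt 2 (ed bt z)" unfolding e by (intro alt_sum) (simp only: one_add_one)
qed

text \<open>In coordinates a 1-form is a combination of differentials of functions, for which pullback and exterior
 derivative visibly commute.\<close>
lemma ed_pullback: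
 fixes g :: "complex ^ 'n::finite => complex ^ 'n"
 assumes S: "open S" "z : S" and S': "open S'" "g ` S <= S'" and g: "!!k. hol_on S (%y. g y $ k)"
  and sm: "esm S' bt" and b: "!!y. y : S' ==> hdeg 1 (bt y)" "!!y. y : S' ==> clin (%w. bt y [w])"
  and e: "!!y vs. y : S ==> al y vs = bt (g y) (map (fd g y) vs)"
 shows "ed al z vs = ed bt (g z) (map (fd g z) vs)"
proof -
 let ?D = "%y. fd g y"
 have gz: "g z : S'" using S S' by auto
 have db: "((%y. bt y [axis k 1]) has_derivative fd (%y. bt y [axis k 1]) (g z)) (at (g z))" for k using esm_edf[OF sm gz] diff_fd by (auto simp: edf_def)
 have dg: "(g has_derivative ?D z) (at z)" by (rule diff_fd[OF vec_hol_differentiable[OF g S(2)]])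
 have dbg: "((%y. bt (g y) [axis k 1]) has_derivative (%w. fd (%y. bt y [axis k 1]) (g z) (?D z w))) (at z)" for k using has_derivative_compose[OF dg db] .
 note fr = fd_at[OF dbg, symmetric]
 have one: "(%vs. one_ext l (map (?D y) vs)) = one_ext (%w. l (?D y w))" for l y by (rule ext) (auto simp: one_ext_def split: list.split)
 have "ed al z = (SUM k:UNIV. wedge (one_ext (fd (%y. bt (g y) [axis k 1]) z)) (one_ext (fd (%y. g y $ k) z)))"
 proof (rule ed_exact_sum[OF S])
  show "smooth_on S (%y. g y $ k)" for k by (rule hol_on_smooth[OF S(1) g])
  show "(%y. bt (g y) [axis k 1]) differentiable (at z)" for k using dbg by (auto simp: differentiable_def)
  fix y assume y: "y : S"
  hence gy: "g y : S'" using S' by auto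
  show "al y = (SUM k:UNIV. (%vs. bt (g y) [axis k 1] * one_ext (fd (%y. g y $ k) y) vs))"
  proof
   fix vs
   have "al y vs = (SUM k:UNIV. (%vs. bt (g y) [axis k 1] * one_ext (%w. w $ k) vs)) (map (?D y) vs)" using e[OF y] one_form_expansion[OF b[OF gy]] by metis
   thus "al y vs = (SUM k:UNIV. (%vs. bt (g y) [axis k 1] * one_ext (fd (%y. g y $ k) y) vs)) vs" by (simp add: sum_app fun_cong[OF one] vec_hol_frechet[OF g y])
  qed
 qed
 moreover have "ed bt (g z) = (SUM k:UNIV. wedge (one_ext (fd (%y. bt y [axis k 1]) (g z))) (one_ext (%w. w $ k)))" by (rule ed_complex_linear(1)[OF S'(1) gz sm]) (use b in auto)
 ultimately show ?thesis by (simp add: sum_app wedge_map one fr vec_hol_frechet[OF g S(2)])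
qed

locale chart_change =
 fixes S S' :: "(complex ^ 'n::finite) set" and g :: "complex ^ 'n => complex ^ 'n"
 assumes S: "open S" and S': "open S'" and gS: "g ` S <= S'" and g: "!!k. hol_on S (%y. g y $ k)"
begin

abbreviation "Dg y == fd g y"

lemma frechet_compose:
 assumes "z : S" "f differentiable (at (g z))"
 shows "fd (%y. f (g y)) z w = fd f (g z) (Dg z w)"
proof -
 have "((%y. f (g y)) has_derivative (%w. fd f (g z) (Dg z w))) (at z)" using has_derivative_compose[OF diff_fd[OF vec_hol_differentiable[OF g assms(1)]] diff_fd[OF assms(2)]] .
 thus ?thesis using fd_at by metis
qed

lemma md_zf_pull:
 assumes z: "z : S" and M: "smm S' p q M"
 shows "md (%y. zf p q (M (g y))) z = pull (Dg z) (md (%y. zf p q (M y)) (g z))"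
proof (rule mdeg1_eqI)
 have m: "mdeg (Suc 0) (md (%y. zf p q (f y)) y)" for f :: "complex ^ 'n => _" and y by (rule mdeg_md) simp
 show "mdeg 1 (md (%y. zf p q (M (g y))) z)" using m by simp
 show "mdeg 1 (pull (Dg z) (md (%y. zf p q (M y)) (g z)))" using m[of M "g z"] by (simp add: mdeg_def hdeg_def pull_def)
 fix i j w
 have dim: "mdim p q (md (%y. zf p q (f y)) y)" for f :: "complex ^ 'n => _" and y by (rule mdim_md) simp
 show "md (%y. zf p q (M (g y))) z i j [w] = pull (Dg z) (md (%y. zf p q (M y)) (g z)) i j [w]"
 proof (cases "i < p & j < q")
  case True
  have "g z : S'" using z gS by auto
  hence "(%y. M y $$ (i, j)) differentiable (at (g z))" using True smooth_dble[OF fnf.Qm_entry[OF ff_sm[OF S'] M]] by blast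
  from frechet_compose[OF z this] show ?thesis using True by (simp add: md_zf_single pull_def)
 next
  case False
  thus ?thesis using dim[of "%y. M (g y)" z] dim[of M "g z"] by (auto simp: mdim_def pull_def fun_apps)
 qed
qed

lemma chern_pull:
 assumes z: "z : S" and H': "smm S' r r H'" "!!y. y : S' ==> H' y : cmat r r" and H: "!!y. y : S ==> H y = H' (g y)"
 shows "chern r H z = pull (Dg z) (chern r H' (g z))"
proof (rule mdeg1_eqI)
 show "mdeg 1 (chern r H z)" by (rule chernD)
 show "mdeg 1 (pull (Dg z) (chern r H' (g z)))" using chernD(1)[of r H' "g z"] by (simp add: mdeg_def hdeg_def pull_def)
 fix i j w
 have gz: "g z : S'" using z gS by auto
 show "chern r H z i j [w] = pull (Dg z) (chern r H' (g z)) i j [w]"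
 proof (cases "i < r & j < r")
  case True
  have "Dm10 r H z w = Dm10 r H' (g z) (Dg z w)" unfolding Dm10_def
  proof (rule cong_mat[OF refl refl], unfold case_prod_conv)
   fix i j assume ij: "i < r" "j < r"
   have "(%y. H' y $$ (i, j)) differentiable (at (g z))" using smooth_dble[OF fnf.Qm_entry[OF ff_sm[OF S'] H'(1) ij] gz] .
   from frechet_compose[OF z this]
   have "fd (%y. H y $$ (i, j)) z w = fd (%y. H' y $$ (i, j)) (g z) (Dg z w)" for w using fd_cong(1)[OF S z, of "%y. H y $$ (i, j)" "%y. H' (g y) $$ (i, j)"] H by simp
   thus "(fd (%y. H y $$ (i, j)) z w - \<i> * fd (%y. H y $$ (i, j)) z (\<i> *s w)) / 2 =
    (fd (%y. H' y $$ (i, j)) (g z) (Dg z w) - \<i> * fd (%y. H' y $$ (i, j)) (g z) (\<i> *s Dg z w)) / 2" by (simp add: vec_hol_linear(2)[OF g z])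
  qed
  thus ?thesis using True H[OF z] by (simp add: chern_single pull_def)
 next
  case False
  thus ?thesis using chernD(2)[of r H z] chernD(2)[of r H' "g z"] by (auto simp: mdim_def pull_def fun_apps)
 qed
qed

lemma curv_pull:
 assumes z: "z : S" and H': "smm S' r r H'" "!!y. y : S' ==> hermitian_metric r (H' y)" and H: "!!y. y : S ==> H y = H' (g y)"
 shows "curv r (chern r H) z = pull (Dg z) (curv r (chern r H') (g z))"
proof -
 have gz: "g z : S'" using z gS by auto
 note t = chern_pull[OF _ H'(1) hmD(1)[OF H'(2)] H]
 note sm = chern_mclin(3)[OF S' gz H'(2,1)]
 note cl = chern_mclin(1)[OF S' _ H'(2,1)]
 have "md (chern r H) z = pull (Dg z) (md (chern r H') (g z))"
 proof (intro ext)
  fix i j vs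
  show "md (chern r H) z i j vs = pull (Dg z) (md (chern r H') (g z)) i j vs" unfolding md_def pull_def
  proof (rule ed_pullback[OF S z S' gS g])
   show "esm S' (%y. chern r H' y i j)" using sm by (simp add: msm_def)
   show "hdeg 1 (chern r H' y i j)" "clin (%w. chern r H' y i j [w])" if "y : S'" for y using cl[OF that] by (simp_all add: mclin_def mdeg_def)
   show "chern r H y i j vs = chern r H' (g y) i j (map (Dg y) vs)" if "y : S" for y vs using t[OF that] by (simp add: pull_def)
  qed
 qed
 moreover have "chern r H z = pull (Dg z) (chern r H' (g z))" by (rule chern_pull[OF z H'(1) _ H]) (use hmD(1)[OF H'(2)] in auto)
 ultimately show ?thesis unfolding curv_def pull_simps pull_mw by simp
qed

end

lemma malt_curv:
 fixes H :: "complex ^ 'n::finite => complex mat"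
 assumes S: "open S" "z : S" and H: "!!y. y : S ==> hermitian_metric r (H y)" and sm: "smm S r r H"
 shows "malt 2 (curv r (chern r H) z)"
proof -
 note cl = chern_mclin(1)[OF S(1) _ H sm]
 have "alt 2 (md (chern r H) z i j)" for i j unfolding md_def
 proof (rule ed_complex_linear(2)[OF S])
  show "esm S (%y. chern r H y i j)" using chern_mclin(3)[OF S H sm] by (simp add: msm_def)
  show "hdeg 1 (chern r H y i j)" "clin (%w. chern r H y i j [w])" if "y : S" for y using cl[OF that] by (simp_all add: mclin_def mdeg_def)
 qed
 moreover have "malt (1 + 1) (mw r (chern r H z) (chern r H z))" by (intro malt_mw mclin_alt cl S)
 ultimately show ?thesis unfolding curv_def malt_def plus_fun_apply[of "md (chern r H) z"] plus_fun_apply[of "md (chern r H) z _"] by (simp only: one_add_one) (intro allI alt_add, auto)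
qed

section \<open>Holomorphic matrices and morphisms of bundles\<close>

lemma massoc: "dim_col A = dim_row B ==> dim_col B = dim_row C ==> A * B * C = A * (B * C)" by (rule assoc_mult_mat[of A "dim_row A" "dim_col A" B "dim_col B" C "dim_col C"]) (rule carrier_matI; simp)+

lemma mat_one: "dim_row A = n ==> idm n * A = (A :: complex mat)" "dim_col A = n ==> A * idm n = (A :: complex mat)" by (rule left_mult_one_mat[of A n "dim_col A"], rule carrier_matI, simp, simp)
  (rule right_mult_one_mat[of A "dim_row A" n], rule carrier_matI, simp, simp)

lemma ctr_dim [simp]: "dim_row (ctr A) = dim_col A" "dim_col (ctr A) = dim_row A" by (simp_all add: ctr_def)

lemmas mat_dims = massoc mat_one

lemma mat_cancel: "A * B = (idm n :: complex mat) ==> dim_col A = dim_row B ==> dim_col B = dim_row C ==> dim_row C = n ==> A * (B * C) = C" by (simp add: mat_one flip: massoc)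

locale hol_atlas =
 fixes \<A> :: "('x::t2_space, 'n::finite) chart set"
 assumes atlas: "holomorphic_atlas \<A>"
begin

abbreviation patch :: "('x, 'n) chart => 'x set => (complex ^ 'n) set" where "patch c W == snd c ` (W Int fst c)"

lemma chart_homeo: "c : \<A> ==> homeomorphism (fst c) (snd c ` fst c) (snd c) (ci c)"
 and chart_open: "c : \<A> ==> open (fst c)" "c : \<A> ==> open (snd c ` fst c)"
 and chart_cover: "EX c:\<A>. x : fst c"
 and chart_trans: "c : \<A> ==> d : \<A> ==> hol_on (snd c ` (fst c Int fst d)) (%z. snd d (ci c z) $ i)" using atlas unfolding holomorphic_atlas_def by (blast, blast, blast, blast, blast)

lemma ci [simp]: "c : \<A> ==> x : fst c ==> ci c (snd c x) = x" using chart_homeo by (simp add: homeomorphism_def)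

lemma opatch: "c : \<A> ==> open W ==> open (patch c W)"
proof -
 assume c: "c : \<A>" and W: "open W"
 have "openin (top_of_set (snd c ` fst c)) (snd c ` (fst c Int W))" by (rule homeomorphism_imp_open_map[OF chart_homeo[OF c]]) (simp add: openin_open_Int W)
 thus ?thesis using chart_open(2)[OF c] openin_open_eq by (metis Int_commute)
qed

lemma patchE: "z : patch c W ==> c : \<A> ==> (!!x. x : W ==> x : fst c ==> z = snd c x ==> ci c z = x ==> P) ==> P" by auto

lemma hol_mat_p: "open W ==> c : \<A> ==> hol_mat \<A> W a b g ==> holo_mat (patch c W) a b (%z. g (ci c z))" by (subst fnf.Qm_def[OF ff_hol[OF opatch]]) (simp_all add: hol_mat_def hol_fun_def)

lemma hol_matI:
 assumes W: "open W" and h: "!!c. c : \<A> ==> holo_mat (patch c W) a b (%z. g (ci c z))"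
 shows "hol_mat \<A> W a b g"
proof -
 have q: "z : patch c W ==> g (ci c z) : cmat a b"
  "i < a ==> j < b ==> hol_on (patch c W) (%z. g (ci c z) $$ (i, j))" if c: "c : \<A>" for c z i j using fnf.Qm_carrier[OF ff_hol[OF opatch[OF c W]] h[OF c]]
   fnf.Qm_entry[OF ff_hol[OF opatch[OF c W]] h[OF c]] by blast+
 show ?thesis unfolding hol_mat_def hol_fun_def
 proof (intro conjI ballI allI impI)
  fix x assume x: "x : W"
  obtain c where c: "c : \<A>" "x : fst c" using chart_cover by blast
  hence "snd c x : patch c W" using x by blast
  thus "g x : cmat a b" using q(1)[OF c(1), of "snd c x"] c by simp
 qed (rule q(2))
qed

lemma holo_mat_subset: "open S ==> open T ==> holo_mat S a b g ==> T <= S ==> holo_mat T a b g" unfolding fnf.Qm_def[OF ff_hol] using hol_on_subset by blast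

lemma smooth_mat_subset: "open S ==> open T ==> smm S a b g ==> T <= S ==> smm T a b g" unfolding fnf.Qm_def[OF ff_sm] using smooth_on_subset by blast

lemma hol_mat_mono:
 assumes "open W" "open V" "hol_mat \<A> W a b g" "V <= W"
 shows "hol_mat \<A> V a b g"
proof (rule hol_matI[OF assms(2)])
 fix c assume c: "c : \<A>"
 show "holo_mat (patch c V) a b (%z. g (ci c z))" by (rule holo_mat_subset[OF opatch[OF c assms(1)] opatch[OF c assms(2)] hol_mat_p[OF assms(1) c assms(3)]])
   (use assms(4) in blast)
qed

context
 fixes W :: "'x set" assumes W: "open W"
begin

lemma hol_mat_mult:
 assumes "hol_mat \<A> W a b g" "hol_mat \<A> W b c h"
 shows "hol_mat \<A> W a c (%x. g x * h x)" by (rule hol_matI[OF W], rule fnf.Qm_mult[OF ff_hol[OF opatch[OF _ W]]])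
  (auto simp del: split_paired_All intro: hol_mat_p[OF W] assms)

lemma hol_mat_add:
 assumes "hol_mat \<A> W a b g" "hol_mat \<A> W a b h"
 shows "hol_mat \<A> W a b (%x. g x + h x)" by (rule hol_matI[OF W], rule fnf.Qm_add[OF ff_hol[OF opatch[OF _ W]]]) (auto intro: hol_mat_p[OF W] assms)

lemma hol_mat_smult:
 assumes "hol_mat \<A> W a b g"
 shows "hol_mat \<A> W a b (%x. k *m g x)" by (rule hol_matI[OF W], rule fnf.Qm_smult[OF ff_hol[OF opatch[OF _ W]]]) (auto intro: hol_mat_p[OF W] assms)

lemma hol_mat_const: "A : cmat a b ==> hol_mat \<A> W a b (%_. A)" by (rule hol_matI[OF W], rule fnf.Qm_const[OF ff_hol[OF opatch[OF _ W]]])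

lemma hol_mat_minv:
 assumes "hol_mat \<A> W a a g" "!!x. x : W ==> det (g x) ~= 0"
 shows "hol_mat \<A> W a a (%x. minv (g x))"
proof (rule hol_matI[OF W])
 fix c assume c: "c : \<A>"
 show "holo_mat (patch c W) a a (%z. minv (g (ci c z)))"
 proof (rule fnf.Qm_minv[OF ff_hol[OF opatch[OF c W]] hol_mat_p[OF W c assms(1)]])
  fix z assume "z : patch c W"
  thus "det (g (ci c z)) ~= 0" using assms(2) c by (elim patchE) simp_all
 qed
qed

lemma hol_mat_cong:
 assumes "hol_mat \<A> W a b g" "!!x. x : W ==> g x = h x"
 shows "hol_mat \<A> W a b h"
proof (rule hol_matI[OF W])
 fix c assume c: "c : \<A>"
 show "holo_mat (patch c W) a b (%z. h (ci c z))"
 proof (rule fnf.Qm_cong[OF ff_hol[OF opatch[OF c W]] hol_mat_p[OF W c assms(1)]])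
  fix z assume "z : patch c W"
  thus "g (ci c z) = h (ci c z)" using assms(2) c by (elim patchE) simp_all
 qed
qed

end

lemma hol_mat_carrier: "hol_mat \<A> W a b g ==> x : W ==> g x : cmat a b" by (simp add: hol_mat_def)

abbreviation hb where "hb E == hol_herm_bundle \<A> E"
abbreviation hm where "hm E F fi == hol_morphism \<A> E F fi"

definition lex :: "('x => complex mat) => ('x => complex mat) => ('x => complex mat) => 'x => complex mat" where
 "lex e f fi x = minv (f x) * fi x * e x"

lemma hbD:
 assumes "hb E"
 shows "(\<Union>(U, e)\<in>frames E. U) = UNIV"
  "ALL (U, e):frames E. open U & (ALL x:U. e x : cmat (rank E) (rank E) & invertible_mat (e x))"
  "ALL (U, e):frames E. ALL (V, f):frames E. EX g. hol_mat \<A> (U Int V) (rank E) (rank E) g & (ALL x:U Int V. e x = f x * g x)"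
  "ALL x. hermitian_metric (rank E) (metric E x)"
  "ALL (U, e):frames E. ALL i<rank E. ALL j<rank E. smooth_fun \<A> U (%x. gram E e x $$ (i, j))" using assms unfolding hol_herm_bundle_def by simp_all

lemma frameD:
 assumes "hb E" "(U, e) : frames E"
 shows "open U" "x : U ==> e x : cmat (rank E) (rank E)" "x : U ==> det (e x) ~= 0"
  "x : U ==> minv (e x) : cmat (rank E) (rank E)" "x : U ==> e x * minv (e x) = idm (rank E)"
  "x : U ==> minv (e x) * e x = idm (rank E)"
proof -
 have *: "open U" "!!x. x : U ==> e x : cmat (rank E) (rank E) & invertible_mat (e x)" using bspec[OF hbD(2)[OF assms(1)] assms(2)] by auto
 thus "open U" and c: "x : U ==> e x : cmat (rank E) (rank E)" by blast+
 show d: "x : U ==> det (e x) ~= 0" using *(2) invertible_det by blast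
 show "x : U ==> minv (e x) : cmat (rank E) (rank E)" "x : U ==> e x * minv (e x) = idm (rank E)"
  "x : U ==> minv (e x) * e x = idm (rank E)" using minv[OF c d] by blast+
qed

lemma frame_cover: "hb E ==> EX (U, e):frames E. x : U" using hbD(1)[of E] by (auto simp: set_eq_iff)

lemma metricD: "hb E ==> hermitian_metric (rank E) (metric E x)" using hbD(4) by (rule spec)

lemma lex_eq:
 assumes E: "hb E" "(U, e) : frames E" and F: "hb F" "(V, f) : frames F" and x: "x : U" "x : V"
  and fi: "fi x : cmat (rank F) (rank E)"
 shows "lex e f fi x : cmat (rank F) (rank E)" "f x * lex e f fi x = fi x * e x"
proof -
 note e = frameD[OF E] and f = frameD[OF F]
 show "lex e f fi x : cmat (rank F) (rank E)" unfolding lex_def using e(2)[OF x(1)] f(4)[OF x(2)] fi by auto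
 show "f x * lex e f fi x = fi x * e x" unfolding lex_def using e(2)[OF x(1)] f(2,4)[OF x(2)] fi mat_cancel[OF f(5)[OF x(2)]] by (simp add: mat_dims)
qed

lemma lex_unique:
 assumes E: "hb E" "(U, e) : frames E" and F: "hb F" "(V, f) : frames F" and x: "x : U" "x : V"
  and fi: "fi x : cmat (rank F) (rank E)" and g: "g : cmat (rank F) (rank E)" "fi x * e x = f x * g"
 shows "lex e f fi x = g"
proof -
 note e = frameD[OF E] and f = frameD[OF F]
 have "lex e f fi x = minv (f x) * (f x * g)" unfolding lex_def g(2)[symmetric] using e(2)[OF x(1)] f(4)[OF x(2)] fi by auto
 thus ?thesis using mat_cancel[OF f(6)[OF x(2)]] f(2,4)[OF x(2)] g(1) by (simp add: mat_dims)
qed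

lemma hom_iff:
 assumes E: "hb E" and F: "hb F"
 shows "hm E F fi \<longleftrightarrow> (ALL x. fi x : cmat (rank F) (rank E)) &
  (ALL (U, e):frames E. ALL (V, f):frames F. hol_mat \<A> (U Int V) (rank F) (rank E) (lex e f fi))"
proof (intro iffI conjI; (elim conjE)?)
 assume h: "hm E F fi"
 thus c: "ALL x. fi x : cmat (rank F) (rank E)" by (simp add: hol_morphism_def)
 show "ALL (U, e):frames E. ALL (V, f):frames F. hol_mat \<A> (U Int V) (rank F) (rank E) (lex e f fi)"
 proof clarify
  fix U e V f assume e: "(U, e) : frames E" and f: "(V, f) : frames F"
  obtain g where g: "hol_mat \<A> (U Int V) (rank F) (rank E) g" "ALL x:U Int V. fi x * e x = f x * g x" using h e f unfolding hol_morphism_def by blast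
  show "hol_mat \<A> (U Int V) (rank F) (rank E) (lex e f fi)"
  proof (rule hol_mat_cong[OF _ g(1)])
   show "open (U Int V)" using frameD(1)[OF E e] frameD(1)[OF F f] by blast
  next
   fix x assume x: "x : U Int V"
   thus "g x = lex e f fi x" using lex_unique[OF E e F f _ _ spec[OF c] hol_mat_carrier[OF g(1) x]] g(2) by simp
  qed
 qed
next
 assume c: "ALL x. fi x : cmat (rank F) (rank E)"
  and l: "ALL (U, e):frames E. ALL (V, f):frames F. hol_mat \<A> (U Int V) (rank F) (rank E) (lex e f fi)"
 show "hm E F fi" unfolding hol_morphism_def
 proof (intro conjI c, clarify)
  fix U e V f assume e: "(U, e) : frames E" and f: "(V, f) : frames F"
  hence "hol_mat \<A> (U Int V) (rank F) (rank E) (lex e f fi)" using l by blast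
  moreover have "ALL x:U Int V. fi x * e x = f x * lex e f fi x" using lex_eq(2)[OF E e F f _ _ spec[OF c]] by simp
  ultimately show "EX g. hol_mat \<A> (U Int V) (rank F) (rank E) g & (ALL x:U Int V. fi x * e x = f x * g x)" by blast
 qed
qed

lemma homD:
 assumes "hb E" "hb F" "hm E F fi"
 shows "fi x : cmat (rank F) (rank E)"
  and "(U, e) : frames E ==> (V, f) : frames F ==> hol_mat \<A> (U Int V) (rank F) (rank E) (lex e f fi)" using assms(3) unfolding hom_iff[OF assms(1,2)] by blast+

lemma lex_comp:
 assumes E: "hb E" "(U, e) : frames E" and F: "hb F" "(V, f) : frames F" and G: "hb G" "(W, g) : frames G"
  and x: "x : U" "x : V" "x : W"
  and fi: "fi x : cmat (rank F) (rank E)" and qs: "qs x : cmat (rank G) (rank F)"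
 shows "lex e g (%x. qs x * fi x) x = lex f g qs x * lex e f fi x"
proof (rule lex_unique[OF E G x(1,3)])
 note e = frameD[OF E] and f = frameD[OF F] and g = frameD[OF G]
 note l1 = lex_eq[where fi=fi, OF E F x(1,2) fi] and l2 = lex_eq[where fi=qs, OF F G x(2,3) qs]
 show "qs x * fi x : cmat (rank G) (rank E)" using fi qs by simp
 show "lex f g qs x * lex e f fi x : cmat (rank G) (rank E)" using l1 l2 by simp
 have "qs x * fi x * e x = qs x * (f x * lex e f fi x)" unfolding l1(2) by (rule assoc_mult_mat[OF qs fi e(2)[OF x(1)]])
 also have "... = (qs x * f x) * lex e f fi x" by (rule assoc_mult_mat[OF qs f(2)[OF x(2)] l1(1), symmetric])
 also have "... = g x * (lex f g qs x * lex e f fi x)" unfolding l2(2)[symmetric] by (rule assoc_mult_mat[OF g(2)[OF x(3)] l2(1) l1(1)])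
 finally show "qs x * fi x * e x = g x * (lex f g qs x * lex e f fi x)" .
qed

lemma hom_one: "hb E ==> hm E E (%_. idm (rank E))" unfolding hol_morphism_def
proof (intro conjI, simp, clarify)
 fix U e V f assume E: "hb E" and e: "(U, e) : frames E" and f: "(V, f) : frames E"
 obtain g where g: "hol_mat \<A> (U Int V) (rank E) (rank E) g" "ALL x:U Int V. e x = f x * g x" using bspec[OF bspec[OF hbD(3)[OF E] e, unfolded case_prod_conv] f] by auto
 have "idm (rank E) * e x = e x" if "x : U" for x using frameD(2)[OF E e that] by (intro mat_one(1)) simp
 thus "EX g. hol_mat \<A> (U Int V) (rank E) (rank E) g & (ALL x:U Int V. idm (rank E) * e x = f x * g x)" using g by (intro exI[of _ g] conjI ballI) (blast, metis IntD1)
qed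

text \<open>It suffices to check holomorphy of a morphism in one pair of frames around each point that the
  frames cover; in particular an endomorphism only has to be checked with equal frames.\<close>
lemma hol_morphism_endoI:
 assumes E: "hb E" and c: "!!x. fi x : cmat (rank E) (rank E)"
  and l: "!!U e. (U, e) : frames E ==> hol_mat \<A> U (rank E) (rank E) (lex e e fi)"
 shows "hm E E fi" unfolding hom_iff[OF E E]
proof (intro conjI allI c, clarify)
 fix U e V f assume e: "(U, e) : frames E" and f: "(V, f) : frames E"
 have o: "open U" "open (U Int V)" using frameD(1)[OF E e] frameD(1)[OF E f] by auto
 show "hol_mat \<A> (U Int V) (rank E) (rank E) (lex e f fi)"
 proof (rule hol_mat_cong[OF o(2) hol_mat_mult[OF o(2) homD(2)[OF E E hom_one[OF E] e f] hol_mat_mono[OF o l[OF e]]]])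
  fix x assume "x : U Int V"
  thus "lex e f (%_. idm (rank E)) x * lex e e fi x = lex e f fi x" using lex_comp[OF E e E e E f, of x fi "%_. idm (rank E)"] c[of x] by (simp add: lex_def)
 qed simp
qed

lemma hom_comp:
 assumes E: "hb E" and F: "hb F" and G: "hb G" and fi: "hm E F fi" and qs: "hm F G qs"
 shows "hm E G (%x. qs x * fi x)" unfolding hom_iff[OF E G]
proof (intro conjI allI, goal_cases)
 case (1 x)
 show ?case using homD(1)[OF E F fi] homD(1)[OF F G qs] by (metis mult_c)
next
 case 2
 show ?case
 proof clarify
  fix U e W g assume e: "(U, e) : frames E" and g: "(W, g) : frames G"
  have loc: "hol_mat \<A> (U Int V Int W) (rank G) (rank E) (lex e g (%x. qs x * fi x))" if f: "(V, f) : frames F" for V f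
  proof -
   have o: "open (U Int V)" "open (V Int W)" "open (U Int V Int W)" using frameD(1)[OF E e] frameD(1)[OF F f] frameD(1)[OF G g] by auto
   have "hol_mat \<A> (U Int V Int W) (rank G) (rank E) (%x. lex f g qs x * lex e f fi x)" by (rule hol_mat_mult[OF o(3) hol_mat_mono[OF o(2,3) homD(2)[OF F G qs f g]]
       hol_mat_mono[OF o(1,3) homD(2)[OF E F fi e f]]]) auto
   thus ?thesis by (rule hol_mat_cong[OF o(3)])
     (use lex_comp[where fi=fi and qs=qs, OF E e F f G g] homD(1)[OF E F fi] homD(1)[OF F G qs] in auto)
  qed
  show "hol_mat \<A> (U Int W) (rank G) (rank E) (lex e g (%x. qs x * fi x))" unfolding hol_mat_def
  proof (intro conjI ballI allI impI)
   fix x assume x: "x : U Int W"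
   obtain V f where "(V, f) : frames F" "x : V" using frame_cover[OF F, of x] by blast
   thus "lex e g (%x. qs x * fi x) x : cmat (rank G) (rank E)" using hol_mat_carrier[OF loc] x by blast
  next
   fix i j assume ij: "i < rank G" "j < rank E"
   show "hol_fun \<A> (U Int W) (%x. lex e g (%x. qs x * fi x) x $$ (i, j))" unfolding hol_fun_def hol_on_def
   proof (intro ballI)
    fix c z assume c: "c : \<A>" and z: "z : patch c (U Int W)"
    obtain V f where f: "(V, f) : frames F" "ci c z : V" using frame_cover[OF F] by blast
    have "z : patch c (U Int V Int W)" using z f(2) c by auto
    thus "EX D. ((%z. lex e g (%x. qs x * fi x) (ci c z) $$ (i, j)) has_derivative D) (at z) & clin D" using loc[OF f(1)] ij c unfolding hol_mat_def hol_fun_def hol_on_def by blast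
   qed
  qed
 qed
qed

lemma lex_add:
 assumes E: "hb E" "(U, e) : frames E" and F: "hb F" "(V, f) : frames F" and x: "x : U" "x : V"
  and c: "fi x : cmat (rank F) (rank E)" "qs x : cmat (rank F) (rank E)"
 shows "lex e f (%x. fi x + qs x) x = lex e f fi x + lex e f qs x" "lex e f (%x. k *m fi x) x = k *m lex e f fi x"
proof -
 note e = frameD(2)[OF E x(1)] and f = frameD(4)[OF F x(2)]
 show "lex e f (%x. fi x + qs x) x = lex e f fi x + lex e f qs x" unfolding lex_def mult_add_distrib_mat[OF f c] by (rule add_mult_distrib_mat[OF _ _ e]) (use f c in auto)
 show "lex e f (%x. k *m fi x) x = k *m lex e f fi x" unfolding lex_def mult_smult_distrib[OF f c(1)] by (rule mult_smult_assoc_mat[OF _ e]) (use f c in auto)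
qed

lemma hom_add:
 assumes E: "hb E" and F: "hb F" and fi: "hm E F fi" and qs: "hm E F qs"
 shows "hm E F (%x. fi x + qs x)" "hm E F (%x. k *m fi x)"
proof -
 note c = homD(1)[OF E F fi] homD(1)[OF E F qs]
 have l: "hol_mat \<A> (U Int V) (rank F) (rank E) (lex e f (%x. fi x + qs x))"
  "hol_mat \<A> (U Int V) (rank F) (rank E) (lex e f (%x. k *m fi x))"
  if e: "(U, e) : frames E" and f: "(V, f) : frames F" for U e V f
 proof -
  have o: "open (U Int V)" using frameD(1)[OF E e] frameD(1)[OF F f] by auto
  note h = homD(2)[OF E F fi e f] homD(2)[OF E F qs e f] and a = lex_add[where fi=fi and qs=qs, OF E e F f _ _ c]
  show "hol_mat \<A> (U Int V) (rank F) (rank E) (lex e f (%x. fi x + qs x))" by (rule hol_mat_cong[OF o hol_mat_add[OF o h]]) (simp add: a)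
  show "hol_mat \<A> (U Int V) (rank F) (rank E) (lex e f (%x. k *m fi x))" by (rule hol_mat_cong[OF o hol_mat_smult[OF o h(1)]]) (simp add: a)
 qed
 show "hm E F (%x. fi x + qs x)" "hm E F (%x. k *m fi x)" unfolding hom_iff[OF E F] using l c by auto
qed

section \<open>The metric in a frame\<close>

lemma gram_eq:
 assumes "hb E" "(U, e) : frames E" "x : U"
 shows "gram E e x = ctr (e x) * metric E x * e x"
proof (rule eq_matI)
 note e = frameD(2)[OF assms] and m = hmD(1)[OF metricD[OF assms(1)], of x]
 fix i j assume "i < dim_row (ctr (e x) * metric E x * e x)" "j < dim_col (ctr (e x) * metric E x * e x)"
 hence "i < rank E" "j < rank E" using e by auto
 thus "gram E e x $$ (i, j) = (ctr (e x) * metric E x * e x) $$ (i, j)" unfolding congruence_entry[OF m e `i < rank E` `j < rank E`] by (simp add: gram_def)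
qed (use frameD(2)[OF assms] in "simp_all add: gram_def ctr_def")

lemma hermitian_metric_congruence:
 assumes H: "hermitian_metric r H" and e: "e : cmat r q" and inj: "!!s. s : cvec q ==> e *V s = zv r ==> s = zv q"
 shows "hermitian_metric q (ctr e * H * e)"
proof -
 note m = hmD(1)[OF H]
 have h: "herm (ctr e * H * e) s t = herm H (e *V s) (e *V t)" if "s : cvec q" "t : cvec q" for s t
  using herm_right[OF m e that(1), of "e *V t"] herm_left[OF _ e that, of "H * e"] m e assoc_mult_mat[OF ctr_c[OF e] m e] by simp
 show ?thesis unfolding hermitian_metric_def
 proof (intro conjI ballI impI)
  show "ctr e * H * e : cmat q q" using m e by (intro carrier_matI) simp_all
  show "herm (ctr e * H * e) s t = cnj (herm (ctr e * H * e) t s)" if "s : cvec q" "t : cvec q" for s t using H that e unfolding h[OF that] h[OF that(2,1)] hermitian_metric_def by (meson mult_mat_vec_carrier)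
  fix s :: "complex Matrix.vec" assume s: "s : cvec q" "s ~= zv q"
  hence "e *V s ~= zv r" using inj by blast
  thus "0 < herm (ctr e * H * e) s s" using H s e unfolding h[OF s(1) s(1)] hermitian_metric_def by (meson mult_mat_vec_carrier)
 qed
qed

lemma gram_hermitian:
 assumes "hb E" "(U, e) : frames E" "x : U"
 shows "hermitian_metric (rank E) (gram E e x)" unfolding gram_eq[OF assms]
proof (rule hermitian_metric_congruence[OF metricD[OF assms(1)] frameD(2)[OF assms]])
 note f = frameD[OF assms(1,2)]
 fix s assume s: "s : cvec (rank E)" "e x *V s = zv (rank E)"
 have "s = (minv (e x) * e x) *V s" using f(6)[OF assms(3)] s(1) by simp
 also have "... = minv (e x) *V (e x *V s)" by (rule assoc_mult_mat_vec[OF f(4)[OF assms(3)] f(2)[OF assms(3)] s(1)])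
 finally show "s = zv (rank E)"  using f(4)[OF assms(3)] unfolding s(2) by (auto intro!: eq_vecI)
qed

lemma gram_smooth:
 assumes E: "hb E" "(U, e) : frames E" and c: "c : \<A>"
 shows "smm (patch c U) (rank E) (rank E) (%z. gram E e (ci c z))" unfolding fnf.Qm_def[OF ff_sm[OF opatch[OF c frameD(1)[OF E]]]]
proof (intro conjI ballI allI impI)
 have "smooth_fun \<A> U (%x. gram E e x $$ (i, j))" if "i < rank E" "j < rank E" for i j using bspec[OF hbD(5)[OF E(1)] E(2)] that by simp
 thus "smooth_on (patch c U) (%z. gram E e (ci c z) $$ (i, j))" if "i < rank E" "j < rank E" for i j using that c unfolding smooth_fun_def by blast
qed (simp add: gram_def)

lemma lex_adjoint:
 assumes E: "hb E" "(U, e) : frames E" and F: "hb F" "(V, f) : frames F" and x: "x : U" "x : V"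
  and fi: "fi x : cmat (rank F) (rank E)" and N: "N x : cmat (rank E) (rank F)"
  and adj: "metric E x * N x = ctr (fi x) * metric F x"
 shows "gram E e x * lex f e N x = ctr (lex e f fi x) * gram F f x"
proof -
 note e = frameD(2)[OF E x(1)] and f = frameD(2)[OF F x(2)]
 note mE = hmD(1)[OF metricD[OF E(1)], of x] and mF = hmD(1)[OF metricD[OF F(1)], of x]
 note l1 = lex_eq[where fi=fi, OF E F x fi] and l2 = lex_eq[where fi=N, OF F E x(2,1) N]
 have "gram E e x * lex f e N x = ctr (e x) * (metric E x * (e x * lex f e N x))" unfolding gram_eq[OF E x(1)] using e mE l2 by (simp add: mat_dims)
 also have "... = ctr (e x) * ((metric E x * N x) * f x)" unfolding l2(2) using e f mE N by (simp add: mat_dims)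
 also have "... = (ctr (e x) * ctr (fi x)) * (metric F x * f x)" unfolding adj using e f mF fi by (simp add: mat_dims)
 also have "... = (ctr (lex e f fi x) * ctr (f x)) * (metric F x * f x)" using ctr_mult[OF fi e] ctr_mult[OF f l1(1)] l1(2) by simp
 also have "... = ctr (lex e f fi x) * gram F f x" unfolding gram_eq[OF F x(2)] using l1(1) f mF by (simp add: mat_dims)
 finally show ?thesis .
qed

end

section \<open>Local expressions of the critical equation\<close>

lemma mw_list_cong:
 assumes "list_all2 (%A B. ALL i<r. ALL j<r. A i j = B i j) As Bs" "i < r" "j < r"
 shows "mwedge_list r As i j = mwedge_list r Bs i j" using assms
proof (induction As Bs arbitrary: i rule: list_all2_induct)
 case (Cons A As B Bs)
 have "mwedge_list r (A # As) i j = (SUM k<r. wedge (A i k) (mwedge_list r As k j))" by (simp add: mwedge_list_def mw_sum)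
 also have "... = (SUM k<r. wedge (B i k) (mwedge_list r Bs k j))" by (rule sum.cong[OF refl]) (use Cons in simp)
 finally show ?case by (simp add: mwedge_list_def mw_sum)
qed (simp add: mwedge_list_def)

lemma sym_prod_cong:
 assumes l: "list_all2 (%A B. fst A = fst B & (ALL i<r. ALL j<r. snd A i j = snd B i j)) As Bs" and ij: "i < r" "j < r"
 shows "sym_prod r As i j = sym_prod r Bs i j"
proof
 fix vs
 have len: "length As = length Bs" using list_all2_lengthD[OF l] .
 have m: "map fst As = map fst Bs" by (rule nth_equalityI) (use len list_all2_nthD[OF l] in auto)
 have "mwedge_list r (map (%k. snd (As ! si k)) [0..<length As]) i j = mwedge_list r (map (%k. snd (Bs ! si k)) [0..<length Bs]) i j"
  if "si permutes {..<length As}" for si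
 proof (rule mw_list_cong[OF _ ij], unfold len, rule list_all2_all_nthI)
  fix k assume "k < length (map (%k. snd (As ! si k)) [0..<length Bs])"
  hence "k < length As" "si k < length As" using permutes_in_image[OF that, of k] len by auto
  thus "ALL i<r. ALL j<r. (map (%k. snd (As ! si k)) [0..<length Bs] ! k) i j = (map (%k. snd (Bs ! si k)) [0..<length Bs] ! k) i j" using list_all2_nthD[OF l, of "si k"] len by simp
 qed simp
 thus "sym_prod r As i j vs = sym_prod r Bs i j vs" unfolding sym_prod_def m by (intro arg_cong2[where f="(/)"] sum.cong) (auto simp: len)
qed

text \<open>The trace in the sub-solution condition; the symmetrised product is replaced by \<open>Xk\<close>.\<close>
definition tau :: "(nat => 'v ext) => nat => nat => 'v mext => 'v mext => 'v mext => 'v ext" where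
 "tau ze n r F A B = (\<Sum>k = 1..n. wedge (ze k) (mtr r (Xk r F A B k)))"

definition vm :: "nat => ('v => complex mat) => 'v mext" where
 "vm r v i j = (if i < r & j < r then one_ext (%w. v w $$ (i, j)) else 0)"

lemma vm_basic: "mdeg 1 (vm r v)" "mdim r r (vm r v)" by (auto simp: vm_def mdeg_def mdim_def hdeg_one_ext[simplified] hdeg_zero)

lemma vm_single: "vm r v i j [w] = (if i < r & j < r then v w $$ (i, j) else 0)" by (simp add: vm_def one_ext_def fun_apps)

lemma sym_prod_tau:
 fixes ze :: "nat => ('v::real_vector) ext"
 assumes F: "!!i j. i < r ==> j < r ==> R i j = F i j" "mdeg 2 F" "mdim r r F"
 shows "(SUM i<r. \<Sum>k = 1..n. of_nat k * wedge (ze k) (sym_prod r (replicate (k - 1) (2, R) @ [(1, mone a), (1, mone b)]) i i) vs)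
  = tau ze n r F (vm r a) (vm r b) vs"
proof -
 have e: "sym_prod r (replicate (k - 1) (2, R) @ [(1, mone a), (1, mone b)]) i i =
   sym_prod r (replicate (k - 1) (2, F) @ [(1, vm r a), (1, vm r b)]) i i" if "i < r" for k i by (rule sym_prod_cong[OF list_all2_appendI that that])
   (auto simp: list_all2_conv_all_nth F nth_Cons vm_def mone_def split: nat.split)
 have "(SUM i<r. of_nat k * wedge (ze k) (sym_prod r (replicate (k - 1) (2, R) @ [(1, mone a), (1, mone b)]) i i) vs) =
   wedge (ze k) (mtr r (Xk r F (vm r a) (vm r b) k)) vs" if k: "k : {1..n}" for k
 proof -
  have "mtr r (Xk r F (vm r a) (vm r b) k) = (SUM i<r. (%vs. of_nat k * sym_prod r (replicate (k - 1) (2, F) @ [(1, vm r a), (1, vm r b)]) i i vs))"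
   using sym_prod_trace[OF F(3) vm_basic(2) vm_basic(2) F(2) vm_basic(1) vm_basic(1), of k a b] k by (intro ext) (simp add: sum_app)
  hence "wedge (ze k) (mtr r (Xk r F (vm r a) (vm r b) k)) vs = (SUM i<r. of_nat k * wedge (ze k)
    (sym_prod r (replicate (k - 1) (2, F) @ [(1, vm r a), (1, vm r b)]) i i) vs)" by (simp add: wedge_sum_right wedge_scale_right sum_app)
  also have "... = (SUM i<r. of_nat k * wedge (ze k) (sym_prod r (replicate (k - 1) (2, R) @ [(1, mone a), (1, mone b)]) i i) vs)" by (rule sum.cong[OF refl]) (simp only: e lessThan_iff)
  finally show ?thesis by simp
 qed
 thus ?thesis unfolding tau_def by (subst sum.swap) (simp add: sum_app)
qed

lemma adjoint_wrt_eq: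
 assumes H: "hermitian_metric r H" and M: "M : cmat r r"
 shows "adjoint_wrt r H M = minv H * (ctr M * H)"
proof -
 note h = hmD[OF H] and i = minv[OF hmD(1,3)[OF H]]
 have iff: "(ALL s:cvec r. ALL t:cvec r. herm H (M *V s) t = herm H s (N *V t)) \<longleftrightarrow> ctr N * H = H * M"
  if N: "N : cmat r r" for N
 proof
  assume *: "ALL s:cvec r. ALL t:cvec r. herm H (M *V s) t = herm H s (N *V t)"
  show "ctr N * H = H * M" by (rule herm_eqI[of _ r r]) (use N M h * herm_right[OF h(1) M] herm_left[OF h(1) N] in auto)
 qed (use N M h herm_right[OF h(1) M] herm_left[OF h(1) N] in auto)
 have c2: "ctr N * H = H * M \<longleftrightarrow> H * N = ctr M * H" if N: "N : cmat r r" for N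
 proof -
  have "ctr (ctr N * H) = H * N" "ctr (H * M) = ctr M * H" using ctr_mult[OF ctr_c[OF N] h(1)] ctr_mult[OF h(1) M] by (simp_all add: h(2) ctr_ctr)
  thus ?thesis by (metis ctr_ctr)
 qed
 have c3: "H * N = ctr M * H \<longleftrightarrow> N = minv H * (ctr M * H)" if N: "N : cmat r r" for N using mat_cancel[OF i(3), of N] mat_cancel[OF i(2), of "ctr M * H"] h N M i by auto
 have c: "minv H * (ctr M * H) : cmat r r" using i h M by (intro carrier_matI) simp_all
 show ?thesis unfolding adjoint_wrt_def
 proof (rule the_equality)
  show "minv H * (ctr M * H) : cmat r r & (ALL s:cvec r. ALL t:cvec r. herm H (M *V s) t = herm H s (minv H * (ctr M * H) *V t))" unfolding iff[OF c] c2[OF c] c3[OF c] using c by simp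
  fix N assume N: "N : cmat r r & (ALL s:cvec r. ALL t:cvec r. herm H (M *V s) t = herm H s (N *V t))"
  hence "N : cmat r r" ..
  from N[unfolded iff[OF this] c2[OF this] c3[OF this]] show "N = minv H * (ctr M * H)" ..
 qed
qed

context hol_atlas
begin

definition cu :: "'x herm_bundle => ('x => complex mat) => ('x, 'n) chart => complex ^ 'n => (complex ^ 'n) mext" where
 "cu E e c z = smul (- 1 / (2 * \<i> * of_real pi)) (curv (rank E) (chern (rank E) (%z. gram E e (ci c z))) z)"

lemma gram_patch:
 assumes "hb E" "(U, e) : frames E" "c : \<A>" "z : patch c U"
 shows "hermitian_metric (rank E) (gram E e (ci c z))" using assms(4,3) by (elim patchE) (simp_all add: gram_hermitian[OF assms(1,2)])

lemma metric_pair_frames: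
 assumes E: "hb E" "(U, e) : frames E" and F: "hb F" "(V, f) : frames F" and c: "c : \<A>"
 shows "metric_pair (patch c (U Int V)) (rank E) (rank F) (%z. gram E e (ci c z)) (%z. gram F f (ci c z))"
proof
 note oU = frameD(1)[OF E] and oV = frameD(1)[OF F]
 show o: "open (patch c (U Int V))" using opatch[OF c open_Int[OF oU oV]] .
 show "hermitian_metric (rank E) (gram E e (ci c y))" if "y : patch c (U Int V)" for y by (rule gram_patch[OF E c]) (use that in blast)
 show "hermitian_metric (rank F) (gram F f (ci c y))" if "y : patch c (U Int V)" for y by (rule gram_patch[OF F c]) (use that in blast)
 show "smm (patch c (U Int V)) (rank E) (rank E) (%z. gram E e (ci c z))" by (rule smooth_mat_subset[OF opatch[OF c oU] o gram_smooth[OF E c]]) blast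
 show "smm (patch c (U Int V)) (rank F) (rank F) (%z. gram F f (ci c z))" by (rule smooth_mat_subset[OF opatch[OF c oV] o gram_smooth[OF F c]]) blast
qed

lemma cu_basic: "mdeg 2 (cu E e c z)" "mdim (rank E) (rank E) (cu E e c z)"
proof -
 let ?t = "chern (rank E) (%z. gram E e (ci c z))"
 have "mdeg (Suc 1) (md ?t z)" "mdeg (1 + 1) (mw (rank E) (?t z) (?t z))" by (rule mdeg_md[OF chernD(1)], rule mdeg_mw[OF chernD(1) chernD(1)])
 thus "mdeg 2 (cu E e c z)" unfolding cu_def curv_def by (intro mdeg_smul mdeg_add) (simp_all add: numeral_2_eq_2)
 show "mdim (rank E) (rank E) (cu E e c z)" unfolding cu_def curv_def by (intro mdim_smul mdim_add mdim_md mdim_mw[OF chernD(2) chernD(2)] chernD)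
qed

lemma malt_smul: "malt p A ==> malt p (smul c A)" by (auto simp: malt_def smul_def[abs_def] intro: alt_scale)

context
 fixes E U e c assumes E: "hb E" "(U, e) : frames E" and c: "c : \<A>"
begin

lemma patch_open: "open (patch c U)" by (rule opatch[OF c frameD(1)[OF E]])

lemmas cu_chern = chern_mclin[OF patch_open _ gram_patch[OF E c] gram_smooth[OF E c]]

lemma cu_malt: "z : patch c U ==> malt 2 (cu E e c z)" unfolding cu_def by (rule malt_smul[OF malt_curv[OF patch_open _ gram_patch[OF E c] gram_smooth[OF E c]]])

lemma cu_smooth: "msm (patch c U) (cu E e c)"
proof (cases "patch c U = {}")
 case True
 have "smooth_on {} f" for f :: "complex ^ 'n => complex" using smooth_on_subset[OF smooth_on_cong[OF open_empty _ smooth_const[OF open_empty, of 0], of f]] by auto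
 thus ?thesis by (simp add: True msm_def esm_def)
next
 case False
 then obtain z where z: "z : patch c U" by blast
 show ?thesis unfolding cu_def[abs_def] curv_def by (intro msm_smul msm_add msm_md msm_mw patch_open cu_chern(3)[OF z])
qed

lemma reduced_curvature_cu:
 assumes x: "x : U" "x : fst c" and ij: "i < rank E" "j < rank E"
 shows "reduced_curvature E c e x i j = cu E e c (snd c x) i j"
proof -
 have z: "snd c x : patch c U" using x by blast
 have "conn_curvature (rank E) (%z. mone (chern_connection (rank E) (%y. gram E e (ci c y)) z)) (snd c x) i j =
  curv (rank E) (chern (rank E) (%z. gram E e (ci c z))) (snd c x) i j" by (rule conn_curvature_curv[OF patch_open z _ ij]) (rule cu_chern(4))
 thus ?thesis by (intro ext) (simp add: reduced_curvature_def cu_def smul_def)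
qed

lemma P_form_eq:
 assumes x: "x : U" "x : fst c" and ij: "i < rank E" "j < rank E"
 shows "P_form ze E c e x i j vs = (SUM k<=CARD('n). wedge (ze k c x) (mpow (rank E) (cu E e c (snd c x)) k i j)) vs"
proof -
 have "mwedge_list (rank E) (replicate k (reduced_curvature E c e x)) i j = mpow (rank E) (cu E e c (snd c x)) k i j" for k unfolding mpow_def
  by (rule mw_list_cong[OF _ ij]) (simp add: list_all2_conv_all_nth reduced_curvature_cu[OF x])
 thus ?thesis by (simp add: P_form_def sum_app)
qed

lemma sub_solution_form:
 assumes x: "x : U" "x : fst c"
 shows "(%vs. SUM i<rank E. \<Sum>k = 1..CARD('n). of_nat k *
     wedge (ze k c x) (sym_prod (rank E) (replicate (k - 1) (2, reduced_curvature E c e x) @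
        [(1, mone (%w. \<i> *m v w)), (1, mone (%w. adjoint_wrt (rank E) (gram E e x) (v w)))]) i i) vs) =
  tau (%k. ze k c x) CARD('n) (rank E) (cu E e c (snd c x)) (vm (rank E) (%w. \<i> *m v w))
   (vm (rank E) (%w. adjoint_wrt (rank E) (gram E e x) (v w)))" by (rule ext, rule sym_prod_tau[OF _ cu_basic], rule reduced_curvature_cu[OF x])

end

definition admissible :: "nat => (complex ^ 'n => complex mat) => bool" where
 "admissible r v \<longleftrightarrow> (ALL w. v w : cmat r r) & (ALL i<r. ALL j<r. clin (%w. v w $$ (i, j)))"

definition positive_at where
 "positive_at ze E e c x v \<longleftrightarrow> positive_top (tau (%k. ze k c x) CARD('n) (rank E) (cu E e c (snd c x)) (vm (rank E) (%w. \<i> *m v w))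
   (vm (rank E) (%w. minv (gram E e x) * (ctr (v w) * gram E e x))))"

lemma sub_solution_iff:
 assumes E: "hb E"
 shows "sub_solution \<A> ze E \<longleftrightarrow> (ALL c:\<A>. ALL (U, e):frames E. ALL x:fst c Int U. ALL v. admissible (rank E) v -->
  (EX w. v w ~= zm (rank E) (rank E)) --> positive_at ze E e c x v)"
proof -
 have e: "positive_top (%vs. SUM i<rank E. \<Sum>k = 1..CARD('n). of_nat k *
     wedge (ze k c x) (sym_prod (rank E) (replicate (k - 1) (2, reduced_curvature E c e x) @
        [(1, mone (%w. \<i> *m v w)), (1, mone (%w. adjoint_wrt (rank E) (gram E e x) (v w)))]) i i) vs) \<longleftrightarrow>
   positive_at ze E e c x v"
  if "c : \<A>" "(U, e) : frames E" "x : fst c" "x : U" "admissible (rank E) v" for c U e x v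
 proof -
  have "adjoint_wrt (rank E) (gram E e x) (v w) = minv (gram E e x) * (ctr (v w) * gram E e x)" for w by (rule adjoint_wrt_eq[OF gram_hermitian[OF E that(2,4)]]) (use that(5) in "simp add: admissible_def")
  thus ?thesis unfolding positive_at_def sub_solution_form[OF E that(2,1,4,3)] by simp
 qed
 show ?thesis unfolding sub_solution_def
  apply (intro ball_cong refl)
  apply (clarify)
  apply (intro ball_cong refl all_cong1) using e unfolding admissible_def by blast
qed

lemma P_zero_iff:
 assumes E: "hb E"
 shows "P_critical \<A> ze E \<longleftrightarrow> sub_solution \<A> ze E & (ALL c:\<A>. ALL (U, e):frames E. ALL x:fst c Int U. ALL i<rank E. ALL j<rank E.
  (SUM k<=CARD('n). wedge (ze k c x) (mpow (rank E) (cu E e c (snd c x)) k i j)) = 0)"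
proof -
 have e: "(ALL vs. P_form ze E c e x i j vs = 0) \<longleftrightarrow> (SUM k<=CARD('n). wedge (ze k c x) (mpow (rank E) (cu E e c (snd c x)) k i j)) = 0"
  if "c : \<A>" "(U, e) : frames E" "x : fst c" "x : U" "i < rank E" "j < rank E" for c U e x i j unfolding P_form_eq[OF E that(2,1,4,3,5,6)] fun_eq_iff zero_fun_apply ..
 show ?thesis unfolding P_critical_def
  apply (intro conj_cong ball_cong refl)
  apply clarify
  apply (intro ball_cong refl) using e by blast
qed

end

section \<open>Isometric holomorphic embeddings\<close>

lemma vm_conj:
 assumes J: "J : cmat r rh" and K: "K : cmat rh r" and v: "!!w. v w : cmat rh rh"
  and v': "!!w. v' w = J * (v w * K)"
 shows "vm r v' = mw rh (zf r rh J) (mw rh (vm rh v) (zf rh r K))"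
proof (rule mdeg1_eqI)
 show "mdeg 1 (vm r v')" by (rule vm_basic)
 have "mdeg (0 + (1 + 0)) (mw rh (zf r rh J) (mw rh (vm rh v) (zf rh r K)))" by (intro mdeg_mw vm_basic zf_basic)
 thus "mdeg 1 (mw rh (zf r rh J) (mw rh (vm rh v) (zf rh r K)))" by simp
 fix i j w
 have 1: "mw rh (zf r rh J) (mw rh (vm rh v) (zf rh r K)) i j [w] =
  (SUM a<rh. zf r rh J i a ([] :: 'a list) * (SUM b<rh. vm rh v a b [w] * zf rh r K b j ([] :: 'a list)))" by (simp add: mw_single(1)[of "zf r rh J"] mw_single(2)[of "zf rh r K"])
 show "vm r v' i j [w] = mw rh (zf r rh J) (mw rh (vm rh v) (zf rh r K)) i j [w]"
 proof (cases "i < r & j < r")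
  case True
  have "vm r v' i j [w] = (J * (v w * K)) $$ (i, j)" using True by (simp add: vm_single v')
  also have "... = (SUM a<rh. J $$ (i, a) * (SUM b<rh. v w $$ (a, b) * K $$ (b, j)))" using True J K v[of w] by (simp add: scalar_prod_def atLeast0LessThan)
  finally show ?thesis unfolding 1 using True by (simp add: vm_single zf_def)
 next
  case False
  thus ?thesis unfolding 1 by (auto simp: vm_single zf_def)
 qed
qed

lemma vm_ctrans:
 assumes "!!w. v w : cmat r r"
 shows "vm r (%w. ctr (v w)) = mstar (vm r v)"
proof (rule mdeg1_eqI[OF vm_basic(1) mdeg_mstar[OF vm_basic(1)]])
 fix i j w
 show "vm r (%w. ctr (v w)) i j [w] = mstar (vm r v) i j [w]" using ctr_index[OF assms] by (simp add: vm_single mstar_def)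
qed

lemma vm_smul:
 assumes "!!w. v w : cmat r r"
 shows "vm r (%w. c *m v w) = smul c (vm r v)"
proof (rule mdeg1_eqI[OF vm_basic(1) mdeg_smul[OF vm_basic(1)]])
 fix i j w
 have "dim_row (v w) = r" "dim_col (v w) = r" using assms[of w] by auto
 thus "vm r (%w. c *m v w) i j [w] = smul c (vm r v) i j [w]" by (simp add: vm_single smul_def)
qed

lemma tau_conjugate:
 assumes F: "mw r F' J = mw rh J F"
  and A: "A' = mw rh J (mw rh A K)" and B: "B' = mw rh J (mw rh B K)"
  and KJ: "mw r K J = zf rh rh (idm rh)"
  and dim: "mdim r rh J" "mdim rh r K" "mdim rh rh F" "mdim rh rh A" "mdim rh rh B" and deg: "mdeg 0 K"
 shows "tau ze n r F' A' B' = tau ze n rh F A B" unfolding tau_def mtr_Xk_conjugate[OF assms] ..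

lemma wedge_hdeg0_commute: "hdeg 0 bt ==> wedge al bt = wedge bt al" using wedge_commute[of 0 bt al] by simp

text \<open>Isometry is expressed through a holomorphic adjoint \<open>ka\<close> that is a left inverse. An isometric inclusion is parallel
 exactly because its adjoint is holomorphic.\<close>
locale isometric_embedding = hol_atlas \<A> for \<A> :: "('x::t2_space, 'n::finite) chart set" +
 fixes G E :: "'x herm_bundle" and io ka :: "'x => complex mat"
 assumes G: "hb G" and E: "hb E" and iota: "hm G E io" and kappa: "hm E G ka"
  and retract: "!!x. ka x * io x = idm (rank G)"
  and adj: "!!x. metric G x * ka x = ctr (io x) * metric E x"
begin

abbreviation "rG == rank G"
abbreviation "rE == rank E"

lemma carriers: "io x : cmat rE rG" "ka x : cmat rG rE" using homD(1)[OF G E iota] homD(1)[OF E G kappa] by auto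

context
 fixes c W f U e assumes c: "c : \<A>" and f: "(W, f) : frames G" and e: "(U, e) : frames E"
begin

lemma lex_retract:
 assumes x: "x : W" "x : U"
 shows "lex e f ka x * lex f e io x = idm rG"
proof -
 note fc = frameD(2)[OF G f x(1)]
 have "lex f f (%x. ka x * io x) x = lex e f ka x * lex f e io x" by (rule lex_comp[OF G f E e G f]) (use x carriers in auto)
 moreover have "lex f f (%x. ka x * io x) x = idm rG" by (rule lex_unique[OF G f G f x(1,1)]) (use fc in "simp_all add: retract mat_one")
 ultimately show ?thesis by simp
qed

lemma lex_carriers:
 assumes x: "x : W" "x : U"
 shows "lex f e io x : cmat rE rG" "lex e f ka x : cmat rG rE" using lex_eq(1)[OF G f E e x carriers(1)] lex_eq(1)[OF E e G f x(2,1) carriers(2)] .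

lemma retract_zf:
 assumes x: "x : W" "x : U"
 shows "mw rE (zf rG rE (lex e f ka x)) (zf rE rG (lex f e io x)) = (zf rG rG (idm rG) :: 'v mext)" unfolding zf_mult[OF lex_carriers(2)[OF x] lex_carriers(1)[OF x], symmetric] lex_retract[OF x] ..

lemma iota_parallel:
 assumes z: "z : patch c (W Int U)"
 shows "nab rG (chern rG (%z. gram G f (ci c z))) rE (chern rE (%z. gram E e (ci c z)))
   (%z. zf rE rG (lex f e io (ci c z))) z = 0"
  and "mw rE (cu E e c z) (zf rE rG (lex f e io (ci c z))) = mw rG (zf rE rG (lex f e io (ci c z))) (cu G f c z)"
proof -
 interpret p: metric_pair "patch c (W Int U)" rG rE "%z. gram G f (ci c z)" "%z. gram E e (ci c z)" by (rule metric_pair_frames[OF G f E e c])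
 have o: "open (W Int U)" "open (U Int W)" using frameD(1)[OF G f] frameD(1)[OF E e] by auto
 have hJ: "holo_mat (patch c (W Int U)) rE rG (%z. lex f e io (ci c z))" by (rule hol_mat_p[OF o(1) c homD(2)[OF G E iota f e]])
 have hK: "holo_mat (patch c (W Int U)) rG rE (%z. lex e f ka (ci c z))" using hol_mat_p[OF o(2) c homD(2)[OF E G kappa e f]] by (simp only: Int_commute)
 have a: "gram G f (ci c y) * lex e f ka (ci c y) = ctr (lex f e io (ci c y)) * gram E e (ci c y)"
  if "y : patch c (W Int U)" for y using that c by (elim patchE) (simp_all add: lex_adjoint[where fi=io and N=ka, OF G f E e _ _ carriers adj])
 have par: "nab rG (chern rG (%z. gram G f (ci c z))) rE (chern rE (%z. gram E e (ci c z)))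
   (%z. zf rE rG (lex f e io (ci c z))) z = 0" if z: "z : patch c (W Int U)" for z by (rule p.adjoint_holomorphic_parallel[OF z hJ hK a])
 show "nab rG (chern rG (%z. gram G f (ci c z))) rE (chern rE (%z. gram E e (ci c z)))
   (%z. zf rE rG (lex f e io (ci c z))) z = 0" by (rule par[OF z])
 show "mw rE (cu E e c z) (zf rE rG (lex f e io (ci c z))) = mw rG (zf rE rG (lex f e io (ci c z))) (cu G f c z)" unfolding cu_def mw_smul_left mw_smul_right
  by (rule arg_cong[where f="smul _"], rule p.parallel_curvature[OF z holo_smooth_mat[OF p.S hJ] par])
qed

end

text \<open>The inclusion intertwines the curvatures. A direction \<open>v\<close> on the subbundle is extended to \<open>io v ka\<close> on the ambient
 bundle, which does not change the trace, and the critical equation restricts by compressing powers of the curvature.\<close>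
theorem critical_subbundle:
 assumes "P_critical \<A> ze E"
 shows "P_critical \<A> ze G"
proof -
 let ?n = "CARD('n)"
 have subE: "ALL c:\<A>. ALL (U, e):frames E. ALL x:fst c Int U. ALL v. admissible rE v --> (EX w. v w ~= zm rE rE) --> positive_at ze E e c x v"
  and PE: "ALL c:\<A>. ALL (U, e):frames E. ALL x:fst c Int U. ALL i<rE. ALL j<rE.
   (SUM k<=?n. wedge (ze k c x) (mpow rE (cu E e c (snd c x)) k i j)) = 0" using assms unfolding P_zero_iff[OF E] sub_solution_iff[OF E] by blast+
 have pos: "positive_at ze G f c x v"
  if c: "c : \<A>" and f: "(W, f) : frames G" and x: "x : fst c" "x : W" and v: "admissible rG v" and nz: "v w ~= zm rG rG" for c W f x v w
 proof -
  obtain U e where e: "(U, e) : frames E" "x : U" using frame_cover[OF E, of x] by blast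
  note xs = x(2) e(2)
  define J K where "J = lex f e io x" and "K = lex e f ka x"
  note JK = lex_carriers[OF c f e(1) xs, folded J_def K_def] and KJ = lex_retract[OF c f e(1) xs, folded J_def K_def]
  have vc: "v w : cmat rG rG" for w using v by (simp add: admissible_def)
  define v' where "v' w = J * (v w * K)" for w
  have v'c: "v' w : cmat rE rE" for w unfolding v'_def using JK vc[of w] by (intro carrier_matI) simp_all
  have bk: "K * (v' w * J) = v w" for w unfolding v'_def using JK vc[of w] by (simp add: massoc mat_cancel[OF KJ] KJ mat_one)
  have vm': "vm rE v' = mw rG (zf rE rG J) (mw rG (vm rG v) (zf rG rE K))" by (rule vm_conj[OF JK vc v'_def])
  have "mclin (vm rG v)" unfolding mclin_def using v vm_basic(1)[of rG v] by (auto simp: admissible_def vm_single clin_iff)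
  hence "mclin (vm rE v')" unfolding vm' by (intro mclin_mw(1)[OF zf_basic(1)] mclin_mw(2)[OF zf_basic(1)])
  hence cl: "clin (%w. vm rE v' i j [w])" for i j by (simp add: mclin_def)
  have "clin (%w. v' w $$ (i, j))" if "i < rE" "j < rE" for i j using cl[of i j] that by (simp add: vm_single)
  hence adm: "admissible rE v'" using v'c by (simp add: admissible_def)
  have "v' w ~= zm rE rE"
  proof
   assume "v' w = zm rE rE"
   hence "v w = zm rG rG" using bk[of w] JK by simp
   thus False using nz by simp
  qed
  hence "positive_at ze E e c x v'" using subE c e x adm by blast
  moreover have "tau (%k. ze k c x) ?n rE (cu E e c (snd c x)) (vm rE (%w. \<i> *m v' w)) (vm rE (%w. minv (gram E e x) * (ctr (v' w) * gram E e x)))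
   = tau (%k. ze k c x) ?n rG (cu G f c (snd c x)) (vm rG (%w. \<i> *m v w)) (vm rG (%w. minv (gram G f x) * (ctr (v w) * gram G f x)))"
  proof (rule tau_conjugate[where J="zf rE rG J" and K="zf rG rE K"])
   have z: "snd c x : patch c (W Int U)" using xs x by blast
   show "mw rE (cu E e c (snd c x)) (zf rE rG J) = mw rG (zf rE rG J) (cu G f c (snd c x))" using iota_parallel(2)[OF c f e(1) z] c x by (simp add: J_def)
   show "vm rE (%w. \<i> *m v' w) = mw rG (zf rE rG J) (mw rG (vm rG (%w. \<i> *m v w)) (zf rG rE K))" by (simp add: vm_smul[OF v'c] vm_smul[OF vc] vm' mw_smul_left mw_smul_right)
   note hE = hmD[OF gram_hermitian[OF E e]] and hG = hmD[OF gram_hermitian[OF G f x(2)]]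
   note iE = minv[OF hE(1,3)] and iG = minv[OF hG(1,3)]
   have a: "gram G f x * K = ctr J * gram E e x" unfolding J_def K_def by (rule lex_adjoint[where fi=io and N=ka, OF G f E e(1) xs carriers adj])
   have a': "ctr K * gram G f x = gram E e x * J"
   proof -
    have "ctr (gram G f x * K) = ctr (ctr J * gram E e x)" by (simp add: a)
    thus ?thesis using ctr_mult[OF hG(1) JK(2)] ctr_mult[OF ctr_c[OF JK(1)] hE(1)] by (simp add: hE(2) hG(2) ctr_ctr)
   qed
   show "vm rE (%w. minv (gram E e x) * (ctr (v' w) * gram E e x)) = mw rG (zf rE rG J)
    (mw rG (vm rG (%w. minv (gram G f x) * (ctr (v w) * gram G f x))) (zf rG rE K))"
   proof (rule vm_conj[OF JK])
    fix w
    note d = JK vc[of w] hE(1) hG(1) iE(1) iG(1)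
    show "minv (gram G f x) * (ctr (v w) * gram G f x) : cmat rG rG" using d by (intro carrier_matI) simp_all
    have "ctr (v' w) = ctr K * (ctr (v w) * ctr J)" unfolding v'_def using d by (simp add: ctr_mult[of _ rE rG _ rE] ctr_mult[of _ rG rG _ rE] massoc)
    hence "minv (gram E e x) * (ctr (v' w) * gram E e x) = minv (gram E e x) * (ctr K * (ctr (v w) * (ctr J * gram E e x)))" using d by (simp add: massoc)
    also have "... = minv (gram E e x) * (ctr K * ((gram G f x * minv (gram G f x)) * (ctr (v w) * (gram G f x * K))))" unfolding a iG(2) using d by (simp add: mat_one a[symmetric])
    also have "... = minv (gram E e x) * ((ctr K * gram G f x) * (minv (gram G f x) * (ctr (v w) * (gram G f x * K))))" using d by (simp add: massoc)
    also have "... = J * (minv (gram G f x) * (ctr (v w) * (gram G f x * K)))" unfolding a' using d mat_cancel[OF iE(3)] by (simp add: massoc)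
    finally show "minv (gram E e x) * (ctr (v' w) * gram E e x) = J * (minv (gram G f x) * (ctr (v w) * gram G f x) * K)" using d by (simp add: massoc)
   qed
   show "mw rE (zf rG rE K) (zf rE rG J) = zf rG rG (idm rG)" unfolding J_def K_def by (rule retract_zf[OF c f e(1) xs])
  qed (simp_all add: cu_basic vm_basic)
  ultimately show ?thesis unfolding positive_at_def by simp
 qed
 have P: "(SUM k<=?n. wedge (ze k c x) (mpow rG (cu G f c (snd c x)) k i j)) = 0"
  if c: "c : \<A>" and f: "(W, f) : frames G" and x: "x : fst c" "x : W" and ij: "i < rG" "j < rG" for c W f x i j
 proof -
  obtain U e where e: "(U, e) : frames E" "x : U" using frame_cover[OF E, of x] by blast
  note xs = x(2) e(2)
  define J K where "J = (zf rE rG (lex f e io x) :: (complex ^ 'n) mext)" and "K = (zf rG rE (lex e f ka x) :: (complex ^ 'n) mext)"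
  have z: "snd c x : patch c (W Int U)" using xs x by blast
  let ?FE = "cu E e c (snd c x)" and ?FG = "cu G f c (snd c x)"
  have F: "mw rE ?FE J = mw rG J ?FG" using iota_parallel(2)[OF c f e(1) z] c x by (simp add: J_def)
  have KJ: "mw rE K J = zf rG rG (idm rG)" unfolding J_def K_def by (rule retract_zf[OF c f e(1) xs])
  have pw: "mpow rG ?FG k i j = mw rE K (mw rE (mpow rE ?FE k) J) i j" for k
  proof -
   have "mw rE (mpow rE ?FE k) J = mw rG J (mpow rG ?FG k)" by (rule mpow_intertwine[OF F]) (simp_all add: J_def cu_basic)
   hence "mw rE K (mw rE (mpow rE ?FE k) J) = mw rG (zf rG rG (idm rG)) (mpow rG ?FG k)" by (simp add: KJ flip: mw_assoc)
   thus ?thesis by (simp add: zf_one_entry(1)[OF ij(1)])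
  qed
  have h0: "hdeg 0 (K i a)" for a using zf_basic(1)[of rG rE "lex e f ka x", where 'a = "complex ^ 'n"] unfolding K_def mdeg_def by blast
  have sw: "wedge al (wedge (K i a) bt) = wedge (K i a) (wedge al bt)" for al bt a using wedge_hdeg0_commute[OF h0, of al a] by (metis wedge_assoc)
  have "(SUM k<=?n. wedge (ze k c x) (mpow rG ?FG k i j)) =
   (SUM k<=?n. SUM a<rE. SUM b<rE. wedge (K i a) (wedge (wedge (ze k c x) (mpow rE ?FE k a b)) (J b j)))" by (simp add: pw mw_sum wedge_sum_right sw wedge_assoc)
  also have "... = (SUM a<rE. SUM b<rE. SUM k<=?n. wedge (K i a) (wedge (wedge (ze k c x) (mpow rE ?FE k a b)) (J b j)))" by (subst sum.swap, rule sum.cong[OF refl], rule sum.swap)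
  also have "... = (SUM a<rE. SUM b<rE. wedge (K i a) (wedge (SUM k<=?n. wedge (ze k c x) (mpow rE ?FE k a b)) (J b j)))" by (simp add: wedge_sum_right wedge_sum_left)
  also have "... = 0"
  proof (intro sum.neutral ballI)
   fix a b assume "a : {..<rE}" "b : {..<rE}"
   hence "(SUM k<=?n. wedge (ze k c x) (mpow rE ?FE k a b)) = 0" using PE c e x by blast
   thus "wedge (K i a) (wedge (SUM k<=?n. wedge (ze k c x) (mpow rE ?FE k a b)) (J b j)) = 0" by simp
  qed
  finally show ?thesis .
 qed
 show ?thesis unfolding P_zero_iff[OF G] sub_solution_iff[OF G] using pos P by blast
qed

end

section \<open>Adjoints of holomorphic endomorphisms are holomorphic\<close>

lemma Xk_smul: "Xk r F (smul c A) B k = smul c (Xk r F A B k)" unfolding Xk_def by (simp add: mw_smul_left mw_smul_right smul_sum)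

lemma tau_smul:
 fixes A :: "'v mext"
 shows "tau ze n r F (smul c A) B = (%vs. c * tau ze n r F A B vs)"
proof
 fix vs
 have "mtr r (smul c X) = (%vs. c * mtr r X vs)" for X :: "'v mext" by (rule ext) (rule mtr_smul)
 thus "tau ze n r F (smul c A) B vs = c * tau ze n r F A B vs" by (simp add: tau_def Xk_smul wedge_scale_right sum_app sum_distrib_left)
qed

lemma tau_zero:
 fixes B :: "'v mext"
 shows "tau ze n r F 0 B = 0"
proof -
 have "Xk r F 0 B k = 0" for k unfolding Xk_def by simp
 moreover have "mtr r (0 :: 'v mext) = 0" by (rule ext) (simp add: mtr_def sum_app zero_fun_apply)
 ultimately show ?thesis by (simp add: tau_def)
qed

lemma tau_pull:
 assumes "!!k. k : {1..n} ==> ze k = (%vs. ze' k (map D vs))"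
 shows "tau ze n r (pull D F) (pull D A) (pull D B) vs = tau ze' n r F A B (map D vs)"
proof -
 have "wedge (ze k) (mtr r (Xk r (pull D F) (pull D A) (pull D B) k)) vs = wedge (ze' k) (mtr r (Xk r F A B k)) (map D vs)"
  if "k : {1..n}" for k
 proof -
  have "mtr r (Xk r (pull D F) (pull D A) (pull D B) k) = (%vs. mtr r (Xk r F A B k) (map D vs))" by (rule ext) (simp add: pull_Xk[symmetric] mtr_pull)
  thus ?thesis by (simp add: assms[OF that] wedge_map)
 qed
 thus ?thesis by (simp add: tau_def sum_app)
qed

lemma alt_tau:
 assumes "malt 2 F" "malt p A" "malt q B" "!!k. k : {1..n} ==> alt (2 * (n - k)) (ze k)" "n >= 1"
 shows "alt (2 * n - 2 + p + q) (tau ze n r F A B)" unfolding tau_def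
proof (rule alt_sum)
 fix k assume k: "k : {1..n}"
 have "alt (2 * (n - k) + (2 * (k - 1) + p + q)) (wedge (ze k) (mtr r (Xk r F A B k)))" by (rule alt_wedge[OF assms(4)[OF k] alt_mtr_Xk[OF assms(1-3)]])
 moreover have "2 * (n - k) + (2 * (k - 1) + p + q) = 2 * n - 2 + p + q" using k by auto
 ultimately show "alt (2 * n - 2 + p + q) (wedge (ze k) (mtr r (Xk r F A B k)))" by (simp only:)
qed

lemma esm_tau:
 assumes S: "open S" and "msm S F" "msm S A" "msm S B" and ze: "!!k. k : {1..n} ==> esm S (ze k)"
 shows "esm S (%z. tau (%k. ze k z) n r (F z) (A z) (B z))"
proof -
 have ms: "msm S (%z. SUM k:K. f k z)" if "!!k. k : K ==> msm S (f k)" for K :: "nat set" and f using that unfolding msm_def by (auto simp: sum_app intro!: esm_sum[OF S])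
 show ?thesis unfolding tau_def Xk_def by (intro esm_sum[OF S] esm_wedge[OF S] ze esm_mtr[OF S] ms msm_mw[OF S] msm_mpow[OF S] assms) auto
qed

locale critical_bundle = hol_atlas \<A> for \<A> :: "('x::t2_space, 'n::finite) chart set" +
 fixes ze :: "nat => ('x, 'n) form" and E :: "'x herm_bundle"
 assumes compact: "compact (UNIV :: 'x set)"
  and zeta: "!!k. k <= CARD('n) ==> closed_real_form \<A> (CARD('n) - k) (CARD('n) - k) (ze k)"
  and E: "hb E" and crit: "P_critical \<A> ze E"
begin

abbreviation "r == rank E"
abbreviation "gr c e == (%z. gram E e (ci c z))"
abbreviation "th c e == chern r (gr c e)"
abbreviation "lx c e M == (%z. lex e e M (ci c z))"
abbreviation "zlex c e M == (%z. zf r r (lx c e M z))"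
abbreviation "nl c e M == nab r (th c e) r (th c e) (zlex c e M)"
abbreviation "zt c == (%k z. ze k c (ci c z))"

lemma zeta_facts:
 assumes c: "c : \<A>" and k: "k <= CARD('n)"
 shows "x : fst c ==> alt (2 * (CARD('n) - k)) (ze k c x)" "esm (snd c ` fst c) (zt c k)"
  "z : snd c ` fst c ==> ed (zt c k) z = 0"
  "c' : \<A> ==> x : fst c ==> x : fst c' ==>
   ze k c x vs = ze k c' x (map (fd (%z. snd c' (ci c z)) (snd c x)) vs)"
proof -
 have d: "diff_form \<A> ((CARD('n) - k) + (CARD('n) - k)) (ze k)" and cl: "closed_form \<A> (ze k)" using zeta[OF k] by (auto simp: closed_real_form_def)
 have d1: "ALL c:\<A>. ALL x:fst c. alternating ((CARD('n) - k) + (CARD('n) - k)) (ze k c x)"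
  and d2: "ALL c:\<A>. ALL c':\<A>. ALL x:fst c Int fst c'. ALL vs. ze k c x vs =
    ze k c' x (map (fd (%z. snd c' (ci c z)) (snd c x)) vs)"
  and d3: "ALL c:\<A>. ALL vs. smooth_on (snd c ` fst c) (%z. ze k c (ci c z) vs)" using d unfolding diff_form_def by blast+
 show "x : fst c ==> alt (2 * (CARD('n) - k)) (ze k c x)" using alternating_alt[of "(CARD('n) - k) + (CARD('n) - k)" "ze k c x"] d1 c by (simp add: mult_2)
 show "esm (snd c ` fst c) (zt c k)" using d3 c by (simp add: esm_def)
 show "c' : \<A> ==> x : fst c ==> x : fst c' ==>
   ze k c x vs = ze k c' x (map (fd (%z. snd c' (ci c z)) (snd c x)) vs)" using d2 c by blast
 assume "z : snd c ` fst c"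
 then obtain x where "x : fst c" "z = snd c x" by blast
 thus "ed (zt c k) z = 0" using cl c unfolding closed_form_def by (intro ext) (simp add: zero_fun_apply)
qed

context
 fixes M :: "'x => complex mat"
 assumes Mc: "!!x. M x : cmat r r"
  and Ms: "!!c U e. c : \<A> ==> (U, e) : frames E ==> smm (patch c U) r r (lx c e M)"
begin

text \<open>The identity is an isometric embedding of the bundle into itself, and its matrix is the frame change.\<close>
lemma endo_frame_change:
 assumes c: "c : \<A>" and e: "(U, e) : frames E" and e': "(U', e') : frames E" and x: "x : U" "x : U'" "x : fst c"
 defines "J == zf r r (lex e e' (%_. idm r) x)" and "K == zf r r (lex e' e (%_. idm r) x)"
 shows "nl c e' M (snd c x) = mw r J (mw r (nl c e M (snd c x)) K)"
  and "zlex c e' M (snd c x) = mw r J (mw r (zlex c e M (snd c x)) K)"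
  and "mw r (cu E e' c (snd c x)) J = mw r J (cu E e c (snd c x))"
  and "mw r K J = zf r r (idm r)"
proof -
 interpret i: isometric_embedding \<A> E E "%_. idm r" "%_. idm r"
 proof
  show "metric E x * idm r = ctr (idm r) * metric E x" for x using hmD(1)[OF metricD[OF E], of x] by (simp add: ctr_one)
 qed (use E hom_one[OF E] in auto)
 let ?z = "snd c x"
 let ?S = "patch c (U Int U')"
 have z: "?z : ?S" using x by blast
 have oU: "open U" "open U'" using frameD(1)[OF E e] frameD(1)[OF E e'] by auto
 have o: "open ?S" by (rule opatch[OF c open_Int[OF oU]])
 let ?j = "%z. lex e e' (%_. idm r) (ci c z)"
 have jz: "zf r r (?j ?z) = J" using c x by (simp add: J_def)
 have JK: "mw r J K = zf r r (idm r)" unfolding J_def K_def by (rule i.retract_zf[OF c e' e x(2,1)])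
 show "mw r K J = zf r r (idm r)" unfolding J_def K_def by (rule i.retract_zf[OF c e e' x(1,2)])
 show "mw r (cu E e' c (snd c x)) J = mw r J (cu E e c (snd c x))" using i.iota_parallel(2)[OF c e e' z] unfolding jz .
 have par: "nab r (th c e) r (th c e') (%z. zf r r (?j z)) ?z = 0" by (rule i.iota_parallel(1)[OF c e e' z])
 have lc: "lex e e M x : cmat r r" "lex e' e' M x : cmat r r" "lex e e' (%_. idm r) x : cmat r r"
  if "x : U" "x : U'" for x using lex_eq(1)[where fi=M, OF E e E e that(1,1) Mc] lex_eq(1)[where fi=M, OF E e' E e' that(2,2) Mc]
   lex_eq(1)[where fi="%_. idm r", OF E e E e' that] by auto
 have comm: "lex e' e' M x * lex e e' (%_. idm r) x = lex e e' (%_. idm r) x * lex e e M x" if "x : U" "x : U'" for x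
 proof -
  have "lex e e' (%x. M x * idm r) x = lex e' e' M x * lex e e' (%_. idm r) x" by (rule lex_comp[OF E e E e' E e']) (use that Mc in auto)
  moreover have "lex e e' (%x. idm r * M x) x = lex e e' (%_. idm r) x * lex e e M x" by (rule lex_comp[OF E e E e E e']) (use that Mc in auto)
  moreover have "M x * idm r = idm r * M x" for x using Mc[of x] by simp
  ultimately show ?thesis by simp
 qed
 have zc: "mw r (zlex c e' M y) (zf r r (?j y) :: (complex ^ 'n) mext) = mw r (zf r r (?j y)) (zlex c e M y)" if "y : ?S" for y
 proof -
  from that obtain x where x: "x : U" "x : U'" "x : fst c" "y = snd c x" by blast
  show ?thesis using c x(3) unfolding x(4) by (simp only: ci zf_mult[OF lc(2)[OF x(1,2)] lc(3)[OF x(1,2)], symmetric]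
     zf_mult[OF lc(3)[OF x(1,2)] lc(1)[OF x(1,2)], symmetric] comm[OF x(1,2)])
 qed
 have zc2: "X = mw r J (mw r Y K)" if "mw r X J = mw r J Y" "mdim r r X" for X Y :: "(complex ^ 'n) mext"
 proof -
  have "mw r J (mw r Y K) = mw r (mw r X J) K" by (simp add: that(1) mw_assoc)
  also have "... = X" using zf_one(2)[OF that(2)] by (simp add: mw_assoc JK)
  finally show ?thesis by simp
 qed
 show "zlex c e' M ?z = mw r J (mw r (zlex c e M ?z) K)" by (rule zc2[OF zc[OF z, unfolded jz]]) simp
 have sj: "smm ?S r r ?j" by (rule holo_smooth_mat[OF o hol_mat_p[OF open_Int[OF oU] c homD(2)[OF E E hom_one[OF E] e e']]])
 have s1: "smm ?S r r (lx c e M)" "smm ?S r r (%z. lex e' e' M (ci c z))" by (rule smooth_mat_subset[OF opatch[OF c oU(1)] o Ms[OF c e]], blast)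
   (rule smooth_mat_subset[OF opatch[OF c oU(2)] o Ms[OF c e']], blast)
 have md: "mdf (%z. zf r r (A z)) ?z" if "smm ?S r r A" for A by (rule msm_mdf[OF msm_zf[OF o that] z])
 have mdeq: "md (%y. mw r (zlex c e' M y) (zf r r (?j y))) ?z = md (%y. mw r (zf r r (?j y)) (zlex c e M y)) ?z" by (rule md_cong[OF o z]) (rule zc)
 have "nab r (th c e) r (th c e') (%y. mw r (zlex c e' M y) (zf r r (?j y))) ?z =
   nab r (th c e) r (th c e') (%y. mw r (zf r r (?j y)) (zlex c e M y)) ?z" unfolding nab_def mdeq zc[OF z] ..
 hence "mw r (nl c e' M ?z) J = mw r J (nl c e M ?z)" unfolding nab_mw[OF md[OF s1(2)] md[OF sj] zf_basic(1), of _ _ _ _ _ "th c e'"]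
   nab_mw[OF md[OF sj] md[OF s1(1)] zf_basic(1), of _ _ _ _ _ "th c e"] par jz by simp
 thus "nl c e' M ?z = mw r J (mw r (nl c e M ?z) K)" by (rule zc2) (intro nab_dim zf_basic chernD)
qed

end

lemma chart_change_frame:
 assumes c: "c : \<A>" "c' : \<A>" and e: "(U, e) : frames E"
 shows "chart_change (patch c (U Int fst c')) (patch c' U) (%z. snd c' (ci c z))"
proof
 note oU = frameD(1)[OF E e]
 show "open (patch c (U Int fst c'))" by (rule opatch[OF c(1) open_Int[OF oU chart_open(1)[OF c(2)]]])
 show "open (patch c' U)" by (rule opatch[OF c(2) oU])
 show "(%z. snd c' (ci c z)) ` patch c (U Int fst c') <= patch c' U"
 proof
  fix y assume "y : (%z. snd c' (ci c z)) ` patch c (U Int fst c')"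
  then obtain x where "x : U" "x : fst c'" "x : fst c" "y = snd c' (ci c (snd c x))" by blast
  thus "y : patch c' U" using c by simp
 qed
 show "hol_on (patch c (U Int fst c')) (%z. snd c' (ci c z) $ k)" for k by (rule hol_on_subset[OF chart_trans[OF c]]) blast
qed

lemma endo_chart_change:
 assumes c: "c : \<A>" "c' : \<A>" and e: "(U, e) : frames E" and x: "x : U" "x : fst c" "x : fst c'"
  and Ms: "smm (patch c' U) r r (%z. lex e e M (ci c' z))"
 defines "D == fd (%z. snd c' (ci c z)) (snd c x)"
 shows "nl c e M (snd c x) = pull D (nl c' e M (snd c' x))"
  and "zlex c e M (snd c x) = pull D (zlex c' e M (snd c' x))"
  and "cu E e c (snd c x) = pull D (cu E e c' (snd c' x))"
proof -
 let ?S = "patch c (U Int fst c')" and ?g = "%z. snd c' (ci c z)"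
 interpret g: chart_change ?S "patch c' U" ?g by (rule chart_change_frame[OF c e])
 have z: "snd c x : ?S" using x by blast
 have gz: "?g (snd c x) = snd c' x" using c x by simp
 have inv: "ci c y = ci c' (?g y)" if "y : ?S" for y using that c by auto
 note H' = gram_smooth[OF E e c(2)] gram_patch[OF E e c(2)]
 have cp: "th c e (snd c x) = pull D (th c' e (snd c' x))" unfolding D_def gz[symmetric] by (rule g.chern_pull[OF z H'(1)]) (use inv hmD(1)[OF H'(2)] in auto)
 show "cu E e c (snd c x) = pull D (cu E e c' (snd c' x))" unfolding cu_def pull_simps D_def gz[symmetric] by (rule arg_cong[where f="smul _"], rule g.curv_pull[OF z H']) (use inv in auto)
 show zp: "zlex c e M (snd c x) = pull D (zlex c' e M (snd c' x))" using c x by (simp add: pull_simps)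
 have "md (zlex c e M) (snd c x) = md (%z. zf r r (lex e e M (ci c' (?g z)))) (snd c x)" by (rule md_cong[OF g.S z]) (use inv in auto)
 also have "... = pull D (md (zlex c' e M) (?g (snd c x)))" unfolding D_def by (rule g.md_zf_pull[OF z Ms])
 finally have "md (zlex c e M) (snd c x) = pull D (md (zlex c' e M) (snd c' x))" unfolding gz .
 thus "nl c e M (snd c x) = pull D (nl c' e M (snd c' x))" unfolding nab_def pull_simps(1,2) pull_mw cp zp by simp
qed

abbreviation "ch i == fst i"
abbreviation "fra i == snd (snd i)"
abbreviation "dm i == patch (fst i) (fst (snd i))"
abbreviation "idx == \<A> \<times> frames E"

definition smooth_endo :: "('x => complex mat) => bool" where
 "smooth_endo M \<longleftrightarrow> (ALL x. M x : cmat r r) & (ALL c:\<A>. ALL (U, e):frames E. smm (patch c U) r r (lx c e M))"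

lemma idxD: "i : idx ==> ch i : \<A>" "i : idx ==> (fst (snd i), fra i) : frames E" by auto

lemma tau_transform:
 assumes i: "i : idx" and j: "j : idx" and x: "x : fst (snd i) Int fst (ch i)" "x : fst (snd j) Int fst (ch j)"
  and M: "smooth_endo M" "smooth_endo M'"
 defines "D == fd (%z. snd (ch j) (ci (ch i) z)) (snd (ch i) x)"
  and "y == snd (ch i) x" and "y' == snd (ch j) x"
 shows "tau (%k. ze k (ch i) x) CARD('n) r (cu E (fra i) (ch i) y) (nl (ch i) (fra i) M y) (nl (ch i) (fra i) M' y) vs =
   tau (%k. ze k (ch j) x) CARD('n) r (cu E (fra j) (ch j) y') (nl (ch j) (fra j) M y') (nl (ch j) (fra j) M' y') (map D vs)"
  and "tau (%k. ze k (ch i) x) CARD('n) r (cu E (fra i) (ch i) y) (nl (ch i) (fra i) M y) (zlex (ch i) (fra i) M' y) vs =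
   tau (%k. ze k (ch j) x) CARD('n) r (cu E (fra j) (ch j) y') (nl (ch j) (fra j) M y') (zlex (ch j) (fra j) M' y') (map D vs)"
proof -
 note c = idxD(1)[OF i] idxD(1)[OF j] and e = idxD(2)[OF i] idxD(2)[OF j]
 have Ms: "smm (patch c U) r r (lx c e L)" if "c : \<A>" "(U, e) : frames E" "smooth_endo L" for c U e L using that unfolding smooth_endo_def by blast
 have Mc: "L x : cmat r r" if "smooth_endo L" for L x using that by (simp add: smooth_endo_def)
 have x': "x : fst (snd i)" "x : fst (ch i)" "x : fst (snd j)" "x : fst (ch j)" using x by auto
 define J K where "J = (zf r r (lex (fra i) (fra j) (%_. idm r) x) :: (complex ^ 'n) mext)"
  and "K = (zf r r (lex (fra j) (fra i) (%_. idm r) x) :: (complex ^ 'n) mext)"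
 note p = endo_chart_change[OF c e(1) x'(1,2,4) Ms[OF c(2) e(1)], folded D_def y_def y'_def]
 have q: "nl (ch j) (fra j) L y' = mw r J (mw r (nl (ch j) (fra i) L y') K)"
   "zlex (ch j) (fra j) L y' = mw r J (mw r (zlex (ch j) (fra i) L y') K)"
   "mw r (cu E (fra j) (ch j) y') J = mw r J (cu E (fra i) (ch j) y')"
   "mw r K J = zf r r (idm r)" if L: "smooth_endo L" for L unfolding J_def K_def y'_def by (rule endo_frame_change[OF Mc[OF L] _ c(2) e x'(1,3,4)], rule Ms[OF _ _ L]; assumption)+
 have ze: "ze k (ch i) x = (%vs. ze k (ch j) x (map D vs))" if "k : {1..CARD('n)}" for k using zeta_facts(4)[OF c(1) _ c(2) x'(2,4), of k] that by (auto simp: D_def)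
 have conj: "tau ze' CARD('n) r (cu E (fra j) (ch j) y') A' B' = tau ze' CARD('n) r (cu E (fra i) (ch j) y') A B"
  if "A' = mw r J (mw r A K)" "B' = mw r J (mw r B K)" "mdim r r A" "mdim r r B" for ze' A' B' A B by (rule tau_conjugate[OF q(3)[OF M(1)] that(1,2) q(4)[OF M(1)] _ _ cu_basic(2) that(3,4)]) (simp_all add: J_def K_def)
 have nd: "mdim r r (nl c e M z)" for c :: "('x, 'n) chart" and e M z by (intro nab_dim zf_basic chernD)
 show "tau (%k. ze k (ch i) x) CARD('n) r (cu E (fra i) (ch i) y) (nl (ch i) (fra i) M y) (nl (ch i) (fra i) M' y) vs =
   tau (%k. ze k (ch j) x) CARD('n) r (cu E (fra j) (ch j) y') (nl (ch j) (fra j) M y') (nl (ch j) (fra j) M' y') (map D vs)"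
  unfolding conj[OF q(1)[OF M(1)] q(1)[OF M(2)] nd nd] p(1,3)[OF M(1)] p(1)[OF M(2)] by (rule tau_pull) (rule ze)
 show "tau (%k. ze k (ch i) x) CARD('n) r (cu E (fra i) (ch i) y) (nl (ch i) (fra i) M y) (zlex (ch i) (fra i) M' y) vs =
   tau (%k. ze k (ch j) x) CARD('n) r (cu E (fra j) (ch j) y') (nl (ch j) (fra j) M y') (zlex (ch j) (fra j) M' y') (map D vs)"
  unfolding conj[OF q(1)[OF M(1)] q(2)[OF M(2)] nd zf_basic(2)] p(1,3)[OF M(1)] p(2)[OF M(2)] by (rule tau_pull) (rule ze)
qed

context
 fixes s t :: "'x => complex mat"
 assumes s: "hm E E s" and tc: "!!x. t x : cmat r r" and adj: "!!x. metric E x * t x = ctr (s x) * metric E x"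
begin

definition T where "T c e z = tau (%k. zt c k z) CARD('n) r (cu E e c z) (nl c e s z) (nl c e t z)"
definition Y where "Y c e z = tau (%k. zt c k z) CARD('n) r (cu E e c z) (nl c e s z) (zlex c e t z)"

lemma nl_dim: "mdim r r (nl c e M z)" by (intro nab_dim zf_basic chernD)

context
 fixes c U e assumes c: "c : \<A>" and e: "(U, e) : frames E"
begin

lemma s_hol: "holo_mat (patch c U) r r (lx c e s)" using hol_mat_p[OF frameD(1)[OF E e] c] homD(2)[OF E E s e e] by simp

lemma s_smooth: "smm (patch c U) r r (lx c e s)" by (rule holo_smooth_mat[OF patch_open[OF E e c] s_hol])

lemma t_adjoint: "z : patch c U ==> gr c e z * lx c e t z = ctr (lx c e s z) * gr c e z" using c by (elim patchE) (simp_all add: lex_adjoint[where fi=s and N=t, OF E e E e _ _ homD(1)[OF E E s] tc adj])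

lemma gr_facts:
 assumes "z : patch c U"
 shows "gr c e z : cmat r r" "det (gr c e z) ~= 0" "minv (gr c e z) : cmat r r" "minv (gr c e z) * gr c e z = idm r" using hmD[OF gram_patch[OF E e c assms]] minv by auto

lemma t_smooth: "smm (patch c U) r r (lx c e t)"
proof -
 note o = patch_open[OF E e c]
 note fs = ff_sm[OF o] and g = gram_smooth[OF E e c]
 have "smm (patch c U) r r (%z. minv (gr c e z) * (ctr (lx c e s z) * gr c e z))" by (rule fnf.Qm_mult[OF fs fnf.Qm_minv[OF fs g gr_facts(2)] fnf.Qm_mult[OF fs smooth_mat_ctrans[OF o s_smooth] g]])
 thus ?thesis
 proof (rule fnf.Qm_cong[OF fs])
  fix z assume z: "z : patch c U"
  have "lx c e t z : cmat r r" using z by (elim patchE[OF _ c]) (rule lex_eq(1)[where fi=t, OF E e E e _ _ tc], simp_all)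
  thus "minv (gr c e z) * (ctr (lx c e s z) * gr c e z) = lx c e t z" unfolding t_adjoint[OF z, symmetric] using mat_cancel[OF gr_facts(4)[OF z]] gr_facts(1,3)[OF z] by simp
 qed
qed

context
 fixes z assumes z: "z : patch c U"
begin

lemma nl_s_clin: "mclin (nl c e s z)" by (intro nab_mclin md_zf_mclin[OF patch_open[OF E e c] z s_hol] cu_chern(1)[OF E e c z] zf_basic)

lemma nl_t: "nl c e t z = mw r (zf r r (minv (gr c e z))) (mw r (mstar (nl c e s z)) (zf r r (gr c e z)))"
proof -
 have "mw r (zf r r (gr c e z)) (nl c e t z) = mw r (mstar (nl c e s z)) (zf r r (gr c e z))" using metric_pair.nab_adjoint_zf[OF metric_pair_frames[OF E e E e c], of z] z s_smooth t_smooth t_adjoint by simp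
 moreover have "nl c e t z = mw r (mw r (zf r r (minv (gr c e z))) (zf r r (gr c e z))) (nl c e t z)" unfolding zf_mult[OF gr_facts(3,1)[OF z], symmetric] gr_facts(4)[OF z] by (rule zf_one(1)[OF nl_dim, symmetric])
 ultimately show ?thesis by (simp only: mw_assoc)
qed

text \<open>\<open>\<nabla>s\<close>, a form of type (1,0), is an admissible direction \<open>v\<close> in the sub-solution condition, and its adjoint is \<open>\<nabla>t\<close>.\<close>
lemma T_positive:
 assumes ks: "distinct ks" "set ks = (UNIV :: 'n set)" and fr: "fr = concat (map (%k. [axis k 1, axis k \<i>]) ks)"
 shows "0 <= Re (\<i> * T c e z fr)" "Re (\<i> * T c e z fr) = 0 ==> nl c e s z = 0"
proof -
 obtain x where x: "x : U" "x : fst c" "z = snd c x" using z by blast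
 define v where "v w = mat r r (%(i, j). nl c e s z i j [w])" for w
 have vc: "v w : cmat r r" for w by (simp add: v_def)
 have nd: "mdim r r (nl c e s z)" by (rule nl_dim)
 have vs: "vm r v = nl c e s z"
 proof (rule mdeg1_eqI[OF vm_basic(1)])
  show "mdeg 1 (nl c e s z)" using nl_s_clin by (simp add: mclin_def)
  show "vm r v i j [w] = nl c e s z i j [w]" for i j w using nd by (auto simp: vm_single v_def mdim_def fun_apps)
 qed
 have vt: "vm r (%w. minv (gr c e z) * (ctr (v w) * gr c e z)) = nl c e t z" by (subst vm_conj[OF gr_facts(3,1)[OF z], where v="%w. ctr (v w)"]) (simp_all add: vc vm_ctrans[OF vc] vs nl_t)
 have "0 < \<i> * T c e z fr" if nz: "nl c e s z ~= 0"
 proof -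
  have "admissible r v" using vc nl_s_clin unfolding admissible_def by (simp add: v_def mclin_def)
  moreover have "EX w. v w ~= zm r r"
  proof (rule ccontr)
   assume "~?thesis"
   hence "vm r v = 0" by (intro mdeg1_eqI[OF vm_basic(1)]) (auto simp: vm_single mdeg_def hdeg_zero fun_apps hdeg_def)
   thus False using nz vs by simp
  qed
  ultimately have "positive_at ze E e c x v" using crit c e x unfolding P_zero_iff[OF E] sub_solution_iff[OF E] by blast
  hence "positive_top (tau (%k. ze k c x) CARD('n) r (cu E e c z) (smul \<i> (nl c e s z)) (nl c e t z))" unfolding positive_at_def vm_smul[OF vc] using vt vs x c by simp
  thus ?thesis unfolding positive_top_def tau_smul T_def using ks fr x c by simp
 qed
 moreover have "T c e z fr = 0" if "nl c e s z = 0" using that by (simp add: T_def tau_zero zero_fun_apply)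
 ultimately show "0 <= Re (\<i> * T c e z fr)" "Re (\<i> * T c e z fr) = 0 ==> nl c e s z = 0" by (cases "nl c e s z = 0"; simp add: less_complex_def)+
qed

lemma Y_primitive: "ed (Y c e) z = - T c e z" "esm (patch c U) (Y c e)"
proof -
 note o = patch_open[OF E e c]
 have mth: "msm (patch c U) (th c e)" by (rule cu_chern(3)[OF E e c z])
 have zes: "esm (patch c U) (zt c k)" if "k <= CARD('n)" for k using zeta_facts(2)[OF c that] smooth_on_subset[of "snd c ` fst c" _ "patch c U"] unfolding esm_def by blast
 have ms: "msm (patch c U) (cu E e c)" "msm (patch c U) (nl c e s)" "msm (patch c U) (zlex c e t)" "msm (patch c U) (zlex c e s)" unfolding nab_def[abs_def]
  by (intro cu_smooth[OF E e c] msm_diff msm_add msm_md msm_mw msm_zf[OF o s_smooth] o mth)+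
   (assumption | rule msm_zf[OF o t_smooth] msm_zf[OF o s_smooth])+
 show "esm (patch c U) (Y c e)" unfolding Y_def[abs_def] by (rule esm_tau[OF o ms(1-3)]) (use zes in auto)
 define a where "a = - 1 / (2 * \<i> * complex_of_real pi)"
 let ?R = "curv r (th c e)" and ?s = "zlex c e s z"
 have F: "cu E e c = (%z. smul a (?R z))" by (rule ext) (simp add: cu_def a_def)
 have sm: "mdf ?R z" unfolding curv_def[abs_def] by (intro mdf_add mdf_mw msm_mdf[OF mth z] msm_mdf[OF msm_md[OF o mth] z])
 have msgs: "msg (smul c X) = smul c (msg X)" for c and X :: "(complex ^ 'n) mext" by (intro ext) (simp add: msg_def sg_def smul_def)
 have "cov r (th c e) (cu E e c) z = smul a (cov r (th c e) ?R z)" unfolding F cov_def md_smul[OF sm] msgs mw_smul_left mw_smul_right by (intro ext) (simp add: smul_def fun_apps algebra_simps)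
 also have "... = 0" unfolding cov_curv[OF o z mth chernD(1), of r] by (intro ext) (simp add: smul_def fun_apps)
 finally have covF: "cov r (th c e) (cu E e c) z = 0" .
 have nd1: "mdeg 1 (nl c e s z)" using nl_s_clin by (simp add: mclin_def)
 hence "cov r (th c e) (nl c e s) z = mw r (?R z) ?s - mw r ?s (?R z)" unfolding cov_def using md_nab[OF o z mth mth ms(4) chernD(1) chernD(1) zf_basic(1), of r r] by (simp add: msg_mdeg' mw_minus_left)
 hence covv: "cov r (th c e) (nl c e s) z = smul (inverse a) (mw r (cu E e c z) ?s - mw r ?s (cu E e c z))" unfolding F mw_smul_left mw_smul_right
  by (intro ext) (simp add: smul_def fun_apps a_def right_diff_distrib flip: mult.assoc)
 have covt: "cov r (th c e) (zlex c e t) z = nl c e t z" unfolding cov_def nab_def by (simp add: msg_mdeg')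
 obtain x where x: "x : U" "x : fst c" "z = snd c x" using z by blast
 have P: "(SUM k<=CARD('n). wedge (zt c k z) (mpow r (cu E e c z) k i j)) = 0" if ij: "i < r" "j < r" for i j
 proof -
  have "(SUM k<=CARD('n). wedge (ze k c x) (mpow r (cu E e c (snd c x)) k i j)) = 0" using crit c e ij x unfolding P_zero_iff[OF E] by blast
  thus ?thesis using x c by simp
 qed
 have zee: "sg (zt c k z) = zt c k z" "ed (zt c k) z = 0" if k: "k <= CARD('n)" for k using sg_hdeg[OF alt_hdeg[OF zeta_facts(1)[OF c k x(2)]]] zeta_facts(3)[OF c k, of z] x c by auto
 show "ed (Y c e) z = - T c e z" unfolding Y_def[abs_def] T_def tau_def
  by (rule ed_primitive[OF o z ms(1,2,3) zes zee(2,1) chernD(1) cu_basic(1) nd1 zf_basic(1) chernD(2) cu_basic(2) zf_basic(2) zf_basic(2) covF covv covt P])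
qed

lemma alt_YT: "alt (2 * CARD('n) - 1) (Y c e z)" "alt (2 * CARD('n)) (T c e z)"
proof -
 have n: "CARD('n) >= 1" by (simp add: Suc_leI)
 have ze: "alt (2 * (CARD('n) - k)) (zt c k z)" if "k : {1..CARD('n)}" for k using z c zeta_facts(1)[OF c] that by (elim patchE) auto
 have m: "malt 1 (nl c e s z)" by (rule mclin_alt[OF nl_s_clin])
 have cnj: "alt p (%vs. cnj (al vs))" if "alt p al" for p and al :: "(complex ^ 'n) ext" using that
 proof (induction p arbitrary: al)
  case (Suc p)
  have c: "contr x (%vs. cnj (al vs)) = (%vs. cnj (contr x al vs))" for x and al :: "(complex ^ 'n) ext" by (rule ext) (simp add: contr_def)
  show ?case using Suc by (simp add: c hdeg_def fun_eq_iff fun_apps)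
 qed (simp add: hdeg_def)
 have ms: "malt 1 (mstar (nl c e s z))" using m cnj unfolding malt_def mstar_def[abs_def] by blast
 have "malt (0 + (1 + 0)) (nl c e t z)" unfolding nl_t by (intro malt_mw ms) (simp_all only: alt_hdeg0 zf_basic)
 note a = alt_tau[OF cu_malt[OF E e c z] m _ ze n]
 have "alt (2 * CARD('n) - 2 + 1 + 0) (Y c e z)" unfolding Y_def by (rule a) (simp_all add: alt_hdeg0)
 moreover have "alt (2 * CARD('n) - 2 + 1 + 1) (T c e z)" unfolding T_def by (rule a) (use `malt (0 + (1 + 0)) (nl c e t z)` in simp_all)
 moreover have "2 * CARD('n) - 2 + 1 + 0 = 2 * CARD('n) - 1" "2 * CARD('n) - 2 + 1 + 1 = 2 * CARD('n)" using n by linarith+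
 ultimately show "alt (2 * CARD('n) - 1) (Y c e z)" "alt (2 * CARD('n)) (T c e z)" by (simp_all only:)
qed

end

end

lemma parallel:
 assumes ce: "c : \<A>" "(U, e) : frames E" and z: "z : patch c U"
 shows "nl c e s z = 0"
proof -
 obtain ks where ks: "distinct ks" "set ks = (UNIV :: 'n set)" using finite_distinct_list[of "UNIV :: 'n set"] by auto
 obtain T0 :: "real ^ 'n bit0 => complex ^ 'n" and T0' ms where T0: "linear T0" "linear T0'" "!!y. T0' (T0 y) = y" "!!z. T0 (T0' z) = z"
  "distinct ms" "set ms = (UNIV :: 'n bit0 set)"
  "map T0 (map (%k. axis k 1) ms) = concat (map (%k. [axis k 1, axis k \<i>]) ks)"
 proof (rule frame_coordinates[OF ks], goal_cases)
  case (1 T T' ms)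
  show ?case by (rule 1(1)[of T T' ms], (fact 1)+)
 qed
 let ?W = "%i :: ('x, 'n) chart \<times> ('x set \<times> ('x => complex mat)). fst (snd i) Int fst (fst i)"
 define ee where "ee i = (%z vs. - \<i> * Y (fst i) (fra i) z vs)" for i :: "('x, 'n) chart \<times> ('x set \<times> ('x => complex mat))"
 have dee: "ed (ee i) z = (%vs. \<i> * T (ch i) (fra i) z vs)" if i: "i : idx" and z: "z : dm i" for i z unfolding ee_def ed_scale[OF esm_edf[OF Y_primitive(2)[OF idxD[OF i] z] z]] Y_primitive(1)[OF idxD[OF i] z]
  by (simp add: uminus_apply)
 have se: "smooth_endo s" "smooth_endo t" unfolding smooth_endo_def using homD(1)[OF E E s] tc s_smooth t_smooth by blast+
 have q: "ci (ch i) (snd (ch i) x) = x" if "i : idx" "x : ?W i" for i x by (rule ci[OF idxD(1)[OF that(1)]]) (use that(2) in blast)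
 interpret st: stokes_data idx ?W "%i. snd (ch i)" "%i. ci (ch i)" ee ks T0 T0' ms
 proof (unfold_locales, goal_cases)
  case 1 show ?case by (rule compact)
 next
  case (2 x)
  obtain c U e where "c : \<A>" "x : fst c" "(U, e) : frames E" "x : U" using chart_cover frame_cover[OF E, of x] by blast
  thus ?case by (intro bexI[of _ "(c, (U, e))"]) auto
 next
  case (3 i) show ?case by (rule open_Int[OF frameD(1)[OF E idxD(2)[OF 3]] chart_open(1)[OF idxD(1)[OF 3]]])
 next
  case (4 i) show ?case by (rule patch_open[OF E idxD(2,1)[OF 4]])
 next
  case (5 i) show ?case by (rule homeomorphism_of_subsets[OF chart_homeo[OF idxD(1)[OF 5]]]) auto
 next
  case (6 i j k) show ?case by (rule hol_on_subset[OF chart_trans[OF idxD(1)[OF 6(1)] idxD(1)[OF 6(2)]]]) auto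
 next
  case (7 i)
  show ?case
  proof (cases "dm i = {}")
   case True
   have "smooth_on {} f" for f :: "complex ^ 'n => complex" using smooth_on_cong[OF open_empty _ smooth_const[OF open_empty, of 0], of f] by auto
   thus ?thesis by (simp only: True esm_def) blast
  next
   case False
   thus ?thesis unfolding ee_def by (intro esm_scale[OF patch_open[OF E idxD(2,1)[OF 7]]]) (use Y_primitive(2)[OF idxD[OF 7]] in blast)
  qed
 next
  case (8 i z) show ?case unfolding ee_def by (rule alt_scale[OF alt_YT(1)[OF idxD[OF 8(1)] 8(2)]])
 next
  case (9 i z) show ?case unfolding dee[OF 9] by (rule alt_scale[OF alt_YT(2)[OF idxD[OF 9(1)] 9(2)]])
 next
  case (10 i j x vs)
  have x: "x : ?W i" "x : ?W j" using 10(3) by auto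
  show ?case using tau_transform(2)[OF 10(1,2) x se, of vs] unfolding ee_def Y_def by (simp only: q[OF 10(1) x(1)] q[OF 10(2) x(2)])
 next
  case (11 i j x vs)
  have x: "x : ?W i" "x : ?W j" using 11(3) by auto
  show ?case unfolding dee[OF 11(1) imageI[OF x(1)]] dee[OF 11(2) imageI[OF x(2)]] T_def
    q[OF 11(1) x(1)] q[OF 11(2) x(2)] tau_transform(1)[OF 11(1,2) x se] ..
 qed (use T0 linear_add[OF T0(1)] linear_add[OF T0(2)] linear_scale[OF T0(1)] linear_scale[OF T0(2)] in auto)
 have i: "(c, (U, e)) : idx" "z : dm (c, (U, e))" using ce z by auto
 have "0 <= st.top i z" if "i : idx" "z : dm i" for i z unfolding dee[OF that] by (rule T_positive(1)[OF idxD[OF that(1)] that(2) ks refl])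
 hence "Re (ed (ee (c, (U, e))) z st.fr) = 0" by (rule st.nonnegative_exact_top_form[OF _ i])
 thus ?thesis unfolding dee[OF i] using T_positive(2)[OF ce z ks refl] by simp
qed

text \<open>The covariant derivative of \<open>t\<close> vanishes as the adjoint of that of \<open>s\<close>, and so the differential of the matrix of \<open>t\<close> is of
 type (1,0), like the connection matrix.\<close>
theorem adjoint_holomorphic: "hm E E t"
proof (rule hol_morphism_endoI[OF E tc], rule hol_matI)
 show "open U" if "(U, e) : frames E" for U e by (rule frameD(1)[OF E that])
 fix U e c assume e: "(U, e) : frames E" and c: "c : \<A>"
 show "holo_mat (patch c U) r r (lx c e t)"
 proof (rule holo_matI_mclin[OF patch_open[OF E e c] t_smooth[OF c e]])
  fix z assume z: "z : patch c U"
  have "nl c e t z = 0" unfolding nl_t[OF c e z] parallel[OF c e z] mstar_simps mw_zero ..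
  hence "md (zlex c e t) z = mw r (zlex c e t z) (th c e z) - mw r (th c e z) (zlex c e t z)" unfolding nab_def by (simp add: algebra_simps)
  thus "mclin (md (zlex c e t) z)" by (simp add: mclin_add(2) mclin_mw[OF zf_basic(1)] cu_chern(1)[OF E e c z])
 qed
qed

end

end

section \<open>Hermitian linear algebra\<close>

definition mt :: "complex mat => complex" where "mt A = (SUM i<dim_row A. A $$ (i, i))"

lemma mt_comm:
 assumes "A : cmat m n" "B : cmat n m"
 shows "mt (A * B) = mt (B * A)"
proof -
 have "mt (A * B) = (SUM i<m. SUM k<n. A $$ (i, k) * B $$ (k, i))" using assms by (simp add: mt_def scalar_prod_def atLeast0LessThan)
 also have "... = (SUM k<n. SUM i<m. B $$ (k, i) * A $$ (i, k))" by (subst sum.swap) (simp add: mult.commute)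
 also have "... = mt (B * A)" using assms by (simp add: mt_def scalar_prod_def atLeast0LessThan)
 finally show ?thesis .
qed

lemma mt_smult: "A : cmat n n ==> mt (c *m A) = c * mt A" by (simp add: mt_def sum_distrib_left)

lemma mt_one: "mt (idm n) = of_nat n" by (simp add: mt_def)

lemma wide_kernel:
 assumes C: "(C :: complex mat) : cmat rh r" and "rh < r"
 shows "EX w:cvec r. w ~= zv r & C *V w = zv rh"
proof -
 define A where "A = mat r r (%(i, j). if i < rh then C $$ (i, j) else 0)"
 have A: "A : cmat r r" by (simp add: A_def)
 have "transpose_mat A *V unit_vec r rh = zv r" by (rule eq_vecI) (use A assms in "auto simp: A_def")
 moreover have "unit_vec r rh ~= (zv r :: complex Matrix.vec)"
 proof
  assume "unit_vec r rh = (zv r :: complex Matrix.vec)"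
  hence "unit_vec r rh $v rh = (zv r :: complex Matrix.vec) $v rh" by simp
  thus False using assms by simp
 qed
 ultimately have "det (transpose_mat A) = 0" using det_0_iff_vec_prod_zero[of "transpose_mat A" r] A unit_vec_carrier transpose_carrier_mat by blast
 hence "det A = 0" using det_transpose[OF A] by simp
 then obtain w where w: "w : cvec r" "w ~= zv r" "A *V w = zv r" using det_0_iff_vec_prod_zero[OF A] by blast
 have "C *V w = zv rh"
 proof (rule eq_vecI)
  fix i assume i: "i < dim_vec (zv rh :: complex Matrix.vec)"
  have "row A i = row C i" using i assms C by (intro eq_vecI) (auto simp: A_def)
  moreover have "(A *V w) $v i = 0" using w(3) i assms by simp
  ultimately show "(C *V w) $v i = zv rh $v i" using i assms C A by simp
 qed (use C in simp)
 thus ?thesis using w by blast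
qed

lemma herm_smult:
 assumes "H : cmat r r" "s : cvec r" "t : cvec r"
 shows "herm H (c \<cdot>\<^sub>v s) t = c * herm H s t" "herm H s (c \<cdot>\<^sub>v t) = cnj c * herm H s t" using assms by (simp_all add: herm_sum[OF assms(1)] sum_distrib_left mult_ac)

lemma orthonormal_basis:
 assumes H: "hermitian_metric r H"
 obtains V where "V : cmat r r" "ctr V * H * V = idm r"
proof -
 note h = hmD(1)[OF H]
 have sym: "herm H s t = cnj (herm H t s)" if "s : cvec r" "t : cvec r" for s t using H that unfolding hermitian_metric_def by blast
 have "EX vs. (ALL i<k. vs i : cvec r) & (ALL i<k. ALL j<k. herm H (vs i) (vs j) = (if i = j then 1 else 0))" if "k <= r" for k using that
 proof (induction k)
  case (Suc k)
  then obtain vs where vs: "!!i. i < k ==> vs i : cvec r"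
   "!!i j. i < k ==> j < k ==> herm H (vs i) (vs j) = (if i = j then 1 else 0)" by auto
  define C where "C = mat k r (%(i, j). SUM l<r. H $$ (l, j) * cnj (vs i $v l))"
  have C: "C : cmat k r" by (simp add: C_def)
  obtain w where w: "w : cvec r" "w ~= zv r" "C *V w = zv k" using wide_kernel[OF C] Suc.prems by auto
  have o: "herm H w (vs i) = 0" if i: "i < k" for i
  proof -
   have "herm H w (vs i) = (SUM j<r. (SUM l<r. H $$ (l, j) * cnj (vs i $v l)) * w $v j)" unfolding herm_sum[OF h w(1) vs(1)[OF i]] by (subst sum.swap) (simp add: sum_distrib_left sum_distrib_right mult_ac)
   also have "... = (C *V w) $v i" using i w(1) by (simp add: C_def scalar_prod_def atLeast0LessThan)
   finally show ?thesis using w(3) i by simp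
  qed
  have pos: "0 < herm H w w" using H w unfolding hermitian_metric_def by blast
  define n where "n = Re (herm H w w)"
  have n: "herm H w w = of_real n" "n > 0" using pos by (auto simp: n_def less_complex_def complex_eq_iff)
  define u where "u = (1 / complex_of_real (sqrt n)) \<cdot>\<^sub>v w"
  have uc: "u : cvec r" using w by (simp add: u_def)
  have sq: "complex_of_real (sqrt n) * complex_of_real (sqrt n) = of_real n" using n(2) by (simp flip: of_real_mult)
  have uu: "herm H u u = 1" unfolding u_def using w(1) n sq by (simp add: herm_smult[OF h])
  have uv: "herm H u (vs i) = 0" "herm H (vs i) u = 0" if "i < k" for i
  proof -
   show "herm H u (vs i) = 0" unfolding u_def using w(1) vs(1)[OF that] o[OF that] by (simp add: herm_smult[OF h])
   thus "herm H (vs i) u = 0" using sym[OF vs(1)[OF that] uc] by simp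
  qed
  show ?case by (rule exI[of _ "vs(k := u)"]) (auto simp: less_Suc_eq uu uv vs uc)
 qed simp
 from this[OF order_refl] obtain vs where vs: "!!i. i < r ==> vs i : cvec r"
  "!!i j. i < r ==> j < r ==> herm H (vs i) (vs j) = (if i = j then 1 else 0)" by auto
 define V where "V = mat r r (%(i, j). vs j $v i)"
 have V: "V : cmat r r" by (simp add: V_def)
 have col: "col V j = vs j" if "j < r" for j using vs(1)[OF that] that by (intro eq_vecI) (auto simp: V_def)
 have "ctr V * H * V = idm r"
 proof (rule eq_matI)
  fix i j assume "i < dim_row (idm r :: complex mat)" "j < dim_col (idm r :: complex mat)"
  thus "(ctr V * H * V) $$ (i, j) = idm r $$ (i, j)" using congruence_entry[OF h V, of i j] vs(2)[of j i] by (auto simp: col)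
 qed (use V h in simp_all)
 thus ?thesis using that V by blast
qed

text \<open>In an orthonormal basis this is the sum of the squared moduli of the entries.\<close>
lemma adjoint_trace:
 assumes H: "hermitian_metric r H" and a: "a : cmat r r" and a': "a' : cmat r r" "H * a' = ctr a * H"
 shows "0 <= mt (a' * a)" "mt (a' * a) = 0 ==> a = zm r r"
proof -
 note h = hmD(1)[OF H]
 obtain V where V: "V : cmat r r" "ctr V * H * V = idm r" by (rule orthonormal_basis[OF H])
 have inv: "V * (ctr V * H) = idm r" by (rule mat_mult_left_right_inverse[OF _ V(1) V(2)]) (use V(1) h in "intro carrier_matI, simp_all")
 have "V * (ctr V * (H * a')) = (V * (ctr V * H)) * a'" using V(1) h a'(1) by (simp add: massoc)
 hence "a' = V * (ctr V * (H * a'))" unfolding inv using a'(1) by simp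
 hence e: "a' = V * (ctr V * (ctr a * H))" by (simp only: a'(2))
 have aV: "a * V : cmat r r" using a V(1) by simp
 have "mt (a' * a) = mt (V * (ctr V * (ctr a * (H * a))))" by (subst e) (use V(1) a h in "simp add: massoc")
 also have "... = mt ((ctr V * (ctr a * (H * a))) * V)" by (rule mt_comm[of _ r r]) (use V(1) a h in "auto intro!: carrier_matI")
 also have "... = mt (ctr (a * V) * H * (a * V))" unfolding ctr_mult[OF a V(1)] using V(1) a h by (simp add: massoc)
 also have "... = (SUM i<r. herm H (col (a * V) i) (col (a * V) i))" unfolding mt_def by (rule sum.cong) (use aV V(1) congruence_entry[OF h aV] in "simp_all del: index_mult_mat(1) col_mult2")
 finally have m: "mt (a' * a) = (SUM i<r. herm H (col (a * V) i) (col (a * V) i))" .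
 have c: "col (a * V) i : cvec r" for i using col_dim[of "a * V" i] carrier_matD(1)[OF aV] by simp
 have p: "0 < herm H v v" if "v : cvec r" "v ~= zv r" for v using H that unfolding hermitian_metric_def by blast
 have z: "herm H (zv r) (zv r) = 0" using herm_sum[OF h zero_carrier_vec zero_carrier_vec] by simp
 have nn: "0 <= herm H v v" if "v : cvec r" for v using p[OF that] z by (cases "v = zv r") (auto intro: less_imp_le)
 show "0 <= mt (a' * a)" unfolding m by (intro sum_nonneg nn c)
 assume "mt (a' * a) = 0"
 hence "ALL i:{..<r}. herm H (col (a * V) i) (col (a * V) i) = 0" unfolding m by (subst (asm) sum_nonneg_eq_0_iff) (auto intro: nn c)
 hence col0: "col (a * V) i = zv r" if "i < r" for i using p[OF c, of i] that by fastforce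
 have "a * V = zm r r"
 proof (rule eq_matI)
  fix i j assume "i < dim_row (zm r r :: complex mat)" "j < dim_col (zm r r :: complex mat)"
  thus "(a * V) $$ (i, j) = zm r r $$ (i, j)" using arg_cong[OF col0[of j], of "%v. v $v i"] aV by (simp del: index_mult_mat)
 qed (use aV in auto)
 hence "(a * V) * (ctr V * H) = zm r r * (ctr V * H)" by simp
 moreover have "(a * V) * (ctr V * H) = a * (V * (ctr V * H))" using a V(1) h by (simp add: massoc)
 moreover have "zm r r * (ctr V * H) = zm r r" by (rule left_mult_zero_mat) (use V(1) h in "auto intro!: carrier_matI")
 ultimately show "a = zm r r" using a inv by (simp add: mat_one)
qed

lemma singular_factor:
 assumes D: "(D :: complex mat) : cmat rh rh" and w: "w : cvec rh" "w ~= zv rh" "D *V w = zv rh"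
 shows "EX D1:cmat rh (rh - 1). EX D2:cmat (rh - 1) rh. D = D1 * D2" and "rh > 0"
proof -
 have "EX m<rh. w $v m ~= 0" using w by (metis eq_vecI carrier_vecD index_zero_vec)
 then obtain m where m: "m < rh" "w $v m ~= 0" by blast
 thus "rh > 0" by simp
 let ?K = "{..<rh} - {m}"
 obtain h where h: "bij_betw h {..<rh - 1} ?K" using ex_bij_betw_nat_finite[of ?K] m by (auto simp: atLeast0LessThan)
 let ?c = "%k j. (if k = j then 1 else 0) - (if j = m then w $v k / w $v m else 0)"
 define D1 where "D1 = mat rh (rh - 1) (%(i, k). D $$ (i, h k))"
 define D2 where "D2 = mat (rh - 1) rh (%(k, j). ?c (h k) j)"
 have "D = D1 * D2"
 proof (rule eq_matI)
  fix i j assume "i < dim_row (D1 * D2)" "j < dim_col (D1 * D2)"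
  hence ij: "i < rh" "j < rh" by (auto simp: D1_def D2_def)
  have "(D *V w) $v i = D $$ (i, m) * w $v m + (SUM k:?K. D $$ (i, k) * w $v k)" using D w(1) ij m by (simp add: scalar_prod_def atLeast0LessThan sum.remove[of "{..<rh}" m])
  hence z: "D $$ (i, m) = - (SUM k:?K. D $$ (i, k) * w $v k) / w $v m" using w(3) ij m by (simp add: nonzero_eq_divide_eq eq_neg_iff_add_eq_0 del: divide_minus_left)
  have "(D1 * D2) $$ (i, j) = (SUM k<rh - 1. D $$ (i, h k) * ?c (h k) j)" using ij by (simp add: D1_def D2_def scalar_prod_def atLeast0LessThan)
  also have "... = (SUM k:?K. D $$ (i, k) * ?c k j)" by (rule sum.reindex_bij_betw[OF h])
  also have "... = D $$ (i, j)"
  proof (cases "j = m")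
   case True
   hence "(SUM k:?K. D $$ (i, k) * ?c k j) = (SUM k:?K. - (D $$ (i, k) * w $v k) / w $v m)" by (intro sum.cong) auto
   thus ?thesis unfolding True z by (simp add: sum_negf sum_divide_distrib)
  next
   case False
   hence "(SUM k:?K. D $$ (i, k) * ?c k j) = (SUM k:?K. if k = j then D $$ (i, k) else 0)" by (intro sum.cong) auto
   thus ?thesis using ij False by simp
  qed
  finally show "D $$ (i, j) = (D1 * D2) $$ (i, j)" by simp
 qed (use D in "auto simp: D1_def D2_def")
 moreover have "D1 : cmat rh (rh - 1)" "D2 : cmat (rh - 1) rh" by (simp_all add: D1_def D2_def)
 ultimately show "EX D1:cmat rh (rh - 1). EX D2:cmat (rh - 1) rh. D = D1 * D2" by blast
qed

text \<open>Rank at most \<open>k\<close>, in the form that the minimality argument manipulates.\<close>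
definition factors :: "nat => complex mat => nat => bool" where
 "factors r A k \<longleftrightarrow> (EX B:cmat r k. EX C:cmat k r. A = B * C)"

lemma factors_refl: "A : cmat r r ==> factors r A r" unfolding factors_def by (rule bexI[of _ A], rule bexI[of _ "idm r"]) auto

text \<open>In a factorisation of minimal inner size, \<open>C * B\<close> is an invertible idempotent.\<close>
lemma idempotent_factorization:
 assumes p: "(p :: complex mat) : cmat r r" "p * p = p"
 obtains rh B C where "B : cmat r rh" "C : cmat rh r" "p = B * C" "C * B = idm rh"
proof -
 define rh where "rh = (LEAST k. factors r p k)"
 have "factors r p rh" unfolding rh_def by (rule LeastI[of _ r]) (rule factors_refl[OF p(1)])
 then obtain B C where BC: "B : cmat r rh" "C : cmat rh r" "p = B * C" unfolding factors_def by blast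
 have min: "~factors r p k" if "k < rh" for k using not_less_Least that unfolding rh_def by blast
 define D where "D = C * B"
 have D: "D : cmat rh rh" using BC by (simp add: D_def)
 have pD: "p = B * (D * C)"
 proof -
  have "p = (B * C) * (B * C)" using p(2) BC(3) by simp
  also have "... = B * (D * C)" unfolding D_def using BC by (simp add: massoc)
  finally show ?thesis .
 qed
 have "det D ~= 0"
 proof
  assume "det D = 0"
  then obtain w where "w : cvec rh" "w ~= zv rh" "D *V w = zv rh" using det_0_iff_vec_prod_zero[OF D] by blast
  from singular_factor[OF D this] obtain D1 D2 where D12: "D1 : cmat rh (rh - 1)" "D2 : cmat (rh - 1) rh" "D = D1 * D2" "rh > 0" by blast
  have "p = (B * D1) * (D2 * C)" unfolding pD D12(3) using BC D12 by (simp add: massoc)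
  moreover have "B * D1 : cmat r (rh - 1)" "D2 * C : cmat (rh - 1) r" using BC D12 by auto
  ultimately have "factors r p (rh - 1)" unfolding factors_def by blast
  thus False using min[of "rh - 1"] D12(4) by simp
 qed
 note i = minv[OF D this]
 have "D * (D * D) = D * D"
 proof -
  have "D * (D * D) = C * (B * (D * C)) * B" unfolding D_def using BC by (simp add: massoc)
  also have "... = C * (B * C) * B" unfolding pD[symmetric] BC(3)[symmetric] ..
  also have "... = D * D" unfolding D_def using BC by (simp add: massoc)
  finally show ?thesis .
 qed
 hence "minv D * (D * (D * D)) = minv D * (D * D)" by simp
 hence "D * D = D" using mat_cancel[OF i(3)] D i by simp
 hence "minv D * (D * D) = minv D * D" by simp
 hence "D = idm rh" using mat_cancel[OF i(3), of D] D i by simp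
 hence "C * B = idm rh" unfolding D_def .
 thus ?thesis using that BC by blast
qed

section \<open>The image of a holomorphic self-adjoint projection\<close>

context hol_atlas
begin

lemma hol_fun_det:
 assumes U: "open U" and M: "hol_mat \<A> U n n M"
 shows "hol_fun \<A> U (%x. det (M x))" unfolding hol_fun_def
proof
 fix c assume c: "c : \<A>"
 show "hol_on (patch c U) (%z. det (M (ci c z)))" by (rule fnf.Q_det[OF ff_hol[OF opatch[OF c U]] hol_mat_p[OF U c M]])
qed

lemma hol_fun_continuous:
 assumes U: "open U" and f: "hol_fun \<A> U f"
 shows "continuous_on U f"
proof -
 have "continuous_on (\<Union>c\<in>\<A>. U Int fst c) f"
 proof (rule continuous_on_open_UN)
  fix c assume c: "c : \<A>"
  show "open (U Int fst c)" using U chart_open(1)[OF c] by blast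
  have 1: "continuous_on (patch c U) (%z. f (ci c z))" using f c unfolding hol_fun_def by (intro hol_on_continuous) blast
  have 2: "continuous_on (U Int fst c) (snd c)" using chart_homeo[OF c] by (auto simp: homeomorphism_def intro: continuous_on_subset)
  have "continuous_on (U Int fst c) (%x. f (ci c (snd c x)))" by (rule continuous_on_compose2[OF 1 2]) simp
  thus "continuous_on (U Int fst c) f" by (rule continuous_on_eq) (use c in auto)
 qed
 moreover have "(\<Union>c\<in>\<A>. U Int fst c) = U" using chart_cover by blast
 ultimately show ?thesis by simp
qed

text \<open>The differential of a real function is real, and a complex linear map with real values is zero.\<close>
lemma real_hol_fun_locally_constant:
 assumes U: "open U" and f: "hol_fun \<A> U f" and re: "!!x. x : U ==> f x : \<real>" and a: "a : U"
 shows "EX V. open V & a : V & (ALL x:V. f x = f a)"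
proof -
 obtain c where c: "c : \<A>" "a : fst c" using chart_cover by blast
 let ?g = "%z. f (ci c z)"
 have o: "open (patch c U)" by (rule opatch[OF c(1) U])
 have za: "snd c a : patch c U" using a c by blast
 obtain \<epsilon> where \<epsilon>: "\<epsilon> > 0" "ball (snd c a) \<epsilon> <= patch c U" using o za open_contains_ball by blast
 have h: "hol_on (patch c U) ?g" using f c(1) unfolding hol_fun_def by blast
 have d: "(?g has_derivative (%_. 0)) (at z within ball (snd c a) \<epsilon>)" if z: "z : ball (snd c a) \<epsilon>" for z
 proof -
  let ?D = "fd ?g z"
  have zp: "z : patch c U" using z \<epsilon>(2) by blast
  note D = hol_onD[OF h zp]
  have im: "Im (?D w) = 0" for w
  proof -
   have "((%z. Im (?g z)) has_derivative (%w. Im (?D w))) (at z)" by (rule bl_hd[OF bounded_linear_Im D(3)])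
   moreover have "((%z. Im (?g z)) has_derivative (%w. 0)) (at z)"
   proof (rule hd_transform[OF has_derivative_const[of 0] o zp])
    fix y assume "y : patch c U"
    hence "?g y : \<real>" using re c(1) by auto
    thus "0 = Im (?g y)" by (simp add: complex_is_Real_iff)
   qed
   ultimately have "(%w. Im (?D w)) = (%w. 0)" by (rule has_derivative_unique)
   thus ?thesis by (rule fun_cong)
  qed
  have "?D w = 0" for w
  proof -
   have "?D (\<i> *s w) = \<i> * ?D w" using D(2) by (simp add: clin_iff)
   hence "Im (\<i> * ?D w) = 0" using im[of "\<i> *s w"] by simp
   thus ?thesis using im[of w] by (simp add: complex_eq_iff)
  qed
  hence "?D = (%_. 0)" by blast
  thus ?thesis using has_derivative_at_withinI[OF D(3)] by simp
 qed
 obtain k where k: "!!z. z : ball (snd c a) \<epsilon> ==> ?g z = k" using has_derivative_zero_constant[OF convex_ball d] by blast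
 let ?V = "fst c Int snd c -` ball (snd c a) \<epsilon>"
 have "continuous_on (fst c) (snd c)" using chart_homeo[OF c(1)] by (simp add: homeomorphism_def)
 hence "open ?V" by (rule continuous_open_preimage[OF _ chart_open(1)[OF c(1)] open_ball])
 moreover have "f x = k" if "x : ?V" for x using k[of "snd c x"] that c(1) by simp
 moreover have "a : ?V" using c \<epsilon>(1) by simp
 ultimately show ?thesis by metis
qed

lemma hol_endo_trace:
 assumes E: "hb E" and h: "hm E E h" and e: "(U, e) : frames E"
 shows "hol_fun \<A> U (%x. mt (h x))" unfolding hol_fun_def
proof
 fix c assume c: "c : \<A>"
 have U: "open U" by (rule frameD(1)[OF E e])
 note hh = hol_mat_p[OF U c homD(2)[OF E E h e e, simplified]]
 note hc = homD(1)[OF E E h]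
 have "hol_on (patch c U) (%z. SUM i<rank E. lex e e h (ci c z) $$ (i, i))" using fnf.Qm_entry[OF ff_hol[OF opatch[OF c U]] hh] by (intro hol_on_sum opatch[OF c U]) auto
 thus "hol_on (patch c U) (%z. mt (h (ci c z)))"
 proof (rule hol_on_cong[OF opatch[OF c U], rotated])
  fix z assume "z : patch c U"
  then obtain x where x: "x : U" "x : fst c" "z = snd c x" by blast
  note f = frameD[OF E e]
  have "mt (lex e e h x) = mt (minv (e x) * (h x * e x))" unfolding lex_def using f(2,4)[OF x(1)] hc[of x] by (simp add: massoc)
  also have "... = mt (h x * e x * minv (e x))" by (rule mt_comm) (use f(2,4)[OF x(1)] hc[of x] in auto)
  also have "... = mt (h x)" using f(2,4,5)[OF x(1)] hc[of x] by (simp add: massoc)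
  finally show "(SUM i<rank E. lex e e h (ci c z) $$ (i, i)) = mt (h (ci c z))" using lex_eq(1)[where fi=h, OF E e E e x(1,1) hc] x c by (simp add: mt_def)
 qed
qed

theorem hol_endo_real_trace_constant:
 assumes conn: "connected (UNIV :: 'x set)" and E: "hb E" and h: "hm E E h" and re: "!!x. mt (h x) : \<real>"
 shows "mt (h x) = mt (h y)"
proof (rule connected_local_const[OF conn UNIV_I UNIV_I], intro ballI)
 fix a :: 'x
 obtain U e where e: "(U, e) : frames E" "a : U" using frame_cover[OF E, of a] by blast
 obtain V where V: "open V" "a : V" "ALL x:V. mt (h x) = mt (h a)" using real_hol_fun_locally_constant[OF frameD(1)[OF E e(1)] hol_endo_trace[OF E h e(1)] re e(2)] by blast
 show "eventually (%b. mt (h a) = mt (h b)) (at a)" unfolding eventually_at_topological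
 proof (intro exI[of _ V] conjI ballI impI V(1,2))
  fix b assume "b : V"
  thus "mt (h a) = mt (h b)" using bspec[OF V(3), of b] by simp
 qed
qed

end

text \<open>The pointwise factorisation \<open>p = io ka\<close> identifies the fibres of the image with the standard space point by point,
 possibly discontinuously; the holomorphic structure of the image comes from its frames.\<close>
locale hermitian_projection = hol_atlas \<A> for \<A> :: "('x::t2_space, 'n::finite) chart set" +
 fixes E :: "'x herm_bundle" and p io ka :: "'x => complex mat" and rh :: nat
 assumes E: "hb E" and p: "hm E E p" and selfadj: "!!x. metric E x * p x = ctr (p x) * metric E x"
  and iota: "!!x. io x : cmat (rank E) rh" and kappa: "!!x. ka x : cmat rh (rank E)"
  and p_eq: "!!x. io x * ka x = p x" and retract: "!!x. ka x * io x = idm rh"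
begin

abbreviation "r == rank E"

text \<open>Where \<open>C e\<^sup>-\<^sup>1 p e B\<close> is invertible, the projections of the combinations \<open>e B\<close> of the frame \<open>e\<close> form
  a frame of the image of \<open>p\<close>.\<close>
definition im_dom :: "'x set => ('x => complex mat) => complex mat => complex mat => 'x set" where
 "im_dom U e B C = {x : U. det (C * (lex e e p x * B)) ~= 0}"

definition im_bundle :: "'x herm_bundle" where
 "im_bundle = \<lparr>rank = rh,
   frames = {(im_dom U e B C, %x. ka x * (e x * B)) | U e B C.
    (U, e) : frames E & B : cmat r rh & C : cmat rh r},
   metric = %x. ctr (io x) * metric E x * io x\<rparr>"

lemma im_simps: "rank im_bundle = rh" "metric im_bundle x = ctr (io x) * metric E x * io x" by (simp_all add: im_bundle_def)

lemma im_frameE: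
 assumes "(W, f) : frames im_bundle"
 obtains U e B C where "(U, e) : frames E" "B : cmat r rh" "C : cmat rh r"
  "W = im_dom U e B C" "f = (%x. ka x * (e x * B))"
proof -
 from assms have "EX U e B C. (W, f) = (im_dom U e B C, %x. ka x * (e x * B)) &
   (U, e) : frames E & B : cmat r rh & C : cmat rh r" unfolding im_bundle_def herm_bundle.simps mem_Collect_eq .
 thus ?thesis unfolding prod.inject by (elim exE conjE) (rule that)
qed

lemma pc: "p x : cmat r r" by (rule homD(1)[OF E E p])

context
 fixes U e and B C :: "complex mat" assumes e: "(U, e) : frames E" and B: "B : cmat r rh" and C: "C : cmat rh r"
begin

abbreviation "WW == im_dom U e B C"
abbreviation "MM x == C * (lex e e p x * B)"
abbreviation "ff x == ka x * (e x * B)"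

lemma W_sub: "x : WW ==> x : U" by (simp add: im_dom_def)

lemma M_hol: "hol_mat \<A> U rh rh MM" using homD(2)[OF E E p e e] by (intro hol_mat_mult[OF frameD(1)[OF E e], of _ r] hol_mat_const[OF frameD(1)[OF E e]] B C) simp_all

lemma W_open: "open WW"
proof -
 have "continuous_on U (%x. det (MM x))" by (rule hol_fun_continuous[OF frameD(1)[OF E e] hol_fun_det[OF frameD(1)[OF E e] M_hol]])
 hence "open (U Int (%x. det (MM x)) -` (- {0}))" by (rule continuous_open_preimage[OF _ frameD(1)[OF E e] open_Compl[OF closed_singleton]])
 moreover have "U Int (%x. det (MM x)) -` (- {0}) = WW" by (auto simp: im_dom_def)
 ultimately show ?thesis by simp
qed

lemma f_carrier: "x : U ==> ff x : cmat rh rh" using frameD(2)[OF E e] B kappa[of x] by (intro carrier_matI) simp_all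

lemma M_carrier: "x : U ==> MM x : cmat rh rh" using M_hol hol_mat_carrier by blast

lemma frame_inverse:
 assumes x: "x : WW"
 shows "det (ff x) ~= 0" and "Y : cmat rh q ==> ff x * (minv (MM x) * (C * (minv (e x) * (io x * Y)))) = Y"
proof -
 note xU = W_sub[OF x]
 note fr = frameD(2,4)[OF E e xU]
 note d = fr B C kappa[of x] iota[of x]
 let ?X = "C * (minv (e x) * io x)"
 have X: "?X : cmat rh rh" using d by (intro carrier_matI) simp_all
 have Xf: "?X * ff x = MM x" unfolding lex_def p_eq[symmetric] using d by (simp add: massoc)
 have dM: "det (MM x) ~= 0" using x by (simp add: im_dom_def)
 have "det ?X * det (ff x) = det (MM x)" using det_mult[OF X f_carrier[OF xU]] Xf by simp
 thus "det (ff x) ~= 0" using dM by auto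
 note i = minv[OF M_carrier[OF xU] dM]
 have "(minv (MM x) * ?X) * ff x = idm rh" using i X f_carrier[OF xU] Xf by (simp only: assoc_mult_mat[OF i(1) X f_carrier[OF xU]])
 hence R: "ff x * (minv (MM x) * ?X) = idm rh" by (rule mat_mult_left_right_inverse[OF mult_c[OF i(1) X] f_carrier[OF xU]])
 assume Y: "Y : cmat rh q"
 have "ff x * (minv (MM x) * (C * (minv (e x) * (io x * Y)))) = (ff x * (minv (MM x) * ?X)) * Y" using d i(1) Y f_carrier[OF xU] by (simp add: massoc)
 thus "ff x * (minv (MM x) * (C * (minv (e x) * (io x * Y)))) = Y" using R Y by simp
qed

end

lemma lex_p:
 assumes "(U, e) : frames E" "(U', e') : frames E" "x : U" "x : U'" "B : cmat r q"
 shows "minv (e' x) * (io x * (ka x * (e x * B))) = lex e e' p x * B" unfolding lex_def p_eq[symmetric] using frameD(2)[OF E assms(1,3)] frameD(4)[OF E assms(2,4)] iota[of x] kappa[of x] assms(5) by (simp add: massoc)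

lemma im_metric: "hermitian_metric rh (metric im_bundle x)" unfolding im_simps
proof (rule hermitian_metric_congruence[OF metricD[OF E] iota])
 fix s assume s: "s : cvec rh" "io x *V s = zv r"
 have "s = (ka x * io x) *V s" using s(1) by (simp add: retract)
 also have "... = ka x *V (io x *V s)" by (rule assoc_mult_mat_vec[OF kappa iota s(1)])
 finally show "s = zv rh" using kappa[of x] unfolding s(2) by (auto intro!: eq_vecI)
qed

lemma im_gram_smooth:
 assumes f: "(W, f) : frames im_bundle" and ij: "i < rh" "j < rh"
 shows "smooth_fun \<A> W (%x. gram im_bundle f x $$ (i, j))" unfolding smooth_fun_def
proof
 fix c assume c: "c : \<A>"
 obtain U e B C where e: "(U, e) : frames E" and B: "B : cmat r rh" and C: "C : cmat rh r"
  and W: "W = im_dom U e B C" and f: "f = (%x. ka x * (e x * B))" using im_frameE[OF f] .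
 have oW: "open W" unfolding W by (rule W_open[OF e B C])
 have oU: "open U" by (rule frameD(1)[OF E e])
 note o = opatch[OF c oW]
 have sub: "patch c W <= patch c U" using W by (auto simp: im_dom_def)
 have hp: "smm (patch c W) r r (%z. lex e e p (ci c z))" by (rule smooth_mat_subset[OF opatch[OF c oU] o holo_smooth_mat[OF opatch[OF c oU]] sub])
   (rule hol_mat_p[OF oU c homD(2)[OF E E p e e, simplified]])
 have hg: "smm (patch c W) r r (%z. gram E e (ci c z))" by (rule smooth_mat_subset[OF opatch[OF c oU] o gram_smooth[OF E e c] sub])
 note fs = ff_sm[OF o]
 have lB: "smm (patch c W) r rh (%z. lex e e p (ci c z) * B)" by (rule fnf.Qm_mult[OF fs hp fnf.Qm_const[OF fs B]])
 have "smm (patch c W) rh rh (%z. ctr (lex e e p (ci c z) * B) * (gram E e (ci c z) * (lex e e p (ci c z) * B)))" by (rule fnf.Qm_mult[OF fs smooth_mat_ctrans[OF o lB] fnf.Qm_mult[OF fs hg lB]])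
 hence "smooth_on (patch c W) (%z. (ctr (lex e e p (ci c z) * B) * (gram E e (ci c z) * (lex e e p (ci c z) * B))) $$ (i, j))" by (rule fnf.Qm_entry[OF fs _ ij])
 thus "smooth_on (patch c W) (%z. gram im_bundle f (ci c z) $$ (i, j))"
 proof (rule smooth_on_cong[OF o, rotated])
  fix z assume "z : patch c W"
  then obtain x where x: "x : W" "x : fst c" "z = snd c x" by blast
  have xU: "x : U" using x W by (simp add: im_dom_def)
  note fr = frameD[OF E e] and m = hmD(1)[OF metricD[OF E], of x]
  have fc: "f x : cmat rh rh" unfolding f by (rule f_carrier[OF e B C xU])
  have if1: "io x * f x = e x * (lex e e p x * B)"
  proof -
   have "e x * (lex e e p x * B) = (e x * minv (e x)) * (p x * (e x * B))" unfolding lex_def using fr(2,4)[OF xU] pc[of x] B by (simp add: massoc)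
   thus ?thesis unfolding f p_eq[symmetric] using fr(2,5)[OF xU] iota[of x] kappa[of x] B by (simp add: massoc mat_one)
  qed
  have l: "lex e e p x : cmat r r" using lex_eq(1)[where fi=p, OF E e E e xU xU pc] .
  have "gram im_bundle f x $$ (i, j) = (ctr (f x) * metric im_bundle x * f x) $$ (i, j)" using congruence_entry[OF hmD(1)[OF im_metric] fc ij] ij by (simp add: gram_def im_simps(1))
  also have "ctr (f x) * metric im_bundle x * f x = ctr (io x * f x) * (metric E x * (io x * f x))" unfolding im_simps ctr_mult[OF iota fc] using iota[of x] fc m by (simp add: massoc)
  also have "... = ctr (lex e e p x * B) * (gram E e x * (lex e e p x * B))" unfolding if1 gram_eq[OF E e xU] ctr_mult[OF fr(2)[OF xU] mult_c[OF l B]] using fr(2)[OF xU] l B m by (simp add: massoc)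
  finally show "(ctr (lex e e p (ci c z) * B) * (gram E e (ci c z) * (lex e e p (ci c z) * B))) $$ (i, j) =
    gram im_bundle f (ci c z) $$ (i, j)" using x c by simp
 qed
qed

lemma im_hb: "hb im_bundle" unfolding hol_herm_bundle_def im_simps(1)
proof (intro conjI)
 have "EX W f. (W, f) : frames im_bundle & x : W" for x
 proof -
  obtain U e where e: "(U, e) : frames E" "x : U" using frame_cover[OF E, of x] by blast
  note fr = frameD[OF E e(1)]
  define B C where "B = minv (e x) * io x" and "C = ka x * e x"
  have BC: "B : cmat r rh" "C : cmat rh r" unfolding B_def C_def using fr(2,4)[OF e(2)] iota[of x] kappa[of x] by auto
  have "C * (lex e e p x * B) = ka x * ((e x * minv (e x)) * (io x * (ka x * ((e x * minv (e x)) * io x))))"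
   unfolding lex_def B_def C_def p_eq[symmetric] using fr(2,4)[OF e(2)] iota[of x] kappa[of x] by (simp add: massoc)
  also have "... = ka x * (io x * (ka x * io x))" unfolding fr(5)[OF e(2)] using iota[of x] kappa[of x] by (simp add: mat_one)
  also have "... = idm rh" unfolding retract using iota[of x] by (simp add: mat_one retract)
  finally have "x : im_dom U e B C" using e by (simp add: im_dom_def)
  moreover have "(im_dom U e B C, %x. ka x * (e x * B)) : frames im_bundle" unfolding im_bundle_def using e(1) BC by auto
  ultimately show ?thesis by blast
 qed
 thus "(\<Union>(U, e)\<in>frames im_bundle. U) = UNIV" by blast
 show "ALL (U, e):frames im_bundle. open U & (ALL x:U. e x : cmat rh rh & invertible_mat (e x))"
 proof clarify
  fix W f assume "(W, f) : frames im_bundle"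
  then obtain U e B C where e: "(U, e) : frames E" and B: "B : cmat r rh" and C: "C : cmat rh r"
   and W: "W = im_dom U e B C" and f: "f = (%x. ka x * (e x * B))" by (rule im_frameE)
  show "open W & (ALL x:W. f x : cmat rh rh & invertible_mat (f x))" unfolding W f using W_open[OF e B C] f_carrier[OF e B C] frame_inverse(1)[OF e B C] W_sub[OF e B C]
    invertible_det by blast
 qed
 show "ALL (U, e):frames im_bundle. ALL (V, f):frames im_bundle. EX g. hol_mat \<A> (U Int V) rh rh g & (ALL x:U Int V. e x = f x * g x)"
 proof clarify
  fix W f W' f' assume F: "(W, f) : frames im_bundle" and F': "(W', f') : frames im_bundle"
  obtain U e B C where e: "(U, e) : frames E" and B: "B : cmat r rh" and C: "C : cmat rh r"
   and W: "W = im_dom U e B C" and f: "f = (%x. ka x * (e x * B))" using im_frameE[OF F] .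
  obtain U' e' B' C' where e': "(U', e') : frames E" and B': "B' : cmat r rh" and C': "C' : cmat rh r"
   and W': "W' = im_dom U' e' B' C'" and f': "f' = (%x. ka x * (e' x * B'))" using im_frameE[OF F'] .
  have o: "open (W Int W')" "open W'" "open W" "open (U Int U')" "open U'" unfolding W W' using W_open[OF e B C] W_open[OF e' B' C'] frameD(1)[OF E e] frameD(1)[OF E e'] by auto
  have sub: "W Int W' <= U Int U'" "W Int W' <= U'" unfolding W W' by (auto simp: im_dom_def)
  show "EX g. hol_mat \<A> (W Int W') rh rh g & (ALL x:W Int W'. f x = f' x * g x)"
  proof (intro exI conjI ballI)
   show "hol_mat \<A> (W Int W') rh rh (%x. minv (C' * (lex e' e' p x * B')) * (C' * (lex e e' p x * B)))"
    by (intro hol_mat_mult[OF o(1), of _ rh] hol_mat_mult[OF o(1), of _ r] hol_mat_minv[OF o(1)] hol_mat_const[OF o(1)] B C'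
      hol_mat_mono[OF o(5,1) M_hol[OF e' B' C'] sub(2)] hol_mat_mono[OF o(4,1) homD(2)[OF E E p e e'] sub(1)])
     (simp add: W' im_dom_def)
   fix x assume x: "x : W Int W'"
   hence xU: "x : U" "x : U'" using sub by auto
   have fc: "ka x * (e x * B) : cmat rh rh" by (rule f_carrier[OF e B C xU(1)])
   show "f x = f' x * (minv (C' * (lex e' e' p x * B')) * (C' * (lex e e' p x * B)))" using frame_inverse(2)[OF e' B' C' _ fc, of x] x unfolding lex_p[OF e e' xU B] by (simp add: f f' W')
  qed
 qed
 show "ALL x. hermitian_metric rh (metric im_bundle x)" using im_metric by blast
 show "ALL (U, e):frames im_bundle. ALL i<rh. ALL j<rh. smooth_fun \<A> U (%x. gram im_bundle e x $$ (i, j))" using im_gram_smooth by blast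
qed

theorem im_embedding: "isometric_embedding \<A> im_bundle E io ka"
proof
 show "hb im_bundle" "hb E" by (rule im_hb, rule E)
 show "hm im_bundle E io" unfolding hom_iff[OF im_hb E] im_simps(1)
 proof (intro conjI allI iota, clarify)
  fix W f U' e' assume F: "(W, f) : frames im_bundle" and e': "(U', e') : frames E"
  obtain U e B C where e: "(U, e) : frames E" and B: "B : cmat r rh" and C: "C : cmat rh r"
   and W: "W = im_dom U e B C" and f: "f = (%x. ka x * (e x * B))" using im_frameE[OF F] .
  have o: "open (W Int U')" "open (U Int U')" unfolding W using W_open[OF e B C] frameD(1)[OF E e] frameD(1)[OF E e'] by auto
  have sub: "W Int U' <= U Int U'" unfolding W by (auto simp: im_dom_def)
  show "hol_mat \<A> (W Int U') r rh (lex f e' io)"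
  proof (rule hol_mat_cong[OF o(1) hol_mat_mult[OF o(1) hol_mat_mono[OF o(2,1) homD(2)[OF E E p e e'] sub] hol_mat_const[OF o(1) B]]])
   fix x assume "x : W Int U'"
   hence x: "x : U" "x : U'" using sub by auto
   show "lex e e' p x * B = lex f e' io x" unfolding lex_p[OF e e' x B, symmetric] lex_def[of f] unfolding f using frameD(2)[OF E e x(1)] frameD(4)[OF E e' x(2)] iota[of x] kappa[of x] B by (simp add: massoc)
  qed
 qed
 show "hm E im_bundle ka" unfolding hom_iff[OF E im_hb] im_simps(1)
 proof (intro conjI allI kappa, clarify)
  fix U' e' W f assume e': "(U', e') : frames E" and F: "(W, f) : frames im_bundle"
  obtain U e B C where e: "(U, e) : frames E" and B: "B : cmat r rh" and C: "C : cmat rh r"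
   and W: "W = im_dom U e B C" and f: "f = (%x. ka x * (e x * B))" using im_frameE[OF F] .
  have o: "open (U' Int W)" "open (U' Int U)" "open U" unfolding W using W_open[OF e B C] frameD(1)[OF E e] frameD(1)[OF E e'] by auto
  have sub: "U' Int W <= U' Int U" "U' Int W <= U" unfolding W by (auto simp: im_dom_def)
  have "hol_mat \<A> (U' Int W) rh r (%x. minv (C * (lex e e p x * B)) * (C * lex e' e p x))" by (intro hol_mat_mult[OF o(1), of _ rh] hol_mat_mult[OF o(1), of _ r] hol_mat_minv[OF o(1)] hol_mat_const[OF o(1)] C
     hol_mat_mono[OF o(3,1) M_hol[OF e B C] sub(2)] hol_mat_mono[OF o(2,1) homD(2)[OF E E p e' e] sub(1)])
    (simp add: W im_dom_def)
  thus "hol_mat \<A> (U' Int W) rh r (lex e' f ka)"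
  proof (rule hol_mat_cong[OF o(1)])
   fix x assume x: "x : U' Int W"
   hence xU: "x : U'" "x : U" using sub by auto
   note fr' = frameD[OF E e'] and fr = frameD[OF E e]
   have M: "C * (lex e e p x * B) : cmat rh rh" by (rule M_carrier[OF e B C xU(2)])
   have "det (C * (lex e e p x * B)) ~= 0" using x by (simp add: W im_dom_def)
   note mi = minv[OF M this]
   have l: "lex e' e p x : cmat r r" using lex_eq(1)[where fi=p, OF E e' E e xU pc] .
   have Y: "ka x * e' x : cmat rh r" using kappa[of x] fr'(2)[OF xU(1)] by simp
   have "lex e' f ka x = minv (C * (lex e e p x * B)) * (C * lex e' e p x)"
   proof (rule lex_unique[OF E e' im_hb F, unfolded im_simps(1), OF xU(1)])
    show "x : W" using x by blast
    show "ka x : cmat rh r" by (rule kappa)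
    show "minv (C * (lex e e p x * B)) * (C * lex e' e p x) : cmat rh r" using mi(1) C l by (intro carrier_matI) simp_all
    have "minv (e x) * (io x * (ka x * e' x)) = lex e' e p x" unfolding lex_def p_eq[symmetric] using fr'(2)[OF xU(1)] fr(4)[OF xU(2)] iota[of x] kappa[of x] by (simp add: massoc)
    thus "ka x * e' x = f x * (minv (C * (lex e e p x * B)) * (C * lex e' e p x))" using frame_inverse(2)[OF e B C _ Y, of x] x by (simp add: f W)
   qed
   thus "minv (C * (lex e e p x * B)) * (C * lex e' e p x) = lex e' f ka x" by simp
  qed
 qed
 fix x
 show "ka x * io x = idm (rank im_bundle)" by (simp add: retract im_simps)
 note m = hmD[OF metricD[OF E], of x]
 have "metric im_bundle x * ka x = ctr (io x) * (metric E x * p x)" unfolding im_simps p_eq[symmetric] using iota[of x] kappa[of x] m by (simp add: massoc)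
 also have "... = ctr (p x * io x) * metric E x" unfolding selfadj ctr_mult[OF pc iota] using iota[of x] pc[of x] m by (simp add: massoc)
 also have "p x * io x = io x" unfolding p_eq[symmetric] using iota[of x] kappa[of x] by (simp add: massoc retract mat_one)
 finally show "metric im_bundle x * ka x = ctr (io x) * metric E x" .
qed

end

section \<open>Decomposition into simple bundles\<close>

definition adjf :: "'x herm_bundle => ('x => complex mat) => 'x => complex mat" where
 "adjf E s x = minv (metric E x) * (ctr (s x) * metric E x)"

lemma nonneg_complex_real: "0 <= (z::complex) ==> z : \<real>" by (simp add: less_eq_complex_def complex_is_Real_iff)

lemma ctr_smult: "ctr (c *m A) = cnj c *m ctr A" by (rule eq_matI) (auto simp: ctr_def)

lemma eigenvector_exists:
 assumes "(A :: complex mat) : cmat n n" "n > 0"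
 obtains \<mu> w where "w : cvec n" "w ~= zv n" "A *V w = \<mu> \<cdot>\<^sub>v w"
proof -
 obtain \<mu> where "eigenvalue A \<mu>" using spectrum_non_empty[OF assms] by (auto simp: spectrum_def)
 then obtain w where "w : cvec n" "w ~= zv n" "A *V w = \<mu> \<cdot>\<^sub>v w" unfolding eigenvalue_def eigenvector_def using assms by auto
 thus ?thesis by (rule that)
qed

lemma shifted_kernel:
 assumes "(A :: complex mat) : cmat n n" "w : cvec n" "A *V w = \<mu> \<cdot>\<^sub>v w"
 shows "(A + (- \<mu>) *m idm n) *V w = zv n"
proof -
 have "(A + (- \<mu>) *m idm n) *V w = A *V w + ((- \<mu>) *m idm n) *V w" by (rule add_mult_distrib_mat_vec[OF assms(1) _ assms(2)]) simp
 also have "((- \<mu>) *m idm n) *V w = (- \<mu>) \<cdot>\<^sub>v w" by (rule eq_vecI) (use assms(2) in auto)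
 finally show ?thesis unfolding assms(3) using assms(2) by (intro eq_vecI) auto
qed

lemma smult_one: "1 *m A = (A :: complex mat)" by (rule eq_matI) auto

lemma mat_diff_zero:
 assumes "(A :: complex mat) : cmat n n" "B : cmat n n"
 shows "A + (- c) *m B = zm n n \<longleftrightarrow> A = c *m B" using assms by (auto simp: mat_eq_iff)

abbreviation (in hol_atlas) emb where "emb == isometric_embedding \<A>"

locale critical_setting = hol_atlas \<A> for \<A> :: "('x::t2_space, 'n::finite) chart set" +
 fixes ze :: "nat => ('x, 'n) form"
 assumes compact: "compact (UNIV :: 'x set)" and connected: "connected (UNIV :: 'x set)"
  and zeta: "!!k. k <= CARD('n) ==> closed_real_form \<A> (CARD('n) - k) (CARD('n) - k) (ze k)"
begin

abbreviation critical :: "'x herm_bundle => bool" where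
 "critical E == hb E & P_critical \<A> ze E"

lemma adjf:
 assumes "hb E" "!!x. s x : cmat (rank E) (rank E)"
 shows "adjf E s x : cmat (rank E) (rank E)" "metric E x * adjf E s x = ctr (s x) * metric E x"
proof -
 note m = hmD[OF metricD[OF assms(1)], of x]
 note i = minv[OF m(1,3)]
 show "adjf E s x : cmat (rank E) (rank E)" unfolding adjf_def using i(1) m(1) assms(2)[of x] by (intro carrier_matI) simp_all
 show "metric E x * adjf E s x = ctr (s x) * metric E x" unfolding adjf_def using mat_cancel[OF i(2)] i(1) m(1) assms(2)[of x] by simp
qed

lemma adjf_hol:
 assumes cE: "critical E" and s: "hm E E s"
 shows "hm E E (adjf E s)"
proof -
 interpret critical_bundle \<A> ze E by unfold_locales (use compact zeta cE in auto)
 show ?thesis by (rule adjoint_holomorphic[OF s]) (use adjf[where s=s, OF E homD(1)[OF E E s]] in auto)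
qed

lemma endo_zero:
 assumes E: "critical E" and a: "hm E E a" and z: "a x = zm (rank E) (rank E)"
 shows "a y = zm (rank E) (rank E)"
proof -
 have hE: "hb E" using E by blast
 note ac = homD(1)[OF hE hE a]
 note d = adjf[where s=a, OF hE ac]
 note t = adjoint_trace[OF metricD[OF hE] ac d]
 have "hm E E (%x. adjf E a x * a x)" by (rule hom_comp[OF hE hE hE a adjf_hol[OF E a]])
 hence "mt (adjf E a y * a y) = mt (adjf E a x * a x)" by (rule hol_endo_real_trace_constant[OF connected hE]) (rule nonneg_complex_real[OF t(1)])
 also have "... = 0" unfolding z using d(1)[of x] by (simp add: mt_def)
 finally show ?thesis by (rule t(2))
qed

lemma endo_eq:
 assumes E: "critical E" and a: "hm E E a" and b: "hm E E b" and e: "a x = c *m b x"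
 shows "a y = c *m b y"
proof -
 have hE: "hb E" using E by blast
 note ac = homD(1)[OF hE hE a] and bc = homD(1)[OF hE hE b]
 have "hm E E (%x. a x + (- c) *m b x)" by (rule hom_add(1)[OF hE hE a hom_add(2)[OF hE hE b b]])
 hence "a y + (- c) *m b y = zm (rank E) (rank E)" by (rule endo_zero[OF E]) (use e mat_diff_zero[OF ac bc] in blast)
 thus ?thesis unfolding mat_diff_zero[OF ac bc] .
qed

text \<open>Subtracting an eigenvalue at one point \<open>x0\<close> makes an endomorphism singular there. Take \<open>a\<close> non-zero with least rank \<open>rh\<close> at \<open>x0\<close>
 and \<open>b = a\<^sup>* a\<close>. For an eigenvalue \<open>\<mu>\<close> of \<open>b\<close> on its image at \<open>x0\<close>, the endomorphism \<open>b\<^sup>2 - \<mu> b\<close> has smaller rank there, so it is zero, and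
 \<open>b / \<mu>\<close> is idempotent.\<close>
theorem nontrivial_projection:
 assumes E: "critical E" and ns: "~simple_bundle \<A> E"
 shows "EX p. hm E E p & (ALL x. p x * p x = p x) & (ALL x. metric E x * p x = ctr (p x) * metric E x) &
  (ALL x. p x ~= zm (rank E) (rank E) & p x ~= idm (rank E))"
proof -
 let ?r = "rank E"
 have hE: "hb E" using E by blast
 note cE = homD(1)[OF hE hE] and one = hom_one[OF hE]
  and add = hom_add(1)[OF hE hE] and smult = hom_add(2)[OF hE hE] and comp = hom_comp[OF hE hE hE]
 obtain fi where fi: "hm E E fi" "!!a. EX x. fi x ~= a *m idm ?r" using ns unfolding simple_bundle_def by blast
 \<comment> \<open>Any point will do; the type of points is not empty.\<close>
 define x0 :: 'x where "x0 = undefined"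
 have r0: "?r > 0"
 proof (rule ccontr)
  assume "~?r > 0"
  hence "fi x = 0 *m idm ?r" for x using cE[OF fi(1), of x] by (intro eq_matI) auto
  thus False using fi(2) by blast
 qed
 define sing where "sing k \<longleftrightarrow> (EX a. hm E E a & a x0 ~= zm ?r ?r & factors ?r (a x0) k)" for k
 have sr: "sing (?r - 1)"
 proof -
  obtain \<mu> w where w: "w : cvec ?r" "w ~= zv ?r" "fi x0 *V w = \<mu> \<cdot>\<^sub>v w" by (rule eigenvector_exists[OF cE[OF fi(1)] r0])
  define a where "a x = fi x + (- \<mu>) *m idm ?r" for x
  have a: "hm E E a" unfolding a_def[abs_def] by (rule add[OF fi(1) smult[OF one one]])
  have "a x0 ~= zm ?r ?r" unfolding a_def mat_diff_zero[OF cE[OF fi(1)] one_carrier_mat] using endo_eq[OF E fi(1) one] fi(2) by blast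
  moreover have "factors ?r (a x0) (?r - 1)" unfolding factors_def using singular_factor(1)[OF cE[OF a] w(1,2)] shifted_kernel[OF cE[OF fi(1)] w(1,3)] unfolding a_def by blast
  ultimately show ?thesis unfolding sing_def using a by blast
 qed
 define rh where "rh = (LEAST k. sing k)"
 have rh: "sing rh" unfolding rh_def by (rule LeastI[of sing, OF sr])
 have min: "~sing k" if "k < rh" for k using not_less_Least that unfolding rh_def by blast
 have rhr: "rh < ?r" using Least_le[of sing, OF sr] r0 unfolding rh_def by linarith
 obtain a B C where a: "hm E E a" "a x0 ~= zm ?r ?r" and BC: "B : cmat ?r rh" "C : cmat rh ?r" "a x0 = B * C" using rh unfolding sing_def factors_def by blast
 define b where "b x = adjf E a x * a x" for x
 have b: "hm E E b" unfolding b_def[abs_def] by (rule comp[OF a(1) adjf_hol[OF E a(1)]])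
 note bc = cE[OF b] and ac = cE[OF a(1)] and m = hmD[OF metricD[OF hE]]
 note ad = adjf[where s=a, OF hE ac]
 have tr: "0 <= mt (b x)" "mt (b x) = 0 ==> a x = zm ?r ?r" for x using adjoint_trace[OF metricD[OF hE] ac ad] unfolding b_def by blast+
 have bsa: "metric E x * b x = ctr (b x) * metric E x" for x
 proof -
  have 1: "metric E x * b x = ctr (a x) * (metric E x * a x)" unfolding b_def using ad[of x] ac[of x] m(1)[of x] by (simp flip: massoc)
  have "ctr (metric E x * b x) = metric E x * b x" unfolding 1 using ac[of x] m(1)[of x] by (simp add: ctr_mult[of _ ?r ?r _ ?r] ctr_ctr m(2) massoc)
  thus ?thesis using ctr_mult[OF m(1) bc] m(2) by simp
 qed
 have trb: "0 <= mt (b x * b x)" "mt (b x * b x) = 0 ==> b x = zm ?r ?r" for x using adjoint_trace[OF metricD[OF hE] bc bc bsa] by blast+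
 have mb0: "mt (b x0) ~= 0" using tr(2) a(2) by blast
 hence b0: "b x0 ~= zm ?r ?r" by (auto simp: mt_def)
 define B' where "B' = adjf E a x0 * B"
 have B': "B' : cmat ?r rh" "b x0 = B' * C" using ad(1)[of x0] BC by (simp_all add: B'_def b_def massoc)
 have rh0: "rh > 0"
 proof (rule ccontr)
  assume "~rh > 0"
  hence "b x0 = zm ?r ?r" unfolding B'(2) using B'(1) BC(2) by (intro eq_matI) (auto simp: scalar_prod_def)
  thus False using b0 by simp
 qed
 have CB: "C * B' : cmat rh rh" using BC B' by simp
 obtain \<mu> w where w: "w : cvec rh" "w ~= zv rh" "(C * B') *V w = \<mu> \<cdot>\<^sub>v w" by (rule eigenvector_exists[OF CB rh0])
 define D where "D = C * B' + (- \<mu>) *m idm rh"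
 have Dc: "D : cmat rh rh" using CB by (simp add: D_def)
 have "D *V w = zv rh" unfolding D_def by (rule shifted_kernel[OF CB w(1,3)])
 from singular_factor(1)[OF Dc w(1,2) this] obtain D1 D2 where D12: "D1 : cmat rh (rh - 1)" "D2 : cmat (rh - 1) rh" "D = D1 * D2" by blast
 let ?d = "%x. b x * b x + (- \<mu>) *m b x"
 have "B' * D = B' * (C * B') + (- \<mu>) *m B'" unfolding D_def using mult_add_distrib_mat[OF B'(1) CB, of "(- \<mu>) *m idm rh"] mult_smult_distrib[OF B'(1) one_carrier_mat, of "- \<mu>"] B'(1) by simp
 hence "?d x0 = B' * D * C" using add_mult_distrib_mat[OF mult_c[OF B'(1) CB] smult_carrier_mat[OF B'(1)] BC(2), of "- \<mu>"]
   mult_smult_assoc_mat[OF B'(1) BC(2)] B'(1) BC(2) by (simp add: B'(2) massoc)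
 hence "?d x0 = (B' * D1) * (D2 * C)" unfolding D12(3) using B'(1) BC(2) D12 by (simp add: massoc)
 hence "factors ?r (?d x0) (rh - 1)" unfolding factors_def using mult_c[OF B'(1) D12(1)] mult_c[OF D12(2) BC(2)] by blast
 moreover have "hm E E ?d" by (rule add[OF comp[OF b b] smult[OF b b]])
 ultimately have "?d x0 = zm ?r ?r" using min[of "rh - 1"] rh0 unfolding sing_def by auto
 hence bb: "b x * b x = \<mu> *m b x" for x unfolding mat_diff_zero[OF mult_c[OF bc bc] bc] by (rule endo_eq[OF E comp[OF b b] b])
 have l: "mt (b x0 * b x0) = \<mu> * mt (b x0)" unfolding bb by (rule mt_smult[OF bc])
 have l0: "\<mu> ~= 0" using l trb(2)[of x0] b0 by auto
 have "\<mu> = mt (b x0 * b x0) / mt (b x0)" using l mb0 by simp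
 hence lr: "cnj (inverse \<mu>) = inverse \<mu>" using nonneg_complex_real[OF trb(1)[of x0]] nonneg_complex_real[OF tr(1)[of x0]] by (simp add: Reals_cnj_iff)
 define p where "p x = inverse \<mu> *m b x" for x
 have ph: "hm E E p" unfolding p_def[abs_def] by (rule smult[OF b b])
 have bp: "b x = \<mu> *m p x" for x unfolding p_def by (rule eq_matI) (use l0 in auto)
 have "p x * p x = inverse \<mu> *m (inverse \<mu> *m (b x * b x))" for x
  unfolding p_def using mult_smult_assoc_mat[OF bc[of x], of "inverse \<mu> *m b x" ?r "inverse \<mu>"] mult_smult_distrib[OF bc[of x] bc[of x]] bc[of x] by simp
 also have "... x = p x" for x unfolding bb p_def by (rule eq_matI) (use l0 in auto)
 finally have pp: "p x * p x = p x" for x .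
 have psa: "metric E x * p x = ctr (p x) * metric E x" for x unfolding p_def ctr_smult using mult_smult_distrib[OF m(1) bc, of x "inverse \<mu>" x] bsa[of x]
   mult_smult_assoc_mat[OF ctr_c[OF bc[of x]] m(1)[of x]] lr by simp
 have p0: "p x ~= zm ?r ?r" for x using endo_zero[OF E b, of x x0] bp[of x] b0 by auto
 have p1: "p x ~= idm ?r" for x
 proof
  assume "p x = idm ?r"
  hence "p x = 1 *m idm ?r" by (simp add: smult_one)
  hence "p x0 = 1 *m idm ?r" by (rule endo_eq[OF E ph one])
  hence px: "p x0 = idm ?r" by (simp add: smult_one)
  obtain w where w: "w : cvec ?r" "w ~= zv ?r" "C *V w = zv rh" using wide_kernel[OF BC(2) rhr] by blast
  have "w = p x0 *V w" using w(1) by (simp add: px)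
  also have "... = (inverse \<mu> *m B') *V (C *V w)" unfolding p_def B'(2) mult_smult_assoc_mat[OF B'(1) BC(2), symmetric] by (rule assoc_mult_mat_vec[OF _ BC(2) w(1)]) (use B'(1) in auto)
  also have "... = zv ?r" unfolding w(3) using B'(1) by (intro eq_vecI) auto
  finally show False using w(2) by simp
 qed
 show ?thesis using ph pp psa p0 p1 by blast
qed

theorem projection_splits:
 assumes E: "hb E" and p: "hm E E p" "!!x. p x * p x = p x" "!!x. metric E x * p x = ctr (p x) * metric E x"
 shows "EX G io ka. emb G E io ka & (ALL x. io x * ka x = p x)"
proof -
 note pc = homD(1)[OF E E p(1)]
 have "EX rh B C. B : cmat (rank E) rh & C : cmat rh (rank E) & p x = B * C & C * B = idm rh" for x by (rule idempotent_factorization[OF pc p(2)]) blast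
 then obtain rh io ka where f: "!!x. io x : cmat (rank E) (rh x)" "!!x. ka x : cmat (rh x) (rank E)"
  "!!x. p x = io x * ka x" "!!x. ka x * io x = idm (rh x)" by metis
 have tr: "mt (p x) = of_nat (rh x)" for x unfolding f(3) mt_comm[OF f(1,2)] f(4) by (rule mt_one)
 have "rh x = rh y" for x y
 proof -
  have "mt (p x) = mt (p y)" by (rule hol_endo_real_trace_constant[OF connected E p(1)]) (simp add: tr)
  thus ?thesis by (simp add: tr)
 qed
 hence rh: "rh x = rh undefined" for x by blast
 interpret hermitian_projection \<A> E p io ka "rh undefined" by unfold_locales (use E p f rh in metis)+
 show ?thesis using im_embedding p_eq by blast
qed

end

section \<open>Orthogonal families of subbundles\<close>

lemma mult_index:
 assumes "A : cmat a n" "B : cmat n b" "i < a" "j < b"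
 shows "(A * B) $$ (i, j) = (SUM k<n. A $$ (i, k) * B $$ (k, j) :: complex)" using assms by (simp add: scalar_prod_def atLeast0LessThan)

type_synonym 'x piece = "'x herm_bundle \<times> ('x => complex mat) \<times> ('x => complex mat)"

context hol_atlas
begin

abbreviation bdl :: "'x piece => 'x herm_bundle" where "bdl t == fst t"
abbreviation inj :: "'x piece => 'x => complex mat" where "inj t == fst (snd t)"
abbreviation prj :: "'x piece => 'x => complex mat" where "prj t == snd (snd t)"

text \<open>The condition \<open>(\<Sum>t. inj t * prj t) = 1\<close> is stated for the entries, so that the pieces can be permuted freely.\<close>
definition decomp :: "'x herm_bundle => 'x piece list => bool" where
 "decomp E D \<longleftrightarrow> (ALL t:set D. emb (bdl t) E (inj t) (prj t)) &
  (ALL x. ALL i<rank E. ALL j<rank E. (\<Sum>t\<leftarrow>D. (inj t x * prj t x) $$ (i, j)) = (if i = j then 1 else 0))"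

lemma embD:
 assumes "emb G E io ka"
 shows "hb G" "hb E" "hm G E io" "hm E G ka" "ka x * io x = idm (rank G)" "metric G x * ka x = ctr (io x) * metric E x"
  "io x : cmat (rank E) (rank G)" "ka x : cmat (rank G) (rank E)"
proof -
 interpret isometric_embedding \<A> G E io ka by (rule assms)
 show "hb G" "hb E" "hm G E io" "hm E G ka" "ka x * io x = idm (rank G)" "metric G x * ka x = ctr (io x) * metric E x"
  "io x : cmat (rank E) (rank G)" "ka x : cmat (rank G) (rank E)" using G E iota kappa retract adj carriers by auto
qed

lemma embI:
 assumes "hb G" "hb E" "hm G E io" "hm E G ka" "!!x. ka x * io x = idm (rank G)" "!!x. metric G x * ka x = ctr (io x) * metric E x"
 shows "emb G E io ka" by unfold_locales (use assms in auto)

lemma emb_refl: "hb E ==> emb E E (%_. idm (rank E)) (%_. idm (rank E))"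
proof (rule embI)
 assume E: "hb E"
 show "metric E x * idm (rank E) = ctr (idm (rank E)) * metric E x" for x using hmD(1)[OF metricD[OF E], of x] by (simp add: ctr_one)
qed (simp_all add: hom_one)

lemma emb_trans:
 assumes 1: "emb G E io ka" and 2: "emb G' G io' ka'"
 shows "emb G' E (%x. io x * io' x) (%x. ka' x * ka x)"
proof (rule embI)
 note a = embD[OF 1] and b = embD[OF 2]
 note m = hmD(1)[OF metricD[OF a(1)]] hmD(1)[OF metricD[OF a(2)]] hmD(1)[OF metricD[OF b(1)]]
 show "hb G'" "hb E" by (rule b, rule a)
 show "hm G' E (%x. io x * io' x)" "hm E G' (%x. ka' x * ka x)" using hom_comp[OF b(1) a(1,2) b(3) a(3)] hom_comp[OF a(2,1) b(1) a(4) b(4)] by auto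
 fix x
 show "ka' x * ka x * (io x * io' x) = idm (rank G')" using mat_cancel[OF a(5)[of x]] a(7,8)[of x] b(5,7,8)[of x] by (simp add: massoc)
 have "metric G' x * (ka' x * ka x) = ctr (io' x) * (metric G x * ka x)" using b(6-8)[of x] a(7,8)[of x] m[of x] by (simp flip: massoc)
 also have "... = ctr (io x * io' x) * metric E x" unfolding a(6) ctr_mult[OF a(7) b(7)] using a(7,8)[of x] b(7,8)[of x] m[of x] by (simp add: massoc)
 finally show "metric G' x * (ka' x * ka x) = ctr (io x * io' x) * metric E x" .
qed

lemma emb_sym:
 assumes "emb G E u u'" and uu': "!!x. u x * u' x = idm (rank E)"
 shows "emb E G u' u"
proof (rule embI)
 note a = embD[OF assms(1)]
 note m = hmD(1)[OF metricD[OF a(1)]] hmD(1)[OF metricD[OF a(2)]]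
 show "hb E" "hb G" "hm E G u'" "hm G E u" by (rule a)+
 show "u x * u' x = idm (rank E)" for x by (rule uu')
 fix x
 have "ctr (u' x) * metric G x = ctr (u' x) * ((metric G x * u' x) * u x)" using a(5,7,8)[of x] m[of x] by (simp add: massoc mat_one)
 also have "... = ctr (u x * u' x) * (metric E x * u x)" unfolding a(6) ctr_mult[OF a(7,8)] using a(7,8)[of x] m[of x] by (simp add: massoc)
 also have "... = metric E x * u x" unfolding uu' ctr_one using m[of x] by (simp add: mat_one)
 finally show "metric E x * u x = ctr (u' x) * metric G x" by simp
qed

definition push :: "('x => complex mat) => ('x => complex mat) => 'x piece => 'x piece" where
 "push io ka t = (bdl t, %x. io x * inj t x, %x. prj t x * ka x)"

lemma decompD:
 assumes "decomp E D"
 shows "t : set D ==> emb (bdl t) E (inj t) (prj t)"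
  "i < rank E ==> j < rank E ==> (\<Sum>t\<leftarrow>D. (inj t x * prj t x) $$ (i, j)) = (if i = j then 1 else 0)" using assms unfolding decomp_def by blast+

lemma sum_list_swap: "(\<Sum>t\<leftarrow>D. SUM k:K. f t k) = (SUM k:K. \<Sum>t\<leftarrow>D. f t k)" for f :: "'a => 'b => complex" by (induction D) (simp_all add: sum.distrib)

lemma decomp_sum:
 assumes D: "decomp E D" and A: "A : cmat a (rank E)" and B: "B : cmat (rank E) b" and ij: "i < a" "j < b"
 shows "(\<Sum>t\<leftarrow>D. (A * (inj t x * prj t x) * B) $$ (i, j)) = (A * B) $$ (i, j)"
proof -
 let ?r = "rank E"
 have "(A * (inj t x * prj t x) * B) $$ (i, j) = (SUM l<?r. SUM k<?r. A $$ (i, k) * B $$ (l, j) * (inj t x * prj t x) $$ (k, l))"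
  if "t : set D" for t
 proof -
  note e = embD(7,8)[OF decompD(1)[OF D that], of x]
  note N = mult_c[OF e]
  show ?thesis unfolding mult_index[OF mult_c[OF A N] B ij] using ij by (auto simp: mult_index[OF A N] sum_distrib_left sum_distrib_right mult_ac simp del: index_mult_mat(1) intro!: sum.cong)
 qed
 hence "(\<Sum>t\<leftarrow>D. (A * (inj t x * prj t x) * B) $$ (i, j)) =
   (SUM l<?r. SUM k<?r. A $$ (i, k) * B $$ (l, j) * (\<Sum>t\<leftarrow>D. (inj t x * prj t x) $$ (k, l)))" by (simp add: sum_list_swap sum_list_const_mult cong: map_cong)
 also have "... = (SUM l<?r. A $$ (i, l) * B $$ (l, j))" by (intro sum.cong refl) (simp add: decompD(2)[OF D] if_distrib[of "%x. _ * x"] sum.delta cong: if_cong)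
 finally show ?thesis unfolding mult_index[OF A B ij] .
qed

lemma decomp_push:
 assumes e: "emb G E io ka" and D: "decomp G D" and ij: "i < rank E" "j < rank E"
 shows "(\<Sum>t\<leftarrow>map (push io ka) D. (inj t x * prj t x) $$ (i, j)) = (io x * ka x) $$ (i, j)"
proof -
 note a = embD(7,8)[OF e, of x]
 have "inj (push io ka t) x * prj (push io ka t) x = io x * (inj t x * prj t x) * ka x" if "t : set D" for t using a embD(7,8)[OF decompD(1)[OF D that], of x] by (simp add: push_def massoc)
 thus ?thesis using decomp_sum[OF D a ij, of x] by (simp add: o_def cong: map_cong)
qed

text \<open>A piece may be moved along the list, and replaced by an isometric copy.\<close>
lemma decomp_move:
 assumes D: "decomp E (t # as @ bs)" and u: "emb G (bdl t) u u'" "!!x. u x * u' x = idm (rank (bdl t))"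
 shows "decomp E (as @ (G, %x. inj t x * u x, %x. u' x * prj t x) # bs)"
proof -
 note et = decompD(1)[OF D, of t, simplified]
 note a = embD[OF et] and b = embD[OF u(1)]
 have "inj t x * u x * (u' x * prj t x) = inj t x * prj t x" for x using mat_cancel[OF u(2)[of x]] a(7,8)[of x] b(7,8)[of x] by (simp add: massoc)
 thus ?thesis using D emb_trans[OF et u(1)] unfolding decomp_def by (auto simp: algebra_simps)
qed

end

context critical_setting
begin

lemma sub_critical: "critical E ==> emb G E io ka ==> critical G" using isometric_embedding.critical_subbundle embD(1) by blast

lemma emb_rank:
 assumes e: "emb G E io ka" and ne: "io x * ka x ~= idm (rank E)"
 shows "rank G < rank E"
proof (rule ccontr)
 note a = embD[OF e]
 assume "~rank G < rank E"
 then consider "rank E < rank G" | "rank E = rank G" by linarith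
 thus False
 proof cases
  case 1
  obtain w where w: "w : cvec (rank G)" "w ~= zv (rank G)" "io x *V w = zv (rank E)" using wide_kernel[OF a(7) 1] by blast
  have "w = (ka x * io x) *V w" using w(1) by (simp add: a(5))
  also have "... = ka x *V (io x *V w)" by (rule assoc_mult_mat_vec[OF a(8,7) w(1)])
  also have "... = zv (rank G)" unfolding w(3) using a(8)[of x] by (intro eq_vecI) auto
  finally show False using w(2) by simp
 next
  case 2
  have "io x * ka x = idm (rank G)" by (rule mat_mult_left_right_inverse[OF _ _ a(5)]) (use a(7,8)[of x] 2 in auto)
  thus False using ne 2 by simp
 qed
qed

theorem simple_decomposition:
 "critical E ==> EX D. decomp E D & (ALL t:set D. simple_bundle \<A> (bdl t))"
proof (induction "rank E" arbitrary: E rule: less_induct)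
 case less
 have hE: "hb E" using less.prems by blast
 let ?r = "rank E"
 show ?case
 proof (cases "simple_bundle \<A> E")
  case True
  have "decomp E [(E, %_. idm ?r, %_. idm ?r)]" unfolding decomp_def by (simp add: emb_refl[OF hE])
  thus ?thesis using True by (intro exI[of _ "[(E, %_. idm ?r, %_. idm ?r)]"]) simp
 next
  case False
  obtain p where p: "hm E E p" "!!x. p x * p x = p x" "!!x. metric E x * p x = ctr (p x) * metric E x"
   "!!x. p x ~= zm ?r ?r" "!!x. p x ~= idm ?r" using nontrivial_projection[OF less.prems False] by blast
  note pc = homD(1)[OF hE hE p(1)] and m = hmD[OF metricD[OF hE]]
  define q where "q x = idm ?r + (- 1) *m p x" for x
  have qh: "hm E E q" unfolding q_def[abs_def] by (rule hom_add(1)[OF hE hE hom_one[OF hE] hom_add(2)[OF hE hE p(1) p(1)]])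
  note qc = homD(1)[OF hE hE qh]
  have mp: "(- 1) *m p x : cmat ?r ?r" for x using pc[of x] by simp
  have qp: "q x * p x = zm ?r ?r" for x
  proof -
   have "q x * p x = p x + (- 1) *m p x" unfolding q_def add_mult_distrib_mat[OF one_carrier_mat mp pc] mult_smult_assoc_mat[OF pc pc] p(2) using pc[of x] by simp
   also have "... = zm ?r ?r" using pc[of x] by (intro eq_matI) auto
   finally show ?thesis .
  qed
  have qq: "q x * q x = q x" for x
  proof -
   have "q x * q x = q x + (- 1) *m (q x * p x)" using mult_add_distrib_mat[OF qc one_carrier_mat mp, of x x] mult_smult_distrib[OF qc pc, of x "- 1" x] qc[of x] by (simp flip: q_def)
   also have "... = q x" unfolding qp using qc[of x] by (intro eq_matI) auto
   finally show ?thesis .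
  qed
  have qsa: "metric E x * q x = ctr (q x) * metric E x" for x
  proof -
   have "ctr (q x) = idm ?r + (- 1) *m ctr (p x)" unfolding q_def by (rule eq_matI) (use pc[of x] in "auto simp: ctr_def")
   hence "ctr (q x) * metric E x = metric E x + (- 1) *m (ctr (p x) * metric E x)" using add_mult_distrib_mat[OF one_carrier_mat _ m(1), of "(- 1) *m ctr (p x)" x]
     mult_smult_assoc_mat[OF ctr_c[OF pc] m(1), of "- 1" x x] pc[of x] m(1)[of x] by simp
   moreover have "metric E x * q x = metric E x + (- 1) *m (metric E x * p x)" unfolding q_def mult_add_distrib_mat[OF m(1) one_carrier_mat mp] mult_smult_distrib[OF m(1) pc] using m(1)[of x] by simp
   ultimately show ?thesis using p(3) by simp
  qed
  obtain G1 io1 ka1 where 1: "emb G1 E io1 ka1" "!!x. io1 x * ka1 x = p x" using projection_splits[OF hE p(1-3)] by blast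
  obtain G2 io2 ka2 where 2: "emb G2 E io2 ka2" "!!x. io2 x * ka2 x = q x" using projection_splits[OF hE qh qq qsa] by blast
  note a1 = embD[OF 1(1)] and a2 = embD[OF 2(1)]
  have qi: "q x $$ (i, j) = idm ?r $$ (i, j) - p x $$ (i, j)" if "i < ?r" "j < ?r" for x i j using pc[of x] that by (simp add: q_def)
  have "q x ~= idm ?r" for x
  proof
   assume "q x = idm ?r"
   hence "p x = zm ?r ?r" using pc[of x] qi[of _ _ x] by (intro eq_matI) auto
   thus False using p(4) by blast
  qed
  hence r: "rank G1 < ?r" "rank G2 < ?r" using emb_rank[OF 1(1), of undefined] emb_rank[OF 2(1), of undefined] p(5) 1(2) 2(2) by auto
  obtain D1 where D1: "decomp G1 D1" "ALL t:set D1. simple_bundle \<A> (bdl t)" using less.hyps[OF r(1) sub_critical[OF less.prems 1(1)]] by blast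
  obtain D2 where D2: "decomp G2 D2" "ALL t:set D2. simple_bundle \<A> (bdl t)" using less.hyps[OF r(2) sub_critical[OF less.prems 2(1)]] by blast
  let ?D = "map (push io1 ka1) D1 @ map (push io2 ka2) D2"
  have "(\<Sum>t\<leftarrow>?D. (inj t x * prj t x) $$ (i, j)) = (if i = j then 1 else 0)" if ij: "i < ?r" "j < ?r" for x i j
   unfolding map_append sum_list_append decomp_push[OF 1(1) D1(1) ij] decomp_push[OF 2(1) D2(1) ij] 1(2) 2(2) using qi[OF ij] ij by simp
  hence "decomp E ?D" unfolding decomp_def using emb_trans[OF 1(1) decompD(1)[OF D1(1)]] emb_trans[OF 2(1) decompD(1)[OF D2(1)]] by (auto simp: push_def)
  thus ?thesis using D1(2) D2(2) by (intro exI[of _ ?D]) (auto simp: push_def)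
 qed
qed

end

section \<open>Grouping isomorphic pieces\<close>

context critical_setting
begin

text \<open>With \<open>qs\<close> the adjoint of \<open>fi\<close>, both composites are homotheties by simplicity, with the same positive factor.\<close>
lemma hom_isometric:
 assumes E: "critical E" and e: "emb G E io ka" "emb G' E io' ka'"
  and simple: "simple_bundle \<A> G" "simple_bundle \<A> G'"
  and fi: "hm G G' fi" "fi x0 ~= zm (rank G') (rank G)"
 obtains u u' where "emb G G' u u'" "!!x. u x * u' x = idm (rank G')"
proof -
 note a = embD[OF e(1)] and b = embD[OF e(2)]
 note pc = homD(1)[OF a(1) b(1) fi(1)]
 note mG = hmD[OF metricD[OF a(1)]] and mG' = hmD[OF metricD[OF b(1)]] and mE = hmD[OF metricD[OF a(2)]]
 \<comment> \<open>The adjoint of a morphism between subbundles is holomorphic because it is induced by the adjoint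
    of an endomorphism of the ambient bundle.\<close>
 define s where "s x = io' x * (fi x * ka x)" for x
 have sh: "hm E E s" unfolding s_def[abs_def] by (rule hom_comp[OF a(2) b(1) a(2) hom_comp[OF a(2,1) b(1) a(4) fi(1)] b(3)])
 note sc = homD(1)[OF a(2) a(2) sh]
 note ad = adjf[where s=s, OF a(2) sc]
 define qs where "qs x = ka x * (adjf E s x * io' x)" for x
 have qsh: "hm G' G qs" unfolding qs_def[abs_def] by (rule hom_comp[OF b(1) a(2,1) hom_comp[OF b(1) a(2) a(2) b(3) adjf_hol[OF E sh]] a(4)])
 note qc = homD(1)[OF b(1) a(1) qsh]
 have adj: "metric G x * qs x = ctr (fi x) * metric G' x" for x
 proof -
  note d = a(7,8)[of x] b(7,8)[of x] pc[of x] mG(1)[of x] mG'(1)[of x] mE(1)[of x] ad(1)[of x] sc[of x]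
  have "metric G x * qs x = (metric G x * ka x) * (adjf E s x * io' x)" unfolding qs_def using d by (simp add: massoc)
  also have "... = ctr (io x) * ((metric E x * adjf E s x) * io' x)" unfolding a(6) using d by (simp add: massoc)
  also have "... = ctr (s x * io x) * (metric E x * io' x)" unfolding ad(2) ctr_mult[OF sc a(7)] using d by (simp add: massoc)
  also have "s x * io x = io' x * fi x" unfolding s_def using d a(5)[of x] by (simp add: massoc mat_one)
  also have "ctr (io' x * fi x) * (metric E x * io' x) = ctr (fi x) * ((ctr (io' x) * metric E x) * io' x)" unfolding ctr_mult[OF b(7) pc] using d by (simp add: massoc)
  also have "... = ctr (fi x) * metric G' x" unfolding b(6)[symmetric] using d b(5)[of x] by (simp add: massoc mat_one)
  finally show ?thesis .
 qed
 obtain al where al: "!!x. qs x * fi x = al *m idm (rank G)" using simple(1) hom_comp[OF a(1) b(1) a(1) fi(1) qsh] unfolding simple_bundle_def by blast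
 obtain bt where bt: "!!x. fi x * qs x = bt *m idm (rank G')" using simple(2) hom_comp[OF b(1) a(1) b(1) qsh fi(1)] unfolding simple_bundle_def by blast
 have albt: "al = bt"
 proof (rule ccontr)
  assume ne: "al ~= bt"
  have "fi x0 * (qs x0 * fi x0) = (fi x0 * qs x0) * fi x0" using pc[of x0] qc[of x0] by (simp add: massoc)
  hence "al *m fi x0 = bt *m fi x0" unfolding al bt mult_smult_distrib[OF pc one_carrier_mat] mult_smult_assoc_mat[OF one_carrier_mat pc] using pc[of x0] by simp
  hence "fi x0 = zm (rank G') (rank G)" using ne pc[of x0] by (auto simp: mat_eq_iff)
  thus False using fi(2) by simp
 qed
 \<comment> \<open>Positivity of \<open>al\<close> is read off from the trace of \<open>s\<^sup>* s\<close> on the ambient bundle.\<close>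
 note d = a(7,8)[of x0] b(7,8)[of x0] pc[of x0] ad(1)[of x0] sc[of x0]
 have "fi x0 = ka' x0 * (s x0 * io x0)" unfolding s_def using mat_cancel[OF b(5)[of x0]] d a(5)[of x0] by (simp add: massoc mat_one)
 hence "s x0 ~= zm (rank E) (rank E)" using fi(2) left_mult_zero_mat[OF a(7)] right_mult_zero_mat[OF b(8)] by metis
 hence pos: "0 <= mt (adjf E s x0 * s x0)" "mt (adjf E s x0 * s x0) ~= 0" using adjoint_trace[OF metricD[OF a(2)] sc ad] by blast+
 have "mt (adjf E s x0 * s x0) = mt ((adjf E s x0 * io' x0) * (fi x0 * ka x0))" unfolding s_def[of x0] using d by (simp add: massoc)
 also have "... = mt (fi x0 * qs x0)" unfolding mt_comm[OF mult_c[OF ad(1) b(7)] mult_c[OF pc a(8)]] qs_def using d by (simp add: massoc)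
 also have "... = al * of_nat (rank G')" unfolding bt albt mt_smult[OF one_carrier_mat] mt_one ..
 finally have m: "mt (adjf E s x0 * s x0) = al * of_nat (rank G')" .
 define t where "t = Re al"
 have n: "real (rank G') > 0" using pos(2) m by (cases "rank G' = 0") auto
 have "0 <= t * real (rank G')" "Im al * real (rank G') = 0" using pos(1) unfolding m t_def by (simp_all add: less_eq_complex_def)
 hence "0 <= t" and alt: "al = of_real t" using n by (auto simp: t_def complex_eq_iff zero_le_mult_iff)
 hence t: "t > 0" using pos(2) unfolding m by (cases "t = 0") auto
 define c where "c = complex_of_real (1 / sqrt t)"
 have cc: "c * (c * al) = 1"
 proof -
  have "1 / sqrt t * (1 / sqrt t * t) = 1" using t by (simp add: real_div_sqrt)
  thus ?thesis unfolding c_def alt by (simp only: of_real_mult[symmetric] of_real_1)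
 qed
 have scale: "(c *m A) * (c *m B) = idm k" if "A * B = al *m idm k" "A : cmat k l" "B : cmat l k" for A B k l
 proof -
  have "(c *m A) * (c *m B) = c *m (c *m (A * B))" using mult_smult_assoc_mat[OF that(2), of "c *m B" k c] mult_smult_distrib[OF that(2,3)] that(3) by simp
  also have "... = idm k" unfolding that(1) by (rule eq_matI) (use cc in "auto simp: mult.assoc")
  finally show ?thesis .
 qed
 have "emb G G' (%x. c *m fi x) (%x. c *m qs x)"
 proof (rule embI[OF a(1) b(1) hom_add(2)[OF a(1) b(1) fi(1) fi(1)] hom_add(2)[OF b(1) a(1) qsh qsh]])
  fix x
  show "(c *m qs x) * (c *m fi x) = idm (rank G)" by (rule scale[OF al qc pc])
  have "cnj c = c" by (simp add: c_def)
  thus "metric G x * (c *m qs x) = ctr (c *m fi x) * metric G' x" unfolding ctr_smult mult_smult_distrib[OF mG(1) qc] mult_smult_assoc_mat[OF ctr_c[OF pc] mG'(1)] adj by simp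
 qed
 moreover have "(c *m fi x) * (c *m qs x) = idm (rank G')" for x by (rule scale[OF bt[folded albt] pc qc])
 ultimately show ?thesis by (rule that)
qed

definition hom_zero :: "'x herm_bundle => 'x herm_bundle => bool" where
 "hom_zero G G' \<longleftrightarrow> (ALL fi. hm G G' fi --> (ALL x. fi x = zm (rank G') (rank G)))"

text \<open>A simple bundle together with its embeddings into the ambient bundle; their number is its multiplicity.\<close>
type_synonym 'y block = "'y herm_bundle \<times> (('y => complex mat) \<times> ('y => complex mat)) list"

definition flat :: "'x block list => 'x piece list" where
 "flat Bs = concat (map (%B. map (Pair (fst B)) (snd B)) Bs)"

definition separated :: "'x block list => bool" where
 "separated Bs \<longleftrightarrow> (ALL B:set Bs. snd B ~= [] & simple_bundle \<A> (fst B)) &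
  sorted_wrt (%B C. hom_zero (fst B) (fst C) & hom_zero (fst C) (fst B)) Bs"

text \<open>Pieces are moved one by one into the list of blocks: into an existing block when there is a morphism to or from
 it, which is then an isometry up to scaling, and otherwise into a new block.\<close>
lemma group_pieces:
 assumes E: "critical E"
 shows "decomp E (D @ flat Bs) ==> separated Bs ==> ALL t:set D. simple_bundle \<A> (bdl t) ==>
  EX Bs'. decomp E (flat Bs') & separated Bs'"
proof (induction D arbitrary: Bs)
 case Nil
 thus ?case by auto
next
 case (Cons t D)
 have et: "emb (bdl t) E (inj t) (prj t)" using decompD(1)[OF Cons.prems(1)] by simp
 have st: "simple_bundle \<A> (bdl t)" using Cons.prems(3) by simp
 show ?case
 proof (cases "EX B:set Bs. ~hom_zero (fst B) (bdl t) \<or> ~hom_zero (bdl t) (fst B)")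
  case False
  let ?Bs = "(bdl t, [(inj t, prj t)]) # Bs"
  have "decomp E (D @ (bdl t, %x. inj t x * idm (rank (bdl t)), %x. idm (rank (bdl t)) * prj t x) # flat Bs)" by (rule decomp_move[OF _ emb_refl[OF embD(1)[OF et]]]) (use Cons.prems(1) in simp_all)
  moreover have "(%x. inj t x * idm (rank (bdl t))) = inj t" "(%x. idm (rank (bdl t)) * prj t x) = prj t" by (rule ext, rule right_mult_one_mat[OF embD(7)[OF et]]) (rule ext, rule left_mult_one_mat[OF embD(8)[OF et]])
  ultimately have "decomp E (D @ flat ?Bs)" by (simp add: flat_def)
  moreover have "separated ?Bs" using Cons.prems(2) False st by (auto simp: separated_def)
  ultimately show ?thesis using Cons.IH[of ?Bs] Cons.prems(3) by simp
 next
  case True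
  then obtain B where B: "B : set Bs" "~hom_zero (fst B) (bdl t) \<or> ~hom_zero (bdl t) (fst B)" by blast
  obtain xs ys where Bs: "Bs = xs @ B # ys" using split_list[OF B(1)] by blast
  have sB: "simple_bundle \<A> (fst B)" "snd B ~= []" using Cons.prems(2) B(1) by (auto simp: separated_def)
  obtain i k where ik: "(i, k) : set (snd B)" using sB(2) by (cases "snd B") auto
  have "(fst B, i, k) : set (flat Bs)" using ik B(1) by (auto simp: flat_def)
  hence eB: "emb (fst B) E i k" using decompD(1)[OF Cons.prems(1), of "(fst B, i, k)"] by simp
  obtain u u' where u: "emb (fst B) (bdl t) u u'" "!!x. u x * u' x = idm (rank (bdl t))"
  proof (cases "hom_zero (fst B) (bdl t)")
   case False
   then obtain fi x where "hm (fst B) (bdl t) fi" "fi x ~= zm (rank (bdl t)) (rank (fst B))" unfolding hom_zero_def by blast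
   from hom_isometric[OF E eB et sB(1) st this] that show ?thesis by blast
  next
   case True
   hence "~hom_zero (bdl t) (fst B)" using B(2) by simp
   then obtain fi x where "hm (bdl t) (fst B) fi" "fi x ~= zm (rank (fst B)) (rank (bdl t))" unfolding hom_zero_def by blast
   from hom_isometric[OF E et eB st sB(1) this] obtain w w' where w: "emb (bdl t) (fst B) w w'" "!!x. w x * w' x = idm (rank (fst B))" by blast
   show ?thesis by (rule that[OF emb_sym[OF w]]) (rule embD(5)[OF w(1)])
  qed
  define B' where "B' = (fst B, (%x. inj t x * u x, %x. u' x * prj t x) # snd B)"
  have f: "flat Bs = flat xs @ (map (Pair (fst B)) (snd B) @ flat ys)"
   "flat (xs @ B' # ys) = flat xs @ (fst B, %x. inj t x * u x, %x. u' x * prj t x) # (map (Pair (fst B)) (snd B) @ flat ys)" by (simp_all add: Bs flat_def B'_def)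
  have "decomp E (D @ flat (xs @ B' # ys))" using decomp_move[OF _ u, of E "D @ flat xs" "map (Pair (fst B)) (snd B) @ flat ys"] Cons.prems(1) unfolding f by simp
  moreover have "separated (xs @ B' # ys)" using Cons.prems(2) unfolding Bs separated_def by (auto simp: sorted_wrt_append B'_def)
  ultimately show ?thesis using Cons.IH[of "xs @ B' # ys"] Cons.prems(3) by simp
 qed
qed

end

section \<open>The direct sum of the pieces\<close>

definition vst :: "complex mat => complex mat => complex mat" where
 "vst A B = mat (dim_row A + dim_row B) (dim_col A) (%(i, j). if i < dim_row A then A $$ (i, j) else B $$ (i - dim_row A, j))"
lemma vst_carrier: "A : cmat a n ==> B : cmat b n ==> vst A B : cmat (a + b) n" by (simp add: vst_def)

lemma sum_split: "(SUM k<a + b. f k) = (SUM k<a. f k) + (SUM k<b. f (a + k :: nat))" for f :: "nat => complex" by (induction b) (simp_all add: add.assoc)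

abbreviation dg :: "complex mat => complex mat => complex mat" where
 "dg A B == four_block_mat A (zm (dim_row A) (dim_col B)) (zm (dim_row B) (dim_col A)) B"

lemma dg_carrier: "A : cmat a a' ==> B : cmat b b' ==> dg A B : cmat (a + b) (a' + b')" by (rule four_block_carrier_mat)

lemma vst_mult:
 assumes A: "A : cmat a n" and B: "B : cmat b n" and X: "X : cmat n m"
 shows "vst A B * X = vst (A * X) (B * X)"
proof (rule eq_matI)
 note c = vst_carrier[OF A B] vst_carrier[OF mult_c[OF A X] mult_c[OF B X]]
 fix i j assume "i < dim_row (vst (A * X) (B * X))" "j < dim_col (vst (A * X) (B * X))"
 hence ij: "i < a + b" "j < m" using c by auto
 show "(vst A B * X) $$ (i, j) = vst (A * X) (B * X) $$ (i, j)" unfolding mult_index[OF c(1) X ij] using ij A B X by (auto simp: vst_def mult_index[OF A X] mult_index[OF B X] simp del: index_mult_mat(1))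
qed (use A B X in "auto simp: vst_def")

lemma dg_vst:
 assumes A: "A : cmat a a'" and B: "B : cmat b b'" and X: "X : cmat a' m" and Y: "Y : cmat b' m"
 shows "dg A B * vst X Y = vst (A * X) (B * Y)"
proof (rule eq_matI)
 note c = dg_carrier[OF A B] vst_carrier[OF X Y] vst_carrier[OF mult_c[OF A X] mult_c[OF B Y]]
 fix i j assume "i < dim_row (vst (A * X) (B * Y))" "j < dim_col (vst (A * X) (B * Y))"
 hence ij: "i < a + b" "j < m" using c by auto
 show "(dg A B * vst X Y) $$ (i, j) = vst (A * X) (B * Y) $$ (i, j)" unfolding mult_index[OF c(1,2) ij] sum_split using ij A B X Y by (auto simp: vst_def mult_index[OF A X] mult_index[OF B Y] simp del: index_mult_mat(1))
qed (use A B X Y in "auto simp: vst_def")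

lemma ctrans_vst:
 assumes A: "A : cmat a n" and B: "B : cmat b n" and X: "X : cmat a m" and Y: "Y : cmat b m"
 shows "ctr (vst A B) * vst X Y = ctr A * X + ctr B * Y"
proof (rule eq_matI)
 fix i j assume "i < dim_row (ctr A * X + ctr B * Y)" "j < dim_col (ctr A * X + ctr B * Y)"
 hence ij: "i < n" "j < m" using B Y by auto
 have "(ctr (vst A B) * vst X Y) $$ (i, j) = (ctr A * X) $$ (i, j) + (ctr B * Y) $$ (i, j)" unfolding mult_index[OF ctr_c[OF vst_carrier[OF A B]] vst_carrier[OF X Y] ij] sum_split
   mult_index[OF ctr_c[OF A] X ij] mult_index[OF ctr_c[OF B] Y ij] using ij A B X Y by (simp add: vst_def ctr_def)
 thus "(ctr (vst A B) * vst X Y) $$ (i, j) = (ctr A * X + ctr B * Y) $$ (i, j)" using ij B Y by (simp del: index_mult_mat(1))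
qed (use A B X Y in "auto simp: vst_def")

context hol_atlas
begin

lemma hol_mat_vst:
 assumes W: "open W" and A: "hol_mat \<A> W a n A" and B: "hol_mat \<A> W b n B"
 shows "hol_mat \<A> W (a + b) n (%x. vst (A x) (B x))"
proof (rule hol_matI[OF W], rule fnf.QmI[OF ff_hol[OF opatch[OF _ W]]])
 fix c assume c: "c : \<A>"
 show "c : \<A>" by (rule c)
 note a = hol_mat_p[OF W c A] and b = hol_mat_p[OF W c B]
 note fh = ff_hol[OF opatch[OF c W]]
 note ca = fnf.Qm_carrier[OF fh a] and cb = fnf.Qm_carrier[OF fh b]
 show "vst (A (ci c z)) (B (ci c z)) : cmat (a + b) n" if "z : patch c W" for z by (rule vst_carrier[OF ca[OF that] cb[OF that]])
 show "hol_on (patch c W) (if i < a then (%z. A (ci c z) $$ (i, j)) else (%z. B (ci c z) $$ (i - a, j)))" if "i < a + b" "j < n" for i j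
  using fnf.Qm_entry[OF fh a, of i j] fnf.Qm_entry[OF fh b, of "i - a" j] that by simp
 show "(if i < a then (%z. A (ci c z) $$ (i, j)) else (%z. B (ci c z) $$ (i - a, j))) z = vst (A (ci c z)) (B (ci c z)) $$ (i, j)"
  if "i < a + b" "j < n" "z : patch c W" for i j z using ca[OF that(3)] cb[OF that(3)] that by (simp add: vst_def)
qed

fun stackP :: "nat => 'x piece list => 'x => complex mat" where
 "stackP r [] x = zm 0 r"
| "stackP r (t # D) x = vst (prj t x) (stackP r D x)"

definition total :: "'x piece list => nat" where "total D = sum_list (map rank (map bdl D))"

lemma total_simps [simp]: "total [] = 0" "total (t # D) = rank (bdl t) + total D" by (simp_all add: total_def)

abbreviation "stackM D x == diag_block_mat (map (%E. metric E x) (map bdl D))"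

context
 fixes E :: "'x herm_bundle" and r defines "r == rank E"
 assumes E: "hb E"
begin

lemma stack_carrier: "ALL t:set D. emb (bdl t) E (inj t) (prj t) ==> stackP r D x : cmat (total D) r"
proof (induction D)
 case (Cons t D)
 hence "emb (bdl t) E (inj t) (prj t)" "stackP r D x : cmat (total D) r" by simp_all
 thus ?case using vst_carrier[OF embD(8)] by (simp add: r_def)
qed simp

lemma stack_metric:
 assumes "ALL t:set D. emb (bdl t) E (inj t) (prj t)"
 shows "stackM D x : cmat (total D) (total D) & (ALL i<r. ALL j<r.
  (ctr (stackP r D x) * (stackM D x * stackP r D x)) $$ (i, j) = (\<Sum>t\<leftarrow>D. (metric E x * (inj t x * prj t x) * idm r) $$ (i, j)))" using assms
proof (induction D)
 case Nil
 show ?case by (auto simp: ctr_def scalar_prod_def)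
next
 case (Cons t D)
 have e: "emb (bdl t) E (inj t) (prj t)" and D: "ALL t:set D. emb (bdl t) E (inj t) (prj t)" using Cons.prems by auto
 let ?m = "metric (bdl t) x" and ?h = "metric E x" and ?P = "stackP r D x"
 note a = embD[OF e, folded r_def] and c = stack_carrier[OF D, of x]
 note m = hmD[OF metricD[OF a(1)], of x] and h = hmD[OF metricD[OF E], of x, folded r_def]
 have IH: "stackM D x : cmat (total D) (total D)"
  "!!i j. i < r ==> j < r ==> (ctr ?P * (stackM D x * ?P)) $$ (i, j) = (\<Sum>t\<leftarrow>D. (?h * (inj t x * prj t x) * idm r) $$ (i, j))" using Cons.IH[OF D] by auto
 have d: "stackM (t # D) x = dg ?m (stackM D x)" by (simp add: Let_def)
 have "ctr (prj t x) * ?m = ?h * inj t x" using arg_cong[OF a(6)[of x], of ctr] a(7,8)[of x] m h by (simp add: ctr_mult[OF m(1) a(8)] ctr_mult[OF ctr_c[OF a(7)] h(1)] ctr_ctr)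
 hence "ctr (prj t x) * (?m * prj t x) = ?h * inj t x * prj t x" using assoc_mult_mat[OF ctr_c[OF a(8)] m(1) a(8), of x x] by simp
 also have "... = ?h * (inj t x * prj t x) * idm r" using assoc_mult_mat[OF h(1) a(7,8), of x x] right_mult_one_mat[OF mult_c[OF h(1) mult_c[OF a(7,8)]], of x x] by simp
 finally have X: "ctr (prj t x) * (?m * prj t x) = ?h * (inj t x * prj t x) * idm r" .
 have "ctr (stackP r (t # D) x) * (stackM (t # D) x * stackP r (t # D) x) =
   ?h * (inj t x * prj t x) * idm r + ctr ?P * (stackM D x * ?P)" unfolding d stackP.simps dg_vst[OF m(1) IH(1) a(8) c] by (simp only: X ctrans_vst[OF a(8) c mult_c[OF m(1) a(8)] mult_c[OF IH(1) c]])
 thus ?case unfolding d using dg_carrier[OF m(1) IH(1)] IH(2) c IH(1) by (auto simp del: index_mult_mat(1))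
qed

lemma stack_frames:
 assumes e: "(U, e) : frames E" and D: "ALL t:set D. emb (bdl t) E (inj t) (prj t)"
  and fs: "list_all2 (%f t. f : frames (bdl t)) fs D"
 shows "open (\<Inter>f\<in>set fs. fst f) &
  (ALL x:\<Inter>f\<in>set fs. fst f. diag_block_mat (map (%f. snd f x) fs) : cmat (total D) (total D)) &
  (EX g. hol_mat \<A> (U Int (\<Inter>f\<in>set fs. fst f)) (total D) r g &
   (ALL x:U Int (\<Inter>f\<in>set fs. fst f). stackP r D x * e x = diag_block_mat (map (%f. snd f x) fs) * g x))" using fs D
proof (induction fs D rule: list_all2_induct)
 case Nil
 note fr = frameD[OF E e, folded r_def]
 have "hol_mat \<A> U 0 r (%_. zm 0 r)" using fr(1) by (auto intro: hol_mat_const)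
 moreover have "zm 0 r * e x = zm 0 0 * zm 0 r" if "x : U" for x using fr(2)[OF that] by (auto intro!: eq_matI)
 ultimately show ?case by auto
next
 case (Cons f fs t D)
 obtain V k where f: "f = (V, k)" by (cases f)
 have et: "emb (bdl t) E (inj t) (prj t)" and D: "ALL t:set D. emb (bdl t) E (inj t) (prj t)" using Cons.prems by auto
 have k: "(V, k) : frames (bdl t)" using Cons.hyps f by simp
 note a = embD[OF et, folded r_def]
 note fr = frameD[OF E e, folded r_def] and fk = frameD[OF a(1) k]
 let ?W = "\<Inter>f\<in>set fs. fst f" and ?d = "%x. diag_block_mat (map (%f. snd f x) fs)"
 obtain g where oW: "open ?W" and dc: "!!x. x : ?W ==> ?d x : cmat (total D) (total D)"
  and g: "hol_mat \<A> (U Int ?W) (total D) r g" "!!x. x : U Int ?W ==> stackP r D x * e x = ?d x * g x" using Cons.IH[OF D] by blast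
 have W: "(\<Inter>f\<in>set (f # fs). fst f) = V Int ?W" by (simp add: f)
 have d: "diag_block_mat (map (%f. snd f x) (f # fs)) = dg (k x) (?d x)" for x by (simp add: f Let_def)
 have o: "open (U Int (V Int ?W))" "open (U Int ?W)" "open (U Int V)" using fr(1) fk(1) oW by auto
 show ?case unfolding W d
 proof (intro conjI ballI exI[of _ "%x. vst (lex e k (prj t) x) (g x)"])
  show "open (V Int ?W)" using fk(1) oW by blast
  show "dg (k x) (?d x) : cmat (total (t # D)) (total (t # D))" if "x : V Int ?W" for x using dg_carrier[OF fk(2) dc] that by simp
  show "hol_mat \<A> (U Int (V Int ?W)) (total (t # D)) r (%x. vst (lex e k (prj t) x) (g x))" unfolding total_simps by (rule hol_mat_vst[OF o(1) hol_mat_mono[OF o(3,1)] hol_mat_mono[OF o(2,1) g(1)]])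
    (use homD(2)[OF a(2,1,4) e k] r_def in auto)
  fix x assume "x : U Int (V Int ?W)"
  hence xs: "x : U" "x : V" "x : U Int ?W" "x : ?W" by auto
  note l = lex_eq[where fi="prj t", OF a(2) e a(1) k xs(1,2) a(8)[unfolded r_def], folded r_def]
  show "stackP r (t # D) x * e x = dg (k x) (?d x) * vst (lex e k (prj t) x) (g x)" unfolding stackP.simps dg_vst[OF fk(2)[OF xs(2)] dc[OF xs(4)] l(1) hol_mat_carrier[OF g(1) xs(3)]] l(2) g(2)[OF xs(3), symmetric]
   by (rule vst_mult[OF a(8) stack_carrier[OF D] fr(2)[OF xs(1)]])
 qed
qed

theorem decomp_isometric_iso:
 assumes D: "decomp E D"
 shows "isometric_iso \<A> E (direct_sum (map bdl D))"
proof -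
 have es: "ALL t:set D. emb (bdl t) E (inj t) (prj t)" using decompD(1)[OF D] by blast
 let ?F = "direct_sum (map bdl D)" and ?P = "stackP r D" and ?I = "%x. minv (stackP r D x)"
 note h = hmD[OF metricD[OF E], folded r_def]
 have tr: "(SUM i<r. (inj t x * prj t x) $$ (i, i)) = of_nat (rank (bdl t))" if "t : set D" for t x
 proof -
  note e = embD(5,7,8)[OF decompD(1)[OF D that], of x, folded r_def]
  show ?thesis using mt_comm[OF e(2,3)] e(2) by (simp add: e(1) mt_one) (simp add: mt_def)
 qed
 have "of_nat r = (SUM i<r. \<Sum>t\<leftarrow>D. (inj t undefined * prj t undefined) $$ (i, i))" by (simp add: decompD(2)[OF D, folded r_def])
 also have "... = of_nat (total D)" unfolding sum_list_swap[symmetric] total_def using tr[of _ undefined] by (induction D) (simp_all cong: map_cong)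
 finally have tot: "total D = r" by (simp only: of_nat_eq_iff)
 have rF: "rank ?F = r" using tot by (simp add: Defs.direct_sum_def total_def o_def)
 have P: "?P x : cmat r r" for x using stack_carrier[OF es] tot by simp
 have M: "stackM D x : cmat r r" for x using stack_metric[OF es, of x] tot by simp
 have PMP: "ctr (?P x) * (stackM D x * ?P x) = metric E x" for x
 proof (rule eq_matI)
  fix i j assume "i < dim_row (metric E x)" "j < dim_col (metric E x)"
  hence ij: "i < r" "j < r" using h(1)[of x] by auto
  have "(ctr (?P x) * (stackM D x * ?P x)) $$ (i, j) = (\<Sum>t\<leftarrow>D. (metric E x * (inj t x * prj t x) * idm r) $$ (i, j))" using stack_metric[OF es, of x] ij by blast
  also have "... = (metric E x * idm r) $$ (i, j)" by (rule decomp_sum[OF D h(1)[unfolded r_def] one_carrier_mat, folded r_def, OF ij])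
  finally show "(ctr (?P x) * (stackM D x * ?P x)) $$ (i, j) = metric E x $$ (i, j)" using h(1)[of x] by simp
 qed (use P[of x] h(1)[of x] in auto)
 have "det (?P x) ~= 0" for x
 proof
  assume "det (?P x) = 0"
  hence "det (ctr (?P x) * (stackM D x * ?P x)) = 0" using det_mult[OF ctr_c[OF P] mult_c[OF M P]] det_mult[OF M P] by simp
  thus False using h(3) unfolding PMP by blast
 qed
 note I = minv[OF P this]
 have fr: "EX g. hol_mat \<A> (U Int V) r r g & (ALL x:U Int V. ?P x * e x = k x * g x & ?I x * k x = e x * minv (g x) & det (g x) ~= 0)"
  and oV: "open (U Int V)" if e: "(U, e) : frames E" and k: "(V, k) : frames ?F" for U e V k
 proof -
  obtain fs where fs: "list_all2 (%f t. f : frames (bdl t)) fs D" and Vk: "V = (\<Inter>f\<in>set fs. fst f)" "k = (%x. diag_block_mat (map (%f. snd f x) fs))" using k by (auto simp: Defs.direct_sum_def list_all2_map2)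
  note fe = frameD[OF E e, folded r_def]
  obtain g where o: "open V" and kc: "!!x. x : V ==> k x : cmat r r" and g: "hol_mat \<A> (U Int V) r r g" "!!x. x : U Int V ==> ?P x * e x = k x * g x" using stack_frames[OF e es fs] unfolding tot Vk by blast
  show "open (U Int V)" using o fe(1) by blast
  have "?I x * k x = e x * minv (g x) & det (g x) ~= 0" if x: "x : U Int V" for x
  proof
   note gc = hol_mat_carrier[OF g(1) x] and ec = fe(2)[of x] and kx = kc[of x]
   have "det (?P x * e x) ~= 0" using det_mult[OF P ec] I(2)[of x] fe(3)[of x] `!!x. det (?P x) ~= 0` x by simp
   thus dg: "det (g x) ~= 0" unfolding g(2)[OF x] using det_mult[OF kx gc] x by auto
   note gi = minv[OF gc dg]
   have "?I x * k x = ?I x * ((k x * g x) * minv (g x))" using gi gc kx x by (simp add: massoc mat_one)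
   also have "... = e x * minv (g x)" unfolding g(2)[OF x, symmetric] using mat_cancel[OF I(3)[of x]] I(1)[of x] P[of x] ec gi(1) x by (simp add: massoc)
   finally show "?I x * k x = e x * minv (g x)" .
  qed
  thus "EX g. hol_mat \<A> (U Int V) r r g & (ALL x:U Int V. ?P x * e x = k x * g x & ?I x * k x = e x * minv (g x) & det (g x) ~= 0)" using g by blast
 qed
 have "hm E ?F ?P" unfolding hol_morphism_def rF r_def[symmetric] using P fr by blast
 moreover have "hm ?F E ?I" unfolding hol_morphism_def rF r_def[symmetric]
 proof (intro conjI allI)
  show "ALL (V, k):frames ?F. ALL (U, e):frames E. EX g. hol_mat \<A> (V Int U) r r g & (ALL x:V Int U. ?I x * k x = e x * g x)"
  proof clarify
   fix V k U e assume k: "(V, k) : frames ?F" and e: "(U, e) : frames E"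
   show "EX g. hol_mat \<A> (V Int U) r r g & (ALL x:V Int U. ?I x * k x = e x * g x)" unfolding Int_commute[of V] using fr[OF e k] hol_mat_minv[OF oV[OF e k]] by blast
  qed
 qed (rule I)
 moreover have "herm (metric ?F x) (?P x *V s) (?P x *V t) = herm (metric E x) s t"
  if s: "s : cvec r" and t: "t : cvec r" for x s t
 proof -
  have "herm (stackM D x) (?P x *V s) (?P x *V t) = herm (stackM D x * ?P x) s (?P x *V t)" by (rule herm_right[OF M P s])
  also have "... = herm (metric E x) s t" unfolding herm_left[OF mult_c[OF M P] P s t] PMP ..
  finally show ?thesis by (simp add: Defs.direct_sum_def)
 qed
 ultimately show ?thesis unfolding isometric_iso_def rF r_def[symmetric] using I(2,3) by blast
qed

end

end

theorem proposition1:
  fixes \<A> :: "('x::t2_space, 'n::finite) chart set"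
    and \<zeta> :: "nat \<Rightarrow> ('x, 'n) form"
    and E :: "'x herm_bundle"
  assumes "holomorphic_atlas \<A>"
    and "compact (UNIV :: 'x set)"
    and "connected (UNIV :: 'x set)"
    and "\<And>k. k \<le> CARD('n) \<Longrightarrow> closed_real_form \<A> (CARD('n) - k) (CARD('n) - k) (\<zeta> k)"
    and "hol_herm_bundle \<A> E"
    and "P_critical \<A> \<zeta> E"
  shows "\<exists>(l::nat) (m :: nat \<Rightarrow> nat) (G :: nat \<Rightarrow> 'x herm_bundle).
           (\<forall>k\<in>{1..l}. 1 \<le> m k \<and> hol_herm_bundle \<A> (G k) \<and>
              simple_bundle \<A> (G k) \<and> P_critical \<A> \<zeta> (G k)) \<and>
           (\<forall>i\<in>{1..l}. \<forall>j\<in>{1..l}. i \<noteq> j \<longrightarrow>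
              (\<forall>\<phi>. hol_morphism \<A> (G i) (G j) \<phi> \<longrightarrow> (\<forall>x. \<phi> x = 0\<^sub>m (rank (G j)) (rank (G i))))) \<and>
           isometric_iso \<A> E (direct_sum (concat (map (\<lambda>k. replicate (m k) (G k)) [1..<Suc l])))"
proof -
 interpret critical_setting \<A> \<zeta> by unfold_locales (use assms in auto)
 have E: "critical E" using assms by blast
 obtain D where D: "decomp E D" "ALL t:set D. simple_bundle \<A> (fst t)" using simple_decomposition[OF E] by blast
 have "EX Bs. decomp E (flat Bs) & separated Bs" by (rule group_pieces[OF E, of D "[]"]) (use D in "auto simp: flat_def separated_def")
 then obtain Bs where Bs: "decomp E (flat Bs)" "separated Bs" by blast
 define m where "m k = length (snd (Bs ! (k - 1)))" for k
 define G where "G k = fst (Bs ! (k - 1))" for k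
 have nth: "Bs ! (k - 1) : set Bs" if "k : {1..length Bs}" for k using that by (intro nth_mem) auto
 have "1 <= m k & hol_herm_bundle \<A> (G k) & simple_bundle \<A> (G k) & P_critical \<A> \<zeta> (G k)"
  if k: "k : {1..length Bs}" for k
 proof -
  have s: "snd (Bs ! (k - 1)) ~= []" "simple_bundle \<A> (G k)" using Bs(2) nth[OF k] by (auto simp: separated_def G_def)
  obtain i j where ij: "(i, j) : set (snd (Bs ! (k - 1)))" using s(1) by (cases "snd (Bs ! (k - 1))") auto
  have "(G k, i, j) : set (flat Bs)" unfolding flat_def G_def using nth[OF k] ij by auto
  hence "isometric_embedding \<A> (G k) E i j" using decompD(1)[OF Bs(1)] by force
  hence "critical (G k)" by (rule sub_critical[OF E])
  thus ?thesis using s by (simp add: m_def Suc_leI)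
 qed
 moreover have "hom_zero (G i) (G j)" if ij: "i : {1..length Bs}" "j : {1..length Bs}" "i ~= j" for i j
 proof -
  have "sorted_wrt (%B C. hom_zero (fst B) (fst C) & hom_zero (fst C) (fst B)) Bs" using Bs(2) by (simp add: separated_def)
  from sorted_wrt_nth_less[OF this] have *: "a < b ==> b < length Bs ==> hom_zero (fst (Bs ! a)) (fst (Bs ! b)) & hom_zero (fst (Bs ! b)) (fst (Bs ! a))" for a b by blast
  show ?thesis unfolding G_def using *[of "i - 1" "j - 1"] *[of "j - 1" "i - 1"] ij by (cases "i < j") auto
 qed
 moreover have "map fst (flat Bs) = concat (map (%k. replicate (m k) (G k)) [1..<Suc (length Bs)])"
 proof -
  have "map fst (flat Bs) = concat (map (%B. replicate (length (snd B)) (fst B)) Bs)" unfolding flat_def by (induction Bs) (simp_all add: o_def map_replicate_const)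
  also have "map (%B. replicate (length (snd B)) (fst B)) Bs = map (%k. replicate (m k) (G k)) [1..<Suc (length Bs)]" by (rule nth_equalityI) (simp_all add: m_def G_def del: upt_Suc)
  finally show ?thesis .
 qed
 moreover have "isometric_iso \<A> E (direct_sum (map fst (flat Bs)))" by (rule decomp_isometric_iso[OF _ Bs(1)]) (use E in blast)
 ultimately show ?thesis unfolding hom_zero_def by (intro exI[of _ "length Bs"] exI[of _ m] exI[of _ G]) auto
qed

end
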